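(* Let $c$ be an absolutely continuous non-increasing function on $(0,\infty)$ with $c(0+)>0$. Suppose $c$ is differentiable on $(0,\infty)\setminus F$ for some closed set $F$ with Lebesgue measure $\ell(F)=0$. Assume $\Pi_S(0,\infty)=\infty$ and that $S$ satisfies the continuous density condition. Then, with probability $1$, $\tau_c\in(0,\infty)\setminus F$, and for $u\in[0,\infty)^d$ and $v\in[0,\infty)^d\setminus\{0\}$, $$\mathsf P\{X(\tau_c-)\in \mathrm du,\ \Delta_X(\tau_c)\in \mathrm dv\mid\tau_c\}=Z(\tau_c)^{-1}\,\nu_1(\mathrm du,\mathrm dv\mid\tau_c),$$ $$\mathsf P\{X(\tau_c-)\in \mathrm du,\ \Delta_X(\tau_c)=0\mid\tau_c\}=Z(\tau_c)^{-1}\,\nu_2(\mathrm du\mid\tau_c),$$ where for $t\in(0,\infty)\setminus F$, $$\nu_1(\mathrm du,\mathrm dv\mid t)=\mathbf 1\{0\le c(t)-\|u\|<\|v\|\}\,\mathsf P\{X(t)\in \mathrm du\}\,\Pi(\mathrm dv),$$ $$\nu_2(\mathrm du\mid t)=-c'(t)\,g_t(c(t))\,\mathsf P\{X(t)\in \mathrm du\mid S(t)=c(t)\},$$ $$Z(t)=-c'(t)\,g_t(c(t))+\int_0^{c(t)}\overline\Pi_S(c(t)-s)\,\mathsf P\{S(t)\in \mathrm ds\}.$$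
   Context: $\|x\|=\sum_i|x_i|$ is the $L^1$ norm on $\mathbb R^d$. $X=(X_1,\dots,X_d)$ is a Lévy process started at $0$ taking values in $[0,\infty)^d$, with Lévy measure $\Pi$ (having no mass at $\{0\}$) and Laplace exponent $\int(1-e^{-\langle\theta,x\rangle})\,\Pi(\mathrm dx)$, $\theta\in[0,\infty)^d$ (i.e. $\mathsf E[e^{-\langle\theta,X(t)\rangle}]=\exp(-t\int(1-e^{-\langle\theta,x\rangle})\Pi(\mathrm dx))$, so there is no drift). $\Delta_X(t)=X(t)-X(t-)$. $S=\|X\|=X_1+\cdots+X_d$ is a subordinator with Lévy measure $\Pi_S(\mathrm dx)=\int_{[0,\infty)^d}\mathbf 1\{\|z\|\in \mathrm dx\}\,\Pi(\mathrm dz)$ on $(0,\infty)$; $\overline\Pi_S(x)=\Pi_S(x,\infty)$. $\tau_c=\inf\{t>0:S(t)>c(t)\}$. $S$ satisfies the continuous density condition if for each $t>0$, $S(t)$ has a probability density function (w.r.t. Lebesgue measure) $g_t$ on $(0,\infty)$, and $(t,x)\mapsto g_t(x)$ is continuous on $(0,\infty)\times(0,\infty)$. By convention $g_t(x)=0$ for $x\le0$, and $\int_0^{a}$ is $0$ for $a\le 0$ (almost surely $c(\tau_c)>0$, so such values do not matter). Equalities between differentials are equalities of measures. Conditional probabilities denote regular conditional distributions, with identities understood almost surely. $\mathsf P\{X(t)\in \mathrm du\mid S(t)=s\}$ is a regular conditional distribution of $X(t)$ given $S(t)=s$, measurable in $(t,s)$; as it is determined only up to null sets of $s$, its evaluation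 at $s=c(t)$ is understood for an appropriate version. *)

theory Defs
  imports "HOL-Probability.Probability"
begin

(* Time is a real parameter t, and only times t >= 0 matter.  On real ^ 'd the order is
   componentwise, so {0..} is the orthant [0,\<infinity>)^d. *)

definition l1norm :: "real ^ 'd \<Rightarrow> real" where
  "l1norm x = (\<Sum>i\<in>UNIV. \<bar>x $ i\<bar>)"

definition cadlag :: "(real \<Rightarrow> 'a::topological_space) \<Rightarrow> bool" where
  "cadlag x \<longleftrightarrow>
     (\<forall>t\<ge>0. (x \<longlongrightarrow> x t) (at_right t)) \<and> (\<forall>t>0. \<exists>l. (x \<longlongrightarrow> l) (at_left t))"

(* Stochastic continuity is not listed: it follows from right-continuity at 0 and
   stationarity of the increments. *)
locale levy_process = prob_space M
  for M :: "'w measure" +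
  fixes X :: "real \<Rightarrow> 'w \<Rightarrow> 'a::euclidean_space"
  assumes random_variable: "\<And>t. 0 \<le> t \<Longrightarrow> X t \<in> borel_measurable M"
    and start: "\<And>\<omega>. \<omega> \<in> space M \<Longrightarrow> X 0 \<omega> = 0"
    and cadlag_paths: "\<And>\<omega>. \<omega> \<in> space M \<Longrightarrow> cadlag (\<lambda>t. X t \<omega>)"
    and independent_increments:
      "\<And>n t. 0 \<le> t 0 \<Longrightarrow> (\<And>i. i < n \<Longrightarrow> t i \<le> t (Suc i)) \<Longrightarrow>
         indep_vars (\<lambda>_. borel) (\<lambda>i \<omega>. X (t (Suc i)) \<omega> - X (t i) \<omega>) {..<n::nat}"
    and stationary_increments:
      "\<And>s h. 0 \<le> s \<Longrightarrow> 0 \<le> h \<Longrightarrow>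
         distr M borel (\<lambda>\<omega>. X (s + h) \<omega> - X s \<omega>) = distr M borel (X h)"

(* Levy process in the orthant with Levy measure \<mu> and no drift.  The condition
   levy_measure_integrable says exactly that the integral in the Laplace exponent is finite for
   all theta, so that the Bochner integral below is the genuine one. *)
locale driftless_subordinator = levy_process M X
  for M :: "'w measure" and X :: "real \<Rightarrow> 'w \<Rightarrow> real ^ 'd" +
  fixes \<mu> :: "(real ^ 'd) measure"
  assumes orthant_valued: "\<And>t \<omega>. 0 \<le> t \<Longrightarrow> \<omega> \<in> space M \<Longrightarrow> X t \<omega> \<in> {0..}"
    and sets_levy_measure: "sets \<mu> = sets borel"
    and levy_measure_zero: "emeasure \<mu> {0} = 0"
    and levy_measure_orthant: "emeasure \<mu> (- {0..}) = 0"
    and levy_measure_integrable: "(\<integral>\<^sup>+ x. ennreal (min 1 (l1norm x)) \<partial>\<mu>) < \<infinity>"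
    and laplace_exponent:
      "\<And>t \<theta>. 0 \<le> t \<Longrightarrow> \<theta> \<in> {0..} \<Longrightarrow>
         expectation (\<lambda>\<omega>. exp (- (\<theta> \<bullet> X t \<omega>))) =
         exp (- t * (\<integral> x. (1 - exp (- (\<theta> \<bullet> x))) \<partial>\<mu>))"

definition norm_process :: "(real \<Rightarrow> 'w \<Rightarrow> real ^ 'd) \<Rightarrow> real \<Rightarrow> 'w \<Rightarrow> real" where
  "norm_process X t \<omega> = l1norm (X t \<omega>)"

definition norm_levy_measure :: "(real ^ 'd) measure \<Rightarrow> real measure" where
  "norm_levy_measure \<mu> = distr \<mu> borel l1norm"

definition norm_levy_tail :: "(real ^ 'd) measure \<Rightarrow> real \<Rightarrow> ennreal" where
  "norm_levy_tail \<mu> x = emeasure (norm_levy_measure \<mu>) {x<..}"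

definition continuous_density ::
  "'w measure \<Rightarrow> (real \<Rightarrow> 'w \<Rightarrow> real) \<Rightarrow> (real \<Rightarrow> real \<Rightarrow> real) \<Rightarrow> bool" where
  "continuous_density M S g \<longleftrightarrow>
     (\<forall>t>0. distributed M lborel (S t) (\<lambda>x. ennreal (g t x))) \<and>
     (\<forall>t>0. \<forall>x. 0 \<le> g t x) \<and>
     (\<forall>t>0. \<forall>x\<le>0. g t x = 0) \<and>
     continuous_on ({0<..} \<times> {0<..}) (\<lambda>(t, x). g t x)"

definition abs_continuous_on :: "real set \<Rightarrow> (real \<Rightarrow> real) \<Rightarrow> bool" where
  "abs_continuous_on I f \<longleftrightarrow>
     (\<forall>\<epsilon>>0. \<exists>\<delta>>0. \<forall>(n::nat) a b.
        (\<forall>i<n. a i \<le> b i \<and> {a i..b i} \<subseteq> I) \<and>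
        (\<forall>i<n. \<forall>j<n. i \<noteq> j \<longrightarrow> {a i<..<b i} \<inter> {a j<..<b j} = {}) \<and>
        (\<Sum>i<n. b i - a i) < \<delta> \<longrightarrow>
        (\<Sum>i<n. \<bar>f (b i) - f (a i)\<bar>) < \<epsilon>)"

(* Absolute continuity on (0,\<infinity>) is absolute continuity on each compact subinterval, so
   the limit c(0+) may be infinite and is taken in the extended reals. *)
definition boundary :: "(real \<Rightarrow> real) \<Rightarrow> real set \<Rightarrow> bool" where
  "boundary c F \<longleftrightarrow>
     antimono_on {0<..} c \<and>
     (\<forall>a b. 0 < a \<longrightarrow> a \<le> b \<longrightarrow> abs_continuous_on {a..b} c) \<and>
     (\<exists>L>0. ((\<lambda>t. ereal (c t)) \<longlongrightarrow> L) (at_right 0)) \<and>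
     closed F \<and> emeasure lborel F = 0 \<and>
     (\<forall>t\<in>{0<..} - F. c differentiable (at t))"

(* Extended-real valued: the infimum of the empty set is \<infinity>. *)
definition passage_time ::
  "(real \<Rightarrow> 'w \<Rightarrow> real ^ 'd) \<Rightarrow> (real \<Rightarrow> real) \<Rightarrow> 'w \<Rightarrow> ereal" where
  "passage_time X c \<omega> = Inf (ereal ` {t. 0 < t \<and> c t < norm_process X t \<omega>})"

(* The value at t <= 0 is a convention.  It is used only on the null event that the passage
   time is 0 or \<infinity> (real_of_ereal sends \<infinity> to 0), where it keeps the
   quantities below measurable. *)
definition left_limit :: "(real \<Rightarrow> 'a::t2_space) \<Rightarrow> real \<Rightarrow> 'a" where
  "left_limit x t = (if 0 < t then Lim (at_left t) x else x 0)"

definition pre_passage ::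
  "(real \<Rightarrow> 'w \<Rightarrow> real ^ 'd) \<Rightarrow> (real \<Rightarrow> real) \<Rightarrow> 'w \<Rightarrow> real ^ 'd" where
  "pre_passage X c \<omega> = left_limit (\<lambda>t. X t \<omega>) (real_of_ereal (passage_time X c \<omega>))"

definition passage_jump ::
  "(real \<Rightarrow> 'w \<Rightarrow> real ^ 'd) \<Rightarrow> (real \<Rightarrow> real) \<Rightarrow> 'w \<Rightarrow> real ^ 'd" where
  "passage_jump X c \<omega> =
     X (real_of_ereal (passage_time X c \<omega>)) \<omega> - pre_passage X c \<omega>"

(* K is a regular conditional distribution of Y given T. *)
definition regular_cond_distr ::
  "'w measure \<Rightarrow> ('w \<Rightarrow> 't::topological_space) \<Rightarrow> ('w \<Rightarrow> 'y::topological_space) \<Rightarrow>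
   ('t \<Rightarrow> 'y measure) \<Rightarrow> bool" where
  "regular_cond_distr M T Y K \<longleftrightarrow>
     T \<in> borel_measurable M \<and> Y \<in> borel_measurable M \<and>
     K \<in> borel \<rightarrow>\<^sub>M prob_algebra borel \<and>
     (\<forall>C\<in>sets borel. AE \<omega> in M.
        nn_cond_exp M (vimage_algebra (space M) T borel)
          (indicator (Y -` C \<inter> space M)) \<omega> = emeasure (K (T \<omega>)) C)"

(* K t s is a version of P(X(t) \<in> . | S(t) = s) that is jointly measurable in (t, s). *)
definition cond_distr_given_norm ::
  "'w measure \<Rightarrow> (real \<Rightarrow> 'w \<Rightarrow> real ^ 'd) \<Rightarrow>
   (real \<Rightarrow> real \<Rightarrow> (real ^ 'd) measure) \<Rightarrow> bool" where
  "cond_distr_given_norm M X K \<longleftrightarrow>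
     (\<lambda>(t, s). K t s) \<in> borel \<Otimes>\<^sub>M borel \<rightarrow>\<^sub>M prob_algebra borel \<and>
     (\<forall>t>0. regular_cond_distr M (norm_process X t) (X t) (K t))"

definition nu1 ::
  "'w measure \<Rightarrow> (real \<Rightarrow> 'w \<Rightarrow> real ^ 'd) \<Rightarrow> (real ^ 'd) measure \<Rightarrow> (real \<Rightarrow> real) \<Rightarrow>
   real \<Rightarrow> ((real ^ 'd) \<times> (real ^ 'd)) measure" where
  "nu1 M X \<mu> c t =
     density (distr M borel (X t) \<Otimes>\<^sub>M \<mu>)
       (indicator {(u, v). 0 \<le> c t - l1norm u \<and> c t - l1norm u < l1norm v})"

definition nu2 ::
  "(real \<Rightarrow> real \<Rightarrow> (real ^ 'd) measure) \<Rightarrow> (real \<Rightarrow> real \<Rightarrow> real) \<Rightarrow> (real \<Rightarrow> real) \<Rightarrow>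
   real \<Rightarrow> (real ^ 'd) measure" where
  "nu2 K g c t = scale_measure (ennreal (- deriv c t * g t (c t))) (K t (c t))"

definition normalizer ::
  "'w measure \<Rightarrow> (real \<Rightarrow> 'w \<Rightarrow> real ^ 'd) \<Rightarrow> (real ^ 'd) measure \<Rightarrow>
   (real \<Rightarrow> real \<Rightarrow> real) \<Rightarrow> (real \<Rightarrow> real) \<Rightarrow> real \<Rightarrow> ennreal" where
  "normalizer M X \<mu> g c t =
     ennreal (- deriv c t * g t (c t)) +
     (\<integral>\<^sup>+ s\<in>{0..c t}. norm_levy_tail \<mu> (c t - s) \<partial>distr M borel (norm_process X t))"

end

theory Submission
  imports Defs
begin

text \<open>
  Partition a compact time interval on which \<open>c > 0\<close> into small cells.  The first passage falls into
  a cell \<open>(t, t + h]\<close> when \<open>X(t)\<close> lies below \<open>c(t)\<close> and the increment over the cell, which is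
  independent of \<open>X(t)\<close>, carries the norm above \<open>c(t + h)\<close>.  As \<open>h\<close> tends to \<open>0\<close>, the increment
  contributes in two ways.  Weighted with a test function vanishing at \<open>0\<close>, its law divided by \<open>h\<close>
  converges to \<open>\<Pi>\<close>; this produces \<open>\<nu>\<^sub>1\<close>.  Without jump, the norm is passed because \<open>c\<close> decreases, by
  \<open>- c'(t) h\<close> over the cell up to a null set of times, while \<open>S(t)\<close> has density \<open>g\<^sub>t(c(t))\<close> near \<open>c(t)\<close>;
  this produces \<open>\<nu>\<^sub>2\<close>.

  For the latter a version of the law of \<open>X(t)\<close> given \<open>S(t) = y\<close> is needed that is continuous in
  \<open>(t, y)\<close>.  It is the limit as \<open>s\<close> increases to \<open>t\<close> of the law of \<open>X(s)\<close> weighted by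
  \<open>g\<^bsub>t-s\<^esub>(y - S(s)) / g\<^sub>t(y)\<close>, which by the Chapman-Kolmogorov equation is the law of the bridge of \<open>S\<close>
  to \<open>y\<close>; exchangeability of the bridge increments controls the dependence on \<open>s\<close>.
\<close>

section \<open>The norm of a driftless subordinator\<close>

text \<open>Little is known near the origin: \<open>g\<close> is continuous only on the open
  quadrant and may blow up as \<open>x\<close> tends to \<open>0\<close>, and \<open>\<mu>\<close>
  may be infinite near \<open>0\<close>. Majorants are therefore scarce. Bridge weights converge in
  L1 by Scheffe's lemma instead, and \<open>\<mu>\<close> is met through
  \<open>1 - exp (- l1norm x)\<close>, which is \<open>\<mu>\<close>-integrable and vanishes only at
  \<open>0\<close>.

  The same weight separates the two kinds of passage: it annihilates \<open>V = 0\<close> and so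
  isolates jumps, while \<open>exp (- m * l1norm v)\<close> with large \<open>m\<close> isolates
  \<open>V = 0\<close>. In the latter case jumps contribute at most a multiple of the Laplace
  exponent at \<open>m\<close> times the all-one vector, divided by \<open>m\<close>; this tends to
  \<open>0\<close> because there is no drift.

  The conditional law is evaluated along the curve \<open>s = c t\<close>, a null set of the plane,
  and one version has to serve every boundary. This is why mere measurability in
  \<open>(t, y)\<close> does not suffice. For creeping, each cell compares two integrals with the
  same value times the drop of \<open>c\<close> over the cell, so the limit uses only integrated
  increments of \<open>c\<close>.\<close>

lemma l1norm_nonneg [simp]: "0 \<le> l1norm x"
  unfolding l1norm_def by (simp add: sum_nonneg)

lemma l1norm_zero [simp]: "l1norm 0 = 0"
  by (simp add: l1norm_def)

lemma norm_le_l1norm: "norm x \<le> l1norm x"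
  unfolding l1norm_def by (rule norm_le_l1_cart)

lemma continuous_on_l1norm [continuous_intros]:
  "continuous_on A f \<Longrightarrow> continuous_on A (\<lambda>x. l1norm (f x))"
  unfolding l1norm_def by (intro continuous_intros)

lemma tendsto_l1norm [tendsto_intros]:
  "(f \<longlongrightarrow> l) F \<Longrightarrow> ((\<lambda>x. l1norm (f x)) \<longlongrightarrow> l1norm l) F"
  unfolding l1norm_def by (intro tendsto_intros)

lemma borel_measurable_l1norm [measurable]: "l1norm \<in> borel_measurable borel"
  by (intro borel_measurable_continuous_onI continuous_on_l1norm continuous_on_id)

lemma borel_measurable_vec_nth' [measurable]: "(\<lambda>x::real^'d. x $ i) \<in> borel_measurable borel"
  by (intro borel_measurable_continuous_onI continuous_intros)

lemma l1norm_eq_0_iff: "l1norm x = 0 \<longleftrightarrow> x = 0"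
  unfolding l1norm_def by (subst sum_nonneg_eq_0_iff) (auto simp: vec_eq_iff)

lemma l1norm_orthant: "0 \<le> x \<Longrightarrow> l1norm x = (\<Sum>i\<in>UNIV. x $ i)"
  unfolding l1norm_def by (auto simp: less_eq_vec_def intro!: sum.cong)

lemma l1norm_eq_inner: "0 \<le> x \<Longrightarrow> l1norm x = (\<chi> i. 1) \<bullet> x"
  by (simp add: l1norm_orthant inner_vec_def)

lemma l1norm_add: "0 \<le> x \<Longrightarrow> 0 \<le> y \<Longrightarrow> l1norm (x + y) = l1norm x + l1norm y"
  by (subst (1 2 3) l1norm_orthant) (auto simp: sum.distrib less_eq_vec_def)

lemma l1norm_diff: "0 \<le> x \<Longrightarrow> x \<le> y \<Longrightarrow> l1norm (y - x) = l1norm y - l1norm x"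
  using l1norm_add[of x "y - x"] by (simp add: less_eq_vec_def)

lemma l1norm_mono: "0 \<le> x \<Longrightarrow> x \<le> y \<Longrightarrow> l1norm x \<le> l1norm y"
  using l1norm_diff[of x y] l1norm_nonneg[of "y - x"] by simp

lemma closed_orthant: "closed {0::real^'d..}"
  by (simp add: closed_eucl_atLeast)

lemma cadlag_at_right: "cadlag x \<Longrightarrow> 0 \<le> t \<Longrightarrow> (x \<longlongrightarrow> x t) (at_right t)"
  by (simp add: cadlag_def)

lemma cadlag_left_limit:
  "cadlag x \<Longrightarrow> 0 < t \<Longrightarrow> (x \<longlongrightarrow> left_limit x t) (at_left t)"
  unfolding cadlag_def left_limit_def
  using tendsto_Lim[of "at_left t" x] by auto

section \<open>Path properties: joint measurability, independent increments, monotonicity\<close>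

context driftless_subordinator
begin

abbreviation "S \<equiv> norm_process X"

abbreviation "\<psi> \<theta> \<equiv> \<integral>x. (1 - exp (- (\<theta> \<bullet> x))) \<partial>\<mu>"

lemma measurable_X [measurable (raw)]: "0 \<le> t \<Longrightarrow> X t \<in> borel_measurable M"
  by (rule random_variable)

lemma measurable_S [measurable (raw)]: "0 \<le> t \<Longrightarrow> S t \<in> borel_measurable M"
  unfolding norm_process_def by measurable

lemma X_nonneg: "0 \<le> t \<Longrightarrow> \<omega> \<in> space M \<Longrightarrow> 0 \<le> X t \<omega>"
  using orthant_valued[of t \<omega>] by simp

lemma S_nonneg [simp]: "0 \<le> S t \<omega>"
  by (simp add: norm_process_def)

lemma S_start: "\<omega> \<in> space M \<Longrightarrow> S 0 \<omega> = 0"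
  by (simp add: norm_process_def start)

text \<open>Right-continuity makes \<open>X\<close> the limit of its values at the next grid point
  to the right of \<open>t\<close>. For a fixed mesh only countably many times occur, so each
  approximation is measurable. \<open>max 0\<close> continues the process to negative times, which
  keeps later Fubini arguments free of side conditions.\<close>

lemma measurable_X_joint: "(\<lambda>(t, \<omega>). X (max 0 t) \<omega>) \<in> borel \<Otimes>\<^sub>M M \<rightarrow>\<^sub>M borel"
proof -
  let ?k = "\<lambda>n (t::real). (nat \<lfloor>real (Suc n) * max 0 t\<rfloor>)"
  let ?X = "\<lambda>n x. X ((1 + real (?k n (fst x))) / real (Suc n)) (snd x)"
  have "(\<lambda>x. X (max 0 (fst x)) (snd x)) \<in> borel_measurable (borel \<Otimes>\<^sub>M M)"
  proof (rule borel_measurable_LIMSEQ_metric)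
    fix n
    have "(\<lambda>x. X ((1 + real k) / real (Suc n)) (snd x)) \<in> borel_measurable (borel \<Otimes>\<^sub>M M)" for k
      by (rule measurable_compose[OF measurable_snd]) (auto intro!: measurable_X)
    moreover have "(\<lambda>x. ?k n (fst x)) \<in> borel \<Otimes>\<^sub>M M \<rightarrow>\<^sub>M count_space UNIV"
      by measurable
    ultimately show "?X n \<in> borel_measurable (borel \<Otimes>\<^sub>M M)"
      by (rule measurable_compose_countable)
  next
    fix x :: "real \<times> 'w" assume x: "x \<in> space (borel \<Otimes>\<^sub>M M)"
    define t where "t = max 0 (fst x)"
    have t: "0 \<le> t" by (simp add: t_def)
    let ?t = "\<lambda>n. (1 + real (nat \<lfloor>real (Suc n) * t\<rfloor>)) / real (Suc n)"
    \<comment> \<open>The inequality is strict even when \<open>t\<close> is itself a grid point,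
      because \<open>at_right\<close> excludes \<open>t\<close>.\<close>
    have gt: "t < ?t n" for n
    proof -
      have "real (Suc n) * t < 1 + real (nat \<lfloor>real (Suc n) * t\<rfloor>)"
        using t by (simp add: of_nat_nat del: of_nat_Suc) linarith
      then show ?thesis by (simp add: pos_less_divide_eq mult.commute del: of_nat_Suc)
    qed
    have le: "?t n \<le> t + 1 / real (Suc n)" for n
    proof -
      have "1 + real (nat \<lfloor>real (Suc n) * t\<rfloor>) \<le> real (Suc n) * t + 1"
        using t by (simp add: of_nat_nat del: of_nat_Suc)
      then have "?t n \<le> (real (Suc n) * t + 1) / real (Suc n)"
        by (intro divide_right_mono) auto
      also have "\<dots> = t + 1 / real (Suc n)"
        by (simp add: add_divide_distrib del: of_nat_Suc)
      finally show ?thesis .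
    qed
    define tn where "tn n = ?t n" for n
    have "(\<lambda>n. t + 1 / real (Suc n)) \<longlonglongrightarrow> t + 0"
      by (intro tendsto_add tendsto_const) (use LIMSEQ_inverse_real_of_nat in \<open>simp add: inverse_eq_divide\<close>)
    then have lim: "(\<lambda>n. t + 1 / real (Suc n)) \<longlonglongrightarrow> t" by simp
    have "tn \<longlonglongrightarrow> t"
      by (rule tendsto_sandwich[OF always_eventually always_eventually tendsto_const lim])
         (simp_all only: tn_def gt le less_imp_le simp_thms)
    then have "filterlim tn (at_right t) sequentially"
      by (rule tendsto_imp_filterlim_at_right) (simp only: tn_def gt eventually_True)
    then have "filterlim ?t (at_right t) sequentially"
      unfolding tn_def .
    moreover have "((\<lambda>t. X t (snd x)) \<longlongrightarrow> X t (snd x)) (at_right t)"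
      using x t by (intro cadlag_at_right cadlag_paths) (auto simp: space_pair_measure)
    ultimately have "(\<lambda>n. X (?t n) (snd x)) \<longlonglongrightarrow> X t (snd x)"
      by (rule filterlim_compose[rotated])
    then show "(\<lambda>n. ?X n x) \<longlonglongrightarrow> X (max 0 (fst x)) (snd x)"
      by (simp add: t_def)
  qed
  then show ?thesis by (simp add: case_prod_beta)
qed

lemma measurable_X_comp [measurable (raw)]:
  assumes "f \<in> borel_measurable N" "h \<in> N \<rightarrow>\<^sub>M M"
  shows "(\<lambda>x. X (max 0 (f x)) (h x)) \<in> borel_measurable N"
  using measurable_compose[OF measurable_Pair[OF assms] measurable_X_joint] by simp

lemma distr_increment:
  assumes "0 \<le> s" "s \<le> t"
  shows "distr M borel (\<lambda>\<omega>. X t \<omega> - X s \<omega>) = distr M borel (X (t - s))"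
  using stationary_increments[of s "t - s"] assms by simp

text \<open>The locale speaks of consecutive increments only. Along the times 0, s, t the first of
  them is \<open>X s\<close>, since paths start at \<open>0\<close>; this holds on
  \<open>space M\<close> only, hence the passage through \<open>distr_cong\<close>.\<close>

lemma indep_increment:
  assumes st: "0 \<le> s" "s \<le> t"
  shows "indep_var borel (X s) borel (\<lambda>\<omega>. X t \<omega> - X s \<omega>)"
proof -
  define T where "T i = (if i = 0 then 0 else if i = 1 then s else t)" for i :: nat
  have "indep_vars (\<lambda>_. borel) (\<lambda>i \<omega>. X (T (Suc i)) \<omega> - X (T i) \<omega>) {..<2}"
    using st by (intro independent_increments) (auto simp: T_def)
  from indep_var_compose[OF indep_var_restrict[OF this, of "{0}" "{1}"],
      of "\<lambda>f. f 0" borel "\<lambda>f. f 1" borel]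
  have *: "indep_var borel (\<lambda>\<omega>. X (T 1) \<omega> - X (T 0) \<omega>) borel (\<lambda>\<omega>. X (T 2) \<omega> - X (T 1) \<omega>)"
    by (simp add: o_def numeral_2_eq_2)
  have rv: "X s \<in> borel_measurable M" "(\<lambda>\<omega>. X t \<omega> - X s \<omega>) \<in> borel_measurable M"
    using st by (auto intro!: borel_measurable_diff random_variable)
  have "distr M borel (\<lambda>\<omega>. X s \<omega> - X 0 \<omega>) = distr M borel (X s)"
    by (rule distr_cong) (auto simp: start)
  moreover have "distr M (borel \<Otimes>\<^sub>M borel) (\<lambda>\<omega>. (X s \<omega> - X 0 \<omega>, X t \<omega> - X s \<omega>)) =
      distr M (borel \<Otimes>\<^sub>M borel) (\<lambda>\<omega>. (X s \<omega>, X t \<omega> - X s \<omega>))"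
    by (rule distr_cong) (auto simp: start)
  ultimately show ?thesis
    using * rv unfolding indep_var_distribution_eq by (simp add: T_def)
qed

interpretation MM: pair_prob_space M M ..

text \<open>Realises the increment by an independent copy of \<open>X (t - s)\<close> on a product
  space, so that expectations of two-time functionals become iterated integrals.\<close>

lemma distr_pair_increment:
  assumes st: "0 \<le> s" "s \<le> t"
  shows "distr M (borel \<Otimes>\<^sub>M borel) (\<lambda>\<omega>. (X s \<omega>, X t \<omega> - X s \<omega>)) =
    distr (M \<Otimes>\<^sub>M M) (borel \<Otimes>\<^sub>M borel) (\<lambda>(\<omega>, \<omega>'). (X s \<omega>, X (t - s) \<omega>'))"
proof -
  have [measurable]: "X s \<in> borel_measurable M" "X (t - s) \<in> borel_measurable M"
    "X t \<in> borel_measurable M"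
    using st by auto
  interpret D: prob_space "distr M borel (X (t - s))"
    by (rule prob_space_distr) simp
  have "distr M (borel \<Otimes>\<^sub>M borel) (\<lambda>\<omega>. (X s \<omega>, X t \<omega> - X s \<omega>)) =
    distr M borel (X s) \<Otimes>\<^sub>M distr M borel (X (t - s))"
    using indep_increment[OF st] distr_increment[OF st]
    by (simp add: indep_var_distribution_eq)
  also have "\<dots> = distr (M \<Otimes>\<^sub>M M) (borel \<Otimes>\<^sub>M borel) (\<lambda>(\<omega>, \<omega>'). (X s \<omega>, X (t - s) \<omega>'))"
    by (rule pair_measure_distr) (auto intro: D.sigma_finite_measure_axioms)
  finally show ?thesis .
qed

lemma nn_integral_increment:
  assumes st: "0 \<le> s" "s \<le> t" and [measurable]: "f \<in> borel_measurable (borel \<Otimes>\<^sub>M borel)"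
  shows "(\<integral>\<^sup>+\<omega>. f (X s \<omega>, X t \<omega> - X s \<omega>) \<partial>M) =
    (\<integral>\<^sup>+\<omega>. \<integral>\<^sup>+\<omega>'. f (X s \<omega>, X (t - s) \<omega>') \<partial>M \<partial>M)"
proof -
  have [measurable]: "X s \<in> borel_measurable M" "X (t - s) \<in> borel_measurable M"
    "X t \<in> borel_measurable M"
    using st by auto
  have "(\<integral>\<^sup>+\<omega>. f (X s \<omega>, X t \<omega> - X s \<omega>) \<partial>M) =
    integral\<^sup>N (distr M (borel \<Otimes>\<^sub>M borel) (\<lambda>\<omega>. (X s \<omega>, X t \<omega> - X s \<omega>))) f"
    by (subst nn_integral_distr) auto
  also have "\<dots> = (\<integral>\<^sup>+p. f (X s (fst p), X (t - s) (snd p)) \<partial>(M \<Otimes>\<^sub>M M))"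
    unfolding distr_pair_increment[OF st] by (subst nn_integral_distr) (auto simp: case_prod_beta)
  also have "\<dots> = (\<integral>\<^sup>+\<omega>. \<integral>\<^sup>+\<omega>'. f (X s \<omega>, X (t - s) \<omega>') \<partial>M \<partial>M)"
    by (subst nn_integral_fst[symmetric]) auto
  finally show ?thesis .
qed

text \<open>The order in which the increment is frozen and the past is integrated out first;
  exchangeability of the bridge and the analysis of one cell both use it.\<close>

lemma nn_integral_increment_swap:
  assumes st: "0 \<le> s" "s \<le> t" and [measurable]: "f \<in> borel_measurable (borel \<Otimes>\<^sub>M borel)"
  shows "(\<integral>\<^sup>+\<omega>. f (X s \<omega>, X t \<omega> - X s \<omega>) \<partial>M) =
    (\<integral>\<^sup>+\<omega>'. \<integral>\<^sup>+\<omega>. f (X s \<omega>, X (t - s) \<omega>') \<partial>M \<partial>M)"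
proof -
  have [measurable]: "X s \<in> borel_measurable M" "X (t - s) \<in> borel_measurable M"
    using st by auto
  show ?thesis
    unfolding nn_integral_increment[OF assms]
    by (rule MM.Fubini') measurable
qed

lemma AE_mono_pair:
  assumes st: "0 \<le> s" "s \<le> t"
  shows "AE \<omega> in M. X s \<omega> \<le> X t \<omega>"
proof -
  have [measurable]: "X s \<in> borel_measurable M" "X (t - s) \<in> borel_measurable M"
    "X t \<in> borel_measurable M"
    using st by auto
  have m[measurable]: "Measurable.pred borel (\<lambda>x::real^'d. 0 \<le> x)"
    using closed_orthant[where 'd='d, THEN borel_closed] by (simp add: pred_def atLeast_def)
  have "AE x in distr M borel (X (t - s)). 0 \<le> x"
    using st by (subst AE_distr_iff) (measurable, auto intro!: AE_I2 X_nonneg)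
  then have "AE x in distr M borel (\<lambda>\<omega>. X t \<omega> - X s \<omega>). 0 \<le> x"
    unfolding distr_increment[OF st] .
  then have "AE \<omega> in M. 0 \<le> X t \<omega> - X s \<omega>"
    by (subst (asm) AE_distr_iff) measurable
  then show ?thesis by eventually_elim (auto simp: less_eq_vec_def)
qed

text \<open>Countably many rational pairs can be treated at once. Right-continuity then carries the
  inequality, coordinate by coordinate, to a real right end and afterwards to a real left
  end.\<close>

lemma AE_mono: "AE \<omega> in M. \<forall>s t. 0 \<le> s \<longrightarrow> s \<le> t \<longrightarrow> X s \<omega> \<le> X t \<omega>"
proof -
  have "AE \<omega> in M. \<forall>p\<in>\<rat> \<inter> {0..}. \<forall>q\<in>\<rat> \<inter> {p..}. X p \<omega> \<le> X q \<omega>"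
    by (simp add: AE_ball_countable countable_Int1 countable_rat AE_mono_pair)
  then show ?thesis
  proof (rule AE_mp, intro AE_I2 impI allI)
    fix \<omega> s t
    assume w: "\<omega> \<in> space M" and q: "\<forall>p\<in>\<rat> \<inter> {0..}. \<forall>q\<in>\<rat> \<inter> {p..}. X p \<omega> \<le> X q \<omega>"
      and st: "0 \<le> s" "s \<le> (t::real)"
    have rat: "X p \<omega> \<le> X t \<omega>" if p: "p \<in> \<rat>" "0 \<le> p" "p \<le> t" for p t
    proof (rule ccontr)
      assume "\<not> X p \<omega> \<le> X t \<omega>"
      then obtain i where i: "X t \<omega> $ i < X p \<omega> $ i" by (auto simp: less_eq_vec_def not_le)
      have "((\<lambda>t. X t \<omega> $ i) \<longlongrightarrow> X t \<omega> $ i) (at_right t)"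
        using p by (intro tendsto_intros cadlag_at_right cadlag_paths w) auto
      from order_tendstoD(2)[OF this i] obtain b where b: "b > t"
        and *: "\<And>y. t < y \<Longrightarrow> y < b \<Longrightarrow> X y \<omega> $ i < X p \<omega> $ i"
        unfolding eventually_at_right_field by auto
      obtain y where y: "y \<in> \<rat>" "t < y" "y < b" using Rats_dense_in_real[OF b] by auto
      then have "X p \<omega> \<le> X y \<omega>" using q p by auto
      then have "X p \<omega> $ i \<le> X y \<omega> $ i" by (simp add: less_eq_vec_def)
      with *[of y] y show False by simp
    qed
    show "X s \<omega> \<le> X t \<omega>"
    proof (cases "s = t")
      case False
      with st have "s < t" by simp
      show ?thesis
      proof (rule ccontr)
        assume "\<not> X s \<omega> \<le> X t \<omega>"
        then obtain i where i: "X t \<omega> $ i < X s \<omega> $ i" by (auto simp: less_eq_vec_def not_le)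
        have "((\<lambda>t. X t \<omega> $ i) \<longlongrightarrow> X s \<omega> $ i) (at_right s)"
          using st by (intro tendsto_intros cadlag_at_right cadlag_paths w) auto
        from order_tendstoD(1)[OF this i] obtain b where b: "b > s"
          and *: "\<And>y. s < y \<Longrightarrow> y < b \<Longrightarrow> X t \<omega> $ i < X y \<omega> $ i"
          unfolding eventually_at_right_field by auto
        obtain y where y: "y \<in> \<rat>" "s < y" "y < min b t"
          using Rats_dense_in_real[of s "min b t"] b \<open>s < t\<close> by auto
        then have "X y \<omega> \<le> X t \<omega>" using rat[of y t] st by auto
        then have "X y \<omega> $ i \<le> X t \<omega> $ i" by (simp add: less_eq_vec_def)
        with *[of y] y show False by simp
      qed
    qed simp
  qed
qed

lemma tendsto_0_right:
  assumes "\<omega> \<in> space M" "filterlim f (at_right 0) F"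
  shows "((\<lambda>x. X (f x) \<omega>) \<longlongrightarrow> 0) F"
  using filterlim_compose[OF cadlag_at_right[OF cadlag_paths[OF assms(1)], of 0] assms(2)]
  by (simp add: start assms(1))

text \<open>There are no fixed times of discontinuity: \<open>X t - X (t - d)\<close> has the law of
  \<open>X d\<close>, which tends to \<open>0\<close> with \<open>d\<close>. The bounded function
  \<open>min 1 (norm x)\<close> expresses this through expectations.\<close>

lemma AE_left_continuous:
  assumes t: "0 < t"
  shows "AE \<omega> in M. left_limit (\<lambda>t. X t \<omega>) t = X t \<omega>"
proof -
  define d where "d n = t / real (Suc (Suc n))" for n
  define s where "s n = t - d n" for n
  have d: "0 < d n" "d n \<le> t" for n
  proof -
    have "t / real (Suc (Suc n)) \<le> t / 1" using t by (intro divide_left_mono) auto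
    then show "0 < d n" "d n \<le> t" using t by (auto simp: d_def)
  qed
  have s: "0 \<le> s n" "s n < t" "t - s n = d n" for n
    using d[of n] by (auto simp: s_def)
  have d0: "d \<longlonglongrightarrow> 0"
    unfolding d_def using LIMSEQ_Suc[OF LIMSEQ_Suc[OF lim_const_over_n[of t]]] by simp
  have "s \<longlonglongrightarrow> t - 0"
    unfolding s_def by (intro tendsto_diff tendsto_const d0)
  then have fl: "filterlim s (at_left t) sequentially"
    by (intro tendsto_imp_filterlim_at_left) (use s in auto)
  have fr: "filterlim d (at_right 0) sequentially"
    by (intro tendsto_imp_filterlim_at_right d0) (use d in auto)
  let ?L = "\<lambda>\<omega>. left_limit (\<lambda>t. X t \<omega>) t"
  have lim: "(\<lambda>n. X (s n) \<omega>) \<longlonglongrightarrow> ?L \<omega>" if "\<omega> \<in> space M" for \<omega>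
    using filterlim_compose[OF cadlag_left_limit[OF cadlag_paths[OF that] t] fl] .
  have [measurable]: "X (s n) \<in> borel_measurable M" "X (d n) \<in> borel_measurable M"
    "X t \<in> borel_measurable M" for n
    using s(1)[of n] d(1)[of n] t by auto
  have [measurable]: "?L \<in> borel_measurable M"
    by (rule borel_measurable_LIMSEQ_metric[OF _ lim]) measurable
  have "(\<lambda>n. \<integral>\<omega>. min 1 (norm (X t \<omega> - X (s n) \<omega>)) \<partial>M) \<longlonglongrightarrow> (\<integral>\<omega>. min 1 (norm (X t \<omega> - ?L \<omega>)) \<partial>M)"
  proof (rule integral_dominated_convergence[where w="\<lambda>_. 1"])
    show "AE \<omega> in M. (\<lambda>n. min 1 (norm (X t \<omega> - X (s n) \<omega>))) \<longlonglongrightarrow> min 1 (norm (X t \<omega> - ?L \<omega>))"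
      by (intro AE_I2 tendsto_min tendsto_const tendsto_norm tendsto_diff lim)
  qed simp_all
  moreover have "(\<integral>\<omega>. min 1 (norm (X t \<omega> - X (s n) \<omega>)) \<partial>M) =
      (\<integral>\<omega>. min 1 (norm (X (d n) \<omega>)) \<partial>M)" for n
  proof -
    have "(\<integral>\<omega>. min 1 (norm (X t \<omega> - X (s n) \<omega>)) \<partial>M) =
      (\<integral>x. min 1 (norm x) \<partial>distr M borel (\<lambda>\<omega>. X t \<omega> - X (s n) \<omega>))"
      by (subst integral_distr) auto
    also have "\<dots> = (\<integral>x. min 1 (norm x) \<partial>distr M borel (X (d n)))"
      using s[of n] by (subst distr_increment) auto
    also have "\<dots> = (\<integral>\<omega>. min 1 (norm (X (d n) \<omega>)) \<partial>M)"
      by (subst integral_distr) auto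
    finally show ?thesis .
  qed
  moreover have "(\<lambda>n. \<integral>\<omega>. min 1 (norm (X (d n) \<omega>)) \<partial>M) \<longlonglongrightarrow> (\<integral>\<omega>. min 1 (norm (0::real^'d)) \<partial>M)"
  proof (rule integral_dominated_convergence[where w="\<lambda>_. 1"])
    show "AE \<omega> in M. (\<lambda>n. min 1 (norm (X (d n) \<omega>))) \<longlonglongrightarrow> min 1 (norm (0::real^'d))"
      by (intro AE_I2 tendsto_min tendsto_const tendsto_norm tendsto_0_right fr)
  qed simp_all
  ultimately have "(\<integral>\<omega>. min 1 (norm (X t \<omega> - ?L \<omega>)) \<partial>M) = (\<integral>\<omega>. min 1 (norm (0::real^'d)) \<partial>M)"
    using LIMSEQ_unique by simp
  then have "(\<integral>\<omega>. min 1 (norm (X t \<omega> - ?L \<omega>)) \<partial>M) = 0" by simp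
  moreover have "integrable M (\<lambda>\<omega>. min 1 (norm (X t \<omega> - ?L \<omega>)))"
    by (rule integrable_const_bound[where B=1]) auto
  ultimately have "AE \<omega> in M. min 1 (norm (X t \<omega> - ?L \<omega>)) = 0"
    by (subst (asm) integral_nonneg_eq_0_iff_AE) simp_all
  then show ?thesis by eventually_elim (auto simp: min_def split: if_splits)
qed

lemma AE_continuous:
  assumes t: "0 < t"
  shows "AE \<omega> in M. ((\<lambda>s. X s \<omega>) \<longlongrightarrow> X t \<omega>) (nhds t)"
  using AE_left_continuous[OF t]
proof (rule AE_mp, intro AE_I2 impI)
  fix \<omega> assume w: "\<omega> \<in> space M" and l: "left_limit (\<lambda>t. X t \<omega>) t = X t \<omega>"
  have "((\<lambda>s. X s \<omega>) \<longlongrightarrow> X t \<omega>) (at t)"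
    using cadlag_left_limit[OF cadlag_paths[OF w] t] cadlag_at_right[OF cadlag_paths[OF w], of t] t l
    by (auto simp: filterlim_at_split)
  then show "((\<lambda>s. X s \<omega>) \<longlongrightarrow> X t \<omega>) (nhds t)"
    by (simp add: tendsto_nhds_iff)
qed

lemma AE_tendsto:
  assumes "0 < t" "ts \<longlonglongrightarrow> t"
  shows "AE \<omega> in M. (\<lambda>n. X (ts n) \<omega>) \<longlonglongrightarrow> X t \<omega>"
  using AE_continuous[OF assms(1)]
  by eventually_elim (rule filterlim_compose[OF _ assms(2)])

section \<open>Integrability against the Levy measure\<close>

lemma min_1_levy: "0 \<le> x \<Longrightarrow> 1 - exp (- x) \<le> min 1 (x::real)"
  using exp_ge_add_one_self[of "-x"] by (intro min.boundedI) (simp, linarith)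

lemma AE_levy_orthant: "AE x in \<mu>. 0 \<le> x"
proof (rule AE_I')
  show "- {0..} \<in> null_sets \<mu>"
    using levy_measure_orthant borel_closed[OF closed_orthant[where 'd='d]]
    by (intro null_setsI) (simp_all add: sets_levy_measure borel_comp)
qed auto

lemma space_levy [simp]: "space \<mu> = UNIV"
  using sets_eq_imp_space_eq[OF sets_levy_measure] by simp

lemma measurable_levy [simp]: "measurable \<mu> N = measurable borel N" "measurable N \<mu> = measurable N borel"
  by (rule measurable_cong_sets; simp add: sets_levy_measure)+

lemma integrable_levy_min: "integrable \<mu> (\<lambda>x. min 1 (l1norm x))"
  using levy_measure_integrable by (intro integrableI_nonneg) auto

lemma integrable_levy_bound:
  assumes [measurable]: "f \<in> borel_measurable borel" and "\<And>x. 0 \<le> x \<Longrightarrow> \<bar>f x\<bar> \<le> C * min 1 (l1norm x)"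
  shows "integrable \<mu> f"
proof (rule Bochner_Integration.integrable_bound[OF integrable_mult_right[OF integrable_levy_min, of C]])
  show "AE x in \<mu>. norm (f x) \<le> norm (C * min 1 (l1norm x))"
    using AE_levy_orthant by eventually_elim (use assms(2) in fastforce)
qed simp

lemma inner_le_l1norm:
  assumes "0 \<le> \<theta>" "0 \<le> (x::real^'d)" shows "\<theta> \<bullet> x \<le> norm \<theta> * l1norm x" "0 \<le> \<theta> \<bullet> x"
proof -
  show "\<theta> \<bullet> x \<le> norm \<theta> * l1norm x"
    using norm_cauchy_schwarz[of \<theta> x] norm_le_l1norm[of x]
    by (smt (verit) mult_left_mono norm_ge_zero)
  show "0 \<le> \<theta> \<bullet> x"
    using assms by (auto simp: inner_vec_def less_eq_vec_def intro!: sum_nonneg)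
qed

lemma integrable_psi:
  assumes "0 \<le> \<theta>"
  shows "integrable \<mu> (\<lambda>x. 1 - exp (- (\<theta> \<bullet> x)))"
\<comment> \<open>Where \<open>l1norm x\<close> is at least \<open>1\<close> the summand
  \<open>1\<close> of the constant does the work, elsewhere the summand
  \<open>norm \<theta>\<close>.\<close>
proof (rule integrable_levy_bound[where C="1 + norm \<theta>"])
  fix x :: "real^'d" assume x: "0 \<le> x"
  have "1 - exp (- (\<theta> \<bullet> x)) \<le> min 1 (\<theta> \<bullet> x)" using inner_le_l1norm[OF assms x] by (intro min_1_levy)
  also have "\<dots> \<le> min 1 (norm \<theta> * l1norm x)" using inner_le_l1norm[OF assms x] by auto
  also have "\<dots> \<le> (1 + norm \<theta>) * min 1 (l1norm x)"
  proof (cases "1 \<le> l1norm x")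
    case True
    then have "min 1 (l1norm x) = 1" by (rule min_absorb1)
    then show ?thesis by (simp add: min.coboundedI1)
  next
    case False
    then have "min 1 (l1norm x) = l1norm x" by (intro min_absorb2) simp
    moreover have "min 1 (norm \<theta> * l1norm x) \<le> norm \<theta> * l1norm x" by simp
    moreover have "min 1 (norm \<theta> * l1norm x) \<le> l1norm x + norm \<theta> * l1norm x"
      using l1norm_nonneg[of x] calculation(2) by linarith
    ultimately show ?thesis by (simp add: distrib_right)
  qed
  finally show "\<bar>1 - exp (- (\<theta> \<bullet> x))\<bar> \<le> (1 + norm \<theta>) * min 1 (l1norm x)"
    using inner_le_l1norm(2)[OF assms x] by simp
qed measurable

lemma laplace: "0 \<le> t \<Longrightarrow> 0 \<le> \<theta> \<Longrightarrow> (\<integral>\<omega>. exp (- (\<theta> \<bullet> X t \<omega>)) \<partial>M) = exp (- t * \<psi> \<theta>)"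
  using laplace_exponent[of t \<theta>] by simp

text \<open>Every point other than \<open>0\<close> lies in a set on which
  \<open>min 1 (l1norm x)\<close> is at least \<open>1 / Suc n\<close>. These sets have finite mass
  by Markov's inequality and \<open>{0}\<close> has none. Fubini with \<open>\<mu>\<close> rests on
  this.\<close>

lemma sigma_finite_levy: "sigma_finite_measure \<mu>"
proof (rule sigma_finite_measure.intro, intro exI conjI)
  let ?A = "\<lambda>n. {x. 1 / real (Suc n) \<le> min 1 (l1norm x)} :: (real^'d) set"
  let ?C = "insert {0} (range ?A)"
  show "countable ?C" by simp
  show "?C \<subseteq> sets \<mu>"
    unfolding sets_levy_measure by (auto simp del: of_nat_Suc)
  show "\<Union> ?C = space \<mu>"
  proof (intro equalityI subsetI)
    fix x :: "real^'d"
    show "x \<in> \<Union> ?C"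
    proof (cases "x = 0")
      case False
    then have "0 < min 1 (l1norm x)"
      using l1norm_eq_0_iff[of x] l1norm_nonneg[of x] by (auto simp: less_le simp del: l1norm_nonneg)
    from reals_Archimedean[OF this] obtain n where "1 / real (Suc n) < min 1 (l1norm x)"
      by (auto simp: inverse_eq_divide simp del: of_nat_Suc)
    then have "x \<in> ?A n" by simp
    then show ?thesis by blast
    qed simp
  qed simp
  show "\<forall>a\<in>?C. emeasure \<mu> a \<noteq> \<infinity>"
  proof
    fix a assume "a \<in> ?C"
    then consider "a = {0}" | n where "a = ?A n" by auto
    then show "emeasure \<mu> a \<noteq> \<infinity>"
    proof cases
      case 2
      have "emeasure \<mu> {x\<in>space \<mu>. 1 / real (Suc n) \<le> min 1 (l1norm x)} < \<infinity>"
        by (rule order_le_less_trans[OF integral_Markov_inequality[OF integrable_levy_min]]) auto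
      then show ?thesis using 2 by simp
    qed (simp add: levy_measure_zero)
  qed
qed
end

section \<open>Densities and the Chapman-Kolmogorov equation\<close>

text \<open>Picks, from any interval, a point at which an almost everywhere identity holds; on
  shrinking intervals this produces a sequence tending to a prescribed point.\<close>

lemma AE_lborel_dense:
  assumes "AE x in lborel. P x" "u < (v::real)"
  shows "\<exists>x. u < x \<and> x < v \<and> P x"
proof (rule ccontr)
  assume *: "\<not> ?thesis"
  obtain N where N: "\<And>x. x \<in> space lborel - N \<Longrightarrow> P x" "N \<in> null_sets lborel"
    using AE_E3[OF assms(1)] by blast
  have "{u<..<v} \<subseteq> N" using * N(1) by (force simp: not_less)
  then have "emeasure lborel {u<..<v} \<le> emeasure lborel N"
    using N(2) by (intro emeasure_mono) (auto simp: null_sets_def)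
  then show False using N(2) assms(2) by (auto simp: null_sets_def)
qed

section \<open>The continuous density of the norm\<close>

locale density_subordinator = driftless_subordinator M X \<mu>
  for M :: "'w measure" and X :: "real \<Rightarrow> 'w \<Rightarrow> real ^ 'd" and \<mu> +
  fixes g :: "real \<Rightarrow> real \<Rightarrow> real"
  assumes continuous_density: "continuous_density M (norm_process X) g"
begin

text \<open>\<open>continuous_density\<close> leaves \<open>g t x\<close> unspecified for
  \<open>t \<le> 0\<close>. Setting it to \<open>0\<close> there gives a function that is
  nonnegative and jointly measurable on the whole plane.\<close>

definition gg :: "real \<Rightarrow> real \<Rightarrow> real" where
  "gg t x = (if 0 < t \<and> 0 < x then g t x else 0)"

lemma gg_eq: "0 < t \<Longrightarrow> g t x = gg t x"
  using continuous_density by (auto simp: gg_def continuous_density_def)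

lemma gg_nonneg [simp]: "0 \<le> gg t x"
  using continuous_density by (auto simp: gg_def continuous_density_def)

lemma gg_zero: "x \<le> 0 \<Longrightarrow> gg t x = 0"
  by (simp add: gg_def)

lemma continuous_on_gg: "continuous_on ({0<..} \<times> {0<..}) (\<lambda>p. gg (fst p) (snd p))"
proof -
  have "continuous_on ({0<..} \<times> {0<..}) (\<lambda>(t, x). g t x)"
    using continuous_density by (simp add: continuous_density_def)
  then show ?thesis
    by (subst continuous_on_cong[OF refl, of _ _ "\<lambda>(t, x). g t x"]) (auto simp: gg_def)
qed

lemma tendsto_gg_pos:
  assumes "(ts \<longlongrightarrow> t) F" "(xs \<longlongrightarrow> x) F" "0 < t" "0 < x"
  shows "((\<lambda>n. gg (ts n) (xs n)) \<longlongrightarrow> gg t x) F"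
proof -
  have "open ({0<..} \<times> {0<..} :: (real \<times> real) set)" by (intro open_Times) auto
  then have "isCont (\<lambda>p. gg (fst p) (snd p)) (t, x)"
    using continuous_on_gg assms by (simp add: continuous_on_eq_continuous_at)
  from isCont_tendsto_compose[OF this tendsto_Pair[OF assms(1,2)]] show ?thesis by simp
qed

text \<open>At \<open>x = 0\<close> the density may jump or blow up, so this value is excluded;
  where the lemma is applied, \<open>AE_S_neq\<close> makes the excluded event null.\<close>

lemma tendsto_gg:
  assumes "(ts \<longlongrightarrow> t) F" "(xs \<longlongrightarrow> x) F" "0 < t" "x \<noteq> 0"
  shows "((\<lambda>n. gg (ts n) (xs n)) \<longlongrightarrow> gg t x) F"
proof (cases "0 < x")
  case False
  then have "x < 0" using assms by simp
  from order_tendstoD(2)[OF assms(2) this] have "\<forall>\<^sub>F n in F. gg (ts n) (xs n) = 0"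
    by eventually_elim (simp add: gg_zero)
  then show ?thesis using \<open>x < 0\<close> by (simp add: gg_zero tendsto_eventually)
qed (use tendsto_gg_pos assms in blast)

lemma measurable_gg_joint: "(\<lambda>p. gg (fst p) (snd p)) \<in> borel_measurable (borel \<Otimes>\<^sub>M borel)"
proof -
  have "(\<lambda>p. indicator ({0<..} \<times> {0<..}) p *\<^sub>R gg (fst p) (snd p)) \<in> borel_measurable borel"
    by (rule borel_measurable_continuous_on_indicator[OF _ continuous_on_gg])
       (intro borel_open open_Times, auto)
  also have "(\<lambda>p. indicator ({0<..} \<times> {0<..}) p *\<^sub>R gg (fst p) (snd p)) = (\<lambda>p. gg (fst p) (snd p))"
    by (auto simp: gg_def indicator_def fun_eq_iff)
  finally show ?thesis by (simp add: borel_prod)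
qed

lemma measurable_gg [measurable (raw)]:
  assumes "f \<in> borel_measurable N" "h \<in> borel_measurable N"
  shows "(\<lambda>x. gg (f x) (h x)) \<in> borel_measurable N"
  using measurable_compose[OF measurable_Pair[OF assms] measurable_gg_joint] by simp

lemma distr_S: "0 < t \<Longrightarrow> distr M borel (S t) = density lborel (\<lambda>x. ennreal (gg t x))"
proof -
  assume t: "0 < t"
  have "distr M borel (S t) = distr M lborel (S t)" by (rule distr_cong) auto
  also have "\<dots> = density lborel (\<lambda>x. ennreal (g t x))"
    using continuous_density t unfolding continuous_density_def distributed_def by blast
  finally show ?thesis using t by (simp add: gg_eq)
qed

lemma nn_integral_S:
  assumes t: "0 < t" and [measurable]: "q \<in> borel_measurable borel"
  shows "(\<integral>\<^sup>+\<omega>. q (S t \<omega>) \<partial>M) = (\<integral>\<^sup>+x. ennreal (gg t x) * q x \<partial>lborel)"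
proof -
  have [measurable]: "S t \<in> borel_measurable M" using t by (intro measurable_S) simp
  have "(\<integral>\<^sup>+\<omega>. q (S t \<omega>) \<partial>M) = integral\<^sup>N (distr M borel (S t)) q"
    by (subst nn_integral_distr) auto
  then show ?thesis
    unfolding distr_S[OF t] by (simp add: nn_integral_density)
qed

lemma nn_integral_gg: "0 < t \<Longrightarrow> (\<integral>\<^sup>+x. ennreal (gg t x) \<partial>lborel) = 1"
  using nn_integral_S[of t "\<lambda>_. 1"] emeasure_space_1 by simp

lemma AE_S_neq:
  assumes t: "0 < t"
  shows "AE \<omega> in M. S t \<omega> \<noteq> y"
proof -
  have [measurable]: "S t \<in> borel_measurable M" using t by (intro measurable_S) simp
  have "(\<integral>\<^sup>+\<omega>. indicator {y} (S t \<omega>) \<partial>M) = (\<integral>\<^sup>+x. ennreal (gg t x) * indicator {y} x \<partial>lborel)"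
    using t by (intro nn_integral_S) auto
  also have "\<dots> = (\<integral>\<^sup>+x. 0 \<partial>(lborel::real measure))"
    using AE_lborel_singleton[of y] by (intro nn_integral_cong_AE) (auto elim!: eventually_mono)
  finally have "(\<integral>\<^sup>+\<omega>. indicator {y} (S t \<omega>) \<partial>M) = 0" by simp
  then have "AE \<omega> in M. indicator {y} (S t \<omega>) = (0::ennreal)"
    by (subst (asm) nn_integral_0_iff_AE) auto
  then show ?thesis by eventually_elim (auto simp: indicator_def split: if_splits)
qed

lemma S_add: "0 \<le> a \<Longrightarrow> 0 \<le> b \<Longrightarrow> \<omega> \<in> space M \<Longrightarrow> \<omega>' \<in> space M \<Longrightarrow>
    l1norm (X a \<omega> + X b \<omega>') = S a \<omega> + S b \<omega>'"
  unfolding norm_process_def by (intro l1norm_add X_nonneg)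

section \<open>Chapman-Kolmogorov, from almost everywhere to everywhere\<close>

interpretation MM: pair_prob_space M M ..
interpretation XL: pair_sigma_finite M lborel ..

text \<open>Both sides are densities of \<open>S (a + b)\<close>. A pointwise identity requires in
  addition that the right-hand side be continuous in \<open>z\<close>.\<close>

lemma chapman_kolmogorov_AE:
  assumes ab: "0 < a" "0 < b"
  shows "AE z in lborel. ennreal (gg (a + b) z) = (\<integral>\<^sup>+\<omega>. ennreal (gg b (z - S a \<omega>)) \<partial>M)"
proof -
  have [measurable]: "S a \<in> borel_measurable M" "S b \<in> borel_measurable M"
    using ab by (auto intro!: measurable_S)
  have eq: "(\<integral>\<^sup>+z\<in>A. ennreal (gg (a + b) z) \<partial>lborel) =
    (\<integral>\<^sup>+z\<in>A. (\<integral>\<^sup>+\<omega>. ennreal (gg b (z - S a \<omega>)) \<partial>M) \<partial>lborel)" if "A \<in> sets lborel" for A :: "real set"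
  proof -
    from that have [measurable]: "A \<in> sets borel" by simp
  have "(\<integral>\<^sup>+z\<in>A. ennreal (gg (a + b) z) \<partial>lborel) = (\<integral>\<^sup>+\<omega>. indicator A (S (a + b) \<omega>) \<partial>M)"
    using ab by (subst nn_integral_S) auto
  also have "\<dots> = (\<integral>\<^sup>+\<omega>. indicator A (l1norm (fst (X a \<omega>, X (a + b) \<omega> - X a \<omega>) + snd (X a \<omega>, X (a + b) \<omega> - X a \<omega>))) \<partial>M)"
    by (simp add: norm_process_def)
  also have "\<dots> = (\<integral>\<^sup>+\<omega>. \<integral>\<^sup>+\<omega>'. indicator A (l1norm (X a \<omega> + X b \<omega>')) \<partial>M \<partial>M)"
    using nn_integral_increment[of a "a + b" "\<lambda>p. indicator A (l1norm (fst p + snd p))"] ab by simp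
  also have "\<dots> = (\<integral>\<^sup>+\<omega>. \<integral>\<^sup>+\<omega>'. indicator A (S a \<omega> + S b \<omega>') \<partial>M \<partial>M)"
    using ab by (intro nn_integral_cong) (simp add: S_add)
  also have "\<dots> = (\<integral>\<^sup>+\<omega>. \<integral>\<^sup>+x. ennreal (gg b x) * indicator A (S a \<omega> + x) \<partial>lborel \<partial>M)"
    using ab by (intro nn_integral_cong nn_integral_S) auto
  also have "\<dots> = (\<integral>\<^sup>+\<omega>. \<integral>\<^sup>+z. ennreal (gg b (z - S a \<omega>)) * indicator A z \<partial>lborel \<partial>M)"
  proof (rule nn_integral_cong)
    fix \<omega>
    show "(\<integral>\<^sup>+x. ennreal (gg b x) * indicator A (S a \<omega> + x) \<partial>lborel) =
      (\<integral>\<^sup>+z. ennreal (gg b (z - S a \<omega>)) * indicator A z \<partial>lborel)"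
      using nn_integral_real_affine[of "\<lambda>x. ennreal (gg b x) * indicator A (S a \<omega> + x)" 1 "- S a \<omega>"]
      by (simp add: add.commute)
  qed
  also have "\<dots> = (\<integral>\<^sup>+z. \<integral>\<^sup>+\<omega>. ennreal (gg b (z - S a \<omega>)) * indicator A z \<partial>M \<partial>lborel)"
    by (rule XL.Fubini'[symmetric]) measurable
  also have "\<dots> = (\<integral>\<^sup>+z. (\<integral>\<^sup>+\<omega>. ennreal (gg b (z - S a \<omega>)) \<partial>M) * indicator A z \<partial>lborel)"
    by (intro nn_integral_cong nn_integral_multc) measurable
  finally show ?thesis .
  qed
  show ?thesis
    by (rule sigma_finite_measure.density_unique2[OF sigma_finite_lborel _ _ eq]) simp_all
qed

lemma gg_bounded:
  assumes "0 < t" "t \<le> u" "0 < x" "x \<le> (y::real)"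
  obtains C where "0 < C" "\<And>s z. s \<in> {t..u} \<Longrightarrow> z \<in> {x..y} \<Longrightarrow> gg s z \<le> C"
proof -
  have "compact ((\<lambda>p. gg (fst p) (snd p)) ` ({t..u} \<times> {x..y}))"
    using assms by (intro compact_continuous_image continuous_on_subset[OF continuous_on_gg] compact_Times) auto
  then have "bounded ((\<lambda>p. gg (fst p) (snd p)) ` ({t..u} \<times> {x..y}))"
    by (rule compact_imp_bounded)
  then obtain C where "0 < C" and C: "\<forall>v\<in>(\<lambda>p. gg (fst p) (snd p)) ` ({t..u} \<times> {x..y}). norm v \<le> C"
    unfolding bounded_pos by auto
  then have "gg s z \<le> C" if "s \<in> {t..u}" "z \<in> {x..y}" for s z
    using C that by force
  with \<open>0 < C\<close> show ?thesis by (rule that)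
qed

text \<open>The cut at distance \<open>r\<close> keeps the argument of \<open>gg b\<close> away from
  \<open>0\<close>, where \<open>gg b\<close> may be unbounded. On what remains it is at most
  \<open>C\<close>, and \<open>C * gg a\<close> dominates.\<close>

lemma convolution_half_tendsto:
  assumes ab: "0 < a" "0 < b" and z: "0 < z" and zn: "zs \<longlonglongrightarrow> z" 
    and r: "0 < r" "r < z" and rz: "\<And>n. zs n < z + r" "\<And>n. z - r / 2 < zs n"
  shows "(\<lambda>n. \<integral>\<^sup>+x. ennreal (gg a x * gg b (zs n - x) * indicator {..<zs n - r} x) \<partial>lborel) \<longlonglongrightarrow>
     (\<integral>\<^sup>+x. ennreal (gg a x * gg b (z - x) * indicator {..<z - r} x) \<partial>lborel)"
proof -
  obtain C where C: "0 < C" "\<And>s x. s \<in> {b..b} \<Longrightarrow> x \<in> {r..z + r} \<Longrightarrow> gg s x \<le> C"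
    using gg_bounded[of b b r "z + r"] assms by auto
  show ?thesis
  proof (rule nn_integral_dominated_convergence[where w="\<lambda>x. ennreal (C * gg a x)"])
    have "(\<integral>\<^sup>+x. ennreal (C * gg a x) \<partial>lborel) = ennreal C * (\<integral>\<^sup>+x. ennreal (gg a x) \<partial>lborel)"
      using C by (simp add: ennreal_mult nn_integral_cmult)
    then show "(\<integral>\<^sup>+x. ennreal (C * gg a x) \<partial>lborel) < \<infinity>"
      using nn_integral_gg[OF ab(1)] by simp
    show "AE x in lborel. ennreal (gg a x * gg b (zs n - x) * indicator {..<zs n - r} x) \<le> ennreal (C * gg a x)" for n
    proof (intro AE_I2 ennreal_leI)
      fix x show "gg a x * gg b (zs n - x) * indicator {..<zs n - r} x \<le> C * gg a x"
      proof (cases "0 < x \<and> x < zs n - r")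
        case True
        then have "gg b (zs n - x) \<le> C" using rz[of n] by (intro C) auto
        from mult_left_mono[OF this gg_nonneg[of a x]] show ?thesis using True by (simp add: mult.commute)
      next
        case False
        then show ?thesis using C by (auto simp: gg_zero indicator_def)
      qed
    qed
    show "AE x in lborel. (\<lambda>n. ennreal (gg a x * gg b (zs n - x) * indicator {..<zs n - r} x)) \<longlonglongrightarrow>
      ennreal (gg a x * gg b (z - x) * indicator {..<z - r} x)"
      \<comment> \<open>At \<open>x = z - r\<close> the indicator need not converge, but a single
        point is null.\<close>
      using AE_lborel_singleton[of "z - r"]
    proof eventually_elim
      fix x assume x: "x \<noteq> z - r"
      have "(\<lambda>n. zs n - r) \<longlonglongrightarrow> z - r" by (intro tendsto_intros zn)
      show "(\<lambda>n. ennreal (gg a x * gg b (zs n - x) * indicator {..<zs n - r} x)) \<longlonglongrightarrow>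
        ennreal (gg a x * gg b (z - x) * indicator {..<z - r} x)"
      proof (cases "x < z - r")
        case True
        have "(\<lambda>n. gg a x * gg b (zs n - x)) \<longlonglongrightarrow> gg a x * gg b (z - x)"
          using True r ab by (intro tendsto_mult tendsto_const tendsto_gg_pos tendsto_diff zn) auto
        moreover have "\<forall>\<^sub>F n in sequentially. gg a x * gg b (zs n - x) = gg a x * gg b (zs n - x) * indicator {..<zs n - r} x"
          using order_tendstoD(1)[OF \<open>(\<lambda>n. zs n - r) \<longlonglongrightarrow> z - r\<close> True] by eventually_elim simp
        ultimately have "(\<lambda>n. gg a x * gg b (zs n - x) * indicator {..<zs n - r} x) \<longlonglongrightarrow> gg a x * gg b (z - x)"
          by (rule Lim_transform_eventually)
        then show ?thesis using True by (intro tendsto_ennrealI) simp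
      next
        case False
        then have "z - r < x" using x by simp
        from order_tendstoD(2)[OF \<open>(\<lambda>n. zs n - r) \<longlonglongrightarrow> z - r\<close> this]
        have "\<forall>\<^sub>F n in sequentially. ennreal (gg a x * gg b (zs n - x) * indicator {..<zs n - r} x) = 0"
          by eventually_elim simp
        then show ?thesis using False by (simp add: tendsto_eventually)
      qed
    qed
  qed measurable
qed

lemma convolution_tendsto:
  assumes ab: "0 < a" "0 < b" and z: "0 < z" and zn: "zs \<longlonglongrightarrow> z"
    and rz: "\<And>n. zs n < z + z / 2" "\<And>n. z - z / 4 < zs n"
  shows "(\<lambda>n. \<integral>\<^sup>+\<omega>. ennreal (gg b (zs n - S a \<omega>)) \<partial>M) \<longlonglongrightarrow> (\<integral>\<^sup>+\<omega>. ennreal (gg b (z - S a \<omega>)) \<partial>M)"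
proof -
  \<comment> \<open>The convolution is cut at \<open>v - z / 2\<close>. Reflecting the upper piece
    exchanges \<open>a\<close> and \<open>b\<close>, so that in both pieces the factor evaluated
    near \<open>0\<close> is the one that serves as integrable majorant.\<close>
  have eq: "(\<integral>\<^sup>+\<omega>. ennreal (gg b (v - S a \<omega>)) \<partial>M) =
    (\<integral>\<^sup>+x. ennreal (gg a x * gg b (v - x) * indicator {..<v - z / 2} x) \<partial>lborel) +
    (\<integral>\<^sup>+x. ennreal (gg b x * gg a (v - x) * indicator {..z / 2} x) \<partial>lborel)" for v
  proof -
    have "(\<integral>\<^sup>+\<omega>. ennreal (gg b (v - S a \<omega>)) \<partial>M) = (\<integral>\<^sup>+x. ennreal (gg a x) * ennreal (gg b (v - x)) \<partial>lborel)"
      using ab by (intro nn_integral_S) auto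
    also have "\<dots> = (\<integral>\<^sup>+x. ennreal (gg a x * gg b (v - x) * indicator {..<v - z / 2} x) +
        ennreal (gg a x * gg b (v - x) * indicator {v - z / 2..} x) \<partial>lborel)"
      by (intro nn_integral_cong) (auto simp: indicator_def ennreal_mult)
    also have "\<dots> = (\<integral>\<^sup>+x. ennreal (gg a x * gg b (v - x) * indicator {..<v - z / 2} x) \<partial>lborel) +
        (\<integral>\<^sup>+x. ennreal (gg a x * gg b (v - x) * indicator {v - z / 2..} x) \<partial>lborel)"
      by (intro nn_integral_add) measurable
    also have "(\<integral>\<^sup>+x. ennreal (gg a x * gg b (v - x) * indicator {v - z / 2..} x) \<partial>lborel) =
      (\<integral>\<^sup>+x. ennreal (gg a (v - x) * gg b x * indicator {v - z / 2..} (v - x)) \<partial>lborel)"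
      by (subst nn_integral_real_affine[where c="-1" and t=v]) auto
    also have "\<dots> = (\<integral>\<^sup>+x. ennreal (gg b x * gg a (v - x) * indicator {..z / 2} x) \<partial>lborel)"
      by (intro nn_integral_cong arg_cong[where f=ennreal]) (auto simp: indicator_def)
    finally show ?thesis .
  qed
  have 2: "(\<lambda>n. \<integral>\<^sup>+x. ennreal (gg b x * gg a (zs n - x) * indicator {..z / 2} x) \<partial>lborel) \<longlonglongrightarrow>
    (\<integral>\<^sup>+x. ennreal (gg b x * gg a (z - x) * indicator {..z / 2} x) \<partial>lborel)"
  proof -
    \<comment> \<open>\<open>zs n\<close> lies between \<open>3 * z / 4\<close> and
      \<open>3 * z / 2\<close>, so for \<open>0 < x \<le> z / 2\<close> the difference
      \<open>zs n - x\<close> stays in this interval.\<close>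
    obtain C where C: "0 < C" "\<And>s x. s \<in> {a..a} \<Longrightarrow> x \<in> {z / 4..2 * z} \<Longrightarrow> gg s x \<le> C"
      using gg_bounded[of a a "z / 4" "2 * z"] assms by auto
    show ?thesis
    proof (rule nn_integral_dominated_convergence[where w="\<lambda>x. ennreal (C * gg b x)"])
      have "(\<integral>\<^sup>+x. ennreal (C * gg b x) \<partial>lborel) = ennreal C * (\<integral>\<^sup>+x. ennreal (gg b x) \<partial>lborel)"
        using C by (simp add: ennreal_mult nn_integral_cmult)
      then show "(\<integral>\<^sup>+x. ennreal (C * gg b x) \<partial>lborel) < \<infinity>"
        using nn_integral_gg[OF ab(2)] by simp
      show "AE x in lborel. ennreal (gg b x * gg a (zs n - x) * indicator {..z / 2} x) \<le> ennreal (C * gg b x)" for n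
      proof (intro AE_I2 ennreal_leI)
        fix x show "gg b x * gg a (zs n - x) * indicator {..z / 2} x \<le> C * gg b x"
        proof (cases "0 < x \<and> x \<le> z / 2")
          case True
          then have "gg a (zs n - x) \<le> C" using rz[of n] by (intro C) auto
          from mult_left_mono[OF this gg_nonneg[of b x]] show ?thesis using True by (simp add: mult.commute)
        next
          case False
          then show ?thesis using C by (auto simp: gg_zero indicator_def)
        qed
      qed
      show "AE x in lborel. (\<lambda>n. ennreal (gg b x * gg a (zs n - x) * indicator {..z / 2} x)) \<longlonglongrightarrow>
        ennreal (gg b x * gg a (z - x) * indicator {..z / 2} x)"
      proof (intro AE_I2)
        fix x
        show "(\<lambda>n. ennreal (gg b x * gg a (zs n - x) * indicator {..z / 2} x)) \<longlonglongrightarrow>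
          ennreal (gg b x * gg a (z - x) * indicator {..z / 2} x)"
        proof (cases "x \<le> z / 2")
          case True
          have "(\<lambda>n. gg b x * gg a (zs n - x)) \<longlonglongrightarrow> gg b x * gg a (z - x)"
            using True z ab by (intro tendsto_mult tendsto_const tendsto_gg_pos tendsto_diff zn) auto
          then show ?thesis using True by (intro tendsto_ennrealI) simp
        qed simp
      qed
    qed measurable
  qed
  show ?thesis
    unfolding eq by (intro tendsto_add 2 convolution_half_tendsto[OF ab z zn]) (use z rz in \<open>auto simp: field_simps\<close>)
qed

text \<open>Both sides are continuous at \<open>y > 0\<close>, so the almost everywhere identity
  extends along points tending to \<open>y\<close> from above.\<close>

lemma chapman_kolmogorov_pos:
  assumes ab: "0 < a" "0 < b"
  shows "(\<integral>\<^sup>+\<omega>. ennreal (gg b (y - S a \<omega>)) \<partial>M) = ennreal (gg (a + b) y)"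
proof (cases "0 < y")
  case False
  then have "gg b (y - S a \<omega>) = 0" for \<omega>
    using S_nonneg[of a \<omega>] by (intro gg_zero) linarith
  then show ?thesis using False by (simp add: gg_zero)
next
  case True
  \<comment> \<open>The factor \<open>y / 4\<close> keeps every \<open>z n\<close> in the range that
    \<open>convolution_tendsto\<close> admits.\<close>
  define \<epsilon> where "\<epsilon> n = (y / 4) / real (Suc n)" for n
  have \<epsilon>: "0 < \<epsilon> n" "\<epsilon> n \<le> y / 4" for n
    using True divide_left_mono[of 1 "real (Suc n)" "y / 4"] by (auto simp: \<epsilon>_def)
  have \<epsilon>0: "\<epsilon> \<longlonglongrightarrow> 0"
    unfolding \<epsilon>_def by (rule LIMSEQ_Suc[OF lim_const_over_n])
  have "\<exists>x. y < x \<and> x < y + \<epsilon> n \<and> ennreal (gg (a + b) x) = (\<integral>\<^sup>+\<omega>. ennreal (gg b (x - S a \<omega>)) \<partial>M)" for n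
    using AE_lborel_dense[OF chapman_kolmogorov_AE[OF ab], of y "y + \<epsilon> n"] \<epsilon>(1)[of n] by simp
  then obtain z where z: "\<And>n. y < z n" "\<And>n. z n < y + \<epsilon> n"
    "\<And>n. ennreal (gg (a + b) (z n)) = (\<integral>\<^sup>+\<omega>. ennreal (gg b (z n - S a \<omega>)) \<partial>M)"
    by metis
  have lim1: "(\<lambda>n. y + \<epsilon> n) \<longlonglongrightarrow> y" using tendsto_add[OF tendsto_const \<epsilon>0, of y] by simp
  have zlim: "z \<longlonglongrightarrow> y"
    by (rule tendsto_sandwich[OF always_eventually always_eventually tendsto_const lim1])
       (use z in \<open>auto intro: less_imp_le\<close>)
  have "(\<lambda>n. \<integral>\<^sup>+\<omega>. ennreal (gg b (z n - S a \<omega>)) \<partial>M) \<longlonglongrightarrow> (\<integral>\<^sup>+\<omega>. ennreal (gg b (y - S a \<omega>)) \<partial>M)"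
  proof (rule convolution_tendsto[OF ab True zlim])
    fix n show "z n < y + y / 2" "y - y / 4 < z n"
      using z(1,2)[of n] \<epsilon>[of n] True by linarith+
  qed
  moreover have "(\<lambda>n. ennreal (gg (a + b) (z n))) \<longlonglongrightarrow> ennreal (gg (a + b) y)"
    using ab True by (intro tendsto_ennrealI tendsto_gg_pos tendsto_const zlim) auto
  ultimately show ?thesis
    unfolding z(3) by (rule LIMSEQ_unique)
qed

lemma chapman_kolmogorov:
  assumes ab: "0 \<le> a" "0 < b"
  shows "(\<integral>\<^sup>+\<omega>. ennreal (gg b (y - S a \<omega>)) \<partial>M) = ennreal (gg (a + b) y)"
proof (cases "a = 0")
  case True
  have "(\<integral>\<^sup>+\<omega>. ennreal (gg b (y - S a \<omega>)) \<partial>M) = (\<integral>\<^sup>+\<omega>. ennreal (gg b y) \<partial>M)"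
    using True by (intro nn_integral_cong) (simp add: S_start)
  then show ?thesis using True emeasure_space_1 by simp
qed (use chapman_kolmogorov_pos[of a b y] ab in simp)

text \<open>The weight \<open>gg (t - r) (y - S r \<omega>)\<close> is a martingale in
  \<open>r\<close>: by Chapman-Kolmogorov its conditional expectation at time \<open>s\<close> is
  the weight at time \<open>s\<close>.\<close>

lemma markov_density:
  assumes sr: "0 \<le> s" "s \<le> r" "r < t" and [measurable]: "f \<in> borel_measurable borel"
  shows "(\<integral>\<^sup>+\<omega>. f (X s \<omega>) * ennreal (gg (t - r) (y - S r \<omega>)) \<partial>M) =
    (\<integral>\<^sup>+\<omega>. f (X s \<omega>) * ennreal (gg (t - s) (y - S s \<omega>)) \<partial>M)"
proof -
  have [measurable]: "X (r - s) \<in> borel_measurable M" "S (r - s) \<in> borel_measurable M"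
    using sr by (auto intro!: measurable_X measurable_S)
  have "(\<integral>\<^sup>+\<omega>. f (X s \<omega>) * ennreal (gg (t - r) (y - S r \<omega>)) \<partial>M) =
    (\<integral>\<^sup>+\<omega>. \<integral>\<^sup>+\<omega>'. f (X s \<omega>) * ennreal (gg (t - r) (y - l1norm (X s \<omega> + X (r - s) \<omega>'))) \<partial>M \<partial>M)"
    using nn_integral_increment[of s r "\<lambda>p. f (fst p) * ennreal (gg (t - r) (y - l1norm (fst p + snd p)))"] sr
    by (simp add: norm_process_def)
  also have "\<dots> = (\<integral>\<^sup>+\<omega>. \<integral>\<^sup>+\<omega>'. f (X s \<omega>) * ennreal (gg (t - r) ((y - S s \<omega>) - S (r - s) \<omega>')) \<partial>M \<partial>M)"
    using sr by (intro nn_integral_cong) (simp add: S_add diff_diff_eq)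
  also have "\<dots> = (\<integral>\<^sup>+\<omega>. f (X s \<omega>) * ennreal (gg (t - s) (y - S s \<omega>)) \<partial>M)"
  proof (intro nn_integral_cong)
    fix \<omega>
    have "(\<integral>\<^sup>+\<omega>'. f (X s \<omega>) * ennreal (gg (t - r) ((y - S s \<omega>) - S (r - s) \<omega>')) \<partial>M) =
      f (X s \<omega>) * (\<integral>\<^sup>+\<omega>'. ennreal (gg (t - r) ((y - S s \<omega>) - S (r - s) \<omega>')) \<partial>M)"
      by (rule nn_integral_cmult) measurable
    also have "\<dots> = f (X s \<omega>) * ennreal (gg (t - s) (y - S s \<omega>))"
      using sr by (subst chapman_kolmogorov) auto
    finally show "(\<integral>\<^sup>+\<omega>'. f (X s \<omega>) * ennreal (gg (t - r) ((y - S s \<omega>) - S (r - s) \<omega>')) \<partial>M) =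
      f (X s \<omega>) * ennreal (gg (t - s) (y - S s \<omega>))" .
  qed
  finally show ?thesis .
qed

text \<open>Exchangeability in the form needed. With the increment over \<open>[s, r]\<close>
  frozen, integrating out \<open>X s\<close> joins the durations \<open>s\<close> and
  \<open>t - r\<close> into \<open>t - (r - s)\<close>, so that only the length \<open>r - s\<close>
  matters.\<close>

lemma bridge_increment:
  assumes sr: "0 \<le> s" "s \<le> r" "r < t"
  shows "(\<integral>\<^sup>+\<omega>. ennreal (l1norm (X r \<omega> - X s \<omega>) * gg (t - r) (y - S r \<omega>)) \<partial>M) =
    (\<integral>\<^sup>+\<omega>. ennreal (S (r - s) \<omega> * gg (t - (r - s)) (y - S (r - s) \<omega>)) \<partial>M)"
proof -
  have [measurable]: "X (r - s) \<in> borel_measurable M" "S (r - s) \<in> borel_measurable M"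
    "S s \<in> borel_measurable M"
    using sr by (auto intro!: measurable_X measurable_S)
  have "(\<integral>\<^sup>+\<omega>. ennreal (l1norm (X r \<omega> - X s \<omega>) * gg (t - r) (y - S r \<omega>)) \<partial>M) =
    (\<integral>\<^sup>+\<omega>'. \<integral>\<^sup>+\<omega>. ennreal (S (r - s) \<omega>' * gg (t - r) (y - l1norm (X s \<omega> + X (r - s) \<omega>'))) \<partial>M \<partial>M)"
    using nn_integral_increment_swap[of s r "\<lambda>p. ennreal (l1norm (snd p) * gg (t - r) (y - l1norm (fst p + snd p)))"] sr
    by (simp add: norm_process_def)
  also have "\<dots> = (\<integral>\<^sup>+\<omega>'. \<integral>\<^sup>+\<omega>. ennreal (S (r - s) \<omega>') * ennreal (gg (t - r) ((y - S (r - s) \<omega>') - S s \<omega>)) \<partial>M \<partial>M)"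
    using sr by (intro nn_integral_cong) (simp add: S_add diff_diff_eq ennreal_mult add.commute)
  also have "\<dots> = (\<integral>\<^sup>+\<omega>'. ennreal (S (r - s) \<omega>' * gg (t - (r - s)) (y - S (r - s) \<omega>')) \<partial>M)"
  proof (intro nn_integral_cong)
    fix \<omega>'
    have "(\<integral>\<^sup>+\<omega>. ennreal (S (r - s) \<omega>') * ennreal (gg (t - r) ((y - S (r - s) \<omega>') - S s \<omega>)) \<partial>M) =
      ennreal (S (r - s) \<omega>') * (\<integral>\<^sup>+\<omega>. ennreal (gg (t - r) ((y - S (r - s) \<omega>') - S s \<omega>)) \<partial>M)"
      by (rule nn_integral_cmult) measurable
    also have "\<dots> = ennreal (S (r - s) \<omega>') * ennreal (gg (s + (t - r)) (y - S (r - s) \<omega>'))"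
      using sr by (subst chapman_kolmogorov) auto
    also have "s + (t - r) = t - (r - s)" by simp
    finally show "(\<integral>\<^sup>+\<omega>. ennreal (S (r - s) \<omega>') * ennreal (gg (t - r) ((y - S (r - s) \<omega>') - S s \<omega>)) \<partial>M) =
      ennreal (S (r - s) \<omega>' * gg (t - (r - s)) (y - S (r - s) \<omega>'))"
      by (simp add: ennreal_mult)
  qed
  finally show ?thesis .
qed

text \<open>The increments of the bridge are exchangeable, so each of \<open>m\<close> equal ones has mean at
  most \<open>y / m\<close>.\<close>

lemma bridge_small_increment:
  assumes d: "0 < d" "real m * d < t" "0 < m"
  shows "(\<integral>\<^sup>+\<omega>. ennreal (S d \<omega> * gg (t - d) (y - S d \<omega>)) \<partial>M) \<le> ennreal (y * gg t y / real m)"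
proof (cases "0 < y")
  case False
  have "ennreal (S d \<omega> * gg (t - d) (y - S d \<omega>)) = 0" for \<omega>
    using False S_nonneg[of d \<omega>] gg_zero[of "y - S d \<omega>" "t - d"] by (simp del: S_nonneg)
  then show ?thesis by (simp only: nn_integral_0_iff_AE nn_integral_const mult_zero_left) simp
next
  case y: True
  define A where "A = (\<integral>\<^sup>+\<omega>. ennreal (S d \<omega> * gg (t - d) (y - S d \<omega>)) \<partial>M)"
  \<comment> \<open>\<open>a j\<close> is the weighted mean of \<open>S\<close> at time
    \<open>j * d\<close>. Each further step adds \<open>A\<close>: the martingale property takes
    care of the past, exchangeability of the new increment.\<close>
  define a where "a j = (\<integral>\<^sup>+\<omega>. ennreal (S (real j * d) \<omega> * gg (t - real j * d) (y - S (real j * d) \<omega>)) \<partial>M)" for j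
  have "real j * A \<le> a j" if "j \<le> m" for j
    using that
  proof (induction j)
    case (Suc j)
    let ?s = "real j * d" and ?r = "real (Suc j) * d"
    have sr: "0 \<le> ?s" "?s \<le> ?r" "?r < t" "?r - ?s = d"
    proof -
      have "?r \<le> real m * d" using d Suc.prems by (intro mult_right_mono) auto
      then show "?r < t" using d(2) by (rule order_le_less_trans)
    qed (use d in \<open>auto simp: algebra_simps\<close>)
    have [measurable]: "X ?s \<in> borel_measurable M" "X ?r \<in> borel_measurable M"
       "S ?s \<in> borel_measurable M" "S ?r \<in> borel_measurable M"
      using sr(1,2) by (auto intro!: measurable_X measurable_S simp del: of_nat_Suc)
    have "a (Suc j) = (\<integral>\<^sup>+\<omega>. ennreal (S ?s \<omega>) * ennreal (gg (t - ?r) (y - S ?r \<omega>)) +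
        ennreal (l1norm (X ?r \<omega> - X ?s \<omega>) * gg (t - ?r) (y - S ?r \<omega>)) \<partial>M)"
      unfolding a_def
    proof (intro nn_integral_cong_AE)
      show "AE \<omega> in M. ennreal (S ?r \<omega> * gg (t - ?r) (y - S ?r \<omega>)) =
        ennreal (S ?s \<omega>) * ennreal (gg (t - ?r) (y - S ?r \<omega>)) +
        ennreal (l1norm (X ?r \<omega> - X ?s \<omega>) * gg (t - ?r) (y - S ?r \<omega>))"
        using AE_mono_pair[OF sr(1,2)] AE_space
      proof eventually_elim
        case (elim \<omega>)
        have "l1norm (X ?r \<omega> - X ?s \<omega>) = S ?r \<omega> - S ?s \<omega>"
          unfolding norm_process_def using elim sr by (intro l1norm_diff X_nonneg) auto
        then have eq: "S ?r \<omega> = S ?s \<omega> + l1norm (X ?r \<omega> - X ?s \<omega>)" by simp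
        have *: "ennreal ((u + v) * w) = ennreal u * ennreal w + ennreal (v * w)"
          if "0 \<le> u" "0 \<le> v" "0 \<le> w" for u v w :: real
          using that by (simp add: distrib_right ennreal_mult)
        show ?case
          by (subst (1) eq) (rule *[OF S_nonneg l1norm_nonneg gg_nonneg])
      qed
    qed
    also have "\<dots> = (\<integral>\<^sup>+\<omega>. ennreal (S ?s \<omega>) * ennreal (gg (t - ?r) (y - S ?r \<omega>)) \<partial>M) +
        (\<integral>\<^sup>+\<omega>. ennreal (l1norm (X ?r \<omega> - X ?s \<omega>) * gg (t - ?r) (y - S ?r \<omega>)) \<partial>M)"
      by (intro nn_integral_add) measurable
    also have "(\<integral>\<^sup>+\<omega>. ennreal (S ?s \<omega>) * ennreal (gg (t - ?r) (y - S ?r \<omega>)) \<partial>M) = a j"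
      using markov_density[OF sr(1-3), of "\<lambda>x. ennreal (l1norm x)" y]
      by (simp add: a_def norm_process_def ennreal_mult del: of_nat_Suc)
    also have "(\<integral>\<^sup>+\<omega>. ennreal (l1norm (X ?r \<omega> - X ?s \<omega>) * gg (t - ?r) (y - S ?r \<omega>)) \<partial>M) = A"
      using bridge_increment[OF sr(1-3), of y] unfolding sr(4) A_def .
    finally have "a (Suc j) = a j + A" .
    moreover have "real (Suc j) * A = real j * A + A"
      by (simp add: ennreal_plus distrib_right add.commute)
    ultimately show ?case using Suc by (simp del: of_nat_Suc add: add_right_mono)
  qed simp
  from this[of m] have "real m * A \<le> a m" by simp
  \<comment> \<open>Wherever \<open>S (real m * d) \<omega>\<close> exceeds \<open>y\<close> the
    weight is \<open>0\<close>, so \<open>y\<close> bounds the norm under the weight.\<close>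
  also have "a m \<le> (\<integral>\<^sup>+\<omega>. ennreal y * ennreal (gg (t - real m * d) (y - S (real m * d) \<omega>)) \<partial>M)"
    unfolding a_def
  proof (intro nn_integral_mono)
    fix \<omega>
    have "S (real m * d) \<omega> * gg (t - real m * d) (y - S (real m * d) \<omega>) \<le>
      y * gg (t - real m * d) (y - S (real m * d) \<omega>)"
      by (cases "S (real m * d) \<omega> \<le> y") (auto intro: mult_right_mono simp: gg_zero)
    then show "ennreal (S (real m * d) \<omega> * gg (t - real m * d) (y - S (real m * d) \<omega>)) \<le>
      ennreal y * ennreal (gg (t - real m * d) (y - S (real m * d) \<omega>))"
      using y by (simp add: ennreal_mult[symmetric] ennreal_leI)
  qed
  also have "\<dots> = ennreal y * (\<integral>\<^sup>+\<omega>. ennreal (gg (t - real m * d) (y - S (real m * d) \<omega>)) \<partial>M)"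
    using d by (intro nn_integral_cmult) (auto intro!: measurable_gg borel_measurable_diff measurable_S)
  also have "\<dots> = ennreal (y * gg t y)"
    using d y by (subst chapman_kolmogorov) (auto simp: ennreal_mult)
  finally have le: "ennreal (real m) * A \<le> ennreal (y * gg t y)" by simp
  have "A = ennreal (1 / real m) * (ennreal (real m) * A)"
    using d by (simp add: mult.assoc[symmetric] ennreal_mult[symmetric])
  also have "\<dots> \<le> ennreal (1 / real m) * ennreal (y * gg t y)"
    using le by (rule mult_left_mono) simp
  also have "\<dots> = ennreal (y * gg t y / real m)"
    using y by (simp add: ennreal_mult[symmetric])
  finally show ?thesis unfolding A_def .
qed

end

section \<open>Bridges\<close>

lemma pred_less_eq_vec:
  fixes F G :: "'b \<Rightarrow> real^'d"
  assumes [measurable]: "F \<in> borel_measurable N" "G \<in> borel_measurable N"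
  shows "Measurable.pred N (\<lambda>x. F x \<le> G x)"
  unfolding less_eq_vec_def by measurable

text \<open>The Lipschitz bound lets the mean increment of a bridge control the change of
  \<open>f\<close>. With the cut-offs of \<open>test_function_infdist\<close> the class still
  determines finite measures.\<close>

definition test_function :: "real \<Rightarrow> (real^'d \<Rightarrow> real) \<Rightarrow> bool" where
  "test_function L f \<longleftrightarrow> 0 \<le> L \<and> (\<forall>x. 0 \<le> f x \<and> f x \<le> 1) \<and> (\<forall>x y. \<bar>f x - f y\<bar> \<le> L * l1norm (x - y))"

lemma test_functionD:
  assumes "test_function L f"
  shows "0 \<le> L" "0 \<le> f x" "f x \<le> 1" "\<bar>f x - f y\<bar> \<le> L * l1norm (x - y)"
  using assms by (auto simp: test_function_def)

lemma test_function_tendsto: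
  assumes f: "test_function L f" and x: "(xs \<longlongrightarrow> x) F"
  shows "((\<lambda>n. f (xs n)) \<longlongrightarrow> f x) F"
proof -
  have "((\<lambda>n. L * l1norm (xs n - x)) \<longlongrightarrow> L * l1norm (x - x)) F"
    by (intro tendsto_intros x)
  then have "((\<lambda>n. L * l1norm (xs n - x)) \<longlongrightarrow> 0) F" by simp
  then have "((\<lambda>n. f (xs n) - f x) \<longlongrightarrow> 0) F"
    by (rule Lim_null_comparison[rotated]) (simp add: test_functionD[OF f])
  then show ?thesis by (simp add: LIM_zero_iff)
qed

lemma test_function_measurable: "test_function L f \<Longrightarrow> f \<in> borel_measurable borel"
  by (intro borel_measurable_continuous_onI)
     (auto simp: continuous_on_def intro: test_function_tendsto tendsto_ident_at)

lemma test_function_infdist: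
  assumes "0 \<le> n"
  shows "test_function n (\<lambda>x::real^'d. max 0 (1 - n * infdist x A))"
  unfolding test_function_def
proof (intro conjI allI assms)
  fix x y :: "real^'d"
  have "\<bar>infdist x A - infdist y A\<bar> \<le> dist x y"
    by (rule infdist_triangle_abs)
  also have "\<dots> \<le> l1norm (x - y)"
    unfolding dist_norm by (rule norm_le_l1norm)
  finally have "n * \<bar>infdist x A - infdist y A\<bar> \<le> n * l1norm (x - y)"
    using assms by (rule mult_left_mono)
  moreover have "n * \<bar>infdist x A - infdist y A\<bar> = \<bar>n * infdist x A - n * infdist y A\<bar>"
    using assms by (simp add: right_diff_distrib[symmetric] abs_mult)
  ultimately show "\<bar>max 0 (1 - n * infdist x A) - max 0 (1 - n * infdist y A)\<bar> \<le> n * l1norm (x - y)"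
    by linarith
qed (use assms infdist_nonneg in \<open>auto intro: mult_nonneg_nonneg\<close>)

lemma (in prob_space) indep_var_nn_integral:
  assumes "indep_var S U T V" and [measurable]: "h \<in> borel_measurable (S \<Otimes>\<^sub>M T)"
  shows "(\<integral>\<^sup>+\<omega>. h (U \<omega>, V \<omega>) \<partial>M) = (\<integral>\<^sup>+\<omega>. \<integral>\<^sup>+x. h (U \<omega>, x) \<partial>distr M T V \<partial>M)"
proof -
  have [measurable]: "U \<in> M \<rightarrow>\<^sub>M S" "V \<in> M \<rightarrow>\<^sub>M T"
    using assms(1) by (auto simp: indep_var_distribution_eq)
  interpret V: prob_space "distr M T V" by (rule prob_space_distr) simp
  interpret U: prob_space "distr M S U" by (rule prob_space_distr) simp
  interpret UV: pair_prob_space "distr M S U" "distr M T V" ..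
  have "(\<integral>\<^sup>+\<omega>. h (U \<omega>, V \<omega>) \<partial>M) = integral\<^sup>N (distr M (S \<Otimes>\<^sub>M T) (\<lambda>\<omega>. (U \<omega>, V \<omega>))) h"
    by (subst nn_integral_distr) auto
  also have "\<dots> = integral\<^sup>N (distr M S U \<Otimes>\<^sub>M distr M T V) h"
    using assms(1) by (simp add: indep_var_distribution_eq)
  also have "\<dots> = (\<integral>\<^sup>+u. \<integral>\<^sup>+x. h (u, x) \<partial>distr M T V \<partial>distr M S U)"
    by (rule V.nn_integral_fst[symmetric]) simp
  also have "\<dots> = (\<integral>\<^sup>+\<omega>. \<integral>\<^sup>+x. h (U \<omega>, x) \<partial>distr M T V \<partial>M)"
    by (subst nn_integral_distr) auto
  finally show ?thesis .
qed

section \<open>Weighted means under the bridge\<close>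

context density_subordinator
begin

interpretation MM: pair_prob_space M M ..

text \<open>The mean of \<open>f\<close> at time \<open>s\<close> under the bridge that reaches
  \<open>y\<close> at time \<open>t\<close>, multiplied by \<open>gg t y\<close>. Without the
  division by \<open>gg t y\<close> there is no exceptional case where the density vanishes.\<close>

definition bridge :: "(real^'d \<Rightarrow> real) \<Rightarrow> real \<Rightarrow> real \<Rightarrow> real \<Rightarrow> real" where
  "bridge f s t y = (\<integral>\<omega>. f (X s \<omega>) * gg (t - s) (y - S s \<omega>) \<partial>M)"

lemma bridge_weight:
  assumes "0 \<le> s" "s < t"
  shows "integrable M (\<lambda>\<omega>. gg (t - s) (y - S s \<omega>))" "(\<integral>\<omega>. gg (t - s) (y - S s \<omega>) \<partial>M) = gg t y"
proof -
  have [measurable]: "S s \<in> borel_measurable M" using assms by (intro measurable_S) simp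
  have *: "(\<integral>\<^sup>+\<omega>. ennreal (gg (t - s) (y - S s \<omega>)) \<partial>M) = ennreal (gg t y)"
    using assms by (subst chapman_kolmogorov) auto
  show "integrable M (\<lambda>\<omega>. gg (t - s) (y - S s \<omega>))"
    by (intro integrableI_nonneg) (auto simp: *)
  show "(\<integral>\<omega>. gg (t - s) (y - S s \<omega>) \<partial>M) = gg t y"
    by (subst integral_eq_nn_integral) (auto simp: *)
qed

lemma integrable_bridge:
  assumes "0 \<le> s" "s \<le> r" "r < t" and f: "test_function L f"
  shows "integrable M (\<lambda>\<omega>. f (X s \<omega>) * gg (t - r) (y - S r \<omega>))"
proof (rule Bochner_Integration.integrable_bound[OF bridge_weight(1)[of r t y]])
  have [measurable]: "S r \<in> borel_measurable M" "X s \<in> borel_measurable M" "f \<in> borel_measurable borel"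
    using assms test_function_measurable by (auto intro!: measurable_S measurable_X)
  show "(\<lambda>\<omega>. f (X s \<omega>) * gg (t - r) (y - S r \<omega>)) \<in> borel_measurable M" by measurable
  show "AE \<omega> in M. norm (f (X s \<omega>) * gg (t - r) (y - S r \<omega>)) \<le> norm (gg (t - r) (y - S r \<omega>))"
    using test_functionD[OF f] by (intro AE_I2) (simp add: abs_mult mult_left_le_one_le)
qed (use assms in auto)

lemma bridge_bounds:
  assumes "0 \<le> s" "s < t" and f: "test_function L f"
  shows "0 \<le> bridge f s t y" "bridge f s t y \<le> gg t y"
proof -
  show "0 \<le> bridge f s t y"
    unfolding bridge_def using test_functionD[OF f] by (intro integral_nonneg_AE) auto
  have "bridge f s t y \<le> (\<integral>\<omega>. gg (t - s) (y - S s \<omega>) \<partial>M)"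
    unfolding bridge_def using assms
    by (intro integral_mono integrable_bridge[OF _ _ _ f] bridge_weight)
       (auto simp: test_functionD[OF f] intro: mult_left_le_one_le)
  then show "bridge f s t y \<le> gg t y" using assms by (simp add: bridge_weight)
qed

lemma ennreal_bridge:
  assumes "0 \<le> s" "s < t" and f: "test_function L f"
  shows "ennreal (bridge f s t y) = (\<integral>\<^sup>+\<omega>. ennreal (f (X s \<omega>)) * ennreal (gg (t - s) (y - S s \<omega>)) \<partial>M)"
  unfolding bridge_def using test_functionD[OF f] assms
  by (subst nn_integral_eq_integral[symmetric]) (auto intro!: integrable_bridge[OF _ _ _ f] simp: ennreal_mult)

lemma bridge_later_weight:
  assumes "0 \<le> s" "s \<le> r" "r < t" and f: "test_function L f"
  shows "(\<integral>\<omega>. f (X s \<omega>) * gg (t - r) (y - S r \<omega>) \<partial>M) = bridge f s t y"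
proof -
  have [measurable]: "f \<in> borel_measurable borel" using f by (rule test_function_measurable)
  have "ennreal (\<integral>\<omega>. f (X s \<omega>) * gg (t - r) (y - S r \<omega>) \<partial>M) =
    (\<integral>\<^sup>+\<omega>. ennreal (f (X s \<omega>)) * ennreal (gg (t - r) (y - S r \<omega>)) \<partial>M)"
    using test_functionD[OF f] assms
    by (subst nn_integral_eq_integral[symmetric]) (auto intro!: integrable_bridge[OF _ _ _ f] simp: ennreal_mult)
  also have "\<dots> = ennreal (bridge f s t y)"
    using assms by (subst markov_density[OF assms(1-3)]) (auto simp: ennreal_bridge[OF _ _ f])
  finally show ?thesis
    using test_functionD[OF f] bridge_bounds[OF _ _ f, of s t y] assms
    by (subst (asm) ennreal_inj) (auto intro!: integral_nonneg_AE)
qed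

text \<open>\<open>f (X r \<omega>) - f (X s \<omega>)\<close> is at most \<open>L\<close> times the
  norm of the increment. As \<open>m\<close> increments of this length fit before \<open>t\<close>,
  its mean under the bridge is at most \<open>y / m\<close>. The bound depends on \<open>r\<close>
  and \<open>s\<close> only through their distance, so it yields a limit at \<open>t\<close>
  together with a rate.\<close>

lemma bridge_cauchy:
  assumes sr: "0 \<le> s" "s < r" "r < t" and m: "0 < m" "real m * (r - s) < t"
    and f: "test_function L f" and y: "0 < y"
  shows "\<bar>bridge f r t y - bridge f s t y\<bar> \<le> L * (y * gg t y) / real m"
proof -
  let ?W = "\<lambda>\<omega>. gg (t - r) (y - S r \<omega>)"
  have [measurable]: "S r \<in> borel_measurable M" "X s \<in> borel_measurable M" "X r \<in> borel_measurable M" "f \<in> borel_measurable borel"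
    using sr test_function_measurable[OF f] by (auto intro!: measurable_S measurable_X)
  have le: "(\<integral>\<^sup>+\<omega>. ennreal (l1norm (X r \<omega> - X s \<omega>) * ?W \<omega>) \<partial>M) \<le> ennreal (y * gg t y / real m)"
    using bridge_increment[of s r t y] bridge_small_increment[of "r - s" m t y] sr m by simp
  have int: "integrable M (\<lambda>\<omega>. l1norm (X r \<omega> - X s \<omega>) * ?W \<omega>)"
    by (intro integrableI_nonneg) (auto intro: order_le_less_trans[OF le])
  have bound: "(\<integral>\<omega>. l1norm (X r \<omega> - X s \<omega>) * ?W \<omega> \<partial>M) \<le> y * gg t y / real m"
  proof -
    have "ennreal (\<integral>\<omega>. l1norm (X r \<omega> - X s \<omega>) * ?W \<omega> \<partial>M) \<le> ennreal (y * gg t y / real m)"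
      using le int by (subst nn_integral_eq_integral[symmetric]) auto
    then show ?thesis using y by (subst (asm) ennreal_le_iff) auto
  qed
  have eq: "bridge f r t y - bridge f s t y = (\<integral>\<omega>. f (X r \<omega>) * ?W \<omega> - f (X s \<omega>) * ?W \<omega> \<partial>M)"
    using sr bridge_later_weight[of s r t L f y] f
    by (subst Bochner_Integration.integral_diff) (auto simp: bridge_def intro!: integrable_bridge[OF _ _ _ f])
  have "\<bar>bridge f r t y - bridge f s t y\<bar> \<le> (\<integral>\<omega>. L * (l1norm (X r \<omega> - X s \<omega>) * ?W \<omega>) \<partial>M)"
    unfolding eq
  proof (rule order_trans[OF integral_abs_bound integral_mono])
    show "integrable M (\<lambda>\<omega>. \<bar>f (X r \<omega>) * ?W \<omega> - f (X s \<omega>) * ?W \<omega>\<bar>)"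
      using sr by (intro integrable_abs Bochner_Integration.integrable_diff integrable_bridge[OF _ _ _ f]) auto
    fix \<omega>
    have "\<bar>f (X r \<omega>) * ?W \<omega> - f (X s \<omega>) * ?W \<omega>\<bar> = \<bar>f (X r \<omega>) - f (X s \<omega>)\<bar> * ?W \<omega>"
      by (simp add: left_diff_distrib[symmetric] abs_mult)
    also have "\<dots> \<le> L * l1norm (X r \<omega> - X s \<omega>) * ?W \<omega>"
      using test_functionD(4)[OF f] by (intro mult_right_mono) auto
    finally show "\<bar>f (X r \<omega>) * ?W \<omega> - f (X s \<omega>) * ?W \<omega>\<bar> \<le> L * (l1norm (X r \<omega> - X s \<omega>) * ?W \<omega>)"
      by (simp add: mult.assoc)
  qed (intro integrable_mult_right int)
  also have "\<dots> = L * (\<integral>\<omega>. l1norm (X r \<omega> - X s \<omega>) * ?W \<omega> \<partial>M)"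
    by (rule integral_mult_right_zero)
  also have "\<dots> \<le> L * (y * gg t y / real m)"
    using bound test_functionD(1)[OF f] by (rule mult_left_mono)
  finally show ?thesis by (simp only: times_divide_eq_right)
qed

text \<open>The lag \<open>h\<close> stays fixed while the end point varies, so the weights never
  meet the singular time \<open>0\<close>. They converge almost surely, and their integrals converge
  by Chapman-Kolmogorov and continuity of the density; Scheffe's lemma then gives convergence in
  L1.\<close>

lemma bridge_continuous:
  assumes h: "0 < h" "h < t" and y: "0 < y" and ts: "ts \<longlonglongrightarrow> t" "\<And>n. h \<le> ts n" and ys: "ys \<longlonglongrightarrow> y"
    and f: "test_function L f"
  shows "(\<lambda>n. bridge f (ts n - h) (ts n) (ys n)) \<longlonglongrightarrow> bridge f (t - h) t y"
proof -
  have [measurable]: "f \<in> borel_measurable borel" using f by (rule test_function_measurable)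
  have [measurable]: "S (ts n - h) \<in> borel_measurable M" "X (ts n - h) \<in> borel_measurable M" 
    "S (t - h) \<in> borel_measurable M" "X (t - h) \<in> borel_measurable M" for n
    using ts(2)[of n] h by (auto intro!: measurable_S measurable_X)
  let ?W = "\<lambda>n \<omega>. gg h (ys n - S (ts n - h) \<omega>)" and ?V = "\<lambda>\<omega>. gg h (y - S (t - h) \<omega>)"
  have W: "integrable M (?W n)" "(\<integral>\<omega>. ?W n \<omega> \<partial>M) = gg (ts n) (ys n)" for n
    using bridge_weight[of "ts n - h" "ts n" "ys n"] h ts(2)[of n] by auto
  have V: "integrable M ?V" "(\<integral>\<omega>. ?V \<omega> \<partial>M) = gg t y"
    using bridge_weight[of "t - h" t y] h by auto
  have th: "(\<lambda>n. ts n - h) \<longlonglongrightarrow> t - h" by (intro tendsto_intros ts)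
  have AEX: "AE \<omega> in M. (\<lambda>n. X (ts n - h) \<omega>) \<longlonglongrightarrow> X (t - h) \<omega>"
    using h by (intro AE_tendsto th) simp
  have AES: "AE \<omega> in M. S (t - h) \<omega> \<noteq> y"
    using h by (intro AE_S_neq) simp
  have AEW: "AE \<omega> in M. (\<lambda>n. ?W n \<omega>) \<longlonglongrightarrow> ?V \<omega>"
    using AEX AES
  proof eventually_elim
    case (elim \<omega>)
    have "(\<lambda>n. ys n - S (ts n - h) \<omega>) \<longlonglongrightarrow> y - S (t - h) \<omega>"
      unfolding norm_process_def by (intro tendsto_intros ys elim)
    then show ?case using elim h by (intro tendsto_gg tendsto_const) auto
  qed
  have nW: "(\<integral>\<^sup>+\<omega>. norm (?W n \<omega>) \<partial>M) = ennreal (gg (ts n) (ys n))" for n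
    using nn_integral_eq_integral[OF W(1)[of n]] W(2)[of n] by simp
  have nV: "(\<integral>\<^sup>+\<omega>. norm (?V \<omega>) \<partial>M) = ennreal (gg t y)"
    using nn_integral_eq_integral[OF V(1)] V(2) by simp
  have "(\<lambda>n. \<integral>\<^sup>+\<omega>. norm (?W n \<omega> - ?V \<omega>) \<partial>M) \<longlonglongrightarrow> 0"
  proof (rule Scheffe_lemma1[OF W(1) V(1) AEW])
    have lim: "(\<lambda>n. ennreal (gg (ts n) (ys n))) \<longlonglongrightarrow> ennreal (gg t y)"
      using h y by (intro tendsto_ennrealI tendsto_gg_pos ts ys) auto
    show "limsup (\<lambda>n. \<integral>\<^sup>+\<omega>. norm (?W n \<omega>) \<partial>M) \<le> (\<integral>\<^sup>+\<omega>. norm (?V \<omega>) \<partial>M)"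
      unfolding nW nV by (simp only: lim_imp_Limsup[OF sequentially_bot lim] order_refl)
  qed
  moreover have "(\<integral>\<^sup>+\<omega>. norm (?W n \<omega> - ?V \<omega>) \<partial>M) = ennreal (\<integral>\<omega>. \<bar>?W n \<omega> - ?V \<omega>\<bar> \<partial>M)" for n
    using W V by (subst nn_integral_eq_integral) auto
  ultimately have L1: "(\<lambda>n. \<integral>\<omega>. \<bar>?W n \<omega> - ?V \<omega>\<bar> \<partial>M) \<longlonglongrightarrow> 0"
    by (simp add: ennreal_tendsto_0_iff)
  have L2: "(\<lambda>n. \<integral>\<omega>. f (X (ts n - h) \<omega>) * ?V \<omega> \<partial>M) \<longlonglongrightarrow> (\<integral>\<omega>. f (X (t - h) \<omega>) * ?V \<omega> \<partial>M)"
  proof (rule integral_dominated_convergence[OF _ _ V(1)])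
    show "AE \<omega> in M. (\<lambda>n. f (X (ts n - h) \<omega>) * ?V \<omega>) \<longlonglongrightarrow> f (X (t - h) \<omega>) * ?V \<omega>"
      using AEX by eventually_elim (intro tendsto_mult tendsto_const test_function_tendsto[OF f])
    show "AE \<omega> in M. norm (f (X (ts n - h) \<omega>) * ?V \<omega>) \<le> ?V \<omega>" for n
      using test_functionD[OF f] by (intro AE_I2) (simp add: abs_mult mult_left_le_one_le)
  qed measurable
  have fV: "integrable M (\<lambda>\<omega>. f (X (ts n - h) \<omega>) * ?V \<omega>)" "integrable M (\<lambda>\<omega>. f (X (ts n - h) \<omega>) * ?W n \<omega>)" for n
    by (rule Bochner_Integration.integrable_bound[OF V(1)], measurable,
        use test_functionD[OF f] in \<open>simp add: abs_mult mult_left_le_one_le\<close>)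
      (rule Bochner_Integration.integrable_bound[OF W(1)[of n]], measurable,
        use test_functionD[OF f] in \<open>simp add: abs_mult mult_left_le_one_le\<close>)
  \<comment> \<open>The error is split in two: here the weight changes while \<open>f\<close> stays
    at the moving time; \<open>L2\<close> treats the change of \<open>f\<close> under the limiting
    weight.\<close>
  have "\<bar>bridge f (ts n - h) (ts n) (ys n) - (\<integral>\<omega>. f (X (ts n - h) \<omega>) * ?V \<omega> \<partial>M)\<bar> \<le> (\<integral>\<omega>. \<bar>?W n \<omega> - ?V \<omega>\<bar> \<partial>M)" for n
  proof -
    have eq: "bridge f (ts n - h) (ts n) (ys n) - (\<integral>\<omega>. f (X (ts n - h) \<omega>) * ?V \<omega> \<partial>M) =
      (\<integral>\<omega>. f (X (ts n - h) \<omega>) * ?W n \<omega> - f (X (ts n - h) \<omega>) * ?V \<omega> \<partial>M)"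
      using fV by (simp add: bridge_def)
    show ?thesis
      unfolding eq
    proof (rule order_trans[OF integral_abs_bound integral_mono])
      fix \<omega>
      have "\<bar>f (X (ts n - h) \<omega>) * ?W n \<omega> - f (X (ts n - h) \<omega>) * ?V \<omega>\<bar> = f (X (ts n - h) \<omega>) * \<bar>?W n \<omega> - ?V \<omega>\<bar>"
        using test_functionD(2)[OF f] by (simp add: right_diff_distrib[symmetric] abs_mult)
      also have "\<dots> \<le> \<bar>?W n \<omega> - ?V \<omega>\<bar>"
        using test_functionD[OF f] by (intro mult_left_le_one_le) auto
      finally show "\<bar>f (X (ts n - h) \<omega>) * ?W n \<omega> - f (X (ts n - h) \<omega>) * ?V \<omega>\<bar> \<le> \<bar>?W n \<omega> - ?V \<omega>\<bar>" .
    qed (intro integrable_abs Bochner_Integration.integrable_diff fV W V)+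
  qed
  then have "(\<lambda>n. bridge f (ts n - h) (ts n) (ys n) - (\<integral>\<omega>. f (X (ts n - h) \<omega>) * ?V \<omega> \<partial>M)) \<longlonglongrightarrow> 0"
    by (intro Lim_null_comparison[OF _ L1]) simp
  from tendsto_add[OF this L2] show ?thesis by (simp add: bridge_def)
qed

section \<open>The bridge observed at countably many times\<close>

lemma indep_path_increment:
  assumes T: "0 \<le> T 0" "\<And>i. T i \<le> T (Suc i)"
  shows "indep_var (PiM {..n} (\<lambda>_. borel)) (\<lambda>\<omega>. \<lambda>j\<in>{..n}. X (T j) \<omega>)
    (PiM {Suc n} (\<lambda>_. borel)) (\<lambda>\<omega>. \<lambda>j\<in>{Suc n}. X (T j) \<omega> - X (T n) \<omega>)"
proof -
  have Tpos: "0 \<le> T i" for i by (induction i) (use T order_trans in auto)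
  have [measurable]: "X (T i) \<in> borel_measurable M" for i using Tpos by (rule measurable_X)
  \<comment> \<open>A time \<open>0\<close> is put in front, so that the first increment is
    \<open>X (T 0)\<close> itself and partial sums of increments recover the path.\<close>
  define U where "U i = (case i of 0 \<Rightarrow> 0 | Suc j \<Rightarrow> T j)" for i :: nat
  have U: "U 0 = 0" "U (Suc i) = T i" for i by (auto simp: U_def)
  let ?D = "\<lambda>i \<omega>. X (U (Suc i)) \<omega> - X (U i) \<omega>"
  have "indep_vars (\<lambda>_. borel) ?D {..<n + 2}"
    using T by (intro independent_increments) (auto simp: U_def split: nat.split)
  then have "indep_var (PiM {..n} (\<lambda>_. borel)) (\<lambda>\<omega>. restrict (\<lambda>i. ?D i \<omega>) {..n})
      (PiM {Suc n} (\<lambda>_. borel)) (\<lambda>\<omega>. restrict (\<lambda>i. ?D i \<omega>) {Suc n})"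
    by (rule indep_var_restrict) auto
  moreover have "(\<lambda>f. \<lambda>j\<in>{..n}. \<Sum>i\<le>j. f i) \<in> PiM {..n} (\<lambda>_. borel :: (real^'d) measure) \<rightarrow>\<^sub>M PiM {..n} (\<lambda>_. borel)"
    by (intro measurable_restrict borel_measurable_sum measurable_component_singleton) auto
  ultimately have *: "indep_var (PiM {..n} (\<lambda>_. borel)) (\<lambda>\<omega>. \<lambda>j\<in>{..n}. \<Sum>i\<le>j. (\<lambda>i\<in>{..n}. ?D i \<omega>) i)
      (PiM {Suc n} (\<lambda>_. borel)) (\<lambda>\<omega>. \<lambda>j\<in>{Suc n}. ?D j \<omega>)"
    using indep_var_compose[OF _ _ measurable_ident_sets[OF refl]] unfolding o_def by blast
  have sum: "(\<Sum>i\<le>j. ?D i \<omega>) = X (T j) \<omega>" if "\<omega> \<in> space M" for \<omega> j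
    by (induction j) (use that in \<open>auto simp: U start\<close>)
  have eq: "(\<lambda>j\<in>{..n}. \<Sum>i\<le>j. (\<lambda>i\<in>{..n}. ?D i \<omega>) i) = (\<lambda>j\<in>{..n}. X (T j) \<omega>)" if "\<omega> \<in> space M" for \<omega>
  proof (rule restrict_ext)
    fix j assume "j \<in> {..n}"
    then have "(\<Sum>i\<le>j. (\<lambda>i\<in>{..n}. ?D i \<omega>) i) = (\<Sum>i\<le>j. ?D i \<omega>)" by (intro sum.cong) auto
    then show "(\<Sum>i\<le>j. (\<lambda>i\<in>{..n}. ?D i \<omega>) i) = X (T j) \<omega>" using sum[OF that] by simp
  qed
  have "distr M (PiM {..n} (\<lambda>_. borel)) (\<lambda>\<omega>. \<lambda>j\<in>{..n}. \<Sum>i\<le>j. (\<lambda>i\<in>{..n}. ?D i \<omega>) i) =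
    distr M (PiM {..n} (\<lambda>_. borel)) (\<lambda>\<omega>. \<lambda>j\<in>{..n}. X (T j) \<omega>)"
    by (intro distr_cong refl eq)
  moreover have "distr M (PiM {..n} (\<lambda>_. borel) \<Otimes>\<^sub>M PiM {Suc n} (\<lambda>_. borel))
      (\<lambda>\<omega>. (\<lambda>j\<in>{..n}. \<Sum>i\<le>j. (\<lambda>i\<in>{..n}. ?D i \<omega>) i, \<lambda>j\<in>{Suc n}. ?D j \<omega>)) =
    distr M (PiM {..n} (\<lambda>_. borel) \<Otimes>\<^sub>M PiM {Suc n} (\<lambda>_. borel))
      (\<lambda>\<omega>. (\<lambda>j\<in>{..n}. X (T j) \<omega>, \<lambda>j\<in>{Suc n}. ?D j \<omega>))"
    by (intro distr_cong refl) (simp only: eq)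
  moreover have "(\<lambda>j\<in>{Suc n}. ?D j \<omega>) = (\<lambda>j\<in>{Suc n}. X (T j) \<omega> - X (T n) \<omega>)" for \<omega>
    by (rule restrict_ext) (simp add: U)
  moreover have "(\<lambda>\<omega>. \<lambda>j\<in>{..n}. X (T j) \<omega>) \<in> M \<rightarrow>\<^sub>M PiM {..n} (\<lambda>_. borel)"
    by measurable
  ultimately show ?thesis
    using * unfolding indep_var_distribution_eq by (simp only: simp_thms)
qed

text \<open>The martingale property against a functional of the whole discrete past. This is the
  consistency condition for the finite-dimensional laws of the bridge.\<close>

lemma markov_density_path:
  assumes T: "0 \<le> T 0" "\<And>i. T i \<le> T (Suc i)" "T (Suc n) < t"
    and [measurable]: "F \<in> borel_measurable (PiM {..n} (\<lambda>_. borel))"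
  shows "(\<integral>\<^sup>+\<omega>. F (\<lambda>j\<in>{..n}. X (T j) \<omega>) * ennreal (gg (t - T (Suc n)) (y - S (T (Suc n)) \<omega>)) \<partial>M) =
    (\<integral>\<^sup>+\<omega>. F (\<lambda>j\<in>{..n}. X (T j) \<omega>) * ennreal (gg (t - T n) (y - S (T n) \<omega>)) \<partial>M)"
proof -
  have Tpos: "0 \<le> T i" for i by (induction i) (use T order_trans in auto)
  let ?d = "T (Suc n) - T n"
  have d: "0 \<le> ?d" using T by simp
  have [measurable]: "X (T i) \<in> borel_measurable M" "S (T i) \<in> borel_measurable M" "X ?d \<in> borel_measurable M"
     "S ?d \<in> borel_measurable M" for i
    using Tpos[of i] d by (auto intro!: measurable_X measurable_S)
  let ?h = "\<lambda>p. F (fst p) * ennreal (gg (t - T (Suc n)) (y - l1norm (fst p n + snd p (Suc n))))"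
  let ?V = "\<lambda>\<omega>. \<lambda>j\<in>{Suc n}. X (T j) \<omega> - X (T n) \<omega>"
  have hm[measurable]: "?h \<in> borel_measurable (PiM {..n} (\<lambda>_. borel) \<Otimes>\<^sub>M PiM {Suc n} (\<lambda>_. borel))"
    by measurable
  have "(\<integral>\<^sup>+\<omega>. F (\<lambda>j\<in>{..n}. X (T j) \<omega>) * ennreal (gg (t - T (Suc n)) (y - S (T (Suc n)) \<omega>)) \<partial>M) =
    (\<integral>\<^sup>+\<omega>. ?h (\<lambda>j\<in>{..n}. X (T j) \<omega>, ?V \<omega>) \<partial>M)"
    by (simp add: norm_process_def)
  also have "\<dots> = (\<integral>\<^sup>+\<omega>. \<integral>\<^sup>+x. ?h (\<lambda>j\<in>{..n}. X (T j) \<omega>, x) \<partial>distr M (PiM {Suc n} (\<lambda>_. borel)) ?V \<partial>M)"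
    by (rule indep_var_nn_integral[OF indep_path_increment]) (use T in auto)
  also have "\<dots> = (\<integral>\<^sup>+\<omega>. \<integral>\<^sup>+\<omega>'. F (\<lambda>j\<in>{..n}. X (T j) \<omega>) * ennreal (gg (t - T (Suc n)) ((y - S (T n) \<omega>) - S ?d \<omega>')) \<partial>M \<partial>M)"
  proof (rule nn_integral_cong)
    fix \<omega> assume w: "\<omega> \<in> space M"
    let ?k = "\<lambda>x. F (\<lambda>j\<in>{..n}. X (T j) \<omega>) * ennreal (gg (t - T (Suc n)) (y - l1norm (X (T n) \<omega> + x)))"
    have "(\<lambda>j\<in>{..n}. X (T j) \<omega>) \<in> space (PiM {..n} (\<lambda>_. borel))" by (simp add: space_PiM)
    then have "(\<lambda>x. ?h (\<lambda>j\<in>{..n}. X (T j) \<omega>, x)) \<in> borel_measurable (PiM {Suc n} (\<lambda>_. borel))"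
      by (rule measurable_compose[OF measurable_Pair1' hm])
    then have hx: "(\<lambda>x. ?h (\<lambda>j\<in>{..n}. X (T j) \<omega>, x)) \<in> borel_measurable (distr M (PiM {Suc n} (\<lambda>_. borel)) ?V)"
      by (simp only: measurable_distr_eq1)
    have "(\<integral>\<^sup>+x. ?h (\<lambda>j\<in>{..n}. X (T j) \<omega>, x) \<partial>distr M (PiM {Suc n} (\<lambda>_. borel)) ?V) =
      (\<integral>\<^sup>+\<omega>'. ?h (\<lambda>j\<in>{..n}. X (T j) \<omega>, ?V \<omega>') \<partial>M)"
      by (rule nn_integral_distr[OF _ hx]) measurable
    also have "\<dots> = (\<integral>\<^sup>+\<omega>'. ?k (X (T (Suc n)) \<omega>' - X (T n) \<omega>') \<partial>M)" by simp
    also have "\<dots> = (\<integral>\<^sup>+x. ?k x \<partial>distr M borel (\<lambda>\<omega>. X (T (Suc n)) \<omega> - X (T n) \<omega>))"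
      by (subst nn_integral_distr) measurable
    also have "\<dots> = (\<integral>\<^sup>+x. ?k x \<partial>distr M borel (X ?d))"
      using T Tpos by (subst distr_increment) auto
    also have "\<dots> = (\<integral>\<^sup>+\<omega>'. ?k (X ?d \<omega>') \<partial>M)"
      by (rule nn_integral_distr) measurable
    also have "\<dots> = (\<integral>\<^sup>+\<omega>'. F (\<lambda>j\<in>{..n}. X (T j) \<omega>) * ennreal (gg (t - T (Suc n)) ((y - S (T n) \<omega>) - S ?d \<omega>')) \<partial>M)"
      using w Tpos d by (intro nn_integral_cong) (simp add: S_add diff_diff_eq)
    finally show "(\<integral>\<^sup>+x. ?h (\<lambda>j\<in>{..n}. X (T j) \<omega>, x) \<partial>distr M (PiM {Suc n} (\<lambda>_. borel)) ?V) =
      (\<integral>\<^sup>+\<omega>'. F (\<lambda>j\<in>{..n}. X (T j) \<omega>) * ennreal (gg (t - T (Suc n)) ((y - S (T n) \<omega>) - S ?d \<omega>')) \<partial>M)" .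
  qed
  also have "\<dots> = (\<integral>\<^sup>+\<omega>. F (\<lambda>j\<in>{..n}. X (T j) \<omega>) * ennreal (gg (t - T n) (y - S (T n) \<omega>)) \<partial>M)"
  proof (rule nn_integral_cong)
    fix \<omega>
    have "(\<integral>\<^sup>+\<omega>'. F (\<lambda>j\<in>{..n}. X (T j) \<omega>) * ennreal (gg (t - T (Suc n)) ((y - S (T n) \<omega>) - S ?d \<omega>')) \<partial>M) =
      F (\<lambda>j\<in>{..n}. X (T j) \<omega>) * (\<integral>\<^sup>+\<omega>'. ennreal (gg (t - T (Suc n)) ((y - S (T n) \<omega>) - S ?d \<omega>')) \<partial>M)"
      by (rule nn_integral_cmult) measurable
    also have "\<dots> = F (\<lambda>j\<in>{..n}. X (T j) \<omega>) * ennreal (gg (t - T n) (y - S (T n) \<omega>))"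
      using d T by (subst chapman_kolmogorov) auto
    finally show "(\<integral>\<^sup>+\<omega>'. F (\<lambda>j\<in>{..n}. X (T j) \<omega>) * ennreal (gg (t - T (Suc n)) ((y - S (T n) \<omega>) - S ?d \<omega>')) \<partial>M) =
      F (\<lambda>j\<in>{..n}. X (T j) \<omega>) * ennreal (gg (t - T n) (y - S (T n) \<omega>))" .
  qed
  finally show ?thesis .
qed

text \<open>The weights degenerate at the end time, so the bridge is observed at countably many
  times that increase to \<open>t\<close> without reaching it.\<close>

definition dyadic_time :: "real \<Rightarrow> nat \<Rightarrow> real" where
  "dyadic_time t i = t - t / 2 ^ Suc i"

lemma dyadic_time:
  assumes "0 < t"
  shows "0 < dyadic_time t i" "dyadic_time t i < t" "dyadic_time t i \<le> dyadic_time t (Suc i)"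
    "dyadic_time t \<longlonglongrightarrow> t"
proof -
  have "(1::real) < 2 ^ Suc i" by (rule one_less_power) auto
  then have "t / 2 ^ Suc i < t / 1" using assms by (intro divide_strict_left_mono) auto
  then show "0 < dyadic_time t i" by (simp add: dyadic_time_def)
  show "dyadic_time t i < t" using assms by (simp add: dyadic_time_def)
  have "t / 2 ^ Suc (Suc i) \<le> t / 2 ^ Suc i"
    using assms by (intro divide_left_mono power_increasing) auto
  then show "dyadic_time t i \<le> dyadic_time t (Suc i)" by (simp add: dyadic_time_def)
  have "(\<lambda>i. t - t * (1 / 2) ^ Suc i) \<longlonglongrightarrow> t - t * 0"
    by (intro tendsto_intros LIMSEQ_Suc[OF LIMSEQ_realpow_zero]) auto
  then show "dyadic_time t \<longlonglongrightarrow> t"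
    unfolding dyadic_time_def[abs_def] by (simp add: power_one_over)
qed

text \<open>The bridge from \<open>0\<close> to level \<open>y\<close> at time \<open>t\<close> is singular to \<open>M\<close>, so it is realised
  on a new space by Kolmogorov extension of its laws at finitely many dyadic times.\<close>

lemma bridge_law_exists:
  assumes t: "0 < t" and pos: "0 < gg t y"
  shows "\<exists>K. prob_space K \<and> sets K = sets borel \<and>
    (\<forall>L f. test_function L f \<longrightarrow> (\<lambda>i. bridge f (dyadic_time t i) t y) \<longlonglongrightarrow> gg t y * (\<integral>x. f x \<partial>K))"
proof -
  define r where "r = dyadic_time t"
  have r: "0 < r i" "r i < t" "r i \<le> r (Suc i)" for i
    using dyadic_time[OF t] by (auto simp: r_def)
  have [measurable]: "X (r i) \<in> borel_measurable M" "S (r i) \<in> borel_measurable M" for i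
    using r(1)[of i] by (auto intro!: measurable_X measurable_S)
  \<comment> \<open>Density relative to \<open>M\<close> of the law of the bridge observed up to
    time \<open>r i\<close>.\<close>
  define W where "W i \<omega> = gg (t - r i) (y - S (r i) \<omega>) / gg t y" for i \<omega>
  have [measurable]: "W i \<in> borel_measurable M" for i
    unfolding W_def by measurable
  have W0: "0 \<le> W i \<omega>" for i \<omega> using pos by (simp add: W_def)
  let ?path = "\<lambda>J \<omega>. \<lambda>j\<in>J. X (r j) \<omega>"
  have W1: "(\<integral>\<^sup>+\<omega>. ennreal (W n \<omega>) \<partial>M) = 1" for n
  proof -
    have "(\<integral>\<^sup>+\<omega>. ennreal (W n \<omega>) \<partial>M) = (\<integral>\<^sup>+\<omega>. ennreal (1 / gg t y) * ennreal (gg (t - r n) (y - S (r n) \<omega>)) \<partial>M)"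
      using pos by (intro nn_integral_cong) (simp add: W_def ennreal_mult[symmetric])
    also have "\<dots> = ennreal (1 / gg t y) * (\<integral>\<^sup>+\<omega>. ennreal (gg (t - r n) (y - S (r n) \<omega>)) \<partial>M)"
      by (rule nn_integral_cmult) measurable
    also have "\<dots> = 1"
      using pos r[of n] by (subst chapman_kolmogorov) (auto simp: ennreal_mult[symmetric])
    finally show ?thesis .
  qed
  have shift: "(\<integral>\<^sup>+\<omega>. ennreal (W (Suc n) \<omega>) * indicator A (?path J \<omega>) \<partial>M) =
      (\<integral>\<^sup>+\<omega>. ennreal (W n \<omega>) * indicator A (?path J \<omega>) \<partial>M)"
    if J: "J \<subseteq> {..n}" and A[measurable]: "A \<in> sets (PiM J (\<lambda>_. borel))" for J n and A :: "(nat \<Rightarrow> real^'d) set"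
  proof -
    let ?F = "\<lambda>p. ennreal (1 / gg t y) * indicator A (restrict p J)"
    have Fm: "?F \<in> borel_measurable (PiM {..n} (\<lambda>_. borel))"
    proof -
      have [measurable]: "(\<lambda>p. indicator A (restrict p J) :: ennreal) \<in> borel_measurable (PiM {..n} (\<lambda>_. borel))"
        by (rule measurable_compose[OF measurable_restrict_subset[OF J] borel_measurable_indicator[OF A]])
      show ?thesis by measurable
    qed
    have "(\<lambda>j\<in>J. (\<lambda>j\<in>{..n}. X (r j) \<omega>) j) = ?path J \<omega>" for \<omega>
      using J by (intro restrict_ext) auto
    then have rr: "restrict (\<lambda>j\<in>{..n}. X (r j) \<omega>) J = ?path J \<omega>" for \<omega>
      using J by (simp add: Int_absorb1)
    have Weq: "ennreal (W m \<omega>) * indicator A (?path J \<omega>) =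
      ennreal (1 / gg t y) * indicator A (?path J \<omega>) * ennreal (gg (t - r m) (y - S (r m) \<omega>))" for m \<omega>
    proof -
      have "ennreal (W m \<omega>) = ennreal (1 / gg t y) * ennreal (gg (t - r m) (y - S (r m) \<omega>))"
        using pos by (simp add: W_def ennreal_mult[symmetric])
      then show ?thesis by (simp only: ac_simps)
    qed
    have "(\<integral>\<^sup>+\<omega>. ?F (\<lambda>j\<in>{..n}. X (r j) \<omega>) * ennreal (gg (t - r (Suc n)) (y - S (r (Suc n)) \<omega>)) \<partial>M) =
      (\<integral>\<^sup>+\<omega>. ?F (\<lambda>j\<in>{..n}. X (r j) \<omega>) * ennreal (gg (t - r n) (y - S (r n) \<omega>)) \<partial>M)"
      by (rule markov_density_path[where T = r, OF less_imp_le[OF r(1)] r(3) r(2) Fm])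
    then show ?thesis
      unfolding rr Weq .
  qed
  have inv: "(\<integral>\<^sup>+\<omega>. ennreal (W m \<omega>) * indicator A (?path J \<omega>) \<partial>M) =
      (\<integral>\<^sup>+\<omega>. ennreal (W n \<omega>) * indicator A (?path J \<omega>) \<partial>M)"
    if J: "J \<subseteq> {..n}" and A: "A \<in> sets (PiM J (\<lambda>_. borel))" and "n \<le> m" for J n m and A :: "(nat \<Rightarrow> real^'d) set"
    using \<open>n \<le> m\<close>
  proof (induction m rule: dec_induct)
    case (step m)
    then have "J \<subseteq> {..m}" using J by auto
    from shift[OF this A] step.IH show ?case by (rule trans)
  qed simp
  \<comment> \<open>By \<open>inv\<close> the weight at any index from the last one of
    \<open>J\<close> on gives the same law; \<open>insert 0\<close> supplies an index for empty
    \<open>J\<close>.\<close>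
  define P where "P J = distr (density M (\<lambda>\<omega>. ennreal (W (Max (insert 0 J)) \<omega>))) (PiM J (\<lambda>_. borel)) (?path J)" for J
  have path[measurable]: "?path J \<in> M \<rightarrow>\<^sub>M PiM J (\<lambda>_. borel)" for J
    by (intro measurable_restrict) measurable
  have emP: "emeasure (P J) A = (\<integral>\<^sup>+\<omega>. ennreal (W n \<omega>) * indicator A (?path J \<omega>) \<partial>M)"
    if J: "finite J" "J \<subseteq> {..n}" and A[measurable]: "A \<in> sets (PiM J (\<lambda>_. borel))" for J n and A :: "(nat \<Rightarrow> real^'d) set"
  proof -
    have "emeasure (P J) A = (\<integral>\<^sup>+\<omega>. ennreal (W (Max (insert 0 J)) \<omega>) * indicator (?path J -` A \<inter> space M) \<omega> \<partial>M)"
      unfolding P_def by (subst emeasure_distr) (auto intro!: emeasure_density)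
    also have "\<dots> = (\<integral>\<^sup>+\<omega>. ennreal (W (Max (insert 0 J)) \<omega>) * indicator A (?path J \<omega>) \<partial>M)"
      by (intro nn_integral_cong) (auto split: split_indicator)
    also have "\<dots> = (\<integral>\<^sup>+\<omega>. ennreal (W n \<omega>) * indicator A (?path J \<omega>) \<partial>M)"
      using J by (intro inv[symmetric] A) auto
    finally show ?thesis .
  qed
  have setsP: "sets (P J) = sets (PiM J (\<lambda>_. borel))" for J
    by (simp add: P_def)
  \<comment> \<open>Kolmogorov's consistency: the weight at one common index \<open>n\<close>
    computes the laws on \<open>H\<close> and on \<open>J\<close>.\<close>
  interpret PP: polish_projective UNIV P
  proof (intro polish_projective.intro projective_family.intro)
    fix J H :: "nat set" assume JH: "J \<subseteq> H" "finite H"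
    then have J: "finite J" by (auto intro: finite_subset)
    define n where "n = Max (insert 0 H)"
    have n: "H \<subseteq> {..n}" "J \<subseteq> {..n}" using JH by (auto simp: n_def)
    show "P J = distr (P H) (PiM J (\<lambda>_. borel)) (\<lambda>f. restrict f J)"
    proof (rule measure_eqI)
      fix A assume "A \<in> sets (P J)"
      then have A[measurable]: "A \<in> sets (PiM J (\<lambda>_. borel))" by (simp add: setsP)
      have res: "(\<lambda>f. restrict f J) \<in> P H \<rightarrow>\<^sub>M PiM J (\<lambda>_. borel)"
        using JH by (simp add: P_def measurable_restrict_subset)
      have pre: "(\<lambda>f. restrict f J) -` A \<inter> space (P H) \<in> sets (PiM H (\<lambda>_. borel))"
        using measurable_sets[OF res A] by (simp add: setsP)
      have "emeasure (distr (P H) (PiM J (\<lambda>_. borel)) (\<lambda>f. restrict f J)) A =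
        (\<integral>\<^sup>+\<omega>. ennreal (W n \<omega>) * indicator ((\<lambda>f. restrict f J) -` A \<inter> space (P H)) (?path H \<omega>) \<partial>M)"
        using emP[OF JH(2) n(1) pre] by (subst emeasure_distr[OF res A])
      also have "\<dots> = (\<integral>\<^sup>+\<omega>. ennreal (W n \<omega>) * indicator A (?path J \<omega>) \<partial>M)"
      proof (rule nn_integral_cong)
        fix \<omega> assume "\<omega> \<in> space M"
        have "?path H \<omega> \<in> space (P H)" by (simp add: P_def space_PiM)
        moreover have "restrict (?path H \<omega>) J = ?path J \<omega>"
          using JH by (intro restrict_ext) auto
        ultimately show "ennreal (W n \<omega>) * indicator ((\<lambda>f. restrict f J) -` A \<inter> space (P H)) (?path H \<omega>) =
          ennreal (W n \<omega>) * indicator A (?path J \<omega>)"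
          by (auto split: split_indicator)
      qed
      also have "\<dots> = emeasure (P J) A" using emP[OF J n(2) A] by simp
      finally show "emeasure (P J) A = emeasure (distr (P H) (PiM J (\<lambda>_. borel)) (\<lambda>f. restrict f J)) A" ..
    qed (simp add: setsP)
  next
    fix J :: "nat set" assume "finite J"
    have "emeasure (density M (\<lambda>\<omega>. ennreal (W n \<omega>))) (space M) = (\<integral>\<^sup>+\<omega>. ennreal (W n \<omega>) \<partial>M)" for n
      by (subst emeasure_density) (auto intro!: nn_integral_cong)
    then have "prob_space (density M (\<lambda>\<omega>. ennreal (W n \<omega>)))" for n
      by (intro prob_spaceI) (simp add: W1)
    then show "prob_space (P J)"
      unfolding P_def by (rule prob_space.prob_space_distr) simp
  qed
  let ?R = "PP.lim"
  have distr_lim: "distr ?R (PiM J (\<lambda>_. borel)) (\<lambda>f. restrict f J) = P J" if J: "finite J" for J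
  proof (rule measure_eqI)
    fix A assume "A \<in> sets (distr ?R (PiM J (\<lambda>_. borel)) (\<lambda>f. restrict f J))"
    then have A: "A \<in> sets (PiM J (\<lambda>_. borel))" by simp
    have res: "(\<lambda>f. restrict f J) \<in> ?R \<rightarrow>\<^sub>M PiM J (\<lambda>_. borel)"
      by (simp add: measurable_cong_sets[OF PP.sets_lim refl] measurable_restrict_subset)
    have "emeasure (distr ?R (PiM J (\<lambda>_. borel)) (\<lambda>f. restrict f J)) A = emeasure ?R (PP.emb UNIV J A)"
      by (subst emeasure_distr[OF res A]) (simp add: prod_emb_def space_PiM)
    also have "\<dots> = emeasure (P J) A"
      using J A by (intro PP.emeasure_lim_emb) auto
    finally show "emeasure (distr ?R (PiM J (\<lambda>_. borel)) (\<lambda>f. restrict f J)) A = emeasure (P J) A" .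
  qed (simp add: setsP)
  have coord[measurable]: "(\<lambda>f. f i) \<in> borel_measurable ?R" for i
    by (simp add: measurable_cong_sets[OF PP.sets_lim refl])
  \<comment> \<open>Carries a property of the path from \<open>M\<close> to the extension; only
    sample points of positive weight have to satisfy it.\<close>
  have AE_lim: "AE f in ?R. Q (restrict f J)"
    if J: "finite J" "J \<subseteq> {..n}" and Q[measurable]: "Measurable.pred (PiM J (\<lambda>_. borel)) Q"
      and ae: "AE \<omega> in M. 0 < W n \<omega> \<longrightarrow> Q (?path J \<omega>)" for J n Q
  proof -
    let ?A = "{x\<in>space (PiM J (\<lambda>_. borel)). \<not> Q x}"
    have A: "?A \<in> sets (PiM J (\<lambda>_. borel))" by measurable
    have "emeasure (P J) ?A = (\<integral>\<^sup>+\<omega>. 0 \<partial>M)"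
      unfolding emP[OF J A]
    proof (intro nn_integral_cong_AE)
      show "AE \<omega> in M. ennreal (W n \<omega>) * indicator ?A (?path J \<omega>) = 0"
        using ae by eventually_elim (use W0 in \<open>auto split: split_indicator simp: less_le\<close>)
    qed
    then have "AE x in P J. Q x"
      using A by (intro AE_I[where N="?A"]) (simp_all add: setsP sets_eq_imp_space_eq[OF setsP])
    then have "AE x in distr ?R (PiM J (\<lambda>_. borel)) (\<lambda>f. restrict f J). Q x"
      unfolding distr_lim[OF J(1)] .
    then show ?thesis
      by (subst (asm) AE_distr_iff) (auto simp: measurable_cong_sets[OF PP.sets_lim refl] measurable_restrict_subset)
  qed
  have incr: "AE f in ?R. f i \<le> f (Suc i)" for i
  proof -
    have "AE f in ?R. (\<lambda>f. f i \<le> f (Suc i)) (restrict f {i, Suc i})"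
    proof (rule AE_lim)
      show "Measurable.pred (PiM {i, Suc i} (\<lambda>_. borel)) (\<lambda>f::nat \<Rightarrow> real^'d. f i \<le> f (Suc i))"
        by (intro pred_less_eq_vec measurable_component_singleton) auto
      show "{i, Suc i} \<subseteq> {..Suc i}" by auto
      show "AE \<omega> in M. 0 < W (Suc i) \<omega> \<longrightarrow> ?path {i, Suc i} \<omega> i \<le> ?path {i, Suc i} \<omega> (Suc i)"
        using AE_mono_pair[OF less_imp_le[OF r(1)] r(3), of i] by eventually_elim simp
    qed simp
    then show ?thesis by simp
  qed
  have bnd: "AE f in ?R. 0 \<le> f i \<and> l1norm (f i) \<le> y" for i
  proof -
    have "AE f in ?R. (\<lambda>f. 0 \<le> f i \<and> l1norm (f i) \<le> y) (restrict f {i})"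
    proof (rule AE_lim)
      have [measurable]: "(\<lambda>f::nat \<Rightarrow> real^'d. f i) \<in> borel_measurable (PiM {i} (\<lambda>_. borel))"
        by (rule measurable_component_singleton) simp
      show "Measurable.pred (PiM {i} (\<lambda>_. borel)) (\<lambda>f::nat \<Rightarrow> real^'d. 0 \<le> f i \<and> l1norm (f i) \<le> y)"
        by (intro pred_intros_logic pred_less_eq_vec) measurable
      show "{i} \<subseteq> {..i}" by auto
      show "AE \<omega> in M. 0 < W i \<omega> \<longrightarrow> 0 \<le> ?path {i} \<omega> i \<and> l1norm (?path {i} \<omega> i) \<le> y"
      proof (intro AE_I2 impI)
        fix \<omega> assume w: "\<omega> \<in> space M" and "0 < W i \<omega>"
        then have "gg (t - r i) (y - S (r i) \<omega>) \<noteq> 0" by (auto simp: W_def)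
        then have "S (r i) \<omega> < y" using gg_zero[of "y - S (r i) \<omega>" "t - r i"] by linarith
        then show "0 \<le> ?path {i} \<omega> i \<and> l1norm (?path {i} \<omega> i) \<le> y"
          using X_nonneg[OF less_imp_le[OF r(1)] w, of i] by (simp add: norm_process_def)
      qed
    qed simp
    then show ?thesis by simp
  qed
  \<comment> \<open>The state of the bridge at its end time. Coordinates increase, and they stay
    below \<open>y\<close> because the weight vanishes once the norm reaches \<open>y\<close>; hence
    they converge.\<close>
  let ?Z = "\<lambda>f::nat \<Rightarrow> real^'d. lim f"
  have Zm[measurable]: "?Z \<in> borel_measurable ?R"
    using borel_measurable_lim_metric[of "\<lambda>i f. f i" ?R] coord by simp
  have conv: "AE f in ?R. f \<longlonglongrightarrow> ?Z f"
  proof -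
    have "AE f in ?R. (\<forall>i. f i \<le> f (Suc i)) \<and> (\<forall>i. 0 \<le> f i \<and> l1norm (f i) \<le> y)"
      by (intro AE_conjI AE_all_countable[THEN iffD2] allI incr bnd)
    then show ?thesis
    proof eventually_elim
      case (elim f)
      have "\<exists>l. (\<lambda>n. f n $ k) \<longlonglongrightarrow> l" for k
      proof -
        have "incseq (\<lambda>n. f n $ k)" using elim by (auto simp: incseq_Suc_iff less_eq_vec_def)
        moreover have "f n $ k \<le> y" for n
        proof -
          have "f n $ k \<le> norm (f n)" using component_le_norm_cart[of "f n" k] by linarith
          also have "\<dots> \<le> l1norm (f n)" by (rule norm_le_l1norm)
          finally show ?thesis using elim by (meson order_trans)
        qed
        ultimately obtain L where "(\<lambda>n. f n $ k) \<longlonglongrightarrow> L"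
          using incseq_convergent[of "\<lambda>n. f n $ k" y] by blast
        then show ?thesis by blast
      qed
      then obtain l where "\<And>k. (\<lambda>n. f n $ k) \<longlonglongrightarrow> l k" by metis
      then have "f \<longlonglongrightarrow> (\<chi> k. l k)" by (intro vec_tendstoI) simp
      then show ?case by (simp add: limI)
    qed
  qed
  have int_coord: "(\<integral>g. f (g i) \<partial>?R) = bridge f (r i) t y / gg t y" if f: "test_function L f" for f L i
  proof -
    have [measurable]: "f \<in> borel_measurable borel" using f by (rule test_function_measurable)
    have [measurable]: "(\<lambda>g. f (g i)) \<in> borel_measurable (PiM {i} (\<lambda>_. borel))" by measurable
    have "(\<integral>g. f (g i) \<partial>?R) = (\<integral>g. f (g i) \<partial>distr ?R (PiM {i} (\<lambda>_. borel)) (\<lambda>f. restrict f {i}))"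
      by (subst integral_distr) (auto simp: measurable_cong_sets[OF PP.sets_lim refl] measurable_restrict_subset)
    also have "\<dots> = (\<integral>g. f (g i) \<partial>P {i})" by (simp add: distr_lim)
    also have "\<dots> = (\<integral>\<omega>. f (?path {i} \<omega> i) \<partial>density M (\<lambda>\<omega>. ennreal (W i \<omega>)))"
      unfolding P_def by (subst integral_distr) auto
    also have "\<dots> = (\<integral>\<omega>. W i \<omega> *\<^sub>R f (X (r i) \<omega>) \<partial>M)"
      using W0 by (subst integral_density) auto
    also have "\<dots> = (\<integral>\<omega>. f (X (r i) \<omega>) * gg (t - r i) (y - S (r i) \<omega>) / gg t y \<partial>M)"
      by (simp add: W_def ac_simps)
    finally show ?thesis by (simp add: bridge_def)
  qed
  show ?thesis
  proof (intro exI conjI allI impI)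
    show "prob_space (distr ?R borel ?Z)" by (rule PP.P.prob_space_distr) (rule Zm)
    fix L and f :: "real^'d \<Rightarrow> real" assume f: "test_function L f"
    have [measurable]: "f \<in> borel_measurable borel" using f by (rule test_function_measurable)
    have "(\<lambda>i. \<integral>g. f (g i) \<partial>?R) \<longlonglongrightarrow> (\<integral>g. f (?Z g) \<partial>?R)"
    proof (rule integral_dominated_convergence[where w="\<lambda>_. 1"])
      show "AE g in ?R. (\<lambda>i. f (g i)) \<longlonglongrightarrow> f (?Z g)"
        using conv by eventually_elim (rule test_function_tendsto[OF f])
    qed (use test_functionD[OF f] in \<open>auto intro!: measurable_compose[OF coord] measurable_compose[OF Zm]\<close>)
    then have "(\<lambda>i. gg t y * (bridge f (r i) t y / gg t y)) \<longlonglongrightarrow> gg t y * (\<integral>g. f (?Z g) \<partial>?R)"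
      unfolding int_coord[OF f] by (intro tendsto_mult tendsto_const)
    then show "(\<lambda>i. bridge f (dyadic_time t i) t y) \<longlonglongrightarrow> gg t y * (\<integral>x. f x \<partial>distr ?R borel ?Z)"
      using pos by (simp add: r_def integral_distr[OF Zm])
  qed simp
qed

end

section \<open>The law of the process given its norm\<close>

lemma infdist_approx_tendsto:
  assumes "closed A" "A \<noteq> {}"
  shows "(\<lambda>n. max 0 (1 - real n * infdist x A)) \<longlonglongrightarrow> indicator A x"
proof (cases "x \<in> A")
  case False
  then have pos: "0 < infdist x A" using assms by (simp add: infdist_pos_not_in_closed)
  obtain N where N: "1 / infdist x A < real N" using reals_Archimedean2 by blast
  have "\<forall>\<^sub>F n in sequentially. max 0 (1 - real n * infdist x A) = 0"
    using eventually_ge_at_top[of N]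
  proof eventually_elim
    case (elim n)
    then have "1 / infdist x A < real n" using N by linarith
    then have "1 < real n * infdist x A" using pos by (simp add: pos_divide_less_eq)
    then show ?case by simp
  qed
  then show ?thesis using False by (simp add: tendsto_eventually)
qed simp

lemma emeasure_eqI_closed:
  assumes "finite_measure M1" "sets M1 = sets borel" "sets M2 = sets (borel :: 'a::topological_space measure)"
    and eq: "\<And>A. closed A \<Longrightarrow> A \<noteq> {} \<Longrightarrow> emeasure M1 A = emeasure M2 A"
  shows "M1 = M2"
proof (rule measure_eqI_generator_eq[where E="Collect closed" and A="\<lambda>_. UNIV" and \<Omega>=UNIV])
  interpret M1: finite_measure M1 by fact
  show "Int_stable (Collect closed)" by (auto simp: Int_stable_def)
  show "emeasure M1 X = emeasure M2 X" if "X \<in> Collect closed" for X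
    using that eq[of X] by (cases "X = {}") auto
  show "sets M1 = sigma_sets UNIV (Collect closed)" "sets M2 = sigma_sets UNIV (Collect closed)"
    using assms(2,3) by (simp_all add: borel_eq_closed)
qed (use finite_measure.emeasure_finite[OF assms(1)] in auto)

text \<open>The sigma-algebra generated by \<open>T\<close> consists of the preimages of Borel sets,
  so the defining property of conditional expectation reduces to integrals over
  \<open>T \<in> B\<close>.\<close>

lemma regular_cond_distrI:
  fixes T :: "'w \<Rightarrow> 't::topological_space" and Y :: "'w \<Rightarrow> 'y::topological_space"
  assumes "prob_space M" and [measurable]: "T \<in> borel_measurable M" "Y \<in> borel_measurable M"
    and K: "K \<in> borel \<rightarrow>\<^sub>M prob_algebra borel"
    and eq: "\<And>B C. B \<in> sets borel \<Longrightarrow> C \<in> sets borel \<Longrightarrow>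
      (\<integral>\<^sup>+\<omega>. indicator C (Y \<omega>) * indicator B (T \<omega>) \<partial>M) =
      (\<integral>\<^sup>+\<omega>. emeasure (K (T \<omega>)) C * indicator B (T \<omega>) \<partial>M)"
  shows "regular_cond_distr M T Y K"
  unfolding regular_cond_distr_def
proof (intro conjI ballI K)
  interpret prob_space M by fact
  fix C :: "'y set" assume C[measurable]: "C \<in> sets borel"
  let ?F = "vimage_algebra (space M) T borel"
  interpret sub: finite_measure_subalgebra M ?F
  proof unfold_locales
    show "subalgebra M ?F"
      unfolding subalgebra_def using assms(2)
      by (auto simp: sets_vimage_algebra2 intro: measurable_sets)
  qed
  have KC[measurable]: "(\<lambda>t. emeasure (K t) C) \<in> borel_measurable borel"
    using measurable_emeasure_kernel[OF measurable_prob_algebraD[OF K] C] .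
  have T: "T \<in> ?F \<rightarrow>\<^sub>M borel" by (rule measurable_vimage_algebra1) auto
  have "AE \<omega> in M. emeasure (K (T \<omega>)) C = nn_cond_exp M ?F (indicator (Y -` C \<inter> space M)) \<omega>"
  proof (rule sub.nn_cond_exp_charact)
    fix A assume "A \<in> sets ?F"
    then obtain B where B: "B \<in> sets borel" "A = T -` B \<inter> space M"
      by (auto simp: sets_vimage_algebra2)
    have "(\<integral>\<^sup>+\<omega>\<in>A. indicator (Y -` C \<inter> space M) \<omega> \<partial>M) = (\<integral>\<^sup>+\<omega>. indicator C (Y \<omega>) * indicator B (T \<omega>) \<partial>M)"
      unfolding B by (intro nn_integral_cong) (auto split: split_indicator)
    also have "\<dots> = (\<integral>\<^sup>+\<omega>. emeasure (K (T \<omega>)) C * indicator B (T \<omega>) \<partial>M)"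
      by (rule eq[OF B(1) C])
    also have "\<dots> = (\<integral>\<^sup>+\<omega>\<in>A. emeasure (K (T \<omega>)) C \<partial>M)"
      unfolding B by (intro nn_integral_cong) (auto split: split_indicator)
    finally show "(\<integral>\<^sup>+\<omega>\<in>A. indicator (Y -` C \<inter> space M) \<omega> \<partial>M) = (\<integral>\<^sup>+\<omega>\<in>A. emeasure (K (T \<omega>)) C \<partial>M)" .
  next
    show "indicator (Y -` C \<inter> space M) \<in> borel_measurable M"
      by (intro borel_measurable_indicator measurable_sets[OF _ C]) simp
    show "(\<lambda>\<omega>. emeasure (K (T \<omega>)) C) \<in> borel_measurable ?F"
      by (rule measurable_compose[OF T KC])
  qed
  then show "AE \<omega> in M. nn_cond_exp M ?F (indicator (Y -` C \<inter> space M)) \<omega> = emeasure (K (T \<omega>)) C"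
    by eventually_elim simp
qed (use assms in auto)

section \<open>The bridge law as a kernel in time and level\<close>

context density_subordinator
begin

interpretation MM: pair_prob_space M M ..
interpretation XL: pair_sigma_finite M lborel ..

text \<open>A kernel needs a probability measure at every \<open>(t, y)\<close>, so a point mass
  fills in where the density vanishes. Choosing by \<open>SOME\<close> does not endanger
  measurability, as integrals of test functions are limits of \<open>bridge\<close>.\<close>

definition bridge_law :: "real \<Rightarrow> real \<Rightarrow> (real^'d) measure" where
  "bridge_law t y = (if 0 < t \<and> 0 < gg t y
     then SOME K. prob_space K \<and> sets K = sets borel \<and>
       (\<forall>L f. test_function L f \<longrightarrow> (\<lambda>i. bridge f (dyadic_time t i) t y) \<longlonglongrightarrow> gg t y * (\<integral>x. f x \<partial>K))
     else return borel 0)"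

lemma bridge_law:
  shows prob_space_bridge_law: "prob_space (bridge_law t y)"
    and sets_bridge_law [simp, measurable_cong]: "sets (bridge_law t y) = sets borel"
    and bridge_law_tendsto: "0 < t \<Longrightarrow> 0 < gg t y \<Longrightarrow> test_function L f \<Longrightarrow>
      (\<lambda>i. bridge f (dyadic_time t i) t y) \<longlonglongrightarrow> gg t y * (\<integral>x. f x \<partial>bridge_law t y)"
proof -
  have *: "prob_space (bridge_law t y) \<and> sets (bridge_law t y) = sets borel \<and>
       (\<forall>L f. test_function L f \<longrightarrow> (\<lambda>i. bridge f (dyadic_time t i) t y) \<longlonglongrightarrow> gg t y * (\<integral>x. f x \<partial>bridge_law t y))"
    if "0 < t \<and> 0 < gg t y"
    using someI_ex[OF bridge_law_exists[of t y]] that unfolding bridge_law_def by auto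
  have **: "bridge_law t y = return borel 0" if "\<not> (0 < t \<and> 0 < gg t y)"
    unfolding bridge_law_def by (rule if_not_P[OF that])
  show "prob_space (bridge_law t y)" "sets (bridge_law t y) = sets borel"
    using * ** by (cases "0 < t \<and> 0 < gg t y"; simp add: prob_space_return)+
  show "0 < t \<Longrightarrow> 0 < gg t y \<Longrightarrow> test_function L f \<Longrightarrow>
      (\<lambda>i. bridge f (dyadic_time t i) t y) \<longlonglongrightarrow> gg t y * (\<integral>x. f x \<partial>bridge_law t y)"
    using * by blast
qed

text \<open>The density in \<open>y\<close> of the law of \<open>S t\<close> weighted by
  \<open>f (X t)\<close>. This product is continuous on the open quadrant, zeros of
  \<open>gg t y\<close> included.\<close>

definition slice :: "(real^'d \<Rightarrow> real) \<Rightarrow> real \<Rightarrow> real \<Rightarrow> real" where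
  "slice f t y = gg t y * (\<integral>x. f x \<partial>bridge_law t y)"

lemma integrable_bridge_law:
  assumes f: "test_function L f" shows "integrable (bridge_law t y) f"
proof -
  interpret K: prob_space "bridge_law t y" by (rule prob_space_bridge_law)
  show ?thesis
    using test_functionD[OF f] test_function_measurable[OF f]
    by (intro K.integrable_const_bound[where B=1]) (auto simp: measurable_cong_sets[OF sets_bridge_law refl])
qed

lemma integral_bridge_law_bounds:
  assumes f: "test_function L f"
  shows "0 \<le> (\<integral>x. f x \<partial>bridge_law t y)" "(\<integral>x. f x \<partial>bridge_law t y) \<le> 1"
proof -
  interpret K: prob_space "bridge_law t y" by (rule prob_space_bridge_law)
  show "0 \<le> (\<integral>x. f x \<partial>bridge_law t y)"
    using test_functionD[OF f] by (intro integral_nonneg_AE) auto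
  have "(\<integral>x. f x \<partial>bridge_law t y) \<le> (\<integral>x. 1 \<partial>bridge_law t y)"
    using test_functionD[OF f] by (intro integral_mono integrable_bridge_law[OF f]) auto
  then show "(\<integral>x. f x \<partial>bridge_law t y) \<le> 1" by (simp add: K.prob_space)
qed

lemma slice_bounds:
  assumes f: "test_function L f"
  shows "0 \<le> slice f t y" "slice f t y \<le> gg t y"
  unfolding slice_def using integral_bridge_law_bounds[OF f, of t y]
  by (auto intro: mult_right_le_one_le)

lemma slice_tendsto:
  assumes t: "0 < t" and f: "test_function L f"
  shows "(\<lambda>i. bridge f (dyadic_time t i) t y) \<longlonglongrightarrow> slice f t y"
proof (cases "0 < gg t y")
  case True
  then show ?thesis unfolding slice_def by (intro bridge_law_tendsto[OF t _ f])
next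
  case False
  then have 0: "gg t y = 0" using gg_nonneg[of t y] by linarith
  have "bridge f (dyadic_time t i) t y = 0" for i
    using bridge_bounds[OF _ _ f, of "dyadic_time t i" t y] dyadic_time(1,2)[OF t, of i] 0 by simp
  then show ?thesis by (simp add: slice_def 0)
qed

text \<open>\<open>bridge_cauchy\<close> with the later time sent to \<open>t\<close> along the
  dyadic times. The approximation is uniform for \<open>(t, y)\<close> in regions where
  \<open>y * gg t y\<close> is bounded.\<close>

lemma slice_approx:
  assumes f: "test_function L f" and y: "0 < y" and s: "0 \<le> s" "s < t" and m: "0 < m" "real m * (t - s) < t"
  shows "\<bar>slice f t y - bridge f s t y\<bar> \<le> L * (y * gg t y) / real m"
proof (rule tendsto_upperbound)
  have t: "0 < t" using s by simp
  show "(\<lambda>i. \<bar>bridge f (dyadic_time t i) t y - bridge f s t y\<bar>) \<longlonglongrightarrow> \<bar>slice f t y - bridge f s t y\<bar>"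
    by (intro tendsto_intros slice_tendsto[OF t f])
  have "\<forall>\<^sub>F i in sequentially. s < dyadic_time t i"
    using order_tendstoD(1)[OF dyadic_time(4)[OF t] s(2)] .
  then show "\<forall>\<^sub>F i in sequentially. \<bar>bridge f (dyadic_time t i) t y - bridge f s t y\<bar> \<le> L * (y * gg t y) / real m"
  proof eventually_elim
    case (elim i)
    have "real m * (dyadic_time t i - s) \<le> real m * (t - s)"
      using dyadic_time(2)[OF t, of i] by (intro mult_left_mono) auto
    then have "real m * (dyadic_time t i - s) < t" using m(2) by (rule order_le_less_trans)
    then show ?case
      by (rule bridge_cauchy[OF s(1) elim dyadic_time(2)[OF t] m(1) _ f y])
  qed
qed simp

text \<open>A three-epsilon argument: near \<open>(t, y)\<close> the function \<open>slice\<close>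
  is uniformly close to \<open>bridge\<close> with a fixed lag \<open>h\<close>, and the latter is
  continuous.\<close>

lemma slice_continuous:
  assumes t: "0 < t" and y: "0 < y" and ts: "ts \<longlonglongrightarrow> t" and ys: "ys \<longlonglongrightarrow> y" and f: "test_function L f"
  shows "(\<lambda>n. slice f (ts n) (ys n)) \<longlonglongrightarrow> slice f t y"
proof (rule LIMSEQ_I)
  fix e :: real assume e: "0 < e"
  \<comment> \<open>\<open>B\<close> exceeds \<open>y * gg t y\<close> throughout a neighbourhood of
    \<open>(t, y)\<close>, so that one \<open>m\<close> brings the bound of
    \<open>slice_approx\<close> down to \<open>e / 4\<close> there.\<close>
  define B where "B = y * gg t y + 1"
  have L: "0 \<le> L" by (rule test_functionD(1)[OF f])
  have B: "0 < B" using y by (simp add: B_def add_nonneg_pos)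
  obtain m where m: "4 * (L * B) / e < real m" using reals_Archimedean2 by blast
  have "0 \<le> 4 * (L * B) / e" using L B e by simp
  then have m0: "0 < m" using m by (metis of_nat_0_less_iff order_le_less_trans)
  have LB: "L * B / real m \<le> e / 4"
    using m m0 e by (simp add: field_simps)
  \<comment> \<open>Small enough that \<open>m\<close> lags take less than \<open>t / 2\<close>,
    hence fit before every \<open>ts n > t / 2\<close>.\<close>
  define h where "h = t / (2 * real m + 2)"
  have h: "0 < h" "h < t" using t by (auto simp: h_def pos_divide_less_eq algebra_simps add_strict_increasing)
  have mh: "real m * h < t / 2"
    using t by (simp add: h_def field_simps)
  \<comment> \<open>\<open>max h\<close> alters only finitely many terms and keeps the start time
    nonnegative.\<close>
  let ?A = "\<lambda>n. bridge f (max h (ts n) - h) (max h (ts n)) (ys n)"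
  have "(\<lambda>n. max h (ts n)) \<longlonglongrightarrow> max h t" by (intro tendsto_intros ts)
  then have mt: "(\<lambda>n. max h (ts n)) \<longlonglongrightarrow> t" using h by (simp add: max_def)
  have "?A \<longlonglongrightarrow> bridge f (t - h) t y"
    by (rule bridge_continuous[OF h y mt _ ys f]) simp
  then have "\<forall>\<^sub>F n in sequentially. \<bar>?A n - bridge f (t - h) t y\<bar> < e / 4"
    using e tendstoD[of ?A "bridge f (t - h) t y" sequentially "e / 4"] by (simp add: dist_real_def)
  moreover have "(\<lambda>n. ys n * gg (ts n) (ys n)) \<longlonglongrightarrow> y * gg t y"
    using t y by (intro tendsto_intros tendsto_gg_pos ts ys) auto
  then have "\<forall>\<^sub>F n in sequentially. ys n * gg (ts n) (ys n) < B"
    by (rule order_tendstoD) (simp add: B_def)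
  moreover have "\<forall>\<^sub>F n in sequentially. t / 2 < ts n" using ts t by (intro order_tendstoD) auto
  moreover have "\<forall>\<^sub>F n in sequentially. h < ts n" using ts h by (intro order_tendstoD) auto
  moreover have "\<forall>\<^sub>F n in sequentially. 0 < ys n" using ys y by (intro order_tendstoD) auto
  ultimately have "\<forall>\<^sub>F n in sequentially. norm (slice f (ts n) (ys n) - slice f t y) < e"
  proof eventually_elim
    case (elim n)
    have bd: "L * v / real m \<le> e / 4" if "v < B" for v
      using order_trans[OF divide_right_mono[OF mult_left_mono[of v B L]] LB] that L by simp
    have "\<bar>slice f (ts n) (ys n) - bridge f (ts n - h) (ts n) (ys n)\<bar> \<le> L * (ys n * gg (ts n) (ys n)) / real m"
      using elim h mh m0 by (intro slice_approx[OF f]) auto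
    from order_trans[OF this bd[OF elim(2)]]
    have 1: "\<bar>slice f (ts n) (ys n) - ?A n\<bar> \<le> e / 4"
      by (simp only: max_absorb2[OF less_imp_le[OF elim(4)]])
    have "\<bar>slice f t y - bridge f (t - h) t y\<bar> \<le> L * (y * gg t y) / real m"
      using h mh m0 y t by (intro slice_approx[OF f]) auto
    from order_trans[OF this bd] have "\<bar>slice f t y - bridge f (t - h) t y\<bar> \<le> e / 4"
      by (simp add: B_def)
    with 1 elim(1) e show ?case unfolding real_norm_def by linarith
  qed
  then show "\<exists>no. \<forall>n\<ge>no. norm (slice f (ts n) (ys n) - slice f t y) < e"
    by (simp add: eventually_sequentially)
qed

text \<open>The law comes from an arbitrary choice, so its definition yields no measurability. The
  integral of a test function, however, is a limit of jointly measurable expressions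
  \<open>bridge\<close>, divided by the density.\<close>

lemma measurable_integral_bridge_law:
  assumes f: "test_function L f"
  shows "(\<lambda>p. \<integral>x. f x \<partial>bridge_law (fst p) (snd p)) \<in> borel_measurable (borel \<Otimes>\<^sub>M borel)"
proof -
  have [measurable]: "f \<in> borel_measurable borel" using f by (rule test_function_measurable)
  let ?X = "\<lambda>i p \<omega>. X (max 0 (dyadic_time (fst p) i)) \<omega>"
  let ?c = "\<lambda>p. 0 < fst p \<and> 0 < gg (fst p) (snd p)"
  let ?b = "\<lambda>i p. \<integral>\<omega>. f (?X i p \<omega>) * gg (fst p - dyadic_time (fst p) i) (snd p - l1norm (?X i p \<omega>)) \<partial>M"
  have dm[measurable]: "(\<lambda>t. dyadic_time t i) \<in> borel_measurable borel" for i
    unfolding dyadic_time_def by measurable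
  have [measurable]: "?b i \<in> borel_measurable (borel \<Otimes>\<^sub>M borel)" for i
    by measurable
  have "(\<lambda>p. if ?c p then \<integral>x. f x \<partial>bridge_law (fst p) (snd p) else f 0) \<in> borel_measurable (borel \<Otimes>\<^sub>M borel)"
  proof (rule borel_measurable_LIMSEQ_real)
    fix i
    show "(\<lambda>p. if ?c p then ?b i p / gg (fst p) (snd p) else f 0) \<in> borel_measurable (borel \<Otimes>\<^sub>M borel)"
      by measurable
  next
    fix p :: "real \<times> real"
    show "(\<lambda>i. if ?c p then ?b i p / gg (fst p) (snd p) else f 0) \<longlonglongrightarrow>
      (if ?c p then \<integral>x. f x \<partial>bridge_law (fst p) (snd p) else f 0)"
    proof (cases "?c p")
      case True
      then have "?b i p = bridge f (dyadic_time (fst p) i) (fst p) (snd p)" for i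
        using dyadic_time(1)[of "fst p" i] by (simp add: bridge_def norm_process_def max_def)
      moreover have "(\<lambda>i. bridge f (dyadic_time (fst p) i) (fst p) (snd p) / gg (fst p) (snd p)) \<longlonglongrightarrow>
        slice f (fst p) (snd p) / gg (fst p) (snd p)"
        using True by (intro tendsto_divide tendsto_const slice_tendsto[OF _ f]) auto
      ultimately show ?thesis using True by (simp add: slice_def)
    next
      case False
      show ?thesis unfolding if_not_P[OF False] by (rule tendsto_const)
    qed
  qed
  moreover have "(if ?c p then \<integral>x. f x \<partial>bridge_law (fst p) (snd p) else f 0) = (\<integral>x. f x \<partial>bridge_law (fst p) (snd p))" for p
    by (auto simp: bridge_law_def integral_return)
  ultimately show ?thesis by simp
qed

lemma pair_t: "Pair (t::real) \<in> (borel :: real measure) \<rightarrow>\<^sub>M borel \<Otimes>\<^sub>M borel"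
  by (rule measurable_Pair1') simp

lemma measurable_integral_bridge_law':
  assumes f: "test_function L f"
  shows "(\<lambda>y. \<integral>x. f x \<partial>bridge_law t y) \<in> borel_measurable borel"
  using measurable_compose[OF pair_t measurable_integral_bridge_law[OF f]] by simp

lemma measure_bridge_law_tendsto:
  assumes A: "closed A" "A \<noteq> {}"
  shows "(\<lambda>n. \<integral>x. max 0 (1 - real n * infdist x A) \<partial>bridge_law t y) \<longlonglongrightarrow> measure (bridge_law t y) A"
proof -
  interpret K: prob_space "bridge_law t y" by (rule prob_space_bridge_law)
  have "(\<lambda>n. \<integral>x. max 0 (1 - real n * infdist x A) \<partial>bridge_law t y) \<longlonglongrightarrow> (\<integral>x. indicator A x \<partial>bridge_law t y)"
  proof (rule integral_dominated_convergence[where w="\<lambda>_. 1"])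
    show "AE x in bridge_law t y. (\<lambda>n. max 0 (1 - real n * infdist x A)) \<longlonglongrightarrow> indicator A x"
      by (intro AE_I2 infdist_approx_tendsto A)
    show "AE x in bridge_law t y. norm (max 0 (1 - real n * infdist x A)) \<le> 1" for n
      using test_functionD(2,3)[OF test_function_infdist[of "real n" A]] by (intro AE_I2) simp
    show "(\<lambda>x. max 0 (1 - real n * infdist x A)) \<in> borel_measurable (bridge_law t y)" for n
      using borel_measurable_integrable[OF integrable_bridge_law[OF test_function_infdist]] by simp
    show "indicator A \<in> borel_measurable (bridge_law t y)"
      using A by (intro borel_measurable_indicator) (simp add: borel_closed)
  qed simp
  then show ?thesis
    using A by (simp add: borel_closed sets_eq_imp_space_eq[OF sets_bridge_law])
qed

lemma measurable_bridge_law: "(\<lambda>(t, y). bridge_law t y) \<in> borel \<Otimes>\<^sub>M borel \<rightarrow>\<^sub>M prob_algebra borel"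
proof (rule measurable_prob_algebra_generated[where G="Collect closed" and \<Omega>=UNIV])
  show "sets (borel :: (real^'d) measure) = sigma_sets UNIV (Collect closed)"
    by (subst borel_eq_closed) simp
  show "Int_stable (Collect closed :: (real^'d) set set)" by (auto simp: Int_stable_def)
  fix A :: "(real^'d) set" assume "A \<in> Collect closed"
  then have A: "closed A" by simp
  show "(\<lambda>p. emeasure (case p of (t, y) \<Rightarrow> bridge_law t y) A) \<in> borel_measurable (borel \<Otimes>\<^sub>M borel)"
  proof (cases "A = {}")
    case False
    have "(\<lambda>p. measure (bridge_law (fst p) (snd p)) A) \<in> borel_measurable (borel \<Otimes>\<^sub>M borel)"
      by (rule borel_measurable_LIMSEQ_real[OF measure_bridge_law_tendsto[OF A False]])
         (rule measurable_integral_bridge_law[OF test_function_infdist[OF of_nat_0_le_iff]])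
    then have "(\<lambda>p. ennreal (measure (bridge_law (fst p) (snd p)) A)) \<in> borel_measurable (borel \<Otimes>\<^sub>M borel)"
      by measurable
    also have "(\<lambda>p. ennreal (measure (bridge_law (fst p) (snd p)) A)) = (\<lambda>p. emeasure (case p of (t, y) \<Rightarrow> bridge_law t y) A)"
    proof
      fix p :: "real \<times> real"
      interpret K: prob_space "bridge_law (fst p) (snd p)" by (rule prob_space_bridge_law)
      show "ennreal (measure (bridge_law (fst p) (snd p)) A) = emeasure (case p of (t, y) \<Rightarrow> bridge_law t y) A"
        by (simp add: K.emeasure_eq_measure split_beta)
    qed
    finally show ?thesis .
  qed simp
qed (auto intro: prob_space_bridge_law)

text \<open>Integrating the weight over levels in \<open>B\<close> gives the probability that
  \<open>S s\<close> plus an independent increment of duration \<open>t - s\<close> falls into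
  \<open>B\<close>.\<close>

lemma bridge_density:
  assumes s: "0 \<le> s" "s < t" and f: "test_function L f" and B[measurable]: "B \<in> sets borel"
  shows "(\<integral>\<^sup>+y. ennreal (bridge f s t y) * indicator B y \<partial>lborel) =
    (\<integral>\<^sup>+\<omega>. ennreal (f (X s \<omega>)) * indicator B (S t \<omega>) \<partial>M)"
proof -
  have [measurable]: "f \<in> borel_measurable borel" using f by (rule test_function_measurable)
  have [measurable]: "S s \<in> borel_measurable M" "X s \<in> borel_measurable M" "S (t - s) \<in> borel_measurable M"
    using s by (auto intro!: measurable_S measurable_X)
  have "(\<integral>\<^sup>+y. ennreal (bridge f s t y) * indicator B y \<partial>lborel) =
    (\<integral>\<^sup>+y. \<integral>\<^sup>+\<omega>. ennreal (f (X s \<omega>)) * ennreal (gg (t - s) (y - S s \<omega>)) * indicator B y \<partial>M \<partial>lborel)"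
    unfolding ennreal_bridge[OF s f] by (intro nn_integral_cong nn_integral_multc[symmetric]) measurable
  also have "\<dots> = (\<integral>\<^sup>+\<omega>. \<integral>\<^sup>+y. ennreal (f (X s \<omega>)) * ennreal (gg (t - s) (y - S s \<omega>)) * indicator B y \<partial>lborel \<partial>M)"
    by (rule XL.Fubini') measurable
  also have "\<dots> = (\<integral>\<^sup>+\<omega>. \<integral>\<^sup>+\<omega>'. ennreal (f (X s \<omega>)) * indicator B (l1norm (X s \<omega> + X (t - s) \<omega>')) \<partial>M \<partial>M)"
  proof (rule nn_integral_cong)
    fix \<omega> assume w: "\<omega> \<in> space M"
    have "(\<integral>\<^sup>+y. ennreal (f (X s \<omega>)) * ennreal (gg (t - s) (y - S s \<omega>)) * indicator B y \<partial>lborel) =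
      (\<integral>\<^sup>+x. ennreal (f (X s \<omega>)) * ennreal (gg (t - s) x) * indicator B (S s \<omega> + x) \<partial>lborel)"
      by (subst nn_integral_real_affine[where c=1 and t="S s \<omega>"]) auto
    also have "\<dots> = (\<integral>\<^sup>+x. ennreal (gg (t - s) x) * (ennreal (f (X s \<omega>)) * indicator B (S s \<omega> + x)) \<partial>lborel)"
      by (rule nn_integral_cong) (simp only: ac_simps)
    also have "\<dots> = (\<integral>\<^sup>+\<omega>'. ennreal (f (X s \<omega>)) * indicator B (S s \<omega> + S (t - s) \<omega>') \<partial>M)"
      using s by (intro nn_integral_S[symmetric]) auto
    also have "\<dots> = (\<integral>\<^sup>+\<omega>'. ennreal (f (X s \<omega>)) * indicator B (l1norm (X s \<omega> + X (t - s) \<omega>')) \<partial>M)"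
      using s w by (intro nn_integral_cong) (simp add: S_add)
    finally show "(\<integral>\<^sup>+y. ennreal (f (X s \<omega>)) * ennreal (gg (t - s) (y - S s \<omega>)) * indicator B y \<partial>lborel) =
      (\<integral>\<^sup>+\<omega>'. ennreal (f (X s \<omega>)) * indicator B (l1norm (X s \<omega> + X (t - s) \<omega>')) \<partial>M)" .
  qed
  also have "\<dots> = (\<integral>\<^sup>+\<omega>. ennreal (f (X s \<omega>)) * indicator B (S t \<omega>) \<partial>M)"
    using nn_integral_increment[of s t "\<lambda>p. ennreal (f (fst p)) * indicator B (l1norm (fst p + snd p))"] s
    by (simp add: norm_process_def)
  finally show ?thesis .
qed

lemma measurable_slice [measurable]:
  assumes f: "test_function L f" shows "slice f t \<in> borel_measurable borel"
  using measurable_integral_bridge_law'[OF f, of t, measurable] unfolding slice_def by measurable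

text \<open>The limit of \<open>bridge_density\<close> as \<open>s\<close> increases to
  \<open>t\<close>. One side is dominated by \<open>gg t\<close>; the other converges because the
  path is almost surely continuous at the fixed time \<open>t\<close>.\<close>

lemma slice_density:
  assumes t: "0 < t" and f: "test_function L f" and B[measurable]: "B \<in> sets borel"
  shows "(\<integral>\<^sup>+\<omega>. ennreal (f (X t \<omega>)) * indicator B (S t \<omega>) \<partial>M) = (\<integral>\<^sup>+y. ennreal (slice f t y) * indicator B y \<partial>lborel)"
proof -
  have [measurable]: "f \<in> borel_measurable borel" using f by (rule test_function_measurable)
  let ?s = "dyadic_time t"
  have s: "0 \<le> ?s i" "?s i < t" for i using dyadic_time(1,2)[OF t, of i] by auto
  have [measurable]: "S t \<in> borel_measurable M" "X t \<in> borel_measurable M" "X (?s i) \<in> borel_measurable M" for i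
    using s[of i] t by (auto intro!: measurable_S measurable_X)
  have bm[measurable]: "bridge f (?s i) t \<in> borel_measurable borel" for i
  proof -
    have [measurable]: "S (?s i) \<in> borel_measurable M" using s[of i] by (intro measurable_S) simp
    show ?thesis unfolding bridge_def[abs_def] by measurable
  qed
  have [measurable]: "slice f t \<in> borel_measurable borel" by (rule measurable_slice[OF f])
  have "(\<lambda>i. \<integral>\<^sup>+y. ennreal (bridge f (?s i) t y) * indicator B y \<partial>lborel) \<longlonglongrightarrow>
    (\<integral>\<^sup>+y. ennreal (slice f t y) * indicator B y \<partial>lborel)"
  proof (rule nn_integral_dominated_convergence[where w="\<lambda>y. ennreal (gg t y)"])
    show "AE y in lborel. ennreal (bridge f (?s i) t y) * indicator B y \<le> ennreal (gg t y)" for i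
      using bridge_bounds(2)[OF s f, of i] by (intro AE_I2) (auto intro!: ennreal_leI split: split_indicator)
    show "(\<integral>\<^sup>+y. ennreal (gg t y) \<partial>lborel) < \<infinity>" by (simp add: nn_integral_gg[OF t])
    show "AE y in lborel. (\<lambda>i. ennreal (bridge f (?s i) t y) * indicator B y) \<longlonglongrightarrow> ennreal (slice f t y) * indicator B y"
      by (intro AE_I2) (auto intro!: tendsto_ennrealI slice_tendsto[OF t f] split: split_indicator)
  qed measurable
  moreover have "(\<lambda>i. \<integral>\<^sup>+\<omega>. ennreal (f (X (?s i) \<omega>)) * indicator B (S t \<omega>) \<partial>M) \<longlonglongrightarrow>
    (\<integral>\<^sup>+\<omega>. ennreal (f (X t \<omega>)) * indicator B (S t \<omega>) \<partial>M)"
  proof (rule nn_integral_dominated_convergence[where w="\<lambda>_. 1"])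
    show "AE \<omega> in M. ennreal (f (X (?s i) \<omega>)) * indicator B (S t \<omega>) \<le> 1" for i
      using test_functionD(3)[OF f] by (intro AE_I2) (auto split: split_indicator)
    show "(\<integral>\<^sup>+\<omega>. 1 \<partial>M) < \<infinity>" by (simp add: emeasure_space_1)
    show "AE \<omega> in M. (\<lambda>i. ennreal (f (X (?s i) \<omega>)) * indicator B (S t \<omega>)) \<longlonglongrightarrow> ennreal (f (X t \<omega>)) * indicator B (S t \<omega>)"
      using AE_tendsto[OF t dyadic_time(4)[OF t]]
      by eventually_elim (auto intro!: tendsto_ennrealI test_function_tendsto[OF f] split: split_indicator)
  qed measurable
  ultimately show ?thesis
    unfolding bridge_density[OF s f B] by (rule LIMSEQ_unique[rotated])
qed

text \<open>\<open>slice_density\<close> is the defining identity for test functions. Approximating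
  closed sets turns it into the equality of two finite measures: the law of \<open>X t\<close> on
  \<open>S t \<in> B\<close>, and the mixture of the kernel over the same event.\<close>

lemma cond_distr_bridge_law: "cond_distr_given_norm M X bridge_law"
  unfolding cond_distr_given_norm_def
proof (intro conjI allI impI measurable_bridge_law)
  fix t :: real assume t: "0 < t"
  have [measurable]: "S t \<in> borel_measurable M" "X t \<in> borel_measurable M"
    using t by (auto intro!: measurable_S measurable_X)
  have Kt: "bridge_law t \<in> borel \<rightarrow>\<^sub>M prob_algebra borel"
    using measurable_compose[OF pair_t measurable_bridge_law] by simp
  show "regular_cond_distr M (S t) (X t) (bridge_law t)"
  proof (rule regular_cond_distrI[OF prob_space_axioms _ _ Kt])
    fix B C assume B[measurable]: "B \<in> sets (borel::real measure)" and C[measurable]: "C \<in> sets (borel :: (real^'d) measure)"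
    let ?D = "density M (\<lambda>\<omega>. indicator B (S t \<omega>))"
    let ?M1 = "distr ?D borel (X t)"
    let ?M2 = "?D \<bind> (\<lambda>\<omega>. bridge_law t (S t \<omega>))"
    have KS: "(\<lambda>\<omega>. bridge_law t (S t \<omega>)) \<in> ?D \<rightarrow>\<^sub>M subprob_algebra borel"
      using measurable_compose[of "S t" ?D borel, OF _ measurable_prob_algebraD[OF Kt]] by simp
    have sp: "space ?D \<noteq> {}" using not_empty by simp
    have em1: "emeasure ?M1 A = (\<integral>\<^sup>+\<omega>. indicator A (X t \<omega>) * indicator B (S t \<omega>) \<partial>M)" if [measurable]: "A \<in> sets borel" for A
    proof -
      have "emeasure ?M1 A = (\<integral>\<^sup>+\<omega>. indicator B (S t \<omega>) * indicator (X t -` A \<inter> space M) \<omega> \<partial>M)"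
        by (subst emeasure_distr) (auto intro!: emeasure_density)
      also have "\<dots> = (\<integral>\<^sup>+\<omega>. indicator A (X t \<omega>) * indicator B (S t \<omega>) \<partial>M)"
        by (intro nn_integral_cong) (auto split: split_indicator)
      finally show ?thesis .
    qed
    have KA: "(\<lambda>\<omega>. emeasure (bridge_law t (S t \<omega>)) A) \<in> borel_measurable M" if "A \<in> sets borel" for A
      using measurable_emeasure_kernel[OF KS that] by simp
    have em2: "emeasure ?M2 A = (\<integral>\<^sup>+\<omega>. emeasure (bridge_law t (S t \<omega>)) A * indicator B (S t \<omega>) \<partial>M)" if "A \<in> sets borel" for A
      unfolding emeasure_bind[OF sp KS that]
      by (subst nn_integral_density) (auto simp: KA[OF that] mult.commute)
    have "?M1 = ?M2"
    proof (rule emeasure_eqI_closed)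
      show "finite_measure ?M1"
      proof (rule finite_measureI)
        have "emeasure ?M1 (space ?M1) = (\<integral>\<^sup>+\<omega>. indicator UNIV (X t \<omega>) * indicator B (S t \<omega>) \<partial>M)"
          using em1[of UNIV] by simp
        also have "\<dots> \<le> (\<integral>\<^sup>+\<omega>. 1 \<partial>M)"
          by (intro nn_integral_mono) (auto split: split_indicator)
        finally show "emeasure ?M1 (space ?M1) \<noteq> \<infinity>" by (auto simp: emeasure_space_1 top_unique)
      qed
      show "sets ?M2 = sets borel" by (rule sets_bind[OF _ sp]) (use KS in \<open>auto dest: subprob_measurableD(2)\<close>)
      fix A :: "(real^'d) set" assume A: "closed A" "A \<noteq> {}"
      then have Ab[measurable]: "A \<in> sets borel" by (simp add: borel_closed)
      let ?f = "\<lambda>n x. max 0 (1 - real n * infdist x A)"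
      have f: "test_function (real n) (?f n)" for n by (rule test_function_infdist) simp
      have fm[measurable]: "?f n \<in> borel_measurable borel" for n by (rule test_function_measurable[OF f])
      have Im[measurable]: "(\<lambda>y. \<integral>x. ?f n x \<partial>bridge_law t y) \<in> borel_measurable borel" for n
        by (rule measurable_integral_bridge_law'[OF f])
      have "(\<integral>\<^sup>+\<omega>. ennreal (?f n (X t \<omega>)) * indicator B (S t \<omega>) \<partial>M) =
        (\<integral>\<^sup>+\<omega>. ennreal (\<integral>x. ?f n x \<partial>bridge_law t (S t \<omega>)) * indicator B (S t \<omega>) \<partial>M)" for n
      proof -
        have "(\<integral>\<^sup>+\<omega>. ennreal (?f n (X t \<omega>)) * indicator B (S t \<omega>) \<partial>M) = (\<integral>\<^sup>+y. ennreal (slice (?f n) t y) * indicator B y \<partial>lborel)"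
          by (rule slice_density[OF t f B])
        also have "\<dots> = (\<integral>\<^sup>+y. ennreal (gg t y) * (ennreal (\<integral>x. ?f n x \<partial>bridge_law t y) * indicator B y) \<partial>lborel)"
          by (intro nn_integral_cong) (simp only: slice_def ennreal_mult[OF gg_nonneg integral_bridge_law_bounds(1)[OF f]] mult.assoc)
        also have "\<dots> = (\<integral>\<^sup>+\<omega>. ennreal (\<integral>x. ?f n x \<partial>bridge_law t (S t \<omega>)) * indicator B (S t \<omega>) \<partial>M)"
          by (rule nn_integral_S[OF t, symmetric]) measurable
        finally show ?thesis .
      qed
      moreover have "(\<lambda>n. \<integral>\<^sup>+\<omega>. ennreal (?f n (X t \<omega>)) * indicator B (S t \<omega>) \<partial>M) \<longlonglongrightarrow>
        (\<integral>\<^sup>+\<omega>. ennreal (indicator A (X t \<omega>)) * indicator B (S t \<omega>) \<partial>M)"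
      proof (rule nn_integral_dominated_convergence[where w="\<lambda>_. 1"])
        show "AE \<omega> in M. ennreal (?f n (X t \<omega>)) * indicator B (S t \<omega>) \<le> 1" for n
          using test_functionD(3)[OF f[of n]] by (intro AE_I2) (auto split: split_indicator)
        show "(\<integral>\<^sup>+\<omega>. 1 \<partial>M) < \<infinity>" by (simp add: emeasure_space_1)
        show "AE \<omega> in M. (\<lambda>n. ennreal (?f n (X t \<omega>)) * indicator B (S t \<omega>)) \<longlonglongrightarrow> ennreal (indicator A (X t \<omega>)) * indicator B (S t \<omega>)"
        proof (intro AE_I2)
          fix \<omega>
          have "(\<lambda>n. ennreal (?f n (X t \<omega>))) \<longlonglongrightarrow> ennreal (indicator A (X t \<omega>))"
            by (intro tendsto_ennrealI infdist_approx_tendsto A)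
          then show "(\<lambda>n. ennreal (?f n (X t \<omega>)) * indicator B (S t \<omega>)) \<longlonglongrightarrow> ennreal (indicator A (X t \<omega>)) * indicator B (S t \<omega>)"
            by (auto split: split_indicator)
        qed
      qed measurable
      moreover have "(\<lambda>n. \<integral>\<^sup>+\<omega>. ennreal (\<integral>x. ?f n x \<partial>bridge_law t (S t \<omega>)) * indicator B (S t \<omega>) \<partial>M) \<longlonglongrightarrow>
        (\<integral>\<^sup>+\<omega>. emeasure (bridge_law t (S t \<omega>)) A * indicator B (S t \<omega>) \<partial>M)"
      proof (rule nn_integral_dominated_convergence[where w="\<lambda>_. 1"])
        show "AE \<omega> in M. ennreal (\<integral>x. ?f n x \<partial>bridge_law t (S t \<omega>)) * indicator B (S t \<omega>) \<le> 1" for n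
          using integral_bridge_law_bounds(2)[OF f[of n]] by (intro AE_I2) (auto split: split_indicator)
        show "(\<integral>\<^sup>+\<omega>. 1 \<partial>M) < \<infinity>" by (simp add: emeasure_space_1)
        show "AE \<omega> in M. (\<lambda>n. ennreal (\<integral>x. ?f n x \<partial>bridge_law t (S t \<omega>)) * indicator B (S t \<omega>)) \<longlonglongrightarrow>
          emeasure (bridge_law t (S t \<omega>)) A * indicator B (S t \<omega>)"
        proof (intro AE_I2)
          fix \<omega>
          interpret K: prob_space "bridge_law t (S t \<omega>)" by (rule prob_space_bridge_law)
          have "(\<lambda>n. ennreal (\<integral>x. ?f n x \<partial>bridge_law t (S t \<omega>))) \<longlonglongrightarrow> emeasure (bridge_law t (S t \<omega>)) A"
            unfolding K.emeasure_eq_measure by (intro tendsto_ennrealI measure_bridge_law_tendsto A)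
          then show "(\<lambda>n. ennreal (\<integral>x. ?f n x \<partial>bridge_law t (S t \<omega>)) * indicator B (S t \<omega>)) \<longlonglongrightarrow>
            emeasure (bridge_law t (S t \<omega>)) A * indicator B (S t \<omega>)"
            by (auto split: split_indicator)
        qed
        show "(\<lambda>\<omega>. emeasure (bridge_law t (S t \<omega>)) A * indicator B (S t \<omega>)) \<in> borel_measurable M"
          using KA[OF Ab] by measurable
      qed measurable
      ultimately have "(\<integral>\<^sup>+\<omega>. ennreal (indicator A (X t \<omega>)) * indicator B (S t \<omega>) \<partial>M) =
        (\<integral>\<^sup>+\<omega>. emeasure (bridge_law t (S t \<omega>)) A * indicator B (S t \<omega>) \<partial>M)"
        using LIMSEQ_unique by simp
      then show "emeasure ?M1 A = emeasure ?M2 A"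
        unfolding em1[OF Ab] em2[OF Ab] by (simp add: ennreal_indicator)
    qed simp
    then show "(\<integral>\<^sup>+\<omega>. indicator C (X t \<omega>) * indicator B (S t \<omega>) \<partial>M) =
      (\<integral>\<^sup>+\<omega>. emeasure (bridge_law t (S t \<omega>)) C * indicator B (S t \<omega>) \<partial>M)"
      using em1[OF C] em2[OF C] by simp
  qed simp_all
qed

end

section \<open>Small increments and the jump measure\<close>

lemma abs_continuous_sum_less:
  fixes c :: "real \<Rightarrow> real"
  assumes ac: "\<forall>(n::nat) a b. (\<forall>i<n. a i \<le> b i \<and> {a i..b i} \<subseteq> I) \<and>
        (\<forall>i<n. \<forall>j<n. i \<noteq> j \<longrightarrow> {a i<..<b i} \<inter> {a j<..<b j} = {}) \<and>
        (\<Sum>i<n. b i - a i) < \<delta> \<longrightarrow> (\<Sum>i<n. \<bar>c (b i) - c (a i)\<bar>) < \<epsilon>"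
    and D: "finite D" "\<And>d. d \<in> D \<Longrightarrow> l d \<le> r d \<and> {l d..r d} \<subseteq> I"
    "\<And>d d'. d \<in> D \<Longrightarrow> d' \<in> D \<Longrightarrow> d \<noteq> d' \<Longrightarrow> {l d<..<r d} \<inter> {l d'<..<r d'} = {}"
    "(\<Sum>d\<in>D. r d - l d) < \<delta>"
  shows "(\<Sum>d\<in>D. \<bar>c (r d) - c (l d)\<bar>) < \<epsilon>"
proof -
  obtain h where h: "bij_betw h {..<card D} D"
    using ex_bij_betw_nat_finite[OF D(1)] by (auto simp: atLeast0LessThan)
  have hD: "h i \<in> D" if "i < card D" for i using bij_betwE[OF h] that by auto
  have hne: "h i \<noteq> h j" if "i < card D" "j < card D" "i \<noteq> j" for i j
    using h that by (auto simp: bij_betw_def inj_on_def)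
  have "(\<Sum>i<card D. \<bar>c (r (h i)) - c (l (h i))\<bar>) < \<epsilon>"
  proof (rule ac[rule_format], intro conjI allI impI)
    show "(\<Sum>i<card D. r (h i) - l (h i)) < \<delta>"
      using D(4) sum.reindex_bij_betw[OF h, of "\<lambda>d. r d - l d"] by simp
  qed (use D hD hne in auto)
  then show ?thesis
    using sum.reindex_bij_betw[OF h, of "\<lambda>d. \<bar>c (r d) - c (l d)\<bar>"] by simp
qed

text \<open>The straddle lemma: differentiability at \<open>x\<close> controls the increment over
  every short interval containing \<open>x\<close>, with an error proportional to its length,
  because the errors on the two sides of \<open>x\<close> add up.\<close>

lemma straddle:
  assumes "c differentiable (at (x::real))" "0 < \<eta>"
  shows "\<exists>d>0. \<forall>u v. u \<le> x \<longrightarrow> x \<le> v \<longrightarrow> {u..v} \<subseteq> ball x d \<longrightarrow>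
    \<bar>c v - c u - deriv c x * (v - u)\<bar> \<le> \<eta> * (v - (u::real))"
proof -
  have "(c has_derivative (\<lambda>h. deriv c x * h)) (at x)"
    using assms(1) DERIV_deriv_iff_real_differentiable[of c x] by (simp add: has_field_derivative_def)
  then obtain d where d: "0 < d" "\<And>y. norm (y - x) < d \<Longrightarrow> norm (c y - c x - deriv c x * (y - x)) \<le> \<eta> * norm (y - x)"
    using assms(2) unfolding has_derivative_at_alt by blast
  show ?thesis
  proof (intro exI conjI allI impI)
    fix u v assume uv: "u \<le> x" "x \<le> v" "{u..v} \<subseteq> ball x d"
    have "u \<in> {u..v}" "v \<in> {u..v}" using uv by auto
    then have "u \<in> ball x d" "v \<in> ball x d" using uv(3) by blast+
    then have "\<bar>c v - c x - deriv c x * (v - x)\<bar> \<le> \<eta> * (v - x)" "\<bar>c u - c x - deriv c x * (u - x)\<bar> \<le> \<eta> * (x - u)"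
      using d(2)[of v] d(2)[of u] uv by (auto simp: dist_real_def abs_minus_commute)
    then show "\<bar>c v - c u - deriv c x * (v - u)\<bar> \<le> \<eta> * (v - u)"
      by (simp add: algebra_simps)
  qed (rule d(1))
qed

text \<open>Proved for the gauge integral. Intervals tagged outside \<open>F\<close> are governed by
  the straddle lemma. Those tagged in \<open>F\<close> lie in an open set of measure below \<delta>,
  so absolute continuity bounds their total increment.\<close>

lemma abs_continuous_has_integral:
  assumes ac: "abs_continuous_on {a..b} c" and ab: "a \<le> b"
    and F: "F \<in> sets borel" "emeasure lborel F = 0"
    and diff: "\<And>t. t \<in> {a..b} - F \<Longrightarrow> c differentiable (at t)"
  shows "((\<lambda>t. if t \<in> F then 0 else deriv c t) has_integral (c b - c a)) {a..b}"
proof -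
  let ?f = "\<lambda>t. if t \<in> F then 0 else deriv c t"
  have "\<exists>\<gamma>. gauge \<gamma> \<and> (\<forall>D. D tagged_division_of {a..b} \<and> \<gamma> fine D \<longrightarrow>
      norm ((\<Sum>(x,k)\<in>D. measure lborel k *\<^sub>R ?f x) - (c b - c a)) < e)" if e: "0 < e" for e
  proof -
    \<comment> \<open>The \<open>+ 1\<close> keeps the denominator positive when
      \<open>a = b\<close>.\<close>
    define \<eta> where "\<eta> = e / (2 * (b - a + 1))"
    have \<eta>: "0 < \<eta>" using e ab by (simp add: \<eta>_def)
    have "0 < e / 2" using e by simp
    from mp[OF spec[OF ac[unfolded abs_continuous_on_def]] this] obtain \<delta> where \<delta>: "0 < \<delta>"
      and acd: "\<forall>(n::nat) l r. (\<forall>i<n. l i \<le> r i \<and> {l i..r i} \<subseteq> {a..b}) \<and>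
        (\<forall>i<n. \<forall>j<n. i \<noteq> j \<longrightarrow> {l i<..<r i} \<inter> {l j<..<r j} = {}) \<and>
        (\<Sum>i<n. r i - l i) < \<delta> \<longrightarrow> (\<Sum>i<n. \<bar>c (r i) - c (l i)\<bar>) < e / 2"
      by (elim exE conjE) (rule that)
    obtain U where U: "open U" "F \<subseteq> U" "emeasure lborel (U - F) < ennreal \<delta>"
      using outer_regular_lborel[OF F(1), of \<delta>] \<delta> by auto
    have "emeasure lborel U \<le> emeasure lborel F + emeasure lborel (U - F)"
      using U F(1) by (intro order_trans[OF emeasure_mono emeasure_subadditive]) auto
    then have Ud: "emeasure lborel U < ennreal \<delta>" using U(3) F(2) by simp
    \<comment> \<open>Radii of the gauge: balls inside \<open>U\<close> around points of
      \<open>F\<close>, balls from the straddle lemma around the remaining points of the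
      interval.\<close>
    have "\<exists>d>0. (x \<in> F \<longrightarrow> ball x d \<subseteq> U) \<and> (x \<in> {a..b} - F \<longrightarrow>
       (\<forall>u v. u \<le> x \<longrightarrow> x \<le> v \<longrightarrow> {u..v} \<subseteq> ball x d \<longrightarrow> \<bar>c v - c u - deriv c x * (v - u)\<bar> \<le> \<eta> * (v - u)))" for x
    proof (cases "x \<in> F")
      case True
      then show ?thesis using U open_contains_ball[of U] by auto
    next
      case False
      then show ?thesis using straddle[OF diff \<eta>, of x] by (cases "x \<in> {a..b}") (auto intro: zero_less_one)
    qed
    then obtain d where d: "\<And>x. 0 < d x" "\<And>x. x \<in> F \<Longrightarrow> ball x (d x) \<subseteq> U"
      "\<And>x u v. x \<in> {a..b} - F \<Longrightarrow> u \<le> x \<Longrightarrow> x \<le> v \<Longrightarrow> {u..v} \<subseteq> ball x (d x) \<Longrightarrow> \<bar>c v - c u - deriv c x * (v - u)\<bar> \<le> \<eta> * (v - u)"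
      by metis
    show ?thesis
    proof (intro exI conjI allI impI)
      show "gauge (\<lambda>x. ball x (d x))" using d(1) by (intro gauge_ball_dependent) auto
      fix D assume D: "D tagged_division_of {a..b} \<and> (\<lambda>x. ball x (d x)) fine D"
      then have tag: "D tagged_division_of {a..b}" and fine: "(\<lambda>x. ball x (d x)) fine D" by auto
      have fin: "finite D" using tag by auto
      have k: "Inf k \<le> x \<and> x \<le> Sup k \<and> k = {Inf k..Sup k} \<and> k \<subseteq> {a..b} \<and> k \<subseteq> ball x (d x)
          \<and> measure lborel k = Sup k - Inf k \<and> x \<in> {a..b}" if "(x, k) \<in> D" for x k
      proof -
        from tagged_division_ofD(4)[OF tag that] obtain u v where uv: "k = {u..v}" by auto
        have x: "x \<in> k" using tagged_division_ofD(2)[OF tag that] .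
        then have "u \<le> v" using uv by auto
        then have "Inf k = u" "Sup k = v" using uv by auto
        then show ?thesis
          using x uv \<open>u \<le> v\<close> tagged_division_ofD(3)[OF tag that] fineD[OF fine that] by auto
      qed
      have disj: "{Inf k<..<Sup k} \<inter> {Inf k'<..<Sup k'} = {}" if "(x, k) \<in> D" "(x', k') \<in> D" "(x, k) \<noteq> (x', k')" for x k x' k'
      proof -
        have i: "interior k = {Inf k<..<Sup k}" "interior k' = {Inf k'<..<Sup k'}"
          using k[OF that(1)] k[OF that(2)] interior_atLeastAtMost_real by metis+
        show ?thesis using tagged_division_ofD(5)[OF tag that] unfolding i .
      qed
      define D1 where "D1 = {p\<in>D. fst p \<notin> F}"
      define D2 where "D2 = {p\<in>D. fst p \<in> F}"
      have DD: "D = D1 \<union> D2" "D1 \<inter> D2 = {}" "finite D1" "finite D2" "D1 \<subseteq> D" "D2 \<subseteq> D"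
        using fin by (auto simp: D1_def D2_def)
      let ?\<Delta> = "\<lambda>p. c (Sup (snd p)) - c (Inf (snd p))"
      have "(\<Sum>(x,k)\<in>D. measure lborel k *\<^sub>R ?f x) - (c b - c a) = (\<Sum>p\<in>D. measure lborel (snd p) * ?f (fst p) - ?\<Delta> p)"
        using additive_tagged_division_1[OF ab tag, of c]
        by (simp add: sum_subtractf split_beta)
      also have "\<dots> = (\<Sum>p\<in>D1. measure lborel (snd p) * ?f (fst p) - ?\<Delta> p) + (\<Sum>p\<in>D2. measure lborel (snd p) * ?f (fst p) - ?\<Delta> p)"
        unfolding DD(1) using DD by (intro sum.union_disjoint) auto
      finally have eq: "(\<Sum>(x,k)\<in>D. measure lborel k *\<^sub>R ?f x) - (c b - c a) =
        (\<Sum>p\<in>D1. measure lborel (snd p) * ?f (fst p) - ?\<Delta> p) + (\<Sum>p\<in>D2. measure lborel (snd p) * ?f (fst p) - ?\<Delta> p)" .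
      have "\<bar>\<Sum>p\<in>D1. measure lborel (snd p) * ?f (fst p) - ?\<Delta> p\<bar> \<le> (\<Sum>p\<in>D1. \<eta> * measure lborel (snd p))"
      proof (rule order_trans[OF sum_abs sum_mono])
        fix p assume p: "p \<in> D1"
        then have pD: "(fst p, snd p) \<in> D" "fst p \<notin> F" by (auto simp: D1_def)
        have "\<bar>?\<Delta> p - deriv c (fst p) * (Sup (snd p) - Inf (snd p))\<bar> \<le> \<eta> * (Sup (snd p) - Inf (snd p))"
          using k[OF pD(1)] pD(2) by (intro d(3)) auto
        then show "\<bar>measure lborel (snd p) * ?f (fst p) - ?\<Delta> p\<bar> \<le> \<eta> * measure lborel (snd p)"
          using k[OF pD(1)] pD(2) by (simp add: abs_minus_commute mult.commute)
      qed
      also have "\<dots> \<le> (\<Sum>p\<in>D. \<eta> * measure lborel (snd p))"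
        using DD fin \<eta> by (intro sum_mono2) auto
      also have "\<dots> = \<eta> * (b - a)"
        using additive_content_tagged_division[of D a b] tag ab
        by (simp add: sum_distrib_left[symmetric] split_beta)
      also have "\<dots> < e / 2"
        using e ab by (simp add: \<eta>_def field_simps)
      finally have 1: "\<bar>\<Sum>p\<in>D1. measure lborel (snd p) * ?f (fst p) - ?\<Delta> p\<bar> < e / 2" .
      have "(\<Sum>p\<in>D2. \<bar>c (Sup (snd p)) - c (Inf (snd p))\<bar>) < e / 2"
      proof (rule abs_continuous_sum_less[OF acd DD(4)])
        show "Inf (snd p) \<le> Sup (snd p) \<and> {Inf (snd p)..Sup (snd p)} \<subseteq> {a..b}" if "p \<in> D2" for p
          using k[of "fst p" "snd p"] that by (auto simp: D2_def)
        show "{Inf (snd p)<..<Sup (snd p)} \<inter> {Inf (snd q)<..<Sup (snd q)} = {}" if "p \<in> D2" "q \<in> D2" "p \<noteq> q" for p q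
          using disj[of "fst p" "snd p" "fst q" "snd q"] that by (auto simp: D2_def prod_eq_iff)
        have nn: "0 \<le> Sup (snd p) - Inf (snd p)" if "p \<in> D2" for p
        proof -
          from that have "(fst p, snd p) \<in> D" by (simp add: D2_def)
          from k[OF this] show ?thesis by linarith
        qed
        have "ennreal (\<Sum>p\<in>D2. Sup (snd p) - Inf (snd p)) = (\<Sum>p\<in>D2. ennreal (Sup (snd p) - Inf (snd p)))"
          by (rule sum_ennreal[symmetric]) (rule nn)
        also have "\<dots> = (\<Sum>p\<in>D2. emeasure lborel {Inf (snd p)<..<Sup (snd p)})"
          by (intro sum.cong refl emeasure_lborel_Ioo[symmetric]) (use nn in simp)
        also have "\<dots> = emeasure lborel (\<Union>p\<in>D2. {Inf (snd p)<..<Sup (snd p)})"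
        proof (rule sum_emeasure)
          show "disjoint_family_on (\<lambda>p. {Inf (snd p)<..<Sup (snd p)}) D2"
            unfolding disjoint_family_on_def
          proof (intro ballI impI)
            fix p q assume "p \<in> D2" "q \<in> D2" "p \<noteq> q"
            then show "{Inf (snd p)<..<Sup (snd p)} \<inter> {Inf (snd q)<..<Sup (snd q)} = {}"
              using disj[of "fst p" "snd p" "fst q" "snd q"] by (simp add: D2_def prod_eq_iff)
          qed
        qed (use DD in auto)
        also have "\<dots> \<le> emeasure lborel U"
        proof (rule emeasure_mono)
          show "(\<Union>p\<in>D2. {Inf (snd p)<..<Sup (snd p)}) \<subseteq> U"
          proof (rule UN_least)
            fix p assume "p \<in> D2"
            then have pD: "(fst p, snd p) \<in> D" "fst p \<in> F" by (auto simp: D2_def)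
            have "{Inf (snd p)<..<Sup (snd p)} \<subseteq> {Inf (snd p)..Sup (snd p)}" by auto
            also have "\<dots> = snd p" using k[OF pD(1)] by simp
            also have "\<dots> \<subseteq> ball (fst p) (d (fst p))" using k[OF pD(1)] by simp
            also have "\<dots> \<subseteq> U" by (rule d(2)[OF pD(2)])
            finally show "{Inf (snd p)<..<Sup (snd p)} \<subseteq> U" .
          qed
        qed (use U in auto)
        also note Ud
        finally show "(\<Sum>p\<in>D2. Sup (snd p) - Inf (snd p)) < \<delta>"
          by (subst (asm) ennreal_less_iff) (auto intro!: sum_nonneg nn)
      qed
      moreover have "\<bar>\<Sum>p\<in>D2. measure lborel (snd p) * ?f (fst p) - ?\<Delta> p\<bar> \<le> (\<Sum>p\<in>D2. \<bar>c (Sup (snd p)) - c (Inf (snd p))\<bar>)"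
        by (rule order_trans[OF sum_abs]) (auto intro!: sum_mono simp: D2_def)
      ultimately show "norm ((\<Sum>(x,k)\<in>D. measure lborel k *\<^sub>R ?f x) - (c b - c a)) < e"
        unfolding eq real_norm_def using 1 by linarith
    qed
  qed
  then show ?thesis
    unfolding has_integral_real by blast
qed

text \<open>Maps the orthant into the compact unit cube and turns \<open>exp (- (x $ i))\<close>
  into coordinates. Continuous functions of \<open>expv x\<close> are then uniform limits of
  polynomials in these exponentials, and the latter are governed by the Laplace exponent.\<close>

definition expv :: "real^'d \<Rightarrow> real^'d" where
  "expv v = (\<chi> i. exp (- (v $ i)))"

lemma expv_nth [simp]: "expv v $ i = exp (- (v $ i))"
  by (simp add: expv_def)

lemma continuous_on_expv: "continuous_on A expv"
  unfolding expv_def[abs_def] by (intro continuous_intros)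

lemma borel_measurable_expv [measurable]: "expv \<in> borel_measurable borel"
  by (intro borel_measurable_continuous_onI continuous_on_expv)

lemma expv_in_cbox: "0 \<le> v \<Longrightarrow> expv v \<in> cbox 0 1"
  by (auto simp: mem_box_cart less_eq_vec_def)

lemma exp_difference_quotient:
  "((\<lambda>h. (exp (- h * A) - exp (- h * B)) / h) \<longlongrightarrow> B - A) (at (0::real))"
proof -
  have "((\<lambda>h. exp (- h * A) - exp (- h * B)) has_real_derivative B - A) (at 0)"
    by (auto intro!: derivative_eq_intros)
  then show ?thesis by (simp add: has_field_derivative_iff)
qed

section \<open>Small-time limits of the increments\<close>

context driftless_subordinator
begin

text \<open>Divided by \<open>h\<close>, the law of \<open>X h\<close> piles up infinite mass at the
  origin as \<open>h\<close> tends to \<open>0\<close>. The factor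
  \<open>1 - exp (- S h \<omega>)\<close> removes it and leaves a finite limit measure.\<close>

definition levy_approx :: "real \<Rightarrow> (real^'d \<Rightarrow> real) \<Rightarrow> real" where
  "levy_approx h k = (1 / h) * (\<integral>\<omega>. (1 - exp (- S h \<omega>)) * k (X h \<omega>) \<partial>M)"

definition levy_limit :: "(real^'d \<Rightarrow> real) \<Rightarrow> real" where
  "levy_limit k = (\<integral>x. (1 - exp (- l1norm x)) * k x \<partial>\<mu>)"

lemma integrable_levy_approx:
  assumes "0 \<le> h" and [measurable]: "k \<in> borel_measurable borel" and B: "\<And>x. 0 \<le> x \<Longrightarrow> \<bar>k x\<bar> \<le> B"
  shows "integrable M (\<lambda>\<omega>. (1 - exp (- S h \<omega>)) * k (X h \<omega>))"
proof (rule integrable_const_bound[where B=B])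
  have [measurable]: "S h \<in> borel_measurable M" "X h \<in> borel_measurable M"
    using assms by (auto intro!: measurable_S measurable_X)
  show "(\<lambda>\<omega>. (1 - exp (- S h \<omega>)) * k (X h \<omega>)) \<in> borel_measurable M" by measurable
  show "AE \<omega> in M. norm ((1 - exp (- S h \<omega>)) * k (X h \<omega>)) \<le> B"
  proof (rule AE_I2)
    fix \<omega> assume w: "\<omega> \<in> space M"
    have "\<bar>1 - exp (- S h \<omega>)\<bar> * \<bar>k (X h \<omega>)\<bar> \<le> 1 * B"
      using B[OF X_nonneg[OF assms(1) w]] S_nonneg[of h \<omega>] by (intro mult_mono) auto
    then show "norm ((1 - exp (- S h \<omega>)) * k (X h \<omega>)) \<le> B" by (simp add: abs_mult)
  qed
qed

lemma integrable_levy_limit: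
  assumes [measurable]: "k \<in> borel_measurable borel" and B: "\<And>x. 0 \<le> x \<Longrightarrow> \<bar>k x\<bar> \<le> B"
  shows "integrable \<mu> (\<lambda>x. (1 - exp (- l1norm x)) * k x)"
proof (rule integrable_levy_bound[where C=B])
  fix x :: "real^'d" assume x: "0 \<le> x"
  have "(1 - exp (- l1norm x)) * \<bar>k x\<bar> \<le> min 1 (l1norm x) * B"
    using B[OF x] by (intro mult_mono min_1_levy) auto
  then show "\<bar>(1 - exp (- l1norm x)) * k x\<bar> \<le> B * min 1 (l1norm x)" by (simp add: abs_mult mult.commute)
qed measurable

text \<open>Convergence is demanded after every exponential tilt \<eta>, so that multiplying
  \<open>k\<close> by \<open>exp (- (x $ i))\<close> preserves the property, as the induction over
  polynomials requires. The tilt \<open>0\<close> gives the convergence finally wanted.\<close>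

definition levy_conv :: "(nat \<Rightarrow> real) \<Rightarrow> (real^'d \<Rightarrow> real) \<Rightarrow> bool" where
  "levy_conv h k \<longleftrightarrow> k \<in> borel_measurable borel \<and> (\<exists>B. \<forall>x\<ge>0. \<bar>k x\<bar> \<le> B) \<and>
    (\<forall>\<eta>\<ge>0. (\<lambda>n. levy_approx (h n) (\<lambda>x. k x * exp (- (\<eta> \<bullet> x)))) \<longlonglongrightarrow> levy_limit (\<lambda>x. k x * exp (- (\<eta> \<bullet> x))))"

text \<open>Here the Laplace exponent enters. With the factor
  \<open>1 - exp (- S h \<omega>)\<close> the tilted mean is a difference of two Laplace transforms;
  divided by \<open>h\<close>, it tends to the difference of the exponents at
  \<open>\<eta> + (\<chi> i. 1)\<close> and at \<eta>.\<close>

lemma levy_conv_one: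
  assumes h: "h \<longlonglongrightarrow> 0" "\<And>n. 0 < h n"
  shows "levy_conv h (\<lambda>_. 1)"
  unfolding levy_conv_def
proof (intro conjI allI impI exI[of _ 1])
  fix \<eta> :: "real^'d" assume \<eta>: "0 \<le> \<eta>"
  let ?\<eta> = "\<eta> + (\<chi> i. 1)"
  have \<eta>1: "0 \<le> ?\<eta>" using \<eta> by (auto simp: less_eq_vec_def add_nonneg_nonneg)
  have split1: "(1 - exp (- l1norm x)) * (1 * exp (- (\<eta> \<bullet> x))) = exp (- (\<eta> \<bullet> x)) - exp (- (?\<eta> \<bullet> x))" if "0 \<le> x" for x
    using that by (simp add: l1norm_eq_inner inner_add_left algebra_simps exp_add[symmetric])
  have int: "integrable M (\<lambda>\<omega>. exp (- (\<theta> \<bullet> X t \<omega>)))" if "0 \<le> t" "0 \<le> \<theta>" for t \<theta>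
    using inner_le_l1norm(2)[OF that(2) X_nonneg[OF that(1)]] that
    by (intro integrable_const_bound[where B=1]) (auto intro!: borel_measurable_exp borel_measurable_uminus borel_measurable_inner measurable_X AE_I2)
  have "levy_approx (h n) (\<lambda>x. 1 * exp (- (\<eta> \<bullet> x))) = (exp (- h n * \<psi> \<eta>) - exp (- h n * \<psi> ?\<eta>)) / h n" for n
  proof -
    have hn: "0 \<le> h n" using h(2)[of n] by simp
    have "(\<integral>\<omega>. (1 - exp (- S (h n) \<omega>)) * (1 * exp (- (\<eta> \<bullet> X (h n) \<omega>))) \<partial>M) =
      (\<integral>\<omega>. exp (- (\<eta> \<bullet> X (h n) \<omega>)) - exp (- (?\<eta> \<bullet> X (h n) \<omega>)) \<partial>M)"
      unfolding norm_process_def by (intro Bochner_Integration.integral_cong refl split1 X_nonneg hn)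
    also have "\<dots> = exp (- h n * \<psi> \<eta>) - exp (- h n * \<psi> ?\<eta>)"
      using int[OF hn \<eta>] int[OF hn \<eta>1] by (simp only: Bochner_Integration.integral_diff laplace[OF hn \<eta>] laplace[OF hn \<eta>1])
    finally show ?thesis unfolding levy_approx_def by simp
  qed
  moreover have "levy_limit (\<lambda>x. 1 * exp (- (\<eta> \<bullet> x))) = \<psi> ?\<eta> - \<psi> \<eta>"
  proof -
    have "levy_limit (\<lambda>x. 1 * exp (- (\<eta> \<bullet> x))) = (\<integral>x. (1 - exp (- (?\<eta> \<bullet> x))) - (1 - exp (- (\<eta> \<bullet> x))) \<partial>\<mu>)"
      unfolding levy_limit_def
    proof (rule integral_cong_AE)
      show "AE x in \<mu>. (1 - exp (- l1norm x)) * (1 * exp (- (\<eta> \<bullet> x))) = (1 - exp (- (?\<eta> \<bullet> x))) - (1 - exp (- (\<eta> \<bullet> x)))"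
        using AE_levy_orthant by eventually_elim (subst split1, assumption, simp)
    qed simp_all
    then show ?thesis
      by (simp only: Bochner_Integration.integral_diff[OF integrable_psi[OF \<eta>1] integrable_psi[OF \<eta>]])
  qed
  moreover have "(\<lambda>n. (exp (- h n * \<psi> \<eta>) - exp (- h n * \<psi> ?\<eta>)) / h n) \<longlonglongrightarrow> \<psi> ?\<eta> - \<psi> \<eta>"
  proof (rule filterlim_compose[OF exp_difference_quotient])
    show "filterlim h (at 0) sequentially"
      using h by (auto simp: filterlim_at less_imp_neq[symmetric])
  qed
  ultimately show "(\<lambda>n. levy_approx (h n) (\<lambda>x. 1 * exp (- (\<eta> \<bullet> x)))) \<longlonglongrightarrow> levy_limit (\<lambda>x. 1 * exp (- (\<eta> \<bullet> x)))"
    by simp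
qed auto

lemma exp_inner_bound:
  assumes "0 \<le> \<eta>" "0 \<le> (x::real^'d)" "\<bar>k\<bar> \<le> B"
  shows "\<bar>k * exp (- (\<eta> \<bullet> x))\<bar> \<le> B"
proof -
  have "\<bar>k\<bar> * exp (- (\<eta> \<bullet> x)) \<le> B * 1"
    using assms inner_le_l1norm(2)[OF assms(1,2)] by (intro mult_mono) auto
  then show ?thesis by (simp add: abs_mult)
qed

lemma levy_conv_add:
  assumes h: "\<And>n. 0 < h n" and k: "levy_conv h k" and l: "levy_conv h l"
  shows "levy_conv h (\<lambda>x. k x + l x)"
proof -
  obtain B C where B: "\<And>x. 0 \<le> x \<Longrightarrow> \<bar>k x\<bar> \<le> B" and C: "\<And>x. 0 \<le> x \<Longrightarrow> \<bar>l x\<bar> \<le> C"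
    using k l unfolding levy_conv_def by blast
  have [measurable]: "k \<in> borel_measurable borel" "l \<in> borel_measurable borel"
    using k l unfolding levy_conv_def by auto
  show ?thesis
    unfolding levy_conv_def
  proof (intro conjI allI impI)
    show "\<exists>B. \<forall>x\<ge>0. \<bar>k x + l x\<bar> \<le> B"
      by (intro exI[of _ "B + C"] allI impI order_trans[OF abs_triangle_ineq] add_mono B C)
    fix \<eta> :: "real^'d" assume \<eta>: "0 \<le> \<eta>"
    have ia: "integrable M (\<lambda>\<omega>. (1 - exp (- S (h n) \<omega>)) * (k (X (h n) \<omega>) * exp (- (\<eta> \<bullet> X (h n) \<omega>))))"
      "integrable M (\<lambda>\<omega>. (1 - exp (- S (h n) \<omega>)) * (l (X (h n) \<omega>) * exp (- (\<eta> \<bullet> X (h n) \<omega>))))" for n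
      by (rule integrable_levy_approx[where k="\<lambda>x. k x * exp (- (\<eta> \<bullet> x))", OF less_imp_le[OF h] _ exp_inner_bound[OF \<eta> _ B]]; measurable)
        (rule integrable_levy_approx[where k="\<lambda>x. l x * exp (- (\<eta> \<bullet> x))", OF less_imp_le[OF h] _ exp_inner_bound[OF \<eta> _ C]]; measurable)
    have il: "integrable \<mu> (\<lambda>x. (1 - exp (- l1norm x)) * (k x * exp (- (\<eta> \<bullet> x))))"
      "integrable \<mu> (\<lambda>x. (1 - exp (- l1norm x)) * (l x * exp (- (\<eta> \<bullet> x))))"
      by (rule integrable_levy_limit[OF _ exp_inner_bound[OF \<eta> _ B]]; measurable)
        (rule integrable_levy_limit[OF _ exp_inner_bound[OF \<eta> _ C]]; measurable)
    have "levy_approx (h n) (\<lambda>x. (k x + l x) * exp (- (\<eta> \<bullet> x))) =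
      levy_approx (h n) (\<lambda>x. k x * exp (- (\<eta> \<bullet> x))) + levy_approx (h n) (\<lambda>x. l x * exp (- (\<eta> \<bullet> x)))" for n
      unfolding levy_approx_def distrib_right by (simp only: distrib_left Bochner_Integration.integral_add[OF ia])
    moreover have "levy_limit (\<lambda>x. (k x + l x) * exp (- (\<eta> \<bullet> x))) =
      levy_limit (\<lambda>x. k x * exp (- (\<eta> \<bullet> x))) + levy_limit (\<lambda>x. l x * exp (- (\<eta> \<bullet> x)))"
      unfolding levy_limit_def distrib_right by (simp only: distrib_left Bochner_Integration.integral_add[OF il])
    ultimately show "(\<lambda>n. levy_approx (h n) (\<lambda>x. (k x + l x) * exp (- (\<eta> \<bullet> x)))) \<longlonglongrightarrow> levy_limit (\<lambda>x. (k x + l x) * exp (- (\<eta> \<bullet> x)))"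
      using k l \<eta> unfolding levy_conv_def by (auto intro!: tendsto_add)
  qed measurable
qed

lemma levy_conv_cmult:
  assumes k: "levy_conv h k"
  shows "levy_conv h (\<lambda>x. a * k x)"
proof -
  obtain B where B: "\<And>x. 0 \<le> x \<Longrightarrow> \<bar>k x\<bar> \<le> B"
    using k unfolding levy_conv_def by blast
  have [measurable]: "k \<in> borel_measurable borel"
    using k unfolding levy_conv_def by auto
  show ?thesis
    unfolding levy_conv_def
  proof (intro conjI allI impI)
    show "\<exists>B. \<forall>x\<ge>0. \<bar>a * k x\<bar> \<le> B"
      using B by (intro exI[of _ "\<bar>a\<bar> * B"]) (auto simp: abs_mult intro!: mult_left_mono)
    fix \<eta> :: "real^'d" assume \<eta>: "0 \<le> \<eta>"
    have "levy_approx (h n) (\<lambda>x. (a * k x) * exp (- (\<eta> \<bullet> x))) = a * levy_approx (h n) (\<lambda>x. k x * exp (- (\<eta> \<bullet> x)))" for n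
      unfolding levy_approx_def by (simp add: mult.assoc mult.left_commute[of _ a])
    moreover have "levy_limit (\<lambda>x. (a * k x) * exp (- (\<eta> \<bullet> x))) = a * levy_limit (\<lambda>x. k x * exp (- (\<eta> \<bullet> x)))"
      unfolding levy_limit_def by (simp add: mult.assoc mult.left_commute[of _ a])
    ultimately show "(\<lambda>n. levy_approx (h n) (\<lambda>x. (a * k x) * exp (- (\<eta> \<bullet> x)))) \<longlonglongrightarrow> levy_limit (\<lambda>x. (a * k x) * exp (- (\<eta> \<bullet> x)))"
      using k \<eta> unfolding levy_conv_def by (auto intro!: tendsto_mult_left)
  qed measurable
qed

text \<open>The extra factor shifts the tilt by a unit vector, which stays in the orthant.\<close>

lemma levy_conv_coordinate:
  assumes k: "levy_conv h k"
  shows "levy_conv h (\<lambda>x. k x * exp (- (x $ i)))"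
proof -
  obtain B where B: "\<And>x. 0 \<le> x \<Longrightarrow> \<bar>k x\<bar> \<le> B"
    using k unfolding levy_conv_def by blast
  have [measurable]: "k \<in> borel_measurable borel"
    using k unfolding levy_conv_def by auto
  have ax: "0 \<le> (axis i 1 :: real^'d)" by (auto simp: less_eq_vec_def axis_def)
  have xi: "axis i 1 \<bullet> x = x $ i" for x :: "real^'d" by (simp add: inner_axis' )
  show ?thesis
    unfolding levy_conv_def
  proof (intro conjI allI impI)
    show "\<exists>B. \<forall>x\<ge>0. \<bar>k x * exp (- (x $ i))\<bar> \<le> B"
      using exp_inner_bound[OF ax _ B] unfolding xi by blast
    fix \<eta> :: "real^'d" assume \<eta>: "0 \<le> \<eta>"
    have "(\<lambda>x. k x * exp (- (x $ i)) * exp (- (\<eta> \<bullet> x))) = (\<lambda>x. k x * exp (- ((axis i 1 + \<eta>) \<bullet> x)))"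
      by (simp add: fun_eq_iff inner_add_left xi exp_add[symmetric] mult.assoc)
    moreover have "0 \<le> axis i 1 + \<eta>" using ax \<eta> by (auto simp: less_eq_vec_def add_nonneg_nonneg)
    ultimately show "(\<lambda>n. levy_approx (h n) (\<lambda>x. k x * exp (- (x $ i)) * exp (- (\<eta> \<bullet> x)))) \<longlonglongrightarrow>
      levy_limit (\<lambda>x. k x * exp (- (x $ i)) * exp (- (\<eta> \<bullet> x)))"
      using k unfolding levy_conv_def by simp
  qed measurable
qed

lemma levy_conv_sum:
  assumes h: "\<And>n. 0 < h n" and "finite I" "\<And>i. i \<in> I \<Longrightarrow> levy_conv h (k i)"
  shows "levy_conv h (\<lambda>x. \<Sum>i\<in>I. k i x)"
  using assms(2,3)
proof (induction I rule: finite_induct)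
  case empty
  show ?case by (auto simp: levy_conv_def levy_approx_def levy_limit_def)
next
  case (insert j I)
  then show ?case by (simp add: levy_conv_add[OF h])
qed

text \<open>The induction is general in \<open>k\<close>, because for a product of polynomials the
  hypothesis for one factor is applied to \<open>k\<close> times the other.\<close>

lemma levy_conv_polynomial:
  assumes h: "\<And>n. 0 < h n" and "real_polynomial_function p" "levy_conv h k"
  shows "levy_conv h (\<lambda>x. k x * p (expv x))"
  using assms(2,3)
proof (induction p arbitrary: k rule: real_polynomial_function.induct)
  case (linear f)
  have "f (expv x) = (\<Sum>i\<in>UNIV. f (axis i 1) * exp (- (x $ i)))" for x
  proof -
    have "expv x = (\<Sum>i\<in>UNIV. exp (- (x $ i)) *\<^sub>R axis i 1)"
      by (simp add: vec_eq_iff axis_def if_distrib cong: if_cong)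
    then show ?thesis
      using linear(1) by (simp add: linear_sum bounded_linear.linear linear_cmul mult.commute)
  qed
  then have "(\<lambda>x. k x * f (expv x)) = (\<lambda>x. \<Sum>i\<in>UNIV. f (axis i 1) * (k x * exp (- (x $ i))))"
    by (simp add: sum_distrib_left mult.left_commute)
  then show ?case
    using linear(2) by (simp only:) (intro levy_conv_sum h levy_conv_cmult levy_conv_coordinate finite)
next
  case (const c)
  then show ?case using levy_conv_cmult[of h k c] by (simp add: mult.commute)
next
  case (add p q)
  then show ?case using levy_conv_add[OF h, where k = "\<lambda>x. k x * p (expv x)" and l = "\<lambda>x. k x * q (expv x)"] by (simp add: distrib_left)
next
  case (mult p q)
  then show ?case using mult.IH(2)[OF mult.IH(1)[OF mult.prems]] by (simp add: mult.assoc)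
qed

lemma continuous_expv_bound:
  assumes "continuous_on UNIV G"
  obtains B where "\<And>x::real^'d. 0 \<le> x \<Longrightarrow> \<bar>G (expv x)\<bar> \<le> (B::real)"
proof -
  have "compact (G ` cbox 0 (1::real^'d))"
    using assms by (intro compact_continuous_image continuous_on_subset[OF assms] compact_cbox) auto
  then have "bounded (G ` cbox 0 (1::real^'d))" by (rule compact_imp_bounded)
  then obtain B where "\<forall>v\<in>G ` cbox 0 (1::real^'d). norm v \<le> B" unfolding bounded_iff by blast
  then show ?thesis using expv_in_cbox by (intro that[of B]) auto
qed

text \<open>A uniform error \<open>e\<close> on the cube costs at most
  \<open>e * \<psi> (\<chi> i. 1)\<close> for all \<open>h\<close> at once, because
  \<open>1 - exp (- h * p)\<close> is at most \<open>h * p\<close>.\<close>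

lemma levy_approx_diff:
  assumes h: "0 < h" and G: "continuous_on UNIV G" and G': "continuous_on UNIV G'"
    and e: "\<And>w::real^'d. w \<in> cbox 0 1 \<Longrightarrow> \<bar>G w - G' w\<bar> \<le> e"
  shows "\<bar>levy_approx h (\<lambda>x. G (expv x)) - levy_approx h (\<lambda>x. G' (expv x))\<bar> \<le> e * \<psi> (\<chi> i. 1)"
    and "\<bar>levy_limit (\<lambda>x. G (expv x)) - levy_limit (\<lambda>x. G' (expv x))\<bar> \<le> e * \<psi> (\<chi> i. 1)"
proof -
  let ?one = "(\<chi> i. 1) :: real^'d"
  have one: "0 \<le> ?one" by (auto simp: less_eq_vec_def)
  have "0 \<le> \<bar>G 0 - G' 0\<bar>" by simp
  also have "\<dots> \<le> e" by (rule e) (auto simp: mem_box_cart)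
  finally have e0: "0 \<le> e" .
  have [measurable]: "G \<in> borel_measurable borel" "G' \<in> borel_measurable borel"
    using G G' by (auto intro: borel_measurable_continuous_onI)
  obtain B where B: "\<And>x::real^'d. 0 \<le> x \<Longrightarrow> \<bar>G (expv x)\<bar> \<le> B" using continuous_expv_bound[OF G] by blast
  obtain B' where B': "\<And>x::real^'d. 0 \<le> x \<Longrightarrow> \<bar>G' (expv x)\<bar> \<le> B'" using continuous_expv_bound[OF G'] by blast
  have int: "integrable M (\<lambda>\<omega>. (1 - exp (- S h \<omega>)) * G (expv (X h \<omega>)))" "integrable M (\<lambda>\<omega>. (1 - exp (- S h \<omega>)) * G' (expv (X h \<omega>)))"
    using h B B' by (auto intro!: integrable_levy_approx[where k="\<lambda>x. G (expv x)"] integrable_levy_approx[where k="\<lambda>x. G' (expv x)"])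
  have int2: "integrable \<mu> (\<lambda>x. (1 - exp (- l1norm x)) * G (expv x))" "integrable \<mu> (\<lambda>x. (1 - exp (- l1norm x)) * G' (expv x))"
    using B B' by (auto intro!: integrable_levy_limit)
  have bound: "\<bar>(1 - exp (- l1norm x)) * G (expv x) - (1 - exp (- l1norm x)) * G' (expv x)\<bar> \<le> e * (1 - exp (- (?one \<bullet> x)))"
    if "0 \<le> x" for x :: "real^'d"
  proof -
    have "\<bar>(1 - exp (- l1norm x)) * G (expv x) - (1 - exp (- l1norm x)) * G' (expv x)\<bar> = (1 - exp (- l1norm x)) * \<bar>G (expv x) - G' (expv x)\<bar>"
      by (simp add: right_diff_distrib[symmetric] abs_mult)
    also have "\<dots> \<le> (1 - exp (- l1norm x)) * e"
      by (intro mult_left_mono e expv_in_cbox that) simp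
    finally show ?thesis using that by (simp add: l1norm_eq_inner mult.commute)
  qed
  show "\<bar>levy_limit (\<lambda>x. G (expv x)) - levy_limit (\<lambda>x. G' (expv x))\<bar> \<le> e * \<psi> (\<chi> i. 1)"
  proof -
    have eq: "levy_limit (\<lambda>x. G (expv x)) - levy_limit (\<lambda>x. G' (expv x)) =
      (\<integral>x. (1 - exp (- l1norm x)) * G (expv x) - (1 - exp (- l1norm x)) * G' (expv x) \<partial>\<mu>)"
      unfolding levy_limit_def using int2 by simp
    have "\<bar>levy_limit (\<lambda>x. G (expv x)) - levy_limit (\<lambda>x. G' (expv x))\<bar> \<le> (\<integral>x. e * (1 - exp (- (?one \<bullet> x))) \<partial>\<mu>)"
      unfolding eq
    proof (rule order_trans[OF integral_abs_bound integral_mono_AE])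
      show "AE x in \<mu>. \<bar>(1 - exp (- l1norm x)) * G (expv x) - (1 - exp (- l1norm x)) * G' (expv x)\<bar> \<le> e * (1 - exp (- (?one \<bullet> x)))"
        using AE_levy_orthant by eventually_elim (rule bound)
    qed (intro integrable_abs Bochner_Integration.integrable_diff int2 integrable_mult_right integrable_psi one)+
    also have "\<dots> = e * \<psi> ?one" by (rule integral_mult_right_zero)
    finally show ?thesis .
  qed
  show "\<bar>levy_approx h (\<lambda>x. G (expv x)) - levy_approx h (\<lambda>x. G' (expv x))\<bar> \<le> e * \<psi> (\<chi> i. 1)"
  proof -
    let ?I = "\<integral>\<omega>. (1 - exp (- S h \<omega>)) * G (expv (X h \<omega>)) - (1 - exp (- S h \<omega>)) * G' (expv (X h \<omega>)) \<partial>M"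
    have eq: "levy_approx h (\<lambda>x. G (expv x)) - levy_approx h (\<lambda>x. G' (expv x)) = (1 / h) * ?I"
      by (subst Bochner_Integration.integral_diff[OF int]) (simp only: levy_approx_def right_diff_distrib)
    have iX: "integrable M (\<lambda>\<omega>. exp (- (?one \<bullet> X h \<omega>)))"
      using h inner_le_l1norm(2)[OF one X_nonneg[of h]]
      by (intro integrable_const_bound[where B=1]) (auto intro!: borel_measurable_exp borel_measurable_uminus borel_measurable_inner measurable_X AE_I2)
    have "\<bar>?I\<bar> \<le> (\<integral>\<omega>. e * (1 - exp (- (?one \<bullet> X h \<omega>))) \<partial>M)"
    proof (rule order_trans[OF integral_abs_bound integral_mono_AE])
      show "AE \<omega> in M. \<bar>(1 - exp (- S h \<omega>)) * G (expv (X h \<omega>)) - (1 - exp (- S h \<omega>)) * G' (expv (X h \<omega>))\<bar> \<le> e * (1 - exp (- (?one \<bullet> X h \<omega>)))"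
        unfolding norm_process_def using h by (intro AE_I2 bound X_nonneg) auto
    qed (intro integrable_abs Bochner_Integration.integrable_diff int integrable_mult_right iX integrable_const)+
    also have "\<dots> = e * (1 - exp (- h * \<psi> ?one))"
      using iX laplace[of h ?one] one h by (simp add: prob_space)
    also have "\<dots> \<le> e * (h * \<psi> ?one)"
      using exp_ge_add_one_self[of "- h * \<psi> ?one"] e0 by (intro mult_left_mono) auto
    finally have le: "\<bar>?I\<bar> \<le> h * (e * \<psi> ?one)" by (simp only: mult.left_commute)
    have "\<bar>(1 / h) * ?I\<bar> = (1 / h) * \<bar>?I\<bar>" using h by (simp add: abs_mult)
    also have "\<dots> \<le> (1 / h) * (h * (e * \<psi> ?one))" using h le by (intro mult_left_mono) auto
    also have "\<dots> = e * \<psi> ?one" using h by simp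
    finally show ?thesis unfolding eq .
  qed
qed

text \<open>The integrand is allowed to vary with \<open>n\<close>, since in the partition argument
  the function attached to a cell depends on its grid points.\<close>

lemma levy_approx_tendsto:
  assumes h: "h \<longlonglongrightarrow> 0" "\<And>n. 0 < h n" and G: "continuous_on UNIV G" and Gs: "\<And>n. continuous_on UNIV (Gs n)"
    and unif: "\<And>e. 0 < e \<Longrightarrow> \<forall>\<^sub>F n in sequentially. \<forall>w\<in>cbox 0 1. \<bar>Gs n w - G w\<bar> \<le> e"
  shows "(\<lambda>n. levy_approx (h n) (\<lambda>x. Gs n (expv x))) \<longlonglongrightarrow> levy_limit (\<lambda>x. G (expv x))"
proof (rule tendstoI)
  fix e :: real assume e: "0 < e"
  let ?P = "\<psi> (\<chi> i. 1)"
  have P: "0 \<le> ?P"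
  proof (rule integral_nonneg_AE)
    show "AE x in \<mu>. 0 \<le> 1 - exp (- ((\<chi> i. 1) \<bullet> x))"
      using AE_levy_orthant by eventually_elim (simp add: inner_le_l1norm(2) less_eq_vec_def)
  qed
  \<comment> \<open>Three replacements, two in \<open>levy_approx\<close> and one in
    \<open>levy_limit\<close>, cost at most \<open>d * ?P \<le> e / 4\<close> each; the last quarter
    is for the convergence of the polynomial.\<close>
  define d where "d = e / (4 * (?P + 1))"
  have d: "0 < d" using e P by (simp add: d_def)
  have dP: "d * ?P \<le> e / 4" using e P by (simp add: d_def field_simps)
  obtain p where p: "real_polynomial_function p" "\<And>w. w \<in> cbox 0 1 \<Longrightarrow> \<bar>G w - p w\<bar> < d"
    using Stone_Weierstrass_real_polynomial_function[OF compact_cbox continuous_on_subset[OF G] d, of 0 1] by auto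
  have pc: "continuous_on UNIV p"
    using p(1) by (intro continuous_on_polymonial_function) (simp add: real_polynomial_function_eq[symmetric])
  have "levy_conv h (\<lambda>x. 1 * p (expv x))"
    by (rule levy_conv_polynomial[OF h(2) p(1) levy_conv_one[OF h]])
  then have "(\<lambda>n. levy_approx (h n) (\<lambda>x. p (expv x))) \<longlonglongrightarrow> levy_limit (\<lambda>x. p (expv x))"
    unfolding levy_conv_def by (auto dest!: spec[of _ 0])
  then have "\<forall>\<^sub>F n in sequentially. dist (levy_approx (h n) (\<lambda>x. p (expv x))) (levy_limit (\<lambda>x. p (expv x))) < e / 4"
    using e by (intro tendstoD) auto
  then show "\<forall>\<^sub>F n in sequentially. dist (levy_approx (h n) (\<lambda>x. Gs n (expv x))) (levy_limit (\<lambda>x. G (expv x))) < e"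
    using unif[OF d]
  proof eventually_elim
    case (elim n)
    have "\<bar>levy_approx (h n) (\<lambda>x. Gs n (expv x)) - levy_approx (h n) (\<lambda>x. G (expv x))\<bar> \<le> d * ?P"
      using elim by (intro levy_approx_diff h Gs G) auto
    moreover have "\<bar>levy_approx (h n) (\<lambda>x. G (expv x)) - levy_approx (h n) (\<lambda>x. p (expv x))\<bar> \<le> d * ?P"
      using p(2) by (intro levy_approx_diff h G pc) (auto intro: less_imp_le)
    moreover have "\<bar>levy_limit (\<lambda>x. G (expv x)) - levy_limit (\<lambda>x. p (expv x))\<bar> \<le> d * ?P"
      using p(2) by (intro levy_approx_diff[OF h(2)] G pc) (auto intro: less_imp_le)
    ultimately show ?case using elim(1) dP unfolding dist_real_def by linarith
  qed
qed

end

section \<open>The first passage over a boundary\<close>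

definition grid :: "real \<Rightarrow> real \<Rightarrow> nat \<Rightarrow> nat \<Rightarrow> real" where
  "grid a b n k = a + real k * ((b - a) / real (Suc n))"

text \<open>Index of the cell containing \<open>t\<close>. Cells are open on the left and closed on
  the right, hence ceiling minus one and not floor.\<close>

definition cell :: "real \<Rightarrow> real \<Rightarrow> nat \<Rightarrow> real \<Rightarrow> nat" where
  "cell a b n t = nat (\<lceil>(t - a) / ((b - a) / real (Suc n))\<rceil> - 1)"

lemma grid_ends: "grid a b n 0 = a" "grid a b n (Suc n) = b"
  by (simp_all add: grid_def del: of_nat_Suc)

lemma grid_mono: "a \<le> b \<Longrightarrow> k \<le> l \<Longrightarrow> grid a b n k \<le> grid a b n l"
  unfolding grid_def by (intro add_mono mult_right_mono) auto

lemma grid_Suc: "grid a b n (Suc k) = grid a b n k + (b - a) / real (Suc n)"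
proof -
  have "real (Suc k) = real k + 1" by simp
  then show ?thesis by (simp only: grid_def distrib_right mult_1 add.assoc)
qed

lemma grid_bounds: "a \<le> b \<Longrightarrow> k \<le> Suc n \<Longrightarrow> grid a b n k \<in> {a..b}"
  using grid_mono[of a b 0 k n] grid_mono[of a b k "Suc n" n] by (simp add: grid_ends)

lemma cell:
  assumes "a < t" "t \<le> b"
  shows "cell a b n t < Suc n" "grid a b n (cell a b n t) < t" "t \<le> grid a b n (Suc (cell a b n t))"
proof -
  define h where "h = (b - a) / real (Suc n)"
  have h: "0 < h" using assms by (simp add: h_def)
  define z where "z = \<lceil>(t - a) / h\<rceil>"
  have "0 < (t - a) / h" using assms h by simp
  then have z: "0 < z" by (simp add: z_def)
  have zc: "real (cell a b n t) = of_int z - 1"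
    unfolding cell_def h_def[symmetric] z_def[symmetric] using z by (simp add: of_nat_nat)
  have z1: "(t - a) / h \<le> of_int z" "of_int z - 1 < (t - a) / h"
    unfolding z_def by linarith+
  have "(t - a) / h \<le> (b - a) / h" using assms h by (intro divide_right_mono) auto
  also have "\<dots> = real (Suc n)" using assms by (simp add: h_def)
  finally have "of_int z - 1 < real (Suc n)" using z1(2) by linarith
  then show "cell a b n t < Suc n" unfolding zc[symmetric] by simp
  have "(of_int z - 1) * h < t - a" using z1(2) h by (simp add: pos_less_divide_eq)
  then show "grid a b n (cell a b n t) < t" unfolding grid_def h_def[symmetric] zc by linarith
  have "t - a \<le> of_int z * h" using z1(1) h by (simp add: pos_divide_le_eq)
  moreover have "real (Suc (cell a b n t)) = of_int z" using zc by simp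
  ultimately show "t \<le> grid a b n (Suc (cell a b n t))" unfolding grid_def h_def[symmetric] by simp
qed

lemma cell_unique:
  assumes "a < t" "t \<le> b" "grid a b n k < t" "t \<le> grid a b n (Suc k)"
  shows "k = cell a b n t"
proof (rule antisym; rule ccontr)
  have ab: "a \<le> b" using assms by simp
  { assume "\<not> k \<le> cell a b n t"
    then have "grid a b n (Suc (cell a b n t)) \<le> grid a b n k" by (intro grid_mono ab) simp
    then show False using cell(3)[OF assms(1,2), of n] assms(3) by simp }
  { assume "\<not> cell a b n t \<le> k"
    then have "grid a b n (Suc k) \<le> grid a b n (cell a b n t)" by (intro grid_mono ab) simp
    then show False using cell(2)[OF assms(1,2), of n] assms(4) by simp }
qed

lemma sum_cells:
  assumes ab: "a < b"
  shows "(\<Sum>k<Suc n. x k * indicator {grid a b n k<..grid a b n (Suc k)} t) =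
    (if t \<in> {a<..b} then x (cell a b n t) else (0::real))"
proof (cases "t \<in> {a<..b}")
  case True
  have "(\<Sum>k<Suc n. x k * indicator {grid a b n k<..grid a b n (Suc k)} t) =
    (\<Sum>k<Suc n. if k = cell a b n t then x k else 0)"
  proof (rule sum.cong[OF refl])
    fix k
    have t: "a < t" "t \<le> b" using True by auto
    have "t \<in> {grid a b n k<..grid a b n (Suc k)} \<longleftrightarrow> k = cell a b n t"
      using cell(2,3)[OF t, of n] cell_unique[OF t, of n k] by auto
    then show "x k * indicator {grid a b n k<..grid a b n (Suc k)} t = (if k = cell a b n t then x k else 0)"
      by (simp only: indicator_def of_bool_def) simp
  qed
  also have "\<dots> = x (cell a b n t)"
    using cell(1)[of a t b n] True by (subst sum.delta) auto
  finally show ?thesis unfolding if_P[OF True] .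
next
  case False
  have "indicator {grid a b n k<..grid a b n (Suc k)} t = (0::real)" if "k < Suc n" for k
    using False grid_bounds[of a b k n] grid_bounds[of a b "Suc k" n] ab that by (auto simp: indicator_def)
  then show ?thesis unfolding if_not_P[OF False] by (intro sum.neutral) simp
qed

text \<open>The left end of the cell is strictly before \<open>t\<close> and so leads to left limits
  of paths; the right end may coincide with \<open>t\<close>, so for it only convergence is
  stated.\<close>

lemma grid_cell_tendsto:
  assumes t: "a < t" "t \<le> b"
  shows "(\<lambda>n. grid a b n (cell a b n t)) \<longlonglongrightarrow> t" "(\<lambda>n. grid a b n (Suc (cell a b n t))) \<longlonglongrightarrow> t"
    "filterlim (\<lambda>n. grid a b n (cell a b n t)) (at_left t) sequentially"
proof -
  have d: "(\<lambda>n. (b - a) / real (Suc n)) \<longlonglongrightarrow> 0" by (rule LIMSEQ_Suc[OF lim_const_over_n])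
  have lo: "t - (b - a) / real (Suc n) \<le> grid a b n (cell a b n t)" for n
    using cell(3)[OF t, of n] by (simp add: grid_Suc)
  have up: "grid a b n (Suc (cell a b n t)) \<le> t + (b - a) / real (Suc n)" for n
    using cell(2)[OF t, of n] by (simp add: grid_Suc)
  have l: "(\<lambda>n. t - (b - a) / real (Suc n)) \<longlonglongrightarrow> t" "(\<lambda>n. t + (b - a) / real (Suc n)) \<longlonglongrightarrow> t"
    using tendsto_diff[OF tendsto_const d, of t] tendsto_add[OF tendsto_const d, of t] by simp_all
  show 1: "(\<lambda>n. grid a b n (cell a b n t)) \<longlonglongrightarrow> t"
    by (rule tendsto_sandwich[OF always_eventually always_eventually l(1) tendsto_const])
       (use lo cell(2)[OF t] in \<open>auto intro: less_imp_le\<close>)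
  show "(\<lambda>n. grid a b n (Suc (cell a b n t))) \<longlonglongrightarrow> t"
    by (rule tendsto_sandwich[OF always_eventually always_eventually tendsto_const l(2)])
       (use up cell(3)[OF t] in auto)
  show "filterlim (\<lambda>n. grid a b n (cell a b n t)) (at_left t) sequentially"
    by (rule tendsto_imp_filterlim_at_left[OF 1 always_eventually]) (use cell(2)[OF t] in auto)
qed

lemma incseq_Ioc:
  fixes p q :: "nat \<Rightarrow> real"
  assumes "\<And>k. p (Suc k) \<le> p k" "\<And>k. q k \<le> q (Suc k)"
  shows "incseq (\<lambda>k. {p k<..q k})"
proof (rule incseq_SucI, rule subsetI)
  fix k x assume "x \<in> {p k<..q k}"
  then show "x \<in> {p (Suc k)<..q (Suc k)}" using assms[of k] by simp
qed

section \<open>The passage time and where it lies\<close>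

locale boundary_crossing = density_subordinator M X \<mu> g
  for M :: "'w measure" and X :: "real \<Rightarrow> 'w \<Rightarrow> real ^ 'd" and \<mu> g +
  fixes c :: "real \<Rightarrow> real" and F :: "real set"
  assumes boundary: "boundary c F"
begin

lemma c_antimono: "0 < s \<Longrightarrow> s \<le> t \<Longrightarrow> c t \<le> c s"
  using boundary unfolding boundary_def by (auto simp: monotone_on_def)

lemma c_abs_continuous: "0 < a \<Longrightarrow> a \<le> b \<Longrightarrow> abs_continuous_on {a..b} c"
  using boundary unfolding boundary_def by blast

lemma c_differentiable: "0 < t \<Longrightarrow> t \<notin> F \<Longrightarrow> c differentiable (at t)"
  using boundary unfolding boundary_def by auto

lemma F_null: "closed F" "emeasure lborel F = 0"
  using boundary unfolding boundary_def by auto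

lemma c_isCont:
  assumes t: "0 < t" shows "isCont c t"
  unfolding continuous_at_eps_delta
proof (intro allI impI)
  fix e :: real assume e: "0 < e"
  have "abs_continuous_on {t / 2..2 * t} c" using t by (intro c_abs_continuous) auto
  from mp[OF spec[OF this[unfolded abs_continuous_on_def]] e] obtain d where d: "0 < d"
    and *: "\<forall>(n::nat) a b. (\<forall>i<n. a i \<le> b i \<and> {a i..b i} \<subseteq> {t / 2..2 * t}) \<and>
        (\<forall>i<n. \<forall>j<n. i \<noteq> j \<longrightarrow> {a i<..<b i} \<inter> {a j<..<b j} = {}) \<and>
        (\<Sum>i<n. b i - a i) < d \<longrightarrow> (\<Sum>i<n. \<bar>c (b i) - c (a i)\<bar>) < e"
    by (elim exE conjE) (rule that)
  show "\<exists>d>0. \<forall>x. dist x t < d \<longrightarrow> dist (c x) (c t) < e"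
  proof (intro exI[of _ "min d (t / 2)"] conjI allI impI)
    fix x assume x: "dist x t < min d (t / 2)"
    have "\<bar>c (max x t) - c (min x t)\<bar> < e"
      using spec[OF spec[OF spec[OF *, of "1::nat"], of "\<lambda>_. min x t"], of "\<lambda>_. max x t"] x t
      by (auto simp: dist_real_def abs_less_iff min_def max_def split: if_splits)
    then show "dist (c x) (c t) < e" by (auto simp: dist_real_def max_def min_def abs_minus_commute split: if_splits)
  qed (use d t in auto)
qed

lemma c_tendsto: "(ts \<longlongrightarrow> t) G \<Longrightarrow> 0 < t \<Longrightarrow> ((\<lambda>n. c (ts n)) \<longlongrightarrow> c t) G"
  using isCont_tendsto_compose[OF c_isCont] by blast

lemma c_continuous_on: "continuous_on {0<..} c"
  using c_isCont by (auto intro: continuous_at_imp_continuous_on)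

abbreviation "\<tau> \<equiv> passage_time X c"
abbreviation "T \<omega> \<equiv> real_of_ereal (\<tau> \<omega>)"
abbreviation "U \<equiv> pre_passage X c"
abbreviation "V \<equiv> passage_jump X c"

text \<open>An interval starting at \<open>0\<close>, since \<open>c\<close> is non-increasing with
  \<open>c(0+) > 0\<close>. On its compact subintervals the density is evaluated at levels bounded
  away from \<open>0\<close>.\<close>

definition active :: "real set" where
  "active = {t. 0 < t \<and> 0 < c t}"

lemma c_right_0: "\<exists>l>0. \<forall>\<^sub>F t in at_right 0. l < c t"
proof -
  obtain L where L: "L > 0" "((\<lambda>t. ereal (c t)) \<longlongrightarrow> L) (at_right 0)"
    using boundary unfolding boundary_def by blast
  obtain l where l: "0 < ereal l" "ereal l < L" using ereal_dense2[OF L(1)] by auto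
  have "\<forall>\<^sub>F t in at_right 0. ereal l < ereal (c t)" by (rule order_tendstoD(1)[OF L(2) l(2)])
  then show ?thesis using l(1) by (intro exI[of _ l]) simp
qed

lemma S_right_continuous: "\<omega> \<in> space M \<Longrightarrow> 0 \<le> t \<Longrightarrow> ((\<lambda>s. S s \<omega>) \<longlongrightarrow> S t \<omega>) (at_right t)"
  unfolding norm_process_def by (intro tendsto_l1norm cadlag_at_right cadlag_paths)

lemma \<tau>_less_iff: "\<tau> \<omega> < y \<longleftrightarrow> (\<exists>s>0. ereal s < y \<and> c s < S s \<omega>)"
  unfolding passage_time_def by (auto simp: Inf_less_iff)

lemma \<tau>_le: "0 < t \<Longrightarrow> c t < S t \<omega> \<Longrightarrow> \<tau> \<omega> \<le> ereal t"
  unfolding passage_time_def by (intro Inf_lower) auto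

lemma \<tau>_nonneg: "0 \<le> \<tau> \<omega>"
  unfolding passage_time_def by (intro Inf_greatest) auto

definition monotone_path :: "'w \<Rightarrow> bool" where
  "monotone_path \<omega> \<longleftrightarrow> \<omega> \<in> space M \<and> (\<forall>s t. 0 \<le> s \<longrightarrow> s \<le> t \<longrightarrow> X s \<omega> \<le> X t \<omega>)"

lemma AE_monotone_path: "AE \<omega> in M. monotone_path \<omega>"
  using AE_mono AE_space unfolding monotone_path_def by eventually_elim auto

lemma S_mono: "monotone_path \<omega> \<Longrightarrow> 0 \<le> s \<Longrightarrow> s \<le> t \<Longrightarrow> S s \<omega> \<le> S t \<omega>"
  unfolding monotone_path_def norm_process_def by (auto intro!: l1norm_mono X_nonneg)

lemma \<tau>_ge:
  assumes "monotone_path \<omega>" "0 < t" "S t \<omega> \<le> c t"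
  shows "ereal t \<le> \<tau> \<omega>"
proof (rule ccontr)
  assume "\<not> ereal t \<le> \<tau> \<omega>"
  then obtain s where s: "0 < s" "s < t" "c s < S s \<omega>" unfolding not_le \<tau>_less_iff by auto
  then show False using S_mono[OF assms(1), of s t] c_antimono[of s t] assms by simp
qed

text \<open>Whether passage has occurred is decided by the position at \<open>t\<close> alone. If
  \<open>S t \<omega>\<close> is below \<open>c t\<close>, right-continuity keeps the path below for
  a while and monotonicity excludes earlier passage. In case of equality the path may exceed the
  boundary immediately after \<open>t\<close>, so that the infimum is \<open>t\<close>.\<close>

lemma \<tau>_le_iff:
  assumes m: "monotone_path \<omega>" and t: "0 < t" and ne: "S t \<omega> \<noteq> c t"
  shows "\<tau> \<omega> \<le> ereal t \<longleftrightarrow> c t < S t \<omega>"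
proof
  assume le: "\<tau> \<omega> \<le> ereal t"
  show "c t < S t \<omega>"
  proof (rule ccontr)
    assume "\<not> c t < S t \<omega>"
    then have lt: "S t \<omega> - c t < 0" using ne by simp
    have w: "\<omega> \<in> space M" using m by (simp add: monotone_path_def)
    have "((\<lambda>s. S s \<omega> - c s) \<longlongrightarrow> S t \<omega> - c t) (at_right t)"
      using t by (intro tendsto_diff S_right_continuous w c_tendsto tendsto_ident_at) auto
    from order_tendstoD(2)[OF this lt] obtain b where b: "b > t" "\<And>s. t < s \<Longrightarrow> s < b \<Longrightarrow> S s \<omega> - c s < 0"
      unfolding eventually_at_right_field by blast
    have "ereal ((t + b) / 2) \<le> \<tau> \<omega>"
      using b(1) b(2)[of "(t + b) / 2"] t by (intro \<tau>_ge[OF m]) auto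
    also note le
    finally show False using b(1) by simp
  qed
qed (rule \<tau>_le[OF t])

lemma \<tau>_pos:
  assumes m: "monotone_path \<omega>" shows "0 < \<tau> \<omega>"
proof -
  have w: "\<omega> \<in> space M" using m by (simp add: monotone_path_def)
  obtain l where l: "0 < l" "\<forall>\<^sub>F t in at_right 0. l < c t" using c_right_0 by blast
  have "\<forall>\<^sub>F t in at_right 0. S t \<omega> < l"
    using S_right_continuous[OF w, of 0] l(1) by (intro order_tendstoD(2)) (auto simp: S_start[OF w])
  with l(2) have "\<forall>\<^sub>F t in at_right 0. S t \<omega> < c t" by eventually_elim simp
  then obtain b where b: "b > 0" "\<And>t. 0 < t \<Longrightarrow> t < b \<Longrightarrow> S t \<omega> < c t"
    unfolding eventually_at_right_field by blast
  have "ereal (b / 2) \<le> \<tau> \<omega>" using b(1) b(2)[of "b / 2"] by (intro \<tau>_ge[OF m]) auto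
  moreover have "0 < ereal (b / 2)" using b(1) by simp
  ultimately show ?thesis by (rule order_less_le_trans[rotated])
qed

text \<open>\<open>S 1\<close> has a density, so it is positive almost surely and the mean of
  \<open>exp (- S 1 \<omega>)\<close> is below \<open>1\<close>.\<close>

lemma psi_one_pos: "0 < \<psi> (\<chi> i. 1)"
proof -
  have one: "0 \<le> ((\<chi> i. 1)::real^'d)" by (auto simp: less_eq_vec_def)
  have [measurable]: "S 1 \<in> borel_measurable M" "X 1 \<in> borel_measurable M" by (auto intro!: measurable_S measurable_X)
  have eq: "(\<integral>\<omega>. exp (- S 1 \<omega>) \<partial>M) = exp (- \<psi> (\<chi> i. 1))"
  proof -
    have "(\<integral>\<omega>. exp (- S 1 \<omega>) \<partial>M) = (\<integral>\<omega>. exp (- ((\<chi> i. 1) \<bullet> X 1 \<omega>)) \<partial>M)"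
      unfolding norm_process_def by (intro Bochner_Integration.integral_cong refl) (simp add: l1norm_eq_inner X_nonneg)
    then show ?thesis using laplace[of 1, OF _ one] by simp
  qed
  have "(\<integral>\<omega>. exp (- S 1 \<omega>) \<partial>M) < (\<integral>\<omega>. 1 \<partial>M)"
  proof (rule integral_less_AE_space)
    show "integrable M (\<lambda>\<omega>. exp (- S 1 \<omega>))" by (rule integrable_const_bound[where B=1]) auto
    show "AE \<omega> in M. exp (- S 1 \<omega>) < 1"
      using AE_S_neq[OF zero_less_one, of 0] by eventually_elim (use S_nonneg[of 1] in \<open>auto simp: less_le\<close>)
  qed (auto simp: emeasure_space_1)
  then show ?thesis unfolding eq by (simp add: prob_space)
qed

text \<open>A Chernoff bound: for every \<open>k\<close> the probability that \<open>S\<close> never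
  exceeds \<open>y\<close> at integer times is at most
  \<open>exp y * exp (- real (Suc k) * ?P)\<close>, with a positive exponent
  \<open>?P\<close>.\<close>

lemma AE_S_exceeds: "AE \<omega> in M. \<exists>k::nat. y < S (real (Suc k)) \<omega>"
proof -
  let ?P = "\<psi> (\<chi> i. 1)"
  have one: "0 \<le> ((\<chi> i. 1)::real^'d)" by (auto simp: less_eq_vec_def)
  have [measurable]: "S (real (Suc k)) \<in> borel_measurable M" for k by (intro measurable_S) simp
  let ?N = "{\<omega>\<in>space M. \<forall>k. S (real (Suc k)) \<omega> \<le> y}"
  have N: "?N \<in> sets M" by measurable
  have le: "measure M ?N \<le> exp y * exp (- real (Suc k) * ?P)" for k
  proof -
    have "measure M ?N = (\<integral>\<omega>. indicator ?N \<omega> \<partial>M)" using N by simp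
    also have "\<dots> \<le> (\<integral>\<omega>. exp y * exp (- S (real (Suc k)) \<omega>) \<partial>M)"
    proof (rule integral_mono)
      show "integrable M (indicator ?N :: 'w \<Rightarrow> real)" using N by (simp add: emeasure_eq_measure)
      show "integrable M (\<lambda>\<omega>. exp y * exp (- S (real (Suc k)) \<omega>))"
        by (intro integrable_mult_right integrable_const_bound[where B=1]) (auto simp del: of_nat_Suc)
      show "indicator ?N \<omega> \<le> exp y * exp (- S (real (Suc k)) \<omega>)" for \<omega>
        by (auto simp: indicator_def exp_add[symmetric] simp del: of_nat_Suc)
    qed
    also have "\<dots> = exp y * (\<integral>\<omega>. exp (- ((\<chi> i. 1) \<bullet> X (real (Suc k)) \<omega>)) \<partial>M)"
      unfolding norm_process_def
      by (subst integral_mult_right_zero, intro arg_cong[where f="\<lambda>x. exp y * x"] Bochner_Integration.integral_cong refl)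
         (simp add: l1norm_eq_inner X_nonneg del: of_nat_Suc)
    also have "\<dots> = exp y * exp (- real (Suc k) * ?P)"
      by (subst laplace[OF _ one]) simp_all
    finally show ?thesis .
  qed
  have lim: "(\<lambda>k. exp y * exp (- ?P) ^ Suc k) \<longlonglongrightarrow> exp y * 0"
    using psi_one_pos by (intro tendsto_mult tendsto_const LIMSEQ_Suc LIMSEQ_realpow_zero) auto
  have eq: "exp (- ?P) ^ Suc k = exp (- real (Suc k) * ?P)" for k
    by (simp only: exp_of_nat_mult[symmetric] mult_minus_right mult_minus_left)
  have "(\<lambda>k. exp y * exp (- real (Suc k) * ?P)) \<longlonglongrightarrow> 0"
    using lim unfolding eq mult_zero_right .
  then have "measure M ?N \<le> 0"
    using LIMSEQ_le_const[of _ 0 "measure M ?N"] le by blast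
  then have "emeasure M ?N = 0" by (simp add: emeasure_eq_measure measure_le_0_iff)
  then show ?thesis
    using N by (intro AE_I[where N="?N"]) (auto simp: not_less)
qed

text \<open>\<open>active\<close> is the half-line or \<open>(0, z)\<close>, with \<open>z\<close>
  the first time at which \<open>c\<close> is not positive. The intervals stay clear of its ends,
  and almost surely the passage occurs by some \<open>q k\<close>.\<close>

lemma active_exhaustion:
  obtains p q :: "nat \<Rightarrow> real"
  where "\<And>k. p k \<in> active" "\<And>k. q k \<in> active" "\<And>k. p k < q k"
    "incseq (\<lambda>k. {p k<..q k})" "active = (\<Union>k. {p k<..q k})"
    "AE \<omega> in M. \<exists>k. c (q k) < S (q k) \<omega>"
proof (cases "\<forall>t>0. 0 < c t")
  case True
  let ?p = "\<lambda>k. 1 / (real k + 2)" and ?q = "\<lambda>k. real (Suc k)"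
  have pq: "?p k < ?q k" "0 < ?p k" for k
  proof -
    have "?p k < 1" by simp
    also have "1 \<le> ?q k" by simp
    finally show "?p k < ?q k" .
  qed simp
  show ?thesis
  proof
    show "?p k \<in> active" "?q k \<in> active" "?p k < ?q k" for k
      using True pq[of k] by (auto simp: active_def)
    show "incseq (\<lambda>k. {?p k<..?q k})"
      by (rule incseq_Ioc) (auto intro!: divide_left_mono)
    show "active = (\<Union>k. {?p k<..?q k})"
    proof (intro equalityI subsetI)
      fix t assume "t \<in> active"
      then have t: "0 < t" by (simp add: active_def)
      obtain n where n: "t \<le> real n" using real_arch_simple by blast
      obtain m where m: "1 / t < real m" using reals_Archimedean2 by blast
      have "1 / t < real (max m n) + 2" using m by (auto simp: max_def)
      then have "?p (max m n) < t" using t by (simp add: field_simps)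
      moreover have "t \<le> ?q (max m n)" using n by (auto simp: max_def)
      ultimately show "t \<in> (\<Union>k. {?p k<..?q k})"
        by (intro UN_I[of "max m n"]) (simp_all del: of_nat_Suc)
    next
      fix t assume "t \<in> (\<Union>k. {?p k<..?q k})"
      then obtain k where "?p k < t" by auto
      then have "0 < t" using pq(2)[of k] by linarith
      then show "t \<in> active" using True by (simp add: active_def)
    qed
    show "AE \<omega> in M. \<exists>k. c (?q k) < S (?q k) \<omega>"
      \<comment> \<open>From time \<open>1\<close> on the boundary is at most \<open>c 1\<close>,
        which \<open>S\<close> eventually exceeds.\<close>
      using AE_S_exceeds[of "c 1"]
    proof eventually_elim
      case (elim \<omega>)
      then obtain k where k: "c 1 < S (real (Suc k)) \<omega>" by blast
      have "c (real (Suc k)) \<le> c 1" by (rule c_antimono) auto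
      then show ?case using k by (intro exI[of _ k]) linarith
    qed
  qed
next
  case False
  let ?Z = "{t. 0 < t \<and> c t \<le> 0}"
  define z where "z = Inf ?Z"
  obtain t0 where "0 < t0" "\<not> 0 < c t0" using False by blast
  then have "t0 \<in> ?Z" by simp
  then have ne: "?Z \<noteq> {}" by blast
  have bd: "bdd_below ?Z" by (rule bdd_belowI[of _ 0]) auto
  have z0: "0 < z"
  proof -
    obtain l where l: "0 < l" "\<forall>\<^sub>F t in at_right 0. l < c t" using c_right_0 by blast
    then obtain b where b: "b > 0" "\<And>t. 0 < t \<Longrightarrow> t < b \<Longrightarrow> l < c t"
      unfolding eventually_at_right_field by blast
    have "b \<le> z" unfolding z_def
    proof (rule cInf_greatest[OF ne])
      fix t assume "t \<in> ?Z"
      then show "b \<le> t" using b(2)[of t] l(1) by force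
    qed
    then show ?thesis using b(1) by simp
  qed
  have lt: "0 < c t" if "0 < t" "t < z" for t
  proof (rule ccontr)
    assume "\<not> 0 < c t"
    then have "z \<le> t" unfolding z_def using that by (intro cInf_lower bd) auto
    then show False using that by simp
  qed
  have gt: "c t \<le> 0" if "z < t" for t
  proof -
    have "Inf ?Z < t" using that by (simp only: z_def)
    from cInf_lessD[OF ne this] obtain s where "s \<in> ?Z" "s < t" by blast
    then show ?thesis using c_antimono[of s t] by auto
  qed
  have cz: "c z \<le> 0"
  proof (rule tendsto_upperbound)
    show "(c \<longlongrightarrow> c z) (at_right z)" using z0 by (intro c_tendsto tendsto_ident_at)
    show "\<forall>\<^sub>F t in at_right z. c t \<le> 0"
      unfolding eventually_at_right_field using gt by (intro exI[of _ "z + 1"]) auto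
  qed simp
  have act: "active = {0<..<z}"
  proof (intro equalityI subsetI)
    fix t assume t: "t \<in> active"
    then have "t \<noteq> z" "\<not> z < t" using cz gt[of t] by (auto simp: active_def)
    then show "t \<in> {0<..<z}" using t by (auto simp: active_def)
  qed (auto simp: active_def lt)
  \<comment> \<open>The \<open>+ 3\<close> gives \<open>d k < z / 2\<close>, hence
    \<open>d k < z - d k\<close>.\<close>
  define d where "d k = z / (real k + 3)" for k :: nat
  have e: "0 < d k" "d k < z / 2" for k
  proof -
    show "0 < d k" using z0 by (simp add: d_def)
    show "d k < z / 2" unfolding d_def by (rule divide_strict_left_mono) (use z0 in simp_all)
  qed
  have e0: "d \<longlonglongrightarrow> 0"
    unfolding d_def using LIMSEQ_ignore_initial_segment[OF lim_const_over_n[of z], of 3] by (simp add: add.commute)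
  let ?p = d and ?q = "\<lambda>k. z - d k"
  have q0: "?q \<longlonglongrightarrow> z" using tendsto_diff[OF tendsto_const e0, of z] by simp
  show ?thesis
  proof
    show "?p k \<in> active" "?q k \<in> active" "?p k < ?q k" for k
      using e[of k] z0 unfolding act by auto
    have "d (Suc k) \<le> d k" for k unfolding d_def using z0 by (intro divide_left_mono) auto
    then show "incseq (\<lambda>k. {?p k<..?q k})"
      by (intro incseq_Ioc) simp_all
    show "active = (\<Union>k. {?p k<..?q k})"
    proof (intro equalityI subsetI)
      fix t assume "t \<in> active"
      then have t: "0 < t" "t < z" by (auto simp: act)
      have "\<forall>\<^sub>F k in sequentially. ?p k < t" using order_tendstoD(2)[OF e0 t(1)] .
      moreover have "\<forall>\<^sub>F k in sequentially. t < ?q k" using order_tendstoD(1)[OF q0 t(2)] .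
      ultimately have "\<forall>\<^sub>F k in sequentially. t \<in> {?p k<..?q k}" by eventually_elim simp
      then show "t \<in> (\<Union>k. {?p k<..?q k})" by (auto dest!: eventually_happens)
    next
      fix t assume "t \<in> (\<Union>k. {?p k<..?q k})"
      then obtain k where k: "?p k < t" "t \<le> ?q k" by auto
      then show "t \<in> active" using e(1)[of k] unfolding act by simp
    qed
    have cq: "(\<lambda>k. c (?q k)) \<longlonglongrightarrow> c z" using z0 by (intro c_tendsto q0)
    have q00: "0 < ?q 0" using e[of 0] z0 by simp
    show "AE \<omega> in M. \<exists>k. c (?q k) < S (?q k) \<omega>"
      using AE_S_neq[OF q00, of 0] AE_monotone_path
    proof eventually_elim
      case (elim \<omega>)
      \<comment> \<open>\<open>S\<close> is already positive at time \<open>?q 0\<close>, while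
        \<open>c (?q k)\<close> tends to \<open>c z \<le> 0\<close>.\<close>
      then have "c z < S (?q 0) \<omega>" using cz S_nonneg[of "?q 0" \<omega>] by linarith
      from order_tendstoD(2)[OF cq this] obtain k where k: "c (?q k) < S (?q 0) \<omega>"
        by (auto dest!: eventually_happens)
      have "d k \<le> d 0" unfolding d_def using z0 by (intro divide_left_mono) auto
      then have "?q 0 \<le> ?q k" by simp
      then have "S (?q 0) \<omega> \<le> S (?q k) \<omega>" using q00 by (intro S_mono elim) auto
      then show ?case using k by (intro exI[of _ k]) linarith
    qed
  qed
qed

lemma active_interval:
  assumes "a \<in> active" "b \<in> active" "a \<le> t" "t \<le> b" shows "t \<in> active"
  using assms c_antimono[of t b] by (auto simp: active_def)

lemma AE_T_active: "AE \<omega> in M. \<tau> \<omega> = ereal (T \<omega>) \<and> T \<omega> \<in> active"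
proof -
  obtain p q where pq: "\<And>k. p k \<in> active" "\<And>k. q k \<in> active" "\<And>k::nat. p k < q k"
    "AE \<omega> in M. \<exists>k. c (q k) < S (q k) \<omega>"
    using active_exhaustion by metis
  show ?thesis
    using pq(4) AE_monotone_path
  proof eventually_elim
    case (elim \<omega>)
    then obtain k where k: "c (q k) < S (q k) \<omega>" by blast
    have q: "0 < q k" "0 < c (q k)" using pq(2)[of k] by (auto simp: active_def)
    have le: "\<tau> \<omega> \<le> ereal (q k)" by (rule \<tau>_le[OF q(1) k])
    have pos: "0 < \<tau> \<omega>" by (rule \<tau>_pos[OF elim(2)])
    obtain t where t: "\<tau> \<omega> = ereal t" using le pos by (cases "\<tau> \<omega>") auto
    then have "0 < t" "t \<le> q k" using le pos by auto
    then have "t \<in> active" using q c_antimono[of t "q k"] by (auto simp: active_def)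
    then show ?case using t by simp
  qed
qed

text \<open>The union over all times reduces to rational ones, because \<open>S - c\<close> is
  right-continuous and a strict inequality persists to the right.\<close>

lemma measurable_\<tau> [measurable]: "\<tau> \<in> borel_measurable M"
proof (rule borel_measurableI_less[where f = \<tau>])
  fix y :: ereal
  have "{\<omega> \<in> space M. \<tau> \<omega> < y} = (\<Union>s\<in>{s\<in>\<rat>. 0 < s \<and> ereal s < y}. {\<omega>\<in>space M. c s < S s \<omega>})"
  proof (intro equalityI subsetI)
    fix \<omega> assume "\<omega> \<in> {\<omega> \<in> space M. \<tau> \<omega> < y}"
    then have w: "\<omega> \<in> space M" and "\<tau> \<omega> < y" by auto
    then obtain s where s: "0 < s" "ereal s < y" "c s < S s \<omega>" unfolding \<tau>_less_iff by blast
    have "((\<lambda>s. S s \<omega> - c s) \<longlongrightarrow> S s \<omega> - c s) (at_right s)"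
      using s by (intro tendsto_diff S_right_continuous w c_tendsto tendsto_ident_at) auto
    moreover have "0 < S s \<omega> - c s" using s by simp
    ultimately have "\<forall>\<^sub>F r in at_right s. 0 < S r \<omega> - c r" by (rule order_tendstoD(1))
    then obtain b where b: "b > s" "\<And>r. s < r \<Longrightarrow> r < b \<Longrightarrow> 0 < S r \<omega> - c r"
      unfolding eventually_at_right_field by blast
    obtain r' where r': "ereal s < ereal r'" "ereal r' < y" using ereal_dense2[OF s(2)] by auto
    obtain r where r: "r \<in> \<rat>" "s < r" "r < min b r'" using Rats_dense_in_real[of s "min b r'"] b(1) r' by auto
    then have "ereal r < y" using r'(2) by (auto intro: order_less_trans[of "ereal r" "ereal r'"])
    moreover have "c r < S r \<omega>" using b(2)[of r] r by auto
    ultimately show "\<omega> \<in> (\<Union>s\<in>{s\<in>\<rat>. 0 < s \<and> ereal s < y}. {\<omega>\<in>space M. c s < S s \<omega>})"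
      using r s(1) w by (intro UN_I[of r]) auto
  next
    fix \<omega> assume "\<omega> \<in> (\<Union>s\<in>{s\<in>\<rat>. 0 < s \<and> ereal s < y}. {\<omega>\<in>space M. c s < S s \<omega>})"
    then show "\<omega> \<in> {\<omega> \<in> space M. \<tau> \<omega> < y}" unfolding \<tau>_less_iff by auto
  qed
  also have "\<dots> \<in> sets M"
  proof (rule sets.countable_UN'')
    show "countable {s\<in>\<rat>. 0 < s \<and> ereal s < y}" by (rule countable_subset[OF _ countable_rat]) auto
    fix s assume "s \<in> {s\<in>\<rat>. 0 < s \<and> ereal s < y}"
    then have [measurable]: "S s \<in> borel_measurable M" by (intro measurable_S) simp
    show "{\<omega>\<in>space M. c s < S s \<omega>} \<in> sets M" by measurable
  qed
  finally show "{\<omega> \<in> space M. \<tau> \<omega> < y} \<in> sets M" .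
qed

lemma T_nonneg: "0 \<le> T \<omega>"
  using \<tau>_nonneg[of \<omega>] by (rule real_of_ereal_pos)

lemma measurable_T [measurable]: "(\<lambda>\<omega>. T \<omega>) \<in> borel_measurable M"
  by measurable

text \<open>The left limit is taken along \<open>T \<omega> - T \<omega> / Suc n\<close>, which is
  measurable in \<omega>. For \<open>T \<omega> = 0\<close> the convention in
  \<open>left_limit\<close> agrees with the constant sequence \<open>X 0\<close>.\<close>

lemma measurable_U [measurable]: "U \<in> borel_measurable M"
proof (rule borel_measurable_LIMSEQ_metric)
  show "(\<lambda>\<omega>. X (max 0 (T \<omega> - T \<omega> / real (Suc n))) \<omega>) \<in> borel_measurable M" for n
    by measurable
  fix \<omega> assume w: "\<omega> \<in> space M"
  let ?s = "\<lambda>n. max 0 (T \<omega> - T \<omega> / real (Suc n))"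
  show "(\<lambda>n. X (?s n) \<omega>) \<longlonglongrightarrow> U \<omega>"
  proof (cases "T \<omega> = 0")
    case True
    then show ?thesis by (simp add: pre_passage_def left_limit_def)
  next
    case False
    then have T: "0 < T \<omega>" using T_nonneg[of \<omega>] by simp
    have "(\<lambda>n. T \<omega> - T \<omega> / real (Suc n)) \<longlonglongrightarrow> T \<omega> - 0"
      by (intro tendsto_diff tendsto_const LIMSEQ_Suc[OF lim_const_over_n])
    then have "?s \<longlonglongrightarrow> max 0 (T \<omega>)" by (intro tendsto_max tendsto_const) simp
    then have "?s \<longlonglongrightarrow> T \<omega>" using T by simp
    moreover have "?s n < T \<omega>" for n using T by simp
    ultimately have "filterlim ?s (at_left (T \<omega>)) sequentially"
      by (intro tendsto_imp_filterlim_at_left always_eventually allI)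
    then show ?thesis
      unfolding pre_passage_def
      using filterlim_compose[OF cadlag_left_limit[OF cadlag_paths[OF w] T]] by blast
  qed
qed

lemma measurable_V [measurable]: "V \<in> borel_measurable M"
proof -
  have "(\<lambda>\<omega>. X (max 0 (T \<omega>)) \<omega> - U \<omega>) \<in> borel_measurable M" by measurable
  moreover have "(\<lambda>\<omega>. X (max 0 (T \<omega>)) \<omega> - U \<omega>) = V"
    by (rule ext) (simp add: passage_jump_def max_absorb2[OF T_nonneg])
  ultimately show ?thesis by simp
qed

text \<open>Almost surely at most one summand survives, that of the cell containing the passage
  time. Its arguments, the state at the left end and the increment over the cell, are discrete
  stand-ins for \<open>U\<close> and \<open>V\<close>.\<close>

definition crossing_sum :: "(real^'d \<Rightarrow> real) \<Rightarrow> (real^'d \<Rightarrow> real) \<Rightarrow> real \<Rightarrow> real \<Rightarrow> nat \<Rightarrow> 'w \<Rightarrow> real" where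
  "crossing_sum f1 f2 a b n \<omega> = (\<Sum>k<Suc n. f1 (X (grid a b n k) \<omega>) *
     f2 (X (grid a b n (Suc k)) \<omega> - X (grid a b n k) \<omega>) *
     indicator {\<omega>. S (grid a b n k) \<omega> \<le> c (grid a b n k) \<and> c (grid a b n (Suc k)) < S (grid a b n (Suc k)) \<omega>} \<omega>)"

text \<open>By \<open>\<tau>_le_iff\<close> the event attached to a cell says that \<open>T\<close>
  lies in it. The exceptional equality of \<open>S\<close> and \<open>c\<close> is null at each of
  the countably many grid points of all meshes together.\<close>

lemma AE_crossing_sum:
  assumes ab: "a \<in> active" "a < b"
  shows "AE \<omega> in M. \<forall>n. crossing_sum f1 f2 a b n \<omega> =
    (if T \<omega> \<in> {a<..b} then f1 (X (grid a b n (cell a b n (T \<omega>))) \<omega>) *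
       f2 (X (grid a b n (Suc (cell a b n (T \<omega>)))) \<omega> - X (grid a b n (cell a b n (T \<omega>))) \<omega>) else 0)"
proof -
  have a: "0 < a" using ab by (simp add: active_def)
  have pos: "0 < grid a b n k" for n k
    using grid_mono[of a b 0 k n] ab a by (simp add: grid_ends)
  have "AE \<omega> in M. \<forall>n k. S (grid a b n k) \<omega> \<noteq> c (grid a b n k)"
    by (intro AE_all_countable[THEN iffD2] allI AE_S_neq pos)
  then show ?thesis
    using AE_monotone_path AE_T_active
  proof eventually_elim
    case (elim \<omega>)
    have iff: "T \<omega> \<le> grid a b n k \<longleftrightarrow> c (grid a b n k) < S (grid a b n k) \<omega>" for n k
      using \<tau>_le_iff[OF elim(2) pos, of n k] elim(1,3) by (metis ereal_less_eq(3))
    have eq: "indicator {\<omega>. S (grid a b n k) \<omega> \<le> c (grid a b n k) \<and> c (grid a b n (Suc k)) < S (grid a b n (Suc k)) \<omega>} \<omega> =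
      (indicator {grid a b n k<..grid a b n (Suc k)} (T \<omega>) :: real)" for n k
      using iff[of n k] iff[of n "Suc k"] by (auto simp: indicator_def not_le not_less)
    show ?case
      unfolding crossing_sum_def eq sum_cells[OF ab(2)] by simp
  qed
qed

lemma crossing_sum_tendsto:
  assumes ab: "a \<in> active" "a < b"
    and f1: "continuous_on UNIV f1" "\<And>x. \<bar>f1 x\<bar> \<le> 1" and f2: "continuous_on UNIV f2" "\<And>x. 0 \<le> x \<Longrightarrow> \<bar>f2 x\<bar> \<le> 1"
  shows "(\<lambda>n. \<integral>\<omega>. crossing_sum f1 f2 a b n \<omega> \<partial>M) \<longlonglongrightarrow> (\<integral>\<omega>. f1 (U \<omega>) * f2 (V \<omega>) * indicator {a<..b} (T \<omega>) \<partial>M)"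
proof (rule integral_dominated_convergence[where w="\<lambda>_. 1"])
  have a: "0 < a" using ab by (simp add: active_def)
  have pos: "0 < grid a b n k" for n k
    using grid_mono[of a b 0 k n] ab a by (simp add: grid_ends)
  have [measurable]: "f1 \<in> borel_measurable borel" "f2 \<in> borel_measurable borel"
    using f1 f2 by (auto intro: borel_measurable_continuous_onI)
  have [measurable]: "X (grid a b n k) \<in> borel_measurable M" "S (grid a b n k) \<in> borel_measurable M" for n k
    using pos[of n k] by (auto intro!: measurable_X measurable_S)
  have "{\<omega>. S (grid a b n k) \<omega> \<le> c (grid a b n k) \<and> c (grid a b n (Suc k)) < S (grid a b n (Suc k)) \<omega>} \<inter> space M \<in> sets M" for n k
  proof -
    have "{\<omega>\<in>space M. S (grid a b n k) \<omega> \<le> c (grid a b n k) \<and> c (grid a b n (Suc k)) < S (grid a b n (Suc k)) \<omega>} \<in> sets M"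
      by measurable
    then show ?thesis by (simp add: Int_def conj_commute)
  qed
  then have [measurable]: "(\<lambda>\<omega>. indicator {\<omega>. S (grid a b n k) \<omega> \<le> c (grid a b n k) \<and> c (grid a b n (Suc k)) < S (grid a b n (Suc k)) \<omega>} \<omega> :: real) \<in> borel_measurable M" for n k
    by (subst borel_measurable_indicator_iff) simp
  show "crossing_sum f1 f2 a b n \<in> borel_measurable M" for n
    unfolding crossing_sum_def[abs_def] by measurable
  show "(\<lambda>\<omega>. f1 (U \<omega>) * f2 (V \<omega>) * indicator {a<..b} (T \<omega>)) \<in> borel_measurable M" by measurable
  show "AE \<omega> in M. norm (crossing_sum f1 f2 a b n \<omega>) \<le> 1" for n
    using AE_crossing_sum[OF ab, of f1 f2] AE_monotone_path
  proof eventually_elim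
    case (elim \<omega>)
    let ?k = "cell a b n (T \<omega>)"
    have "X (grid a b n ?k) \<omega> \<le> X (grid a b n (Suc ?k)) \<omega>"
      using elim(2) pos[of n ?k] grid_mono[of a b ?k "Suc ?k" n] ab by (auto simp: monotone_path_def)
    then have "0 \<le> X (grid a b n (Suc ?k)) \<omega> - X (grid a b n ?k) \<omega>" by (auto simp: less_eq_vec_def)
    then have "\<bar>f1 (X (grid a b n ?k) \<omega>)\<bar> * \<bar>f2 (X (grid a b n (Suc ?k)) \<omega> - X (grid a b n ?k) \<omega>)\<bar> \<le> 1 * 1"
      by (intro mult_mono f1 f2) auto
    then show ?case using spec[OF elim(1), of n] by (simp add: abs_mult)
  qed
  show "AE \<omega> in M. (\<lambda>n. crossing_sum f1 f2 a b n \<omega>) \<longlonglongrightarrow> f1 (U \<omega>) * f2 (V \<omega>) * indicator {a<..b} (T \<omega>)"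
    using AE_crossing_sum[OF ab, of f1 f2] AE_space AE_T_active
  proof eventually_elim
    case (elim \<omega>)
    then have eq: "crossing_sum f1 f2 a b n \<omega> =
      (if T \<omega> \<in> {a<..b} then f1 (X (grid a b n (cell a b n (T \<omega>))) \<omega>) *
       f2 (X (grid a b n (Suc (cell a b n (T \<omega>)))) \<omega> - X (grid a b n (cell a b n (T \<omega>))) \<omega>) else 0)" for n
      by blast
    show ?case
    proof (cases "T \<omega> \<in> {a<..b}")
      case False
      then have "indicator {a<..b} (T \<omega>) = (0::real)" by (simp add: indicator_def)
      then show ?thesis unfolding eq if_not_P[OF False] by simp
    next
      case True
      then have T: "a < T \<omega>" "T \<omega> \<le> b" "0 < T \<omega>" using a by auto
      have l: "(\<lambda>n. X (grid a b n (cell a b n (T \<omega>))) \<omega>) \<longlonglongrightarrow> U \<omega>"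
        unfolding pre_passage_def
        by (rule filterlim_compose[OF cadlag_left_limit[OF cadlag_paths[OF elim(2)] T(3)] grid_cell_tendsto(3)[OF T(1,2)]])
      \<comment> \<open>\<open>at_right\<close> omits the passage time itself, whereas the right
        grid point may be equal to it; hence open sets and a case split.\<close>
      have r: "(\<lambda>n. X (grid a b n (Suc (cell a b n (T \<omega>)))) \<omega>) \<longlonglongrightarrow> X (T \<omega>) \<omega>"
      proof (rule topological_tendstoI)
        fix W assume W: "open W" "X (T \<omega>) \<omega> \<in> W"
        have "((\<lambda>t. X t \<omega>) \<longlongrightarrow> X (T \<omega>) \<omega>) (at_right (T \<omega>))"
          using T by (intro cadlag_at_right cadlag_paths elim) auto
        from topological_tendstoD[OF this W] obtain e where e: "T \<omega> < e"
          "\<And>y. T \<omega> < y \<Longrightarrow> y < e \<Longrightarrow> X y \<omega> \<in> W"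
          unfolding eventually_at_right_field by blast
        have "\<forall>\<^sub>F n in sequentially. grid a b n (Suc (cell a b n (T \<omega>))) < e"
          by (rule order_tendstoD(2)[OF grid_cell_tendsto(2)[OF T(1,2)] e(1)])
        then show "\<forall>\<^sub>F n in sequentially. X (grid a b n (Suc (cell a b n (T \<omega>)))) \<omega> \<in> W"
        proof eventually_elim
          case (elim n)
          have "T \<omega> \<le> grid a b n (Suc (cell a b n (T \<omega>)))" by (rule cell(3)[OF T(1,2)])
          then show ?case using elim e(2) W(2) by (cases "T \<omega> = grid a b n (Suc (cell a b n (T \<omega>)))") auto
        qed
      qed
      have fc: "isCont f1 x" "isCont f2 x" for x
        using f1(1) f2(1) by (auto simp: continuous_on_eq_continuous_at)
      have "(\<lambda>n. f1 (X (grid a b n (cell a b n (T \<omega>))) \<omega>) *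
       f2 (X (grid a b n (Suc (cell a b n (T \<omega>)))) \<omega> - X (grid a b n (cell a b n (T \<omega>))) \<omega>)) \<longlonglongrightarrow> f1 (U \<omega>) * f2 (X (T \<omega>) \<omega> - U \<omega>)"
        by (intro tendsto_mult isCont_tendsto_compose[OF fc(1) l] isCont_tendsto_compose[OF fc(2)] tendsto_diff l r)
      then show ?thesis
        unfolding eq if_P[OF True] using True by (simp add: passage_jump_def)
    qed
  qed
qed simp

end

section \<open>The slope of the boundary\<close>

text \<open>Applied to an interval of levels and to the slope over a cell of time, it compares both
  integrals with the same constant.\<close>

lemma integral_near_constant:
  fixes f \<rho> :: "'a \<Rightarrow> real"
  assumes "integrable N \<rho>" "integrable N (\<lambda>x. f x * \<rho> x)" "\<And>x. 0 \<le> \<rho> x"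
    and near: "\<And>x. \<rho> x \<noteq> 0 \<Longrightarrow> \<bar>f x - m\<bar> \<le> e"
  shows "\<bar>(\<integral>x. f x * \<rho> x \<partial>N) - m * (\<integral>x. \<rho> x \<partial>N)\<bar> \<le> e * (\<integral>x. \<rho> x \<partial>N)"
proof -
  have eq: "(\<integral>x. f x * \<rho> x \<partial>N) - m * (\<integral>x. \<rho> x \<partial>N) = (\<integral>x. f x * \<rho> x - m * \<rho> x \<partial>N)"
    using assms by simp
  have "\<bar>\<integral>x. f x * \<rho> x - m * \<rho> x \<partial>N\<bar> \<le> (\<integral>x. e * \<rho> x \<partial>N)"
  proof (rule order_trans[OF integral_abs_bound integral_mono])
    fix x
    have "\<bar>f x * \<rho> x - m * \<rho> x\<bar> = \<bar>f x - m\<bar> * \<rho> x"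
      using assms(3)[of x] by (simp add: left_diff_distrib[symmetric] abs_mult)
    also have "\<dots> \<le> e * \<rho> x"
      using near[of x] assms(3)[of x] by (cases "\<rho> x = 0") (auto intro: mult_right_mono)
    finally show "\<bar>f x * \<rho> x - m * \<rho> x\<bar> \<le> e * \<rho> x" .
  qed (use assms in auto)
  then show ?thesis unfolding eq by simp
qed

context boundary_crossing
begin

text \<open>The speed at which the boundary descends, with the value \<open>0\<close> on the null
  set where \<open>c\<close> need not be differentiable.\<close>

definition slope :: "real \<Rightarrow> real" where
  "slope t = (if t \<in> F then 0 else - deriv c t)"

lemma F_borel [measurable]: "F \<in> sets borel"
  using F_null by (simp add: borel_closed)

lemma deriv_nonpos:
  assumes "0 < t" "t \<notin> F" shows "deriv c t \<le> 0"
proof -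
  have "(c has_real_derivative deriv c t) (at t)"
    using c_differentiable[OF assms] by (simp add: DERIV_deriv_iff_real_differentiable)
  then have "((\<lambda>h. (c (t + h) - c t) / h) \<longlongrightarrow> deriv c t) (at_right 0)"
    unfolding DERIV_def by (simp add: filterlim_at_split)
  then show ?thesis
  proof (rule tendsto_upperbound)
    show "\<forall>\<^sub>F h in at_right 0. (c (t + h) - c t) / h \<le> 0"
      unfolding eventually_at_right_field
      using assms(1) c_antimono[of t] by (intro exI[of _ 1]) (auto intro!: divide_nonpos_pos)
  qed simp
qed

lemma slope_nonneg: "0 < t \<Longrightarrow> 0 \<le> slope t"
  using deriv_nonpos[of t] by (simp add: slope_def)

text \<open>A derivative is the limit of difference quotients along \<open>1 / Suc n\<close>, each
  of which is measurable in \<open>t\<close>.\<close>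

lemma measurable_slope [measurable]:
  "(\<lambda>t. indicator {0<..} t * slope t) \<in> borel_measurable borel"
proof -
  have cm: "(\<lambda>t. if 0 < t then c t else 0) \<in> borel_measurable borel"
  proof -
    have "(\<lambda>t. indicator {0<..} t *\<^sub>R c t) \<in> borel_measurable borel"
      by (rule borel_measurable_continuous_on_indicator[OF _ c_continuous_on]) simp
    also have "(\<lambda>t. indicator {0<..} t *\<^sub>R c t) = (\<lambda>t. if 0 < t then c t else 0)"
      by (auto simp: indicator_def)
    finally show ?thesis .
  qed
  let ?c = "\<lambda>t. if 0 < t then c t else 0"
  let ?q = "\<lambda>n t. - ((?c (t + 1 / real (Suc n)) - ?c t) / (1 / real (Suc n)))"
  show ?thesis
  proof (rule borel_measurable_LIMSEQ_real)
    fix n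
    have "(\<lambda>t. ?c (t + 1 / real (Suc n))) \<in> borel_measurable borel"
      by (rule measurable_compose[OF _ cm]) simp
    then show "(\<lambda>t. if 0 < t \<and> t \<notin> F then ?q n t else 0) \<in> borel_measurable borel"
      using cm by measurable
  next
    fix t :: real
    show "(\<lambda>n. if 0 < t \<and> t \<notin> F then ?q n t else 0) \<longlonglongrightarrow> indicator {0<..} t * slope t"
    proof (cases "0 < t \<and> t \<notin> F")
      case True
      then have "(c has_real_derivative deriv c t) (at t)"
        using c_differentiable by (simp add: DERIV_deriv_iff_real_differentiable)
      then have D: "((\<lambda>h. (c (t + h) - c t) / h) \<longlongrightarrow> deriv c t) (at 0)"
        by (simp add: DERIV_def)
      have "filterlim (\<lambda>n. 1 / real (Suc n)) (at 0) sequentially"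
        unfolding filterlim_at using LIMSEQ_Suc[OF lim_const_over_n[of 1]] by (auto simp del: of_nat_Suc)
      from filterlim_compose[OF D this]
      have "(\<lambda>n. - ((c (t + 1 / real (Suc n)) - c t) / (1 / real (Suc n)))) \<longlonglongrightarrow> - deriv c t"
        by (rule tendsto_minus)
      moreover have "?q n t = - ((c (t + 1 / real (Suc n)) - c t) / (1 / real (Suc n)))" for n
        using True by (simp add: add_pos_pos)
      ultimately show ?thesis using True by (simp add: slope_def)
    next
      case False
      then show ?thesis unfolding if_not_P[OF False] by (auto simp: slope_def indicator_def)
    qed
  qed
qed

lemma measurable_slope_Ioc [measurable]:
  assumes "0 < a" shows "(\<lambda>t. indicator {a<..b} t * slope t) \<in> borel_measurable borel"
proof -
  have "(\<lambda>t. indicator {a<..b} t * (indicator {0<..} t * slope t)) \<in> borel_measurable borel"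
    by measurable
  also have "(\<lambda>t. indicator {a<..b} t * (indicator {0<..} t * slope t)) = (\<lambda>t. indicator {a<..b} t * slope t)"
    using assms by (auto simp: indicator_def)
  finally show ?thesis .
qed

text \<open>The gauge integral of the fundamental theorem is a Lebesgue integral here, because
  \<open>slope\<close> is nonnegative at positive times.\<close>

lemma slope_integral:
  assumes ab: "0 < a" "a \<le> b"
  shows "integrable lborel (\<lambda>t. indicator {a<..b} t * slope t)"
    "(\<integral>t. indicator {a<..b} t * slope t \<partial>lborel) = c a - c b"
proof -
  have "((\<lambda>t. if t \<in> F then 0 else deriv c t) has_integral (c b - c a)) {a..b}"
    using ab F_null c_differentiable by (intro abs_continuous_has_integral c_abs_continuous F_borel) auto
  then have "((\<lambda>t. - (if t \<in> F then 0 else deriv c t)) has_integral - (c b - c a)) {a..b}"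
    by (rule has_integral_neg)
  moreover have "(\<lambda>t. - (if t \<in> F then 0 else deriv c t)) = slope"
    by (auto simp: slope_def)
  ultimately have hi: "(slope has_integral (c a - c b)) {a..b}" by simp
  have "(\<integral>\<^sup>+t. ennreal (indicator {a..b} t * slope t) \<partial>lborel) = ennreal (c a - c b)"
    using ab by (intro nn_integral_has_integral_lebesgue[OF _ hi] slope_nonneg) auto
  moreover have "(\<integral>\<^sup>+t. ennreal (indicator {a..b} t * slope t) \<partial>lborel) = (\<integral>\<^sup>+t. ennreal (indicator {a<..b} t * slope t) \<partial>lborel)"
    using AE_lborel_singleton[of a] by (intro nn_integral_cong_AE) (auto simp: indicator_def elim!: eventually_mono)
  ultimately have nn: "(\<integral>\<^sup>+t. ennreal (indicator {a<..b} t * slope t) \<partial>lborel) = ennreal (c a - c b)" by simp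
  have nonneg: "0 \<le> indicator {a<..b} t * slope t" for t
    using ab slope_nonneg[of t] by (auto simp: indicator_def)
  have [measurable]: "(\<lambda>t. indicator {a<..b} t * slope t) \<in> borel_measurable lborel"
    using measurable_slope_Ioc[OF ab(1)] by simp
  show "integrable lborel (\<lambda>t. indicator {a<..b} t * slope t)"
    using nn nonneg by (intro integrableI_nonneg) auto
  show "(\<integral>t. indicator {a<..b} t * slope t \<partial>lborel) = c a - c b"
    using nn nonneg c_antimono[OF ab] by (subst integral_eq_nn_integral) auto
qed

text \<open>The distribution function in \<open>y\<close> of \<open>S t\<close>, weighted by
  \<open>f (X t)\<close>; its density is \<open>slice f t\<close>.\<close>

definition below :: "(real^'d \<Rightarrow> real) \<Rightarrow> real \<Rightarrow> real \<Rightarrow> real" where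
  "below f t y = (\<integral>\<omega>. f (X t \<omega>) * indicator {..y} (S t \<omega>) \<partial>M)"

section \<open>Weighted distribution functions and the mass swept by the boundary\<close>

context
  fixes L :: real and f :: "real^'d \<Rightarrow> real"
  assumes f: "test_function L f"
begin

lemma measurable_f [measurable]: "f \<in> borel_measurable borel"
  using f by (rule test_function_measurable)

lemma integrable_below:
  assumes "0 \<le> t" "A \<in> sets borel" shows "integrable M (\<lambda>\<omega>. f (X t \<omega>) * indicator A (S t \<omega>))"
proof -
  have [measurable]: "X t \<in> borel_measurable M" "S t \<in> borel_measurable M" "A \<in> sets borel"
    using assms by (auto intro!: measurable_X measurable_S)
  show ?thesis
    using test_functionD(2,3)[OF f] by (intro integrable_const_bound[where B=1]) (auto simp: indicator_def)
qed

lemma below_diff: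
  assumes "0 \<le> t" "y1 \<le> y2"
  shows "below f t y2 - below f t y1 = (\<integral>\<omega>. f (X t \<omega>) * indicator {y1<..y2} (S t \<omega>) \<partial>M)"
proof -
  have "below f t y2 - below f t y1 = (\<integral>\<omega>. f (X t \<omega>) * indicator {..y2} (S t \<omega>) - f (X t \<omega>) * indicator {..y1} (S t \<omega>) \<partial>M)"
    unfolding below_def by (intro Bochner_Integration.integral_diff[symmetric] integrable_below assms) auto
  also have "\<dots> = (\<integral>\<omega>. f (X t \<omega>) * indicator {y1<..y2} (S t \<omega>) \<partial>M)"
    using assms(2) by (intro Bochner_Integration.integral_cong refl) (auto simp: indicator_def)
  finally show ?thesis .
qed

lemma below_bounds:
  assumes "0 \<le> t" shows "0 \<le> below f t y" "below f t y \<le> 1"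
proof -
  show "0 \<le> below f t y"
    unfolding below_def using test_functionD(2)[OF f] by (intro integral_nonneg_AE) auto
  have "below f t y \<le> (\<integral>\<omega>. 1 \<partial>M)"
    unfolding below_def using test_functionD(2,3)[OF f]
    by (intro integral_mono integrable_below assms) (auto simp: indicator_def)
  then show "below f t y \<le> 1" by (simp add: prob_space)
qed

lemma below_mono:
  assumes "0 \<le> t" "y1 \<le> y2"
  shows "below f t y1 \<le> below f t y2"
proof -
  have "0 \<le> (\<integral>\<omega>. f (X t \<omega>) * indicator {y1<..y2} (S t \<omega>) \<partial>M)"
    using test_functionD(2)[OF f] by (intro integral_nonneg_AE) auto
  then show ?thesis using below_diff[OF assms] by simp
qed

lemma below_nonpos:
  assumes t: "0 < t" "y \<le> 0" shows "below f t y = 0"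
proof -
  have [measurable]: "X t \<in> borel_measurable M" "S t \<in> borel_measurable M"
    using t by (auto intro!: measurable_X measurable_S)
  have "below f t y = (\<integral>\<omega>. 0 \<partial>M)"
    unfolding below_def
  proof (rule integral_cong_AE)
    show "AE \<omega> in M. f (X t \<omega>) * indicator {..y} (S t \<omega>) = 0"
      using AE_S_neq[OF t(1), of 0]
    proof eventually_elim
      case (elim \<omega>)
      then have "\<not> S t \<omega> \<le> y" using S_nonneg[of t \<omega>] t(2) by linarith
      then show ?case by simp
    qed
  qed measurable
  then show ?thesis by simp
qed

lemma below_slice:
  assumes t: "0 < t" and y: "y1 \<le> y2"
  shows "integrable lborel (\<lambda>x. slice f t x * indicator {y1<..y2} x)"
    "below f t y2 - below f t y1 = (\<integral>x. slice f t x * indicator {y1<..y2} x \<partial>lborel)"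
proof -
  have [measurable]: "slice f t \<in> borel_measurable borel" by (rule measurable_slice[OF f])
  have b: "0 \<le> slice f t x" "slice f t x \<le> gg t x" for x using slice_bounds[OF f] by auto
  have nn: "(\<integral>\<^sup>+x. ennreal (slice f t x * indicator {y1<..y2} x) \<partial>lborel) = ennreal (below f t y2 - below f t y1)"
  proof -
    have "(\<integral>\<^sup>+x. ennreal (slice f t x * indicator {y1<..y2} x) \<partial>lborel) =
      (\<integral>\<^sup>+x. ennreal (slice f t x) * indicator {y1<..y2} x \<partial>lborel)"
      by (intro nn_integral_cong) (auto split: split_indicator)
    also have "\<dots> = (\<integral>\<^sup>+\<omega>. ennreal (f (X t \<omega>)) * indicator {y1<..y2} (S t \<omega>) \<partial>M)"
      using t by (intro slice_density[OF _ f, symmetric]) auto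
    also have "\<dots> = (\<integral>\<^sup>+\<omega>. ennreal (f (X t \<omega>) * indicator {y1<..y2} (S t \<omega>)) \<partial>M)"
      by (intro nn_integral_cong) (auto split: split_indicator)
    also have "\<dots> = ennreal (\<integral>\<omega>. f (X t \<omega>) * indicator {y1<..y2} (S t \<omega>) \<partial>M)"
      using t test_functionD(2)[OF f] by (intro nn_integral_eq_integral integrable_below) auto
    finally show ?thesis using below_diff[of t y1 y2] t y by simp
  qed
  show "integrable lborel (\<lambda>x. slice f t x * indicator {y1<..y2} x)"
    using nn b(1) by (intro integrableI_nonneg) auto
  show "below f t y2 - below f t y1 = (\<integral>x. slice f t x * indicator {y1<..y2} x \<partial>lborel)"
    using nn b(1) below_mono[of t y1 y2] t y by (subst integral_eq_nn_integral) auto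
qed

lemma below_continuous:
  assumes t: "0 < t" and ts: "ts \<longlonglongrightarrow> t" "\<And>n. 0 < ts n" and ys: "ys \<longlonglongrightarrow> y"
  shows "(\<lambda>n. below f (ts n) (ys n)) \<longlonglongrightarrow> below f t y"
  unfolding below_def
proof (rule integral_dominated_convergence[where w="\<lambda>_. 1"])
  have [measurable]: "X t \<in> borel_measurable M" "S t \<in> borel_measurable M"
    "X (ts n) \<in> borel_measurable M" "S (ts n) \<in> borel_measurable M" for n
    using t ts(2)[of n] by (auto intro!: measurable_X measurable_S)
  show "(\<lambda>\<omega>. f (X t \<omega>) * indicator {..y} (S t \<omega>)) \<in> borel_measurable M"
    "(\<lambda>\<omega>. f (X (ts n) \<omega>) * indicator {..ys n} (S (ts n) \<omega>)) \<in> borel_measurable M" for n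
    by measurable
  show "AE \<omega> in M. norm (f (X (ts n) \<omega>) * indicator {..ys n} (S (ts n) \<omega>)) \<le> 1" for n
    using test_functionD(2,3)[OF f] by (intro AE_I2) (auto simp: indicator_def)
  show "AE \<omega> in M. (\<lambda>n. f (X (ts n) \<omega>) * indicator {..ys n} (S (ts n) \<omega>)) \<longlonglongrightarrow> f (X t \<omega>) * indicator {..y} (S t \<omega>)"
    using AE_tendsto[OF t ts(1)] AE_S_neq[OF t, of y]
  proof eventually_elim
    case (elim \<omega>)
    have lim: "(\<lambda>n. ys n - S (ts n) \<omega>) \<longlonglongrightarrow> y - S t \<omega>"
      unfolding norm_process_def by (intro tendsto_intros ys elim)
    have "\<forall>\<^sub>F n in sequentially. indicator {..ys n} (S (ts n) \<omega>) = (indicator {..y} (S t \<omega>) :: real)"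
    proof (cases "S t \<omega> < y")
      case True
      then have "0 < y - S t \<omega>" by simp
      from order_tendstoD(1)[OF lim this] show ?thesis by eventually_elim (use True in simp)
    next
      case False
      then have "y - S t \<omega> < 0" using elim(2) by simp
      from order_tendstoD(2)[OF lim this] show ?thesis by eventually_elim (use False elim(2) in simp)
    qed
    then have "(\<lambda>n. indicator {..ys n} (S (ts n) \<omega>) :: real) \<longlonglongrightarrow> indicator {..y} (S t \<omega>)"
      by (rule tendsto_eventually)
    then show ?case by (intro tendsto_mult test_function_tendsto[OF f] elim(1))
  qed
qed simp

text \<open>A short drop uses the bound \<open>D\<close> on the density over levels at least
  \<open>y0 / 2\<close>. For a longer one the trivial bound \<open>1\<close> is at most
  \<open>(2 / y0) * r\<close>. \<open>C\<close> adds the two constants.\<close>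

lemma below_lipschitz:
  assumes ab: "0 < a" "a \<le> b" and y: "0 < y0" "y0 \<le> y1"
  obtains C where "0 < C" "\<And>t y r. t \<in> {a..b} \<Longrightarrow> y \<in> {y0..y1} \<Longrightarrow> 0 \<le> r \<Longrightarrow> below f t y - below f t (y - r) \<le> C * r"
proof -
  obtain D where D: "0 < D" "\<And>s z. s \<in> {a..b} \<Longrightarrow> z \<in> {y0 / 2..y1} \<Longrightarrow> gg s z \<le> D"
    using gg_bounded[of a b "y0 / 2" y1] assms by auto
  define C where "C = D + 2 / y0"
  show ?thesis
  proof
    show "0 < C" using D y by (simp add: C_def add_pos_pos)
    fix t v r assume t: "t \<in> {a..b}" and v: "v \<in> {y0..y1}" and r: "0 \<le> (r::real)"
    have t0: "0 < t" using t ab by simp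
    show "below f t v - below f t (v - r) \<le> C * r"
    proof (cases "r \<le> y0 / 2")
      case True
      have "below f t v - below f t (v - r) = (\<integral>x. slice f t x * indicator {v - r<..v} x \<partial>lborel)"
        using t0 r by (intro below_slice) auto
      also have "\<dots> \<le> (\<integral>x. D * indicator {v - r<..v} x \<partial>lborel)"
      proof (rule integral_mono)
        show "integrable lborel (\<lambda>x. slice f t x * indicator {v - r<..v} x)" using t0 r by (intro below_slice) auto
        show "slice f t x * indicator {v - r<..v} x \<le> D * indicator {v - r<..v} x" for x
        proof (cases "x \<in> {v - r<..v}")
          case xin: True
          then have "gg t x \<le> D" using t v True by (intro D(2)) auto
          then have "slice f t x \<le> D" using slice_bounds(2)[OF f, of t x] by linarith
          then show ?thesis using xin by simp
        qed simp
      qed (use r in auto)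
      also have "\<dots> = D * r" using r by simp
      also have "\<dots> \<le> C * r" using r y by (intro mult_right_mono) (auto simp: C_def)
      finally show ?thesis .
    next
      case False
      have "below f t v - below f t (v - r) \<le> 1"
        using below_bounds[of t v] below_bounds[of t "v - r"] t0 by linarith
      also have "\<dots> \<le> (2 / y0) * r" using False y by (simp add: field_simps)
      also have "\<dots> \<le> C * r" using r D by (intro mult_right_mono) (auto simp: C_def)
      finally show ?thesis .
    qed
  qed
qed

text \<open>The mass overtaken by the descending boundary while the path stands still: in each cell,
  paths whose norm lies between the new level and the old one.\<close>

definition "riemann_sum a b n = (\<Sum>k<Suc n. below f (grid a b n k) (c (grid a b n k)) - below f (grid a b n k) (c (grid a b n (Suc k))))"

lemma continuous_slice_on:
  assumes "0 < a" "0 < y0"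
  shows "continuous_on ({a..b} \<times> {y0..y1}) (\<lambda>p. slice f (fst p) (snd p))"
  unfolding continuous_on_sequentially
proof (intro allI ballI impI)
  fix x :: "nat \<Rightarrow> real \<times> real" and p
  assume p: "p \<in> {a..b} \<times> {y0..y1}" and "(\<forall>n. x n \<in> {a..b} \<times> {y0..y1}) \<and> x \<longlonglongrightarrow> p"
  then have "(\<lambda>n. fst (x n)) \<longlonglongrightarrow> fst p" "(\<lambda>n. snd (x n)) \<longlonglongrightarrow> snd p" by (auto intro: tendsto_fst tendsto_snd)
  moreover have "0 < fst p" "0 < snd p" using p assms by auto
  ultimately show "((\<lambda>p. slice f (fst p) (snd p)) \<circ> x) \<longlonglongrightarrow> slice f (fst p) (snd p)"
    unfolding o_def by (intro slice_continuous[OF _ _ _ _ f])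
qed

lemma integrable_slice_slope:
  assumes ab: "a \<in> active" "b \<in> active" "a \<le> u" "u \<le> v" "v \<le> b"
  shows "integrable lborel (\<lambda>t. slice f t (c t) * (indicator {u<..v} t * slope t))"
proof -
  have a: "0 < a" "0 < c b" "a \<le> b" using ab by (auto simp: active_def)
  have "compact ((\<lambda>p. slice f (fst p) (snd p)) ` ({a..b} \<times> {c b..c a}))"
    by (intro compact_continuous_image continuous_slice_on a compact_Times) auto
  then have "bounded ((\<lambda>p. slice f (fst p) (snd p)) ` ({a..b} \<times> {c b..c a}))" by (rule compact_imp_bounded)
  then obtain B where "\<forall>v\<in>(\<lambda>p. slice f (fst p) (snd p)) ` ({a..b} \<times> {c b..c a}). norm v \<le> B"
    unfolding bounded_iff by blast
  then have B: "\<bar>slice f t y\<bar> \<le> B" if "t \<in> {a..b}" "y \<in> {c b..c a}" for t y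
    using that by force
  have ct: "c t \<in> {c b..c a}" if "t \<in> {a..b}" for t
    using that a c_antimono[of a t] c_antimono[of t b] by auto
  have "continuous_on {a..b} (\<lambda>t. slice f t (c t))"
  proof -
    have "continuous_on {a..b} (\<lambda>t. (t, c t))"
      by (intro continuous_intros continuous_on_subset[OF c_continuous_on]) (use a in auto)
    moreover have "(\<lambda>t. (t, c t)) ` {a..b} \<subseteq> {a..b} \<times> {c b..c a}" using ct by auto
    ultimately show ?thesis
      using continuous_on_compose2[OF continuous_slice_on[OF a(1,2), of b "c a"], of "{a..b}" "\<lambda>t. (t, c t)"] by simp
  qed
  then have m1: "(\<lambda>t. indicator {a..b} t *\<^sub>R slice f t (c t)) \<in> borel_measurable borel"
    by (intro borel_measurable_continuous_on_indicator) auto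
  have [measurable]: "(\<lambda>t. indicator {u<..v} t * slope t) \<in> borel_measurable borel"
    using ab a by (intro measurable_slope_Ioc) simp
  have "(\<lambda>t. (indicator {a..b} t *\<^sub>R slice f t (c t)) * (indicator {u<..v} t * slope t)) \<in> borel_measurable borel"
    using m1 by measurable
  also have "(\<lambda>t. (indicator {a..b} t *\<^sub>R slice f t (c t)) * (indicator {u<..v} t * slope t)) =
    (\<lambda>t. slice f t (c t) * (indicator {u<..v} t * slope t))"
    using ab by (auto simp: indicator_def fun_eq_iff)
  finally have m: "(\<lambda>t. slice f t (c t) * (indicator {u<..v} t * slope t)) \<in> borel_measurable borel" .
  show ?thesis
  proof (rule Bochner_Integration.integrable_bound)
    show "integrable lborel (\<lambda>t. B * (indicator {u<..v} t * slope t))"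
      using ab a by (intro integrable_mult_right slope_integral) auto
    show "AE t in lborel. norm (slice f t (c t) * (indicator {u<..v} t * slope t)) \<le> norm (B * (indicator {u<..v} t * slope t))"
    proof (intro AE_I2)
      fix t
      show "norm (slice f t (c t) * (indicator {u<..v} t * slope t)) \<le> norm (B * (indicator {u<..v} t * slope t))"
      proof (cases "t \<in> {u<..v}")
        case True
        then have "t \<in> {a..b}" using ab by auto
        then have "\<bar>slice f t (c t)\<bar> \<le> \<bar>B\<bar>" using B[OF _ ct, of t t] by fastforce
        then show ?thesis using True by (simp add: abs_mult mult_right_mono)
      qed simp
    qed
  qed (use m in simp)
qed

text \<open>Over a cell, the level interval has length \<open>c ?u - c ?v\<close>, and the slope has
  this same total mass over the cell. Both integrals are thus within \<epsilon> times this length of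
  one common multiple of it, and the errors telescope.\<close>

lemma riemann_sum_tendsto:
  assumes ab: "a \<in> active" "b \<in> active" "a < b"
  shows "riemann_sum a b \<longlonglongrightarrow> (\<integral>t. slice f t (c t) * (indicator {a<..b} t * slope t) \<partial>lborel)"
proof (rule LIMSEQ_I)
  fix e :: real assume e: "0 < e"
  have a: "0 < a" "0 < c b" "a \<le> b" using ab by (auto simp: active_def)
  \<comment> \<open>The \<open>+ 1\<close> covers a boundary that is constant on the
    interval.\<close>
  define \<epsilon> where "\<epsilon> = e / (2 * (c a - c b + 1))"
  have cab: "c b \<le> c a" using a by (intro c_antimono) auto
  have \<epsilon>: "0 < \<epsilon>" using e cab by (simp add: \<epsilon>_def)
  let ?K = "{a..b} \<times> {c b..c a}"
  have "uniformly_continuous_on ?K (\<lambda>p. slice f (fst p) (snd p))"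
    by (intro compact_uniformly_continuous continuous_slice_on a compact_Times) auto
  then obtain d1 where d1: "0 < d1" "\<And>p q. p \<in> ?K \<Longrightarrow> q \<in> ?K \<Longrightarrow> dist q p < d1 \<Longrightarrow> dist (slice f (fst q) (snd q)) (slice f (fst p) (snd p)) < \<epsilon>"
    using \<epsilon> unfolding uniformly_continuous_on_def by metis
  have "uniformly_continuous_on {a..b} c"
    by (intro compact_uniformly_continuous continuous_on_subset[OF c_continuous_on]) (use a in auto)
  moreover have "0 < d1 / 2" using d1 by simp
  ultimately obtain d2 where d2: "0 < d2" "\<And>s t. s \<in> {a..b} \<Longrightarrow> t \<in> {a..b} \<Longrightarrow> dist t s < d2 \<Longrightarrow> dist (c t) (c s) < d1 / 2"
    unfolding uniformly_continuous_on_def by metis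
  \<comment> \<open>One half of \<open>d1\<close> is spent on the distance in time, the other on the
    distance in level.\<close>
  define d where "d = min d2 (d1 / 2)"
  have d: "0 < d" using d1 d2 by (simp add: d_def)
  have "(\<lambda>n. (b - a) / real (Suc n)) \<longlonglongrightarrow> 0" by (rule LIMSEQ_Suc[OF lim_const_over_n])
  from order_tendstoD(2)[OF this d] obtain N where N: "\<And>n. N \<le> n \<Longrightarrow> (b - a) / real (Suc n) < d"
    unfolding eventually_sequentially by blast
  show "\<exists>no. \<forall>n\<ge>no. norm (riemann_sum a b n - (\<integral>t. slice f t (c t) * (indicator {a<..b} t * slope t) \<partial>lborel)) < e"
  proof (intro exI[of _ N] allI impI)
    fix n assume "N \<le> n"
    then have h: "(b - a) / real (Suc n) < d" by (rule N)
    let ?g = "grid a b n"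
    let ?I = "\<lambda>k. \<integral>t. slice f t (c t) * (indicator {?g k<..?g (Suc k)} t * slope t) \<partial>lborel"
    let ?J = "\<lambda>k. below f (?g k) (c (?g k)) - below f (?g k) (c (?g (Suc k)))"
    have gin: "?g k \<in> {a..b}" "?g (Suc k) \<in> {a..b}" "?g k \<le> ?g (Suc k)" if "k < Suc n" for k
      using grid_bounds[OF a(3), of k n] grid_bounds[OF a(3), of "Suc k" n] grid_mono[OF a(3), of k "Suc k" n] that by auto
    have eqI: "(\<integral>t. slice f t (c t) * (indicator {a<..b} t * slope t) \<partial>lborel) = (\<Sum>k<Suc n. ?I k)"
    proof -
      have "(\<Sum>k<Suc n. ?I k) = (\<integral>t. (\<Sum>k<Suc n. slice f t (c t) * (indicator {?g k<..?g (Suc k)} t * slope t)) \<partial>lborel)"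
        using gin by (intro Bochner_Integration.integral_sum[symmetric] integrable_slice_slope[OF ab(1,2)]) auto
      also have "(\<lambda>t. \<Sum>k<Suc n. slice f t (c t) * (indicator {?g k<..?g (Suc k)} t * slope t)) =
        (\<lambda>t. slice f t (c t) * (indicator {a<..b} t * slope t))"
      proof
        fix t
        have "(\<Sum>k<Suc n. 1 * indicator {?g k<..?g (Suc k)} t) = (indicator {a<..b} t :: real)"
          unfolding sum_cells[OF ab(3)] by (simp add: indicator_def)
        then show "(\<Sum>k<Suc n. slice f t (c t) * (indicator {?g k<..?g (Suc k)} t * slope t)) =
          slice f t (c t) * (indicator {a<..b} t * slope t)"
          unfolding sum_distrib_left[symmetric] sum_distrib_right[symmetric] mult_1 by simp
      qed
      finally show ?thesis by simp
    qed
    have close: "\<bar>?J k - ?I k\<bar> \<le> 2 * \<epsilon> * (c (?g k) - c (?g (Suc k)))" if k: "k < Suc n" for k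
    proof -
      let ?u = "?g k" and ?v = "?g (Suc k)" and ?m = "slice f (?g k) (c (?g k))"
      have uv: "?u \<in> {a..b}" "?v \<in> {a..b}" "?u \<le> ?v" "?v - ?u < d"
        using gin[OF k] h by (auto simp: grid_Suc)
      have u0: "0 < ?u" "0 < ?v" using uv a by auto
      have cuv: "c ?v \<le> c ?u" using uv u0 by (intro c_antimono) auto
      have cin: "c t \<in> {c b..c a}" if "t \<in> {a..b}" for t
        using that a c_antimono[of a t] c_antimono[of t b] by auto
      have cd: "\<bar>c s - c t\<bar> < d1 / 2" if "s \<in> {?u..?v}" "t \<in> {?u..?v}" for s t
        using d2(2)[of t s] that uv by (auto simp: dist_real_def d_def)
      have near: "\<bar>slice f t y - ?m\<bar> \<le> \<epsilon>" if "t \<in> {?u..?v}" "y \<in> {c ?v..c ?u}" for t y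
      proof -
        have tab: "t \<in> {a..b}" using that uv by auto
        have y: "y \<in> {c b..c a}" using that cin[OF uv(1)] cin[OF uv(2)] by auto
        have "dist (t, y) (?u, c ?u) \<le> dist t ?u + dist y (c ?u)"
          unfolding dist_prod_def using sqrt_sum_squares_le_sum[of "dist t ?u" "dist y (c ?u)"] by simp
        also have "dist t ?u < d1 / 2" using that uv by (auto simp: dist_real_def d_def)
        also have "dist y (c ?u) < d1 / 2" using that cd[of ?u ?v] uv(3) by (auto simp: dist_real_def)
        finally have "dist (t, y) (?u, c ?u) < d1" by simp
        then have "dist (slice f t y) ?m < \<epsilon>"
          using d1(2)[of "(?u, c ?u)" "(t, y)"] tab y uv(1) cin[OF uv(1)] by simp
        then show ?thesis by (simp add: dist_real_def)
      qed
      have J: "\<bar>?J k - ?m * (c ?u - c ?v)\<bar> \<le> \<epsilon> * (c ?u - c ?v)"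
      proof -
        have "\<bar>(\<integral>x. slice f ?u x * indicator {c ?v<..c ?u} x \<partial>lborel) - ?m * (\<integral>x. indicator {c ?v<..c ?u} x \<partial>lborel)\<bar> \<le>
          \<epsilon> * (\<integral>x. indicator {c ?v<..c ?u} x \<partial>lborel)"
        proof (rule integral_near_constant)
          show "integrable lborel (\<lambda>x. slice f ?u x * indicator {c ?v<..c ?u} x)"
            by (rule below_slice[OF u0(1) cuv])
          show "integrable lborel (indicator {c ?v<..c ?u} :: real \<Rightarrow> real)" using cuv by simp
          show "\<bar>slice f ?u x - ?m\<bar> \<le> \<epsilon>" if "indicator {c ?v<..c ?u} x \<noteq> (0::real)" for x
            using that uv(3) by (intro near) (auto simp: indicator_def split: if_splits)
        qed simp
        moreover have "(\<integral>x. indicator {c ?v<..c ?u} x \<partial>lborel) = c ?u - c ?v" using cuv by simp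
        ultimately show ?thesis using below_slice(2)[OF u0(1) cuv] by simp
      qed
      have I: "\<bar>?I k - ?m * (c ?u - c ?v)\<bar> \<le> \<epsilon> * (c ?u - c ?v)"
      proof -
        have "\<bar>?I k - ?m * (\<integral>t. indicator {?u<..?v} t * slope t \<partial>lborel)\<bar> \<le> \<epsilon> * (\<integral>t. indicator {?u<..?v} t * slope t \<partial>lborel)"
        proof (rule integral_near_constant)
          show "integrable lborel (\<lambda>t. indicator {?u<..?v} t * slope t)" by (rule slope_integral[OF u0(1) uv(3)])
          show "integrable lborel (\<lambda>t. slice f t (c t) * (indicator {?u<..?v} t * slope t))"
            using uv by (intro integrable_slice_slope[OF ab(1,2)]) auto
          show "0 \<le> indicator {?u<..?v} t * slope t" for t
            using slope_nonneg[of t] u0 by (auto simp: indicator_def)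
          show "\<bar>slice f t (c t) - ?m\<bar> \<le> \<epsilon>" if "indicator {?u<..?v} t * slope t \<noteq> 0" for t
          proof -
            have "t \<in> {?u<..?v}" using that by (auto simp: indicator_def split: if_splits)
            then show ?thesis using c_antimono[of ?u t] c_antimono[of t ?v] u0 by (intro near) auto
          qed
        qed
        then show ?thesis unfolding slope_integral(2)[OF u0(1) uv(3)] .
      qed
      show ?thesis using I J by linarith
    qed
    have "\<bar>riemann_sum a b n - (\<Sum>k<Suc n. ?I k)\<bar> = \<bar>\<Sum>k<Suc n. ?J k - ?I k\<bar>"
      unfolding riemann_sum_def by (simp only: sum_subtractf)
    also have "\<dots> \<le> (\<Sum>k<Suc n. 2 * \<epsilon> * (c (?g k) - c (?g (Suc k))))"
      by (rule order_trans[OF sum_abs sum_mono]) (use close in auto)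
    also have "\<dots> = 2 * \<epsilon> * (c a - c b)"
      by (simp only: sum_distrib_left[symmetric] sum_lessThan_telescope'[of "\<lambda>k. c (grid a b n k)"] grid_ends)
    also have "\<dots> < e"
      using e cab by (simp add: \<epsilon>_def field_simps)
    finally show "norm (riemann_sum a b n - (\<integral>t. slice f t (c t) * (indicator {a<..b} t * slope t) \<partial>lborel)) < e"
      unfolding eqI by simp
  qed
qed

end

end

section \<open>Passage by jump and by creeping\<close>

context boundary_crossing
begin

definition mean :: "(real^'d \<Rightarrow> real) \<Rightarrow> real \<Rightarrow> real" where
  "mean f2 h = (\<integral>\<omega>. f2 (X h \<omega>) \<partial>M)"

text \<open>Passage of level \<open>y\<close> by an independent increment alone: it starts from
  states with norm in \<open>(y - S h \<omega>, y]\<close>.\<close>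

definition overshoot :: "(real^'d \<Rightarrow> real) \<Rightarrow> (real^'d \<Rightarrow> real) \<Rightarrow> real \<Rightarrow> real \<Rightarrow> real \<Rightarrow> real" where
  "overshoot f1 f2 t y h = (\<integral>\<omega>. f2 (X h \<omega>) * (below f1 t y - below f1 t (y - S h \<omega>)) \<partial>M)"

lemma measurable_below:
  assumes f1: "test_function L f1" and t: "0 < t"
  shows "below f1 t \<in> borel_measurable borel"
proof (rule borel_measurable_mono)
  show "mono (below f1 t)" by (rule monoI) (rule below_mono[OF f1 less_imp_le[OF t]])
qed

text \<open>With the increment frozen, the event says that \<open>S s\<close> lies above
  \<open>z\<close> minus the norm of the increment and at most at \<open>y\<close>. Cutting this
  interval at \<open>z\<close> separates passage due to the descent of the boundary from passage due
  to the increment.\<close>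

lemma crossing_expectation:
  assumes f1: "test_function L f1" and f2: "f2 \<in> borel_measurable borel" "\<And>x. 0 \<le> f2 x" "\<And>x. f2 x \<le> 1"
    and st: "0 < s" "s < t" and yz: "z \<le> y"
  shows "(\<integral>\<omega>. f1 (X s \<omega>) * f2 (X t \<omega> - X s \<omega>) * indicator {\<omega>. S s \<omega> \<le> y \<and> z < S t \<omega>} \<omega> \<partial>M) =
    mean f2 (t - s) * (below f1 s y - below f1 s z) + overshoot f1 f2 s z (t - s)"
proof -
  let ?h = "t - s"
  note [measurable] = f2(1) test_function_measurable[OF f1] measurable_below[OF f1 st(1)]
  have [measurable]: "X s \<in> borel_measurable M" "X t \<in> borel_measurable M" "S s \<in> borel_measurable M" "S t \<in> borel_measurable M"
    "X ?h \<in> borel_measurable M" "S ?h \<in> borel_measurable M"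
    using st by (auto intro!: measurable_X measurable_S)
  let ?k = "\<lambda>p. ennreal (f1 (fst p) * f2 (snd p) * (if l1norm (fst p) \<le> y \<and> z < l1norm (fst p + snd p) then 1 else 0))"
  let ?b = "\<lambda>\<omega>. below f1 s y - below f1 s (z - S ?h \<omega>)"
  have b01: "0 \<le> ?b \<omega>" "?b \<omega> \<le> 1" for \<omega>
    using below_bounds[OF f1, of s y] below_bounds[OF f1, of s "z - S ?h \<omega>"] below_mono[OF f1, of s "z - S ?h \<omega>" y] S_nonneg[of ?h \<omega>] yz st
    by auto
  have intb: "integrable M (\<lambda>\<omega>. f2 (X ?h \<omega>) * ?b \<omega>)"
    using b01 f2 by (intro integrable_const_bound[where B=1]) (auto simp: abs_mult intro!: mult_le_one)
  have int2: "integrable M (\<lambda>\<omega>. f2 (X ?h \<omega>))"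
    using f2 by (intro integrable_const_bound[where B=1]) auto
  have "(\<integral>\<omega>. f1 (X s \<omega>) * f2 (X t \<omega> - X s \<omega>) * indicator {\<omega>. S s \<omega> \<le> y \<and> z < S t \<omega>} \<omega> \<partial>M) =
    (\<integral>\<omega>. f1 (X s \<omega>) * f2 (X t \<omega> - X s \<omega>) * (if S s \<omega> \<le> y \<and> z < S t \<omega> then 1 else 0) \<partial>M)"
    by (intro Bochner_Integration.integral_cong refl) (auto simp: indicator_def)
  \<comment> \<open>For nonnegative integrals the order can be exchanged without integrability
    checks; the result is finite and converted back.\<close>
  also have "\<dots> = enn2real (\<integral>\<^sup>+\<omega>. ?k (X s \<omega>, X t \<omega> - X s \<omega>) \<partial>M)"
    using test_functionD(2)[OF f1] f2
    by (subst integral_eq_nn_integral) (auto simp: norm_process_def)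
  also have "(\<integral>\<^sup>+\<omega>. ?k (X s \<omega>, X t \<omega> - X s \<omega>) \<partial>M) = (\<integral>\<^sup>+\<omega>'. \<integral>\<^sup>+\<omega>. ?k (X s \<omega>, X ?h \<omega>') \<partial>M \<partial>M)"
    using st by (intro nn_integral_increment_swap) auto
  also have "\<dots> = (\<integral>\<^sup>+\<omega>'. ennreal (f2 (X ?h \<omega>') * ?b \<omega>') \<partial>M)"
  proof (rule nn_integral_cong)
    fix \<omega>' assume w': "\<omega>' \<in> space M"
    let ?A = "{z - S ?h \<omega>'<..y}"
    have "(\<integral>\<^sup>+\<omega>. ?k (X s \<omega>, X ?h \<omega>') \<partial>M) = (\<integral>\<^sup>+\<omega>. ennreal (f2 (X ?h \<omega>')) * ennreal (f1 (X s \<omega>) * indicator ?A (S s \<omega>)) \<partial>M)"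
    proof (rule nn_integral_cong)
      fix \<omega> assume w: "\<omega> \<in> space M"
      have "l1norm (X s \<omega> + X ?h \<omega>') = S s \<omega> + S ?h \<omega>'" using st w w' by (intro S_add) auto
      then show "?k (X s \<omega>, X ?h \<omega>') = ennreal (f2 (X ?h \<omega>')) * ennreal (f1 (X s \<omega>) * indicator ?A (S s \<omega>))"
        using f2(2) test_functionD(2)[OF f1]
        by (auto simp: ennreal_mult[symmetric] norm_process_def[symmetric] indicator_def mult.commute less_diff_eq diff_less_eq)
    qed
    also have "\<dots> = ennreal (f2 (X ?h \<omega>')) * (\<integral>\<^sup>+\<omega>. ennreal (f1 (X s \<omega>) * indicator ?A (S s \<omega>)) \<partial>M)"
      by (rule nn_integral_cmult) measurable
    also have "(\<integral>\<^sup>+\<omega>. ennreal (f1 (X s \<omega>) * indicator ?A (S s \<omega>)) \<partial>M) = ennreal (\<integral>\<omega>. f1 (X s \<omega>) * indicator ?A (S s \<omega>) \<partial>M)"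
      using st test_functionD(2)[OF f1] by (intro nn_integral_eq_integral integrable_below[OF f1]) auto
    also have "(\<integral>\<omega>. f1 (X s \<omega>) * indicator ?A (S s \<omega>) \<partial>M) = ?b \<omega>'"
    proof (rule below_diff[OF f1, symmetric])
      show "z - S ?h \<omega>' \<le> y" using S_nonneg[of ?h \<omega>'] yz by linarith
    qed (use st in simp)
    finally show "(\<integral>\<^sup>+\<omega>. ?k (X s \<omega>, X ?h \<omega>') \<partial>M) = ennreal (f2 (X ?h \<omega>') * ?b \<omega>')"
      using f2(2) b01(1) by (simp add: ennreal_mult)
  qed
  also have "\<dots> = ennreal (\<integral>\<omega>. f2 (X ?h \<omega>) * ?b \<omega> \<partial>M)"
    using f2(2) b01 by (intro nn_integral_eq_integral intb) auto
  also have "enn2real \<dots> = (\<integral>\<omega>. f2 (X ?h \<omega>) * ?b \<omega> \<partial>M)"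
    using f2(2) b01 by (intro enn2real_ennreal integral_nonneg_AE) auto
  also have "\<dots> = (\<integral>\<omega>. f2 (X ?h \<omega>) * (below f1 s y - below f1 s z) + f2 (X ?h \<omega>) * (below f1 s z - below f1 s (z - S ?h \<omega>)) \<partial>M)"
    by (intro Bochner_Integration.integral_cong refl) (simp add: algebra_simps)
  also have "\<dots> = mean f2 ?h * (below f1 s y - below f1 s z) + overshoot f1 f2 s z ?h"
  proof -
    have "integrable M (\<lambda>\<omega>. f2 (X ?h \<omega>) * (below f1 s z - below f1 s (z - S ?h \<omega>)))"
    proof (rule integrable_const_bound[where B=1])
      have "0 \<le> below f1 s z - below f1 s (z - S ?h \<omega>)" "below f1 s z - below f1 s (z - S ?h \<omega>) \<le> 1" for \<omega>
        using below_bounds[OF f1, of s z] below_bounds[OF f1, of s "z - S ?h \<omega>"] below_mono[OF f1, of s "z - S ?h \<omega>" z] S_nonneg[of ?h \<omega>] st by auto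
      then show "AE \<omega> in M. norm (f2 (X ?h \<omega>) * (below f1 s z - below f1 s (z - S ?h \<omega>))) \<le> 1"
        using f2 by (intro AE_I2) (auto simp: abs_mult intro!: mult_le_one)
    qed measurable
    then show ?thesis
      unfolding mean_def overshoot_def using int2 by (subst Bochner_Integration.integral_add) auto
  qed
  finally show ?thesis .
qed

lemma crossing_sum_expectation:
  assumes f1: "test_function L f1" and f2: "f2 \<in> borel_measurable borel" "\<And>x. 0 \<le> f2 x" "\<And>x. f2 x \<le> 1"
    and ab: "a \<in> active" "a < b"
  shows "(\<integral>\<omega>. crossing_sum f1 f2 a b n \<omega> \<partial>M) =
    mean f2 ((b - a) / real (Suc n)) * riemann_sum f1 a b n +
    (\<Sum>k<Suc n. overshoot f1 f2 (grid a b n k) (c (grid a b n (Suc k))) ((b - a) / real (Suc n)))"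
proof -
  let ?g = "grid a b n" and ?h = "(b - a) / real (Suc n)"
  let ?E = "\<lambda>k. {\<omega>. S (?g k) \<omega> \<le> c (?g k) \<and> c (?g (Suc k)) < S (?g (Suc k)) \<omega>}"
  have a: "0 < a" using ab by (simp add: active_def)
  have h: "0 < ?h" using ab by simp
  have g: "0 < ?g k" "?g k < ?g (Suc k)" "?g (Suc k) - ?g k = ?h" for k
    using grid_mono[of a b 0 k n] ab a h by (auto simp: grid_ends grid_Suc)
  have cg: "c (?g (Suc k)) \<le> c (?g k)" for k using g[of k] by (intro c_antimono) auto
  have eq: "(\<integral>\<omega>. f1 (X (?g k) \<omega>) * f2 (X (?g (Suc k)) \<omega> - X (?g k) \<omega>) * indicator (?E k) \<omega> \<partial>M) =
    mean f2 ?h * (below f1 (?g k) (c (?g k)) - below f1 (?g k) (c (?g (Suc k)))) + overshoot f1 f2 (?g k) (c (?g (Suc k))) ?h" for k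
    using crossing_expectation[OF f1 f2 g(1,2) cg] unfolding g(3) .
  have "(\<integral>\<omega>. crossing_sum f1 f2 a b n \<omega> \<partial>M) =
    (\<Sum>k<Suc n. \<integral>\<omega>. f1 (X (?g k) \<omega>) * f2 (X (?g (Suc k)) \<omega> - X (?g k) \<omega>) * indicator (?E k) \<omega> \<partial>M)"
    unfolding crossing_sum_def
  proof (rule Bochner_Integration.integral_sum)
    fix k
    note [measurable] = f2(1) test_function_measurable[OF f1]
    have [measurable]: "X (?g k) \<in> borel_measurable M" "S (?g k) \<in> borel_measurable M" for k
      using g(1)[of k] by (auto intro!: measurable_X measurable_S)
    have "{\<omega>\<in>space M. S (?g k) \<omega> \<le> c (?g k) \<and> c (?g (Suc k)) < S (?g (Suc k)) \<omega>} \<in> sets M"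
      by measurable
    then have "?E k \<inter> space M \<in> sets M" by (simp add: Int_def conj_commute)
    then have [measurable]: "(\<lambda>\<omega>. indicator (?E k) \<omega> :: real) \<in> borel_measurable M"
      by (subst borel_measurable_indicator_iff) simp
    show "integrable M (\<lambda>\<omega>. f1 (X (?g k) \<omega>) * f2 (X (?g (Suc k)) \<omega> - X (?g k) \<omega>) * indicator (?E k) \<omega>)"
      using test_functionD(2,3)[OF f1] f2
      by (intro integrable_const_bound[where B=1]) (auto simp: abs_mult indicator_def intro!: mult_le_one)
  qed
  also have "\<dots> = mean f2 ?h * riemann_sum f1 a b n + (\<Sum>k<Suc n. overshoot f1 f2 (?g k) (c (?g (Suc k))) ?h)"
    unfolding eq sum.distrib sum_distrib_left[symmetric] riemann_sum_def[OF f1] ..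
  finally show ?thesis .
qed

section \<open>Limits as the mesh tends to zero\<close>

lemma mesh_tendsto: "(\<lambda>n. (b - a) / real (Suc n)) \<longlonglongrightarrow> 0"
  by (rule LIMSEQ_Suc[OF lim_const_over_n])

abbreviation "ones \<equiv> (\<chi> i. 1) :: real^'d"

lemma laplace_S:
  assumes "0 \<le> h" "0 \<le> m" shows "(\<integral>\<omega>. exp (- m * S h \<omega>) \<partial>M) = exp (- h * \<psi> (m *\<^sub>R ones))"
proof -
  have "0 \<le> m *\<^sub>R ones" using assms by (auto simp: less_eq_vec_def)
  then have "(\<integral>\<omega>. exp (- ((m *\<^sub>R ones) \<bullet> X h \<omega>)) \<partial>M) = exp (- h * \<psi> (m *\<^sub>R ones))"
    by (rule laplace[OF assms(1)])
  moreover have "(\<integral>\<omega>. exp (- m * S h \<omega>) \<partial>M) = (\<integral>\<omega>. exp (- ((m *\<^sub>R ones) \<bullet> X h \<omega>)) \<partial>M)"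
    unfolding norm_process_def using assms(1)
    by (intro Bochner_Integration.integral_cong refl) (simp add: l1norm_eq_inner X_nonneg)
  ultimately show ?thesis by simp
qed

text \<open>The absence of a drift is decisive here: \<open>(1 - exp (- m * r)) / m\<close> tends to
  \<open>0\<close> under the majorant \<open>min 1 r\<close>, whereas a drift would add a
  constant.\<close>

lemma psi_over_m_tendsto: "(\<lambda>m. \<psi> (real (Suc m) *\<^sub>R ones) / real (Suc m)) \<longlonglongrightarrow> 0"
proof -
  have "(\<lambda>m. \<integral>x. (1 - exp (- real (Suc m) * l1norm x)) / real (Suc m) \<partial>\<mu>) \<longlonglongrightarrow> (\<integral>x. 0 \<partial>\<mu>)"
  proof (rule integral_dominated_convergence[OF _ _ integrable_levy_min])
    show "AE x in \<mu>. norm ((1 - exp (- real (Suc m) * l1norm x)) / real (Suc m)) \<le> min 1 (l1norm x)" for m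
    proof (intro AE_I2)
      fix x :: "real^'d"
      let ?z = "real (Suc m) * l1norm x"
      have z: "0 \<le> ?z" by simp
      have le: "1 - exp (- ?z) \<le> min 1 ?z" by (rule min_1_levy[OF z])
      have "(1 - exp (- ?z)) / real (Suc m) \<le> 1 / real (Suc m)" using le by (intro divide_right_mono) auto
      also have "\<dots> \<le> 1" by simp
      finally have 1: "(1 - exp (- ?z)) / real (Suc m) \<le> 1" .
      have "(1 - exp (- ?z)) / real (Suc m) \<le> ?z / real (Suc m)" using le by (intro divide_right_mono) auto
      also have "\<dots> = l1norm x" by simp
      finally have 2: "(1 - exp (- ?z)) / real (Suc m) \<le> l1norm x" .
      have 3: "0 \<le> (1 - exp (- ?z)) / real (Suc m)" using z by (intro divide_nonneg_nonneg) auto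
      show "norm ((1 - exp (- real (Suc m) * l1norm x)) / real (Suc m)) \<le> min 1 (l1norm x)"
        using 1 2 3 by (simp del: of_nat_Suc)
    qed
    show "AE x in \<mu>. (\<lambda>m. (1 - exp (- real (Suc m) * l1norm x)) / real (Suc m)) \<longlonglongrightarrow> 0"
    proof (intro AE_I2)
      fix x :: "real^'d"
      show "(\<lambda>m. (1 - exp (- real (Suc m) * l1norm x)) / real (Suc m)) \<longlonglongrightarrow> 0"
      proof (rule Lim_null_comparison[OF always_eventually LIMSEQ_Suc[OF lim_const_over_n[of 1]]], rule allI)
        fix m
        have "0 \<le> real (Suc m) * l1norm x" by simp
        then show "norm ((1 - exp (- real (Suc m) * l1norm x)) / real (Suc m)) \<le> 1 / real (Suc m)"
          by (simp del: of_nat_Suc add: divide_right_mono)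
      qed
    qed
  qed simp_all
  moreover have "(\<integral>x. (1 - exp (- real (Suc m) * l1norm x)) / real (Suc m) \<partial>\<mu>) = \<psi> (real (Suc m) *\<^sub>R ones) / real (Suc m)" for m
  proof -
    have "(\<integral>x. 1 - exp (- real (Suc m) * l1norm x) \<partial>\<mu>) = \<psi> (real (Suc m) *\<^sub>R ones)"
    proof (rule integral_cong_AE)
      show "AE x in \<mu>. 1 - exp (- real (Suc m) * l1norm x) = 1 - exp (- ((real (Suc m) *\<^sub>R ones) \<bullet> x))"
        using AE_levy_orthant by eventually_elim (simp add: l1norm_eq_inner del: of_nat_Suc)
    qed simp_all
    then show ?thesis by (simp only: integral_divide_zero)
  qed
  ultimately show ?thesis by (simp del: of_nat_Suc)
qed

text \<open>\<open>exp (- m * l1norm v)\<close> approximates the indicator of \<open>v = 0\<close>.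
  For fixed \<open>m\<close> the mean over a cell tends to \<open>1\<close>, which leaves the
  Riemann sum. The overshoots of all cells together are at most \<open>C * (b - a)\<close> times the
  quotient in \<open>psi_over_m_tendsto\<close>, and this disappears as \<open>m\<close>
  grows.\<close>

lemma crossing_limit_creep:
  assumes f1: "test_function L f1" and ab: "a \<in> active" "b \<in> active" "a < b"
  shows "(\<integral>\<omega>. f1 (U \<omega>) * indicator {0} (V \<omega>) * indicator {a<..b} (T \<omega>) \<partial>M) =
    (\<integral>t. slice f1 t (c t) * (indicator {a<..b} t * slope t) \<partial>lborel)" (is "?lhs = ?R")
proof -
  have a: "0 < a" "0 < c b" "a \<le> b" using ab by (auto simp: active_def)
  have cab: "c b \<le> c a" using a by (intro c_antimono) auto
  obtain C where C: "0 < C" "\<And>t y r. t \<in> {a..b} \<Longrightarrow> y \<in> {c b..c a} \<Longrightarrow> 0 \<le> r \<Longrightarrow> below f1 t y - below f1 t (y - r) \<le> C * r"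
    using below_lipschitz[OF f1 a(1) a(3) a(2) cab] by metis
  let ?f2 = "\<lambda>m x. exp (- real (Suc m) * l1norm (x::real^'d))"
  let ?A = "\<lambda>m. \<integral>\<omega>. f1 (U \<omega>) * ?f2 m (V \<omega>) * indicator {a<..b} (T \<omega>) \<partial>M"
  let ?h = "\<lambda>n. (b - a) / real (Suc n)"
  have h: "0 < ?h n" for n using ab by simp
  have f2: "?f2 m \<in> borel_measurable borel" "0 \<le> ?f2 m x" "?f2 m x \<le> 1" "continuous_on UNIV (?f2 m)" for m x
    by (auto intro!: continuous_intros simp del: of_nat_Suc)
  have f1c: "continuous_on UNIV f1"
    by (auto simp: continuous_on_def intro: test_function_tendsto[OF f1] tendsto_ident_at)
  note [measurable] = test_function_measurable[OF f1]
  have bound: "\<bar>?A m - ?R\<bar> \<le> C * (b - a) * (\<psi> (real (Suc m) *\<^sub>R ones) / real (Suc m))" for m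
  proof -
    let ?P = "\<psi> (real (Suc m) *\<^sub>R ones)"
    have mean_eq: "mean (?f2 m) (?h n) = exp (- ?h n * ?P)" for n
      using laplace_S[OF less_imp_le[OF h[of n]], of "real (Suc m)"] by (simp add: mean_def norm_process_def del: of_nat_Suc)
    have lim: "(\<lambda>n. (\<integral>\<omega>. crossing_sum f1 (?f2 m) a b n \<omega> \<partial>M) - mean (?f2 m) (?h n) * riemann_sum f1 a b n) \<longlonglongrightarrow> ?A m - exp (- 0 * ?P) * ?R"
      unfolding mean_eq
      by (intro tendsto_diff tendsto_mult crossing_sum_tendsto[OF ab(1,3) f1c _ f2(4)] riemann_sum_tendsto[OF f1 ab]
           tendsto_exp tendsto_minus tendsto_const mesh_tendsto)
         (use test_functionD(2,3)[OF f1] in \<open>auto simp del: of_nat_Suc\<close>)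
    have ov: "\<bar>overshoot f1 (?f2 m) t y (?h n)\<bar> \<le> C * (?h n * (?P / real (Suc m)))" if t: "t \<in> {a..b}" and y: "y \<in> {c b..c a}" for t y n
    proof -
      have t0: "0 < t" using t a by simp
      have [measurable]: "S (?h n) \<in> borel_measurable M" "X (?h n) \<in> borel_measurable M"
        using h[of n] by (auto intro!: measurable_S measurable_X)
      note [measurable] = measurable_below[OF f1 t0]
      have ie: "integrable M (\<lambda>\<omega>. exp (- real (Suc m) * S (?h n) \<omega>))"
        by (rule integrable_const_bound[where B=1]) (auto simp del: of_nat_Suc)
      have nn: "0 \<le> below f1 t y - below f1 t (y - S (?h n) \<omega>)" for \<omega>
        using below_mono[OF f1, of t "y - S (?h n) \<omega>" y] t0 by simp
      have le1: "below f1 t y - below f1 t (y - S (?h n) \<omega>) \<le> 1" for \<omega>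
        using below_bounds[OF f1, of t y] below_bounds[OF f1, of t "y - S (?h n) \<omega>"] t0 by linarith
      have "0 \<le> overshoot f1 (?f2 m) t y (?h n)"
        unfolding overshoot_def using nn by (intro integral_nonneg_AE AE_I2 mult_nonneg_nonneg) auto
      moreover have "overshoot f1 (?f2 m) t y (?h n) \<le> (\<integral>\<omega>. (C / real (Suc m)) * (1 - exp (- real (Suc m) * S (?h n) \<omega>)) \<partial>M)"
        unfolding overshoot_def
      proof (rule integral_mono)
        show "integrable M (\<lambda>\<omega>. ?f2 m (X (?h n) \<omega>) * (below f1 t y - below f1 t (y - S (?h n) \<omega>)))"
          using nn le1 by (intro integrable_const_bound[where B=1]) (auto simp: abs_mult intro!: mult_le_one simp del: of_nat_Suc)
        show "integrable M (\<lambda>\<omega>. (C / real (Suc m)) * (1 - exp (- real (Suc m) * S (?h n) \<omega>)))"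
          by (intro integrable_mult_right Bochner_Integration.integrable_diff ie integrable_const)
        fix \<omega>
        let ?r = "S (?h n) \<omega>" and ?m = "real (Suc m)"
        \<comment> \<open>The Lipschitz bound leaves \<open>C * r * exp (- m * r)\<close>. The
          inequality \<open>m * r * exp (- m * r) \<le> 1 - exp (- m * r)\<close> turns it into an
          expression with a known Laplace transform.\<close>
        have "?f2 m (X (?h n) \<omega>) * (below f1 t y - below f1 t (y - ?r)) \<le> exp (- ?m * ?r) * (C * ?r)"
          unfolding norm_process_def[symmetric] using C(2)[OF t y S_nonneg] by (intro mult_left_mono) auto
        also have "\<dots> = (C / ?m) * ((?m * ?r) * exp (- (?m * ?r)))"
          by (simp only: mult_minus_left) (simp del: of_nat_Suc)
        also have "\<dots> \<le> (C / ?m) * (1 - exp (- (?m * ?r)))"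
        proof (rule mult_left_mono)
          have "1 + ?m * ?r \<le> exp (?m * ?r)" by (rule exp_ge_add_one_self)
          then have "(1 + ?m * ?r) * exp (- (?m * ?r)) \<le> exp (?m * ?r) * exp (- (?m * ?r))" by (rule mult_right_mono) simp
          also have "\<dots> = 1" by (simp add: exp_minus)
          finally show "(?m * ?r) * exp (- (?m * ?r)) \<le> 1 - exp (- (?m * ?r))" by (simp only: distrib_right mult_1)
        qed (use C in simp)
        finally show "?f2 m (X (?h n) \<omega>) * (below f1 t y - below f1 t (y - ?r)) \<le> (C / ?m) * (1 - exp (- ?m * ?r))" by (simp only: mult_minus_left)
      qed
      moreover have "(\<integral>\<omega>. (C / real (Suc m)) * (1 - exp (- real (Suc m) * S (?h n) \<omega>)) \<partial>M) = (C / real (Suc m)) * (1 - exp (- ?h n * ?P))"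
      proof -
        have "(\<integral>\<omega>. 1 - exp (- real (Suc m) * S (?h n) \<omega>) \<partial>M) = 1 - exp (- ?h n * ?P)"
          unfolding Bochner_Integration.integral_diff[OF integrable_const ie]
          by (subst laplace_S) (use h[of n] in \<open>auto simp: prob_space simp del: of_nat_Suc\<close>)
        then show ?thesis by (simp only: integral_mult_right_zero)
      qed
      moreover have "(C / real (Suc m)) * (1 - exp (- ?h n * ?P)) \<le> (C / real (Suc m)) * (?h n * ?P)"
        using exp_ge_add_one_self[of "- ?h n * ?P"] C(1) by (intro mult_left_mono) auto
      ultimately have "\<bar>overshoot f1 (?f2 m) t y (?h n)\<bar> \<le> (C / real (Suc m)) * (?h n * ?P)" by linarith
      also have "\<dots> = C * (?h n * (?P / real (Suc m)))" by (simp add: ac_simps del: of_nat_Suc)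
      finally show ?thesis .
    qed
    have "\<bar>(\<integral>\<omega>. crossing_sum f1 (?f2 m) a b n \<omega> \<partial>M) - mean (?f2 m) (?h n) * riemann_sum f1 a b n\<bar> \<le> C * (b - a) * (?P / real (Suc m))" for n
    proof -
      have eq: "(\<integral>\<omega>. crossing_sum f1 (?f2 m) a b n \<omega> \<partial>M) - mean (?f2 m) (?h n) * riemann_sum f1 a b n =
        (\<Sum>k<Suc n. overshoot f1 (?f2 m) (grid a b n k) (c (grid a b n (Suc k))) (?h n))"
        unfolding crossing_sum_expectation[OF f1 f2(1-3) ab(1,3)] by simp
      have "\<bar>\<Sum>k<Suc n. overshoot f1 (?f2 m) (grid a b n k) (c (grid a b n (Suc k))) (?h n)\<bar> \<le> (\<Sum>k<Suc n. C * (?h n * (?P / real (Suc m))))"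
      proof (rule order_trans[OF sum_abs sum_mono])
        fix k assume "k \<in> {..<Suc n}"
        then have g: "grid a b n k \<in> {a..b}" "grid a b n (Suc k) \<in> {a..b}"
          using grid_bounds[OF a(3), of k n] grid_bounds[OF a(3), of "Suc k" n] by auto
        have "c (grid a b n (Suc k)) \<in> {c b..c a}"
          using g(2) a c_antimono[of a "grid a b n (Suc k)"] c_antimono[of "grid a b n (Suc k)" b] by auto
        then show "\<bar>overshoot f1 (?f2 m) (grid a b n k) (c (grid a b n (Suc k))) (?h n)\<bar> \<le> C * (?h n * (?P / real (Suc m)))"
          by (rule ov[OF g(1)])
      qed
      also have "\<dots> = real (Suc n) * (C * (?h n * (?P / real (Suc m))))" by (simp del: of_nat_Suc)
      also have "\<dots> = C * (real (Suc n) * ?h n) * (?P / real (Suc m))" by (simp only: ac_simps)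
      also have "real (Suc n) * ?h n = b - a" by (simp del: of_nat_Suc)
      finally show ?thesis unfolding eq .
    qed
    then have "\<bar>?A m - exp (- 0 * ?P) * ?R\<bar> \<le> C * (b - a) * (?P / real (Suc m))"
      by (intro tendsto_upperbound[OF tendsto_rabs[OF lim]] always_eventually allI) auto
    then show ?thesis by simp
  qed
  have "(\<lambda>m. C * (b - a) * (\<psi> (real (Suc m) *\<^sub>R ones) / real (Suc m))) \<longlonglongrightarrow> C * (b - a) * 0"
    by (intro tendsto_mult_left psi_over_m_tendsto)
  then have lim0: "(\<lambda>m. C * (b - a) * (\<psi> (real (Suc m) *\<^sub>R ones) / real (Suc m))) \<longlonglongrightarrow> 0" by simp
  have "(\<lambda>m. ?A m - ?R) \<longlonglongrightarrow> 0"
    by (rule Lim_null_comparison[OF always_eventually lim0]) (rule allI, unfold real_norm_def, rule bound)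
  then have "?A \<longlonglongrightarrow> ?R" by (rule LIM_zero_cancel)
  moreover have "?A \<longlonglongrightarrow> ?lhs"
  proof (rule integral_dominated_convergence[where w="\<lambda>_. 1"])
    show "AE \<omega> in M. (\<lambda>m. f1 (U \<omega>) * ?f2 m (V \<omega>) * indicator {a<..b} (T \<omega>)) \<longlonglongrightarrow> f1 (U \<omega>) * indicator {0} (V \<omega>) * indicator {a<..b} (T \<omega>)"
    proof (intro AE_I2 tendsto_mult tendsto_const)
      fix \<omega>
      show "(\<lambda>m. ?f2 m (V \<omega>)) \<longlonglongrightarrow> indicator {0} (V \<omega>)"
      proof (cases "V \<omega> = 0")
        case False
        then have p: "0 < l1norm (V \<omega>)" using l1norm_nonneg[of "V \<omega>"] l1norm_eq_0_iff[of "V \<omega>"] by linarith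
        have "(\<lambda>m. exp (- l1norm (V \<omega>)) ^ Suc m) \<longlonglongrightarrow> 0"
          using p by (intro LIMSEQ_Suc LIMSEQ_realpow_zero) auto
        moreover have "exp (- l1norm (V \<omega>)) ^ Suc m = ?f2 m (V \<omega>)" for m
          by (simp only: exp_of_nat_mult[symmetric] mult_minus_right mult_minus_left)
        ultimately show ?thesis using False by (simp del: of_nat_Suc power_Suc)
      qed simp
    qed
    show "AE \<omega> in M. norm (f1 (U \<omega>) * ?f2 m (V \<omega>) * indicator {a<..b} (T \<omega>)) \<le> 1" for m
      using test_functionD(2,3)[OF f1] f2(2,3)[of m]
      by (intro AE_I2) (auto simp: abs_mult indicator_def intro!: mult_le_one simp del: of_nat_Suc)
    show "(\<lambda>\<omega>. f1 (U \<omega>) * ?f2 m (V \<omega>) * indicator {a<..b} (T \<omega>)) \<in> borel_measurable M" for m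
      by measurable
    show "(\<lambda>\<omega>. f1 (U \<omega>) * indicator {0} (V \<omega>) * indicator {a<..b} (T \<omega>)) \<in> borel_measurable M"
      by measurable
  qed simp
  ultimately show ?thesis by (rule LIMSEQ_unique[rotated])
qed

text \<open>Because of the factor \<open>1 - exp (- l1norm v)\<close> the mean over a cell tends to
  \<open>0\<close>, and with it the part due to the descending boundary. The overshoot divided by
  the mesh converges to \<open>J t\<close>, and the sum over cells becomes an integral over
  time.\<close>

lemma crossing_limit_jump:
  assumes f1: "test_function L f1" and G: "test_function L' G" and ab: "a \<in> active" "b \<in> active" "a < b"
  defines "J \<equiv> \<lambda>t. levy_limit (\<lambda>v. G (expv v) * (below f1 t (c t) - below f1 t (c t - l1norm v)))"
  shows "integrable lborel (\<lambda>t. indicator {a<..b} t * J t)"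
    "(\<integral>\<omega>. f1 (U \<omega>) * ((1 - exp (- l1norm (V \<omega>))) * G (expv (V \<omega>))) * indicator {a<..b} (T \<omega>) \<partial>M) =
    (\<integral>t. indicator {a<..b} t * J t \<partial>lborel)"
proof -
  have a: "0 < a" "0 < c b" "a \<le> b" using ab by (auto simp: active_def)
  have cab: "c b \<le> c a" using a by (intro c_antimono) auto
  let ?f2 = "\<lambda>x::real^'d. (1 - exp (- l1norm x)) * G (expv x)"
  let ?h = "\<lambda>n. (b - a) / real (Suc n)"
  have h: "0 < ?h n" for n using ab by simp
  have f1c: "continuous_on UNIV f1"
    by (auto simp: continuous_on_def intro: test_function_tendsto[OF f1] tendsto_ident_at)
  have Gc: "continuous_on UNIV G"
    by (auto simp: continuous_on_def intro: test_function_tendsto[OF G] tendsto_ident_at)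
  have [measurable]: "G \<in> borel_measurable borel" by (rule test_function_measurable[OF G])
  have f2: "?f2 \<in> borel_measurable borel" "0 \<le> ?f2 x" "?f2 x \<le> 1" "continuous_on UNIV ?f2" for x
  proof -
    show "continuous_on UNIV ?f2"
      by (intro continuous_intros continuous_on_compose2[OF Gc continuous_on_expv]) auto
    show "0 \<le> ?f2 x" "?f2 x \<le> 1"
      using test_functionD(2,3)[OF G, of "expv x"] by (auto intro!: mult_nonneg_nonneg mult_le_one)
  qed measurable
  define Y where "Y = c a"
  have Y: "0 < Y" using a cab by (simp add: Y_def)
  \<comment> \<open>At \<open>w = expv v\<close> with \<open>v\<close> in the orthant the product of
    coordinates is \<open>exp (- l1norm v)\<close>, so the logarithm recovers
    \<open>- l1norm v\<close>. Truncation at \<open>- Y\<close> makes it continuous where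
    coordinates vanish. It is harmless for levels up to \<open>Y\<close>, since \<open>below\<close>
    is \<open>0\<close> at nonpositive levels.\<close>
  define lx where "lx w = ln (max (\<Prod>i\<in>UNIV. w $ i) (exp (- Y)))" for w :: "real^'d"
  define \<beta> where "\<beta> t y w = G w * (below f1 t y - below f1 t (y + lx w))" for t y w
  have pos: "0 < max p (exp (- Y))" for p :: real by (simp add: less_max_iff_disj)
  have lx_cont: "continuous_on UNIV lx"
    unfolding lx_def
    by (rule continuous_on_ln) (intro continuous_intros, simp add: order_less_imp_not_eq2[OF pos])
  have lx_range: "lx w \<in> {- Y..0}" if "w \<in> cbox 0 1" for w
  proof -
    have "(\<Prod>i\<in>UNIV. w $ i) \<le> 1" using that by (intro prod_le_1) (auto simp: mem_box_cart)
    then have "max (\<Prod>i\<in>UNIV. w $ i) (exp (- Y)) \<le> 1" using Y by simp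
    then have "lx w \<le> ln 1" unfolding lx_def ln_le_cancel_iff[OF pos zero_less_one] .
    moreover have "ln (exp (- Y)) \<le> lx w" unfolding lx_def ln_le_cancel_iff[OF exp_gt_zero pos] by simp
    ultimately show ?thesis by simp
  qed
  have lx_expv: "below f1 t (y + lx (expv v)) = below f1 t (y - l1norm v)" if "0 < t" "y \<le> Y" "0 \<le> v" for t y v
  proof -
    have "(\<Prod>i\<in>UNIV. expv v $ i) = exp (- l1norm v)"
      using that(3) by (simp add: exp_sum[symmetric] l1norm_orthant sum_negf)
    then have lx: "lx (expv v) = (if l1norm v \<le> Y then - l1norm v else - Y)"
      unfolding lx_def by (auto simp: max_def)
    show ?thesis
    proof (cases "l1norm v \<le> Y")
      case False
      then show ?thesis using that unfolding lx by (simp add: below_nonpos[OF f1])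
    qed (simp add: lx)
  qed
  have below_cont: "continuous_on UNIV (below f1 t)" if "0 < t" for t
    unfolding continuous_on_sequentially o_def
    using below_continuous[OF f1 that tendsto_const] that by auto
  have \<beta>_cont: "continuous_on UNIV (\<beta> t y)" if "0 < t" for t y
    unfolding \<beta>_def by (intro continuous_intros Gc continuous_on_compose2[OF below_cont[OF that]] lx_cont) auto
  have \<beta>_bound: "\<bar>\<beta> t y w - 0\<bar> \<le> 1" if "0 < t" "w \<in> cbox 0 1" for t y w
  proof -
    have "0 \<le> below f1 t y - below f1 t (y + lx w)" "below f1 t y - below f1 t (y + lx w) \<le> 1"
      using below_mono[OF f1, of t "y + lx w" y] below_bounds[OF f1, of t y] below_bounds[OF f1, of t "y + lx w"] lx_range[OF that(2)] that(1) by auto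
    then show ?thesis using test_functionD(2,3)[OF G, of w] by (auto simp: \<beta>_def abs_mult intro!: mult_le_one)
  qed
  have ov: "overshoot f1 ?f2 t y (?h n) = ?h n * levy_approx (?h n) (\<lambda>x. \<beta> t y (expv x))" if "0 < t" "y \<le> Y" for t y n
  proof -
    have "overshoot f1 ?f2 t y (?h n) = (\<integral>\<omega>. (1 - exp (- S (?h n) \<omega>)) * \<beta> t y (expv (X (?h n) \<omega>)) \<partial>M)"
      unfolding overshoot_def
    proof (intro Bochner_Integration.integral_cong refl)
      fix \<omega> assume w: "\<omega> \<in> space M"
      have "below f1 t (y + lx (expv (X (?h n) \<omega>))) = below f1 t (y - S (?h n) \<omega>)"
        unfolding norm_process_def using that h[of n] w by (intro lx_expv X_nonneg) auto
      then show "?f2 (X (?h n) \<omega>) * (below f1 t y - below f1 t (y - S (?h n) \<omega>)) = (1 - exp (- S (?h n) \<omega>)) * \<beta> t y (expv (X (?h n) \<omega>))"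
        by (simp add: \<beta>_def norm_process_def[symmetric] mult.assoc)
    qed
    moreover have "x * (1 / x * i) = i" "x * (i / x) = i" if "0 < x" for x i :: real using that by simp_all
    ultimately show ?thesis unfolding levy_approx_def by (simp only: h)
  qed
  have J: "J t = levy_limit (\<lambda>x. \<beta> t (c t) (expv x))" if "t \<in> {a..b}" for t
    unfolding J_def levy_limit_def
  proof (rule integral_cong_AE)
    have t: "0 < t" "c t \<le> Y" using that a c_antimono[of a t] by (auto simp: Y_def)
    note [measurable] = measurable_below[OF f1 t(1)] borel_measurable_continuous_onI[OF \<beta>_cont[OF t(1)]]
    show "AE x in \<mu>. (1 - exp (- l1norm x)) * (G (expv x) * (below f1 t (c t) - below f1 t (c t - l1norm x))) =
        (1 - exp (- l1norm x)) * \<beta> t (c t) (expv x)"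
      using AE_levy_orthant by eventually_elim (simp add: \<beta>_def lx_expv[OF t])
    show "(\<lambda>x. (1 - exp (- l1norm x)) * (G (expv x) * (below f1 t (c t) - below f1 t (c t - l1norm x)))) \<in> borel_measurable \<mu>"
      "(\<lambda>x. (1 - exp (- l1norm x)) * \<beta> t (c t) (expv x)) \<in> borel_measurable \<mu>"
      by simp_all
  qed
  let ?P = "\<psi> ones"
  \<comment> \<open>The overshoots as a step function of time: its integral is their sum, and at a
    given \<open>t\<close> only the cell containing \<open>t\<close> contributes.\<close>
  let ?st = "\<lambda>n t. \<Sum>k<Suc n. levy_approx (?h n) (\<lambda>x. \<beta> (grid a b n k) (c (grid a b n (Suc k))) (expv x)) * indicator {grid a b n k<..grid a b n (Suc k)} t"
  have g: "grid a b n k \<in> {a..b}" if "k \<le> Suc n" for n k using grid_bounds[OF a(3) that] .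
  have la_bound: "\<bar>levy_approx (?h n) (\<lambda>x. \<beta> t y (expv x))\<bar> \<le> ?P" if "0 < t" for n t y
    using levy_approx_diff(1)[OF h \<beta>_cont[OF that, of y] continuous_on_const[of UNIV 0], of 1] \<beta>_bound[OF that]
    by (simp add: levy_approx_def)
  have st_lim: "(\<lambda>n. ?st n t) \<longlonglongrightarrow> indicator {a<..b} t * J t" for t
  proof (cases "t \<in> {a<..b}")
    case False
    then show ?thesis unfolding sum_cells[OF ab(3)] if_not_P[OF False] by simp
  next
    case True
    then have t: "a < t" "t \<le> b" by auto
    let ?s = "\<lambda>n. grid a b n (cell a b n t)" and ?s' = "\<lambda>n. grid a b n (Suc (cell a b n t))"
    have s: "?s n \<in> {a..b}" "?s' n \<in> {a..b}" for n
      using cell(1)[OF t, of n] by (intro g; simp)+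
    have spos: "0 < ?s n" "0 < ?s' n" for n using s[of n] a by auto
    have lim: "?s \<longlonglongrightarrow> t" "(\<lambda>n. c (?s' n)) \<longlonglongrightarrow> c t"
      using grid_cell_tendsto[OF t] t a by (auto intro!: c_tendsto)
    \<comment> \<open>The levels \<open>c t + lx w\<close> reach down to \<open>c b - Y\<close>.
      Uniform continuity of \<open>below\<close> on this compact set gives convergence uniformly in
      \<open>w\<close>.\<close>
    let ?K = "{a..b} \<times> {c b - Y..c a}"
    have unif: "uniformly_continuous_on ?K (\<lambda>p. below f1 (fst p) (snd p))"
    proof (rule compact_uniformly_continuous)
      show "continuous_on ?K (\<lambda>p. below f1 (fst p) (snd p))"
        unfolding continuous_on_sequentially
      proof (intro allI ballI impI)
        fix x :: "nat \<Rightarrow> real \<times> real" and p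
        assume p: "p \<in> ?K" and "(\<forall>n. x n \<in> ?K) \<and> x \<longlonglongrightarrow> p"
        then have x: "\<And>n. x n \<in> ?K" and "(\<lambda>n. fst (x n)) \<longlonglongrightarrow> fst p" "(\<lambda>n. snd (x n)) \<longlonglongrightarrow> snd p" by (auto intro: tendsto_fst tendsto_snd)
        moreover have "0 < fst p" "0 < fst (x n)" for n using p x[of n] a by auto
        ultimately show "((\<lambda>p. below f1 (fst p) (snd p)) \<circ> x) \<longlonglongrightarrow> below f1 (fst p) (snd p)"
          unfolding o_def by (intro below_continuous[OF f1]) auto
      qed
    qed (intro compact_Times compact_Icc)
    have "(\<lambda>n. levy_approx (?h n) (\<lambda>x. \<beta> (?s n) (c (?s' n)) (expv x))) \<longlonglongrightarrow> levy_limit (\<lambda>x. \<beta> t (c t) (expv x))"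
    proof (rule levy_approx_tendsto[OF mesh_tendsto h])
      show "continuous_on UNIV (\<beta> t (c t))" using t a by (intro \<beta>_cont) simp
      show "continuous_on UNIV (\<beta> (?s n) (c (?s' n)))" for n by (rule \<beta>_cont[OF spos(1)])
      fix e :: real assume e: "0 < e"
      then have "0 < e / 2" by simp
      then obtain d where d: "0 < d" "\<And>p q. p \<in> ?K \<Longrightarrow> q \<in> ?K \<Longrightarrow> dist q p < d \<Longrightarrow> dist (below f1 (fst q) (snd q)) (below f1 (fst p) (snd p)) < e / 2"
        using unif unfolding uniformly_continuous_on_def by metis
      have "\<forall>\<^sub>F n in sequentially. dist (?s n, c (?s' n)) (t, c t) < d"
        by (intro tendstoD tendsto_Pair lim d)
      then show "\<forall>\<^sub>F n in sequentially. \<forall>w\<in>cbox 0 1. \<bar>\<beta> (?s n) (c (?s' n)) w - \<beta> t (c t) w\<bar> \<le> e"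
      proof eventually_elim
        case (elim n)
        have cs: "c (?s' n) \<in> {c b..c a}" "c t \<in> {c b..c a}"
          using s(2)[of n] spos(2)[of n] t a c_antimono[of a "?s' n"] c_antimono[of "?s' n" b] c_antimono[of a t] c_antimono[of t b] by auto
        show ?case
        proof
          fix w :: "real^'d" assume w: "w \<in> cbox 0 1"
          have close: "\<bar>below f1 (?s n) (c (?s' n) + l) - below f1 t (c t + l)\<bar> < e / 2" if l: "l \<in> {- Y..0}" for l
          proof -
            have "dist (?s n, c (?s' n) + l) (t, c t + l) = dist (?s n, c (?s' n)) (t, c t)"
              by (simp add: dist_prod_def dist_real_def)
            then have "dist (?s n, c (?s' n) + l) (t, c t + l) < d" using elim by simp
            then show ?thesis
              using d(2)[of "(t, c t + l)" "(?s n, c (?s' n) + l)"] s(1)[of n] t cs l by (auto simp: dist_real_def)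
          qed
          have "\<bar>\<beta> (?s n) (c (?s' n)) w - \<beta> t (c t) w\<bar> =
            \<bar>G w\<bar> * \<bar>(below f1 (?s n) (c (?s' n)) - below f1 t (c t)) - (below f1 (?s n) (c (?s' n) + lx w) - below f1 t (c t + lx w))\<bar>"
            unfolding \<beta>_def abs_mult[symmetric] by (simp add: algebra_simps)
          also have "\<dots> \<le> 1 * e"
          proof (rule mult_mono)
            have diff: "\<bar>p - q\<bar> \<le> e" if "\<bar>p\<bar> < e / 2" "\<bar>q\<bar> < e / 2" for p q :: real
              using that by (simp add: abs_if split: if_splits)
            have "0 \<in> {- Y..0}" using Y by simp
            note diff[OF close[OF this] close[OF lx_range[OF w]]]
            then show "\<bar>(below f1 (?s n) (c (?s' n)) - below f1 t (c t)) - (below f1 (?s n) (c (?s' n) + lx w) - below f1 t (c t + lx w))\<bar> \<le> e" by simp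
          qed (use test_functionD(2,3)[OF G, of w] in auto)
          finally show "\<bar>\<beta> (?s n) (c (?s' n)) w - \<beta> t (c t) w\<bar> \<le> e" by simp
        qed
      qed
    qed
    then show ?thesis
      unfolding sum_cells[OF ab(3)] if_P[OF True] using True J[of t] by simp
  qed
  have st_bound: "\<bar>?st n t\<bar> \<le> ?P * indicator {a<..b} t" for n t
  proof (cases "t \<in> {a<..b}")
    case True
    then have "0 < grid a b n (cell a b n t)" using cell(1)[of a t b n] g[of "cell a b n t" n] a by auto
    from la_bound[OF this] show ?thesis unfolding sum_cells[OF ab(3)] if_P[OF True] using True by simp
  next
    case False
    then show ?thesis unfolding sum_cells[OF ab(3)] if_not_P[OF False] by simp
  qed
  have Jm: "(\<lambda>t. indicator {a<..b} t * J t) \<in> borel_measurable lborel"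
    by (rule borel_measurable_LIMSEQ_real[OF st_lim]) measurable
  have dom: "integrable lborel (\<lambda>t. ?P * indicator {a<..b} t)" using a by simp
  have st_meas: "?st n \<in> borel_measurable lborel" for n by measurable
  have st_norm: "norm (?st n t) \<le> ?P * indicator {a<..b} t" for n t unfolding real_norm_def by (rule st_bound)
  show "integrable lborel (\<lambda>t. indicator {a<..b} t * J t)"
    by (rule integrable_dominated_convergence[OF Jm st_meas dom AE_I2[OF st_lim] AE_I2[OF st_norm]])
  have st_int: "(\<lambda>n. \<integral>t. ?st n t \<partial>lborel) \<longlonglongrightarrow> (\<integral>t. indicator {a<..b} t * J t \<partial>lborel)"
    by (rule integral_dominated_convergence[OF Jm st_meas dom AE_I2[OF st_lim] AE_I2[OF st_norm]])
  have mean_lim: "(\<lambda>n. mean ?f2 (?h n)) \<longlonglongrightarrow> 0"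
  proof -
    have "(\<lambda>n. ?h n * levy_approx (?h n) (\<lambda>x. G (expv x))) \<longlonglongrightarrow> 0 * levy_limit (\<lambda>x. G (expv x))"
      by (intro tendsto_mult mesh_tendsto levy_approx_tendsto[OF mesh_tendsto h Gc Gc]) auto
    moreover have "?h n * levy_approx (?h n) (\<lambda>x. G (expv x)) = mean ?f2 (?h n)" for n
      using ab(3) by (simp add: levy_approx_def mean_def norm_process_def)
    ultimately show ?thesis by simp
  qed
  have eq: "(\<integral>\<omega>. crossing_sum f1 ?f2 a b n \<omega> \<partial>M) = mean ?f2 (?h n) * riemann_sum f1 a b n + (\<integral>t. ?st n t \<partial>lborel)" for n
  proof -
    have "(\<integral>t. ?st n t \<partial>lborel) = (\<Sum>k<Suc n. overshoot f1 ?f2 (grid a b n k) (c (grid a b n (Suc k))) (?h n))"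
    proof -
      have "(\<integral>t. ?st n t \<partial>lborel) = (\<Sum>k<Suc n. \<integral>t. levy_approx (?h n) (\<lambda>x. \<beta> (grid a b n k) (c (grid a b n (Suc k))) (expv x)) * indicator {grid a b n k<..grid a b n (Suc k)} t \<partial>lborel)"
        using grid_mono[OF a(3)] by (intro Bochner_Integration.integral_sum integrable_mult_right) auto
      also have "\<dots> = (\<Sum>k<Suc n. overshoot f1 ?f2 (grid a b n k) (c (grid a b n (Suc k))) (?h n))"
      proof (rule sum.cong[OF refl])
        fix k assume "k \<in> {..<Suc n}"
        then have gk: "grid a b n k \<in> {a..b}" "grid a b n (Suc k) \<in> {a..b}" by (intro g; simp)+
        have "c (grid a b n (Suc k)) \<le> Y" using gk a by (auto simp: Y_def intro!: c_antimono)
        then have "overshoot f1 ?f2 (grid a b n k) (c (grid a b n (Suc k))) (?h n) =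
          ?h n * levy_approx (?h n) (\<lambda>x. \<beta> (grid a b n k) (c (grid a b n (Suc k))) (expv x))"
          using gk a by (intro ov) auto
        moreover have "(\<integral>t. indicator {grid a b n k<..grid a b n (Suc k)} t \<partial>lborel) = ?h n"
          using h[of n] by (simp add: grid_Suc del: of_nat_Suc)
        ultimately show "(\<integral>t. levy_approx (?h n) (\<lambda>x. \<beta> (grid a b n k) (c (grid a b n (Suc k))) (expv x)) * indicator {grid a b n k<..grid a b n (Suc k)} t \<partial>lborel) =
          overshoot f1 ?f2 (grid a b n k) (c (grid a b n (Suc k))) (?h n)"
          unfolding integral_mult_right_zero by (simp only: mult.commute)
      qed
      finally show ?thesis .
    qed
    then show ?thesis unfolding crossing_sum_expectation[OF f1 f2(1-3) ab(1,3)] by simp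
  qed
  have "(\<lambda>n. \<integral>\<omega>. crossing_sum f1 ?f2 a b n \<omega> \<partial>M) \<longlonglongrightarrow> 0 * (\<integral>t. slice f1 t (c t) * (indicator {a<..b} t * slope t) \<partial>lborel) + (\<integral>t. indicator {a<..b} t * J t \<partial>lborel)"
    unfolding eq by (intro tendsto_add tendsto_mult mean_lim riemann_sum_tendsto[OF f1 ab] st_int)
  moreover have "(\<lambda>n. \<integral>\<omega>. crossing_sum f1 ?f2 a b n \<omega> \<partial>M) \<longlonglongrightarrow> (\<integral>\<omega>. f1 (U \<omega>) * ?f2 (V \<omega>) * indicator {a<..b} (T \<omega>) \<partial>M)"
    using test_functionD(2,3)[OF f1] f2(2,3)
    by (intro crossing_sum_tendsto[OF ab(1,3) f1c _ f2(4)]) (auto simp: abs_le_iff intro: order_trans)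
  ultimately show "(\<integral>\<omega>. f1 (U \<omega>) * ?f2 (V \<omega>) * indicator {a<..b} (T \<omega>) \<partial>M) = (\<integral>t. indicator {a<..b} t * J t \<partial>lborel)"
    using LIMSEQ_unique by fastforce
qed

end

section \<open>Identification of measures by test functions\<close>

lemma sum_measure_exists:
  assumes "sets B = sets A"
  shows "\<exists>Q. sets Q = sets A \<and> (\<forall>C\<in>sets A. emeasure Q C = emeasure A C + emeasure B C)"
proof -
  let ?e = "\<lambda>C. emeasure A C + emeasure B C"
  let ?Q = "measure_of (space A) (sets A) ?e"
  have ca: "countably_additive (sets A) ?e"
  proof (rule countably_additiveI)
    fix F :: "nat \<Rightarrow> 'a set"
    assume F: "range F \<subseteq> sets A" "disjoint_family F" "\<Union> (range F) \<in> sets A"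
    then show "(\<Sum>i. ?e (F i)) = ?e (\<Union> (range F))"
      using assms by (simp add: suminf_add[symmetric] suminf_emeasure)
  qed
  have "emeasure ?Q C = ?e C" if "C \<in> sets A" for C
    by (rule emeasure_measure_of_sigma[OF sets.sigma_algebra_axioms _ ca that]) (simp add: positive_def)
  then show ?thesis by (intro exI[of _ ?Q]) (simp add: sets.sigma_sets_eq)
qed

lemma expv_inject: "expv u = expv v \<longleftrightarrow> u = v"
  by (auto simp: vec_eq_iff)

text \<open>Boxes generate the Borel sets and are stable under intersection. The second coordinate
  is seen only through \<open>expv\<close>; its continuity and injectivity turn a box into a compact
  set that the cut-offs approximate and that determines the box.\<close>

lemma measure_pair_eqI_test:
  fixes M1 M2 :: "((real^'d) \<times> (real^'d)) measure"
  assumes fin: "finite_measure M1" "finite_measure M2" and sets: "sets M1 = sets borel" "sets M2 = sets borel"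
    and eq: "\<And>L f L' G. test_function L f \<Longrightarrow> test_function L' G \<Longrightarrow>
      (\<integral>\<^sup>+p. ennreal (f (fst p) * G (expv (snd p))) \<partial>M1) = (\<integral>\<^sup>+p. ennreal (f (fst p) * G (expv (snd p))) \<partial>M2)"
  shows "M1 = M2"
proof -
  let ?E = "range (\<lambda>(a, b). cbox a b) :: ((real^'d) \<times> (real^'d)) set set"
  have gen: "sets borel = sigma_sets UNIV ?E"
  proof -
    have "range (\<lambda>(a, b). {a..b}) = ?E" by (simp add: interval_cbox)
    then show ?thesis by (subst borel_eq_atLeastAtMost) simp
  qed
  have box: "emeasure M1 (cbox a b) = emeasure M2 (cbox a b)" for a b
  proof (cases "cbox a b = {}")
    case False
    let ?A = "cbox (fst a) (fst b)" and ?B = "cbox (snd a) (snd b)"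
    have ab: "cbox a b = ?A \<times> ?B" by (metis cbox_Pair_eq prod.collapse)
    have A: "closed ?A" "?A \<noteq> {}" using False ab by auto
    have B: "closed (expv ` ?B)" "expv ` ?B \<noteq> {}"
      using False ab by (auto intro!: compact_imp_closed compact_continuous_image continuous_on_expv)
    let ?f = "\<lambda>n x. max 0 (1 - real n * infdist x ?A)" and ?G = "\<lambda>n x. max 0 (1 - real n * infdist x (expv ` ?B))"
    have tf: "test_function (real n) (?f n)" and tG: "test_function (real n) (?G n)" for n
      by (rule test_function_infdist, simp)+
    note [measurable] = test_function_measurable[OF tf] test_function_measurable[OF tG]
    have lim: "(\<lambda>n. \<integral>\<^sup>+p. ennreal (?f n (fst p) * ?G n (expv (snd p))) \<partial>N) \<longlonglongrightarrow> emeasure N (cbox a b)"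
      if N: "finite_measure N" "sets N = sets borel" for N
    proof -
      interpret N: finite_measure N by fact
      have mN: "measurable N borel = measurable (borel \<Otimes>\<^sub>M borel) borel"
        by (rule measurable_cong_sets[OF _ refl]) (subst borel_prod, rule N(2))
      have "(\<lambda>n. \<integral>\<^sup>+p. ennreal (?f n (fst p) * ?G n (expv (snd p))) \<partial>N) \<longlonglongrightarrow> (\<integral>\<^sup>+p. ennreal (indicator (cbox a b) p) \<partial>N)"
      proof (rule nn_integral_dominated_convergence[where w="\<lambda>_. 1"])
        show "AE p in N. ennreal (?f n (fst p) * ?G n (expv (snd p))) \<le> 1" for n
          using test_functionD(2,3)[OF tf[of n]] test_functionD(2,3)[OF tG[of n]] by (intro AE_I2) (simp add: mult_le_one)
        show "(\<integral>\<^sup>+p. 1 \<partial>N) < \<infinity>" using N.emeasure_finite[of "space N"] by (simp add: less_top[symmetric])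
        show "AE p in N. (\<lambda>n. ennreal (?f n (fst p) * ?G n (expv (snd p)))) \<longlonglongrightarrow> ennreal (indicator (cbox a b) p)"
        proof (intro AE_I2 tendsto_ennrealI)
          fix p :: "(real^'d) \<times> (real^'d)"
          have "(\<lambda>n. ?f n (fst p) * ?G n (expv (snd p))) \<longlonglongrightarrow> indicator ?A (fst p) * indicator (expv ` ?B) (expv (snd p))"
            by (intro tendsto_mult infdist_approx_tendsto A B)
          moreover have "indicator ?A (fst p) * indicator (expv ` ?B) (expv (snd p)) = (indicator (cbox a b) p :: real)"
            unfolding ab by (auto simp: indicator_def expv_inject mem_Times_iff)
          ultimately show "(\<lambda>n. ?f n (fst p) * ?G n (expv (snd p))) \<longlonglongrightarrow> indicator (cbox a b) p" by simp
        qed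
        show "(\<lambda>p. ennreal (?f n (fst p) * ?G n (expv (snd p)))) \<in> borel_measurable N" for n
          unfolding mN by measurable
        show "(\<lambda>p. ennreal (indicator (cbox a b) p)) \<in> borel_measurable N"
          using N by (intro measurable_compose[OF _ measurable_ennreal] borel_measurable_indicator) simp
      qed simp
      then show ?thesis using N by (simp add: ennreal_indicator)
    qed
    show ?thesis
      using lim[OF fin(1) sets(1)] lim[OF fin(2) sets(2)] unfolding eq[OF tf tG] by (rule LIMSEQ_unique)
  qed simp
  show ?thesis
  proof (rule measure_eqI_generator_eq[where E="?E" and \<Omega>=UNIV and A="\<lambda>n. cbox (- (real n *\<^sub>R One)) (real n *\<^sub>R One)"])
    show "Int_stable ?E"
      unfolding Int_stable_def by (auto simp: Int_interval)
    show "emeasure M1 X = emeasure M2 X" if "X \<in> ?E" for X using that box by auto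
    show "sets M1 = sigma_sets UNIV ?E" "sets M2 = sigma_sets UNIV ?E" using sets gen by auto
    show "(\<Union>n. cbox (- (real n *\<^sub>R One)) (real n *\<^sub>R One)) = (UNIV :: ((real^'d) \<times> (real^'d)) set)"
      using UN_box_eq_UNIV box_subset_cbox by blast
    show "emeasure M1 (cbox (- (real n *\<^sub>R One)) (real n *\<^sub>R One)) \<noteq> \<infinity>" for n
      using finite_measure.emeasure_finite[OF fin(1)] by simp
  qed auto
qed

section \<open>Joint laws of passage time, state and jump\<close>

context boundary_crossing
begin

interpretation mu: sigma_finite_measure \<mu> by (rule sigma_finite_levy)
interpretation Mm: pair_sigma_finite M \<mu> ..

text \<open>A total and measurable version of the boundary; at nonpositive times \<open>c\<close> is
  unconstrained.\<close>

definition cc :: "real \<Rightarrow> real" where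
  "cc t = (if 0 < t then c t else 0)"

lemma measurable_cc [measurable]: "cc \<in> borel_measurable borel"
proof -
  have "(\<lambda>t. indicator {0<..} t *\<^sub>R c t) \<in> borel_measurable borel"
    by (rule borel_measurable_continuous_on_indicator[OF _ c_continuous_on]) simp
  also have "(\<lambda>t. indicator {0<..} t *\<^sub>R c t) = cc"
    by (auto simp: cc_def indicator_def)
  finally show ?thesis .
qed

abbreviation "XX t \<omega> \<equiv> X (max 0 t) \<omega>"

text \<open>The restriction in \<open>nu1\<close> as a function of time, sample point and jump,
  defined for all real times so that Fubini applies.\<close>

definition jumps :: "real \<Rightarrow> 'w \<Rightarrow> real^'d \<Rightarrow> ennreal" where
  "jumps t \<omega> v = (if 0 \<le> cc t - l1norm (XX t \<omega>) \<and> cc t - l1norm (XX t \<omega>) < l1norm v then 1 else 0)"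

lemma sets_Mmu [measurable_cong]: "sets \<mu> = sets borel"
  by (rule sets_levy_measure)

lemma measurable_jumps [measurable]:
  "(\<lambda>p. jumps (fst p) (fst (snd p)) (snd (snd p))) \<in> borel_measurable (borel \<Otimes>\<^sub>M (M \<Otimes>\<^sub>M borel))"
  unfolding jumps_def by measurable

lemma measurable_jumps' [measurable]:
  assumes "0 \<le> t" shows "(\<lambda>p. jumps t (fst p) (snd p)) \<in> borel_measurable (M \<Otimes>\<^sub>M borel)"
  unfolding jumps_def by measurable

lemma nu1_eq:
  assumes t: "0 < t" and C: "C \<in> sets borel"
  shows "emeasure (nu1 M X \<mu> c t) C = (\<integral>\<^sup>+p. jumps t (fst p) (snd p) * indicator C (X t (fst p), snd p) \<partial>(M \<Otimes>\<^sub>M \<mu>))"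
proof -
  have Xt[measurable]: "X t \<in> borel_measurable M" using t by (intro measurable_X) simp
  have C': "C \<in> sets (borel \<Otimes>\<^sub>M borel)" using C by (subst borel_prod)
  note [measurable] = C'
  have sets_eq: "sets (distr M borel (X t) \<Otimes>\<^sub>M \<mu>) = sets (borel \<Otimes>\<^sub>M borel)"
    by (intro sets_pair_measure_cong) (auto simp: sets_levy_measure)
  let ?D = "{(u, v). 0 \<le> c t - l1norm u \<and> c t - l1norm u < l1norm v} :: ((real^'d) \<times> (real^'d)) set"
  have D[measurable]: "?D \<in> sets (borel \<Otimes>\<^sub>M borel)"
  proof -
    have "{p \<in> space (borel \<Otimes>\<^sub>M borel). 0 \<le> c t - l1norm (fst p) \<and> c t - l1norm (fst p) < l1norm (snd p :: real^'d)} \<in> sets (borel \<Otimes>\<^sub>M borel)"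
      by measurable
    also have "{p \<in> space (borel \<Otimes>\<^sub>M borel). 0 \<le> c t - l1norm (fst p) \<and> c t - l1norm (fst p) < l1norm (snd p :: real^'d)} = ?D"
      by (auto simp: space_pair_measure)
    finally show ?thesis .
  qed
  have pd: "distr M borel (X t) \<Otimes>\<^sub>M \<mu> = distr (M \<Otimes>\<^sub>M \<mu>) (borel \<Otimes>\<^sub>M borel) (\<lambda>(\<omega>, v). (X t \<omega>, v))"
  proof -
    have e: "distr \<mu> borel (\<lambda>v. v) = \<mu>" by (rule distr_id2) (simp add: sets_levy_measure)
    have "distr M borel (X t) \<Otimes>\<^sub>M distr \<mu> borel (\<lambda>v. v) = distr (M \<Otimes>\<^sub>M \<mu>) (borel \<Otimes>\<^sub>M borel) (\<lambda>(\<omega>, v). (X t \<omega>, v))"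
      by (rule pair_measure_distr) (auto simp: e intro: sigma_finite_levy)
    then show ?thesis unfolding e .
  qed
  have "emeasure (nu1 M X \<mu> c t) C = (\<integral>\<^sup>+p. indicator ?D p * indicator C p \<partial>(distr M borel (X t) \<Otimes>\<^sub>M \<mu>))"
    unfolding nu1_def
    by (rule emeasure_density) (simp_all add: measurable_cong_sets[OF sets_eq refl] sets_eq C')
  also have "\<dots> = (\<integral>\<^sup>+p. indicator ?D (X t (fst p), snd p) * indicator C (X t (fst p), snd p) \<partial>(M \<Otimes>\<^sub>M \<mu>))"
    unfolding pd by (subst nn_integral_distr) (auto simp: split_beta)
  also have "\<dots> = (\<integral>\<^sup>+p. jumps t (fst p) (snd p) * indicator C (X t (fst p), snd p) \<partial>(M \<Otimes>\<^sub>M \<mu>))"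
    using t by (intro nn_integral_cong) (auto simp: jumps_def cc_def indicator_def)
  finally show ?thesis .
qed

definition w_exp :: "real^'d \<Rightarrow> ennreal" where
  "w_exp v = ennreal (1 - exp (- l1norm v))"

lemma measurable_w_exp [measurable]: "w_exp \<in> borel_measurable borel"
  unfolding w_exp_def by measurable

text \<open>Fubini rewrites \<open>crossing_limit_jump\<close> as an integral over time, sample
  point and jump, the form in which two measures on pairs of state and jump can be compared.\<close>

lemma jump_test:
  assumes f1: "test_function L f1" and G: "test_function L' G" and ab: "a \<in> active" "b \<in> active" "a < b"
  shows "(\<integral>\<^sup>+\<omega>. ennreal (f1 (U \<omega>) * G (expv (V \<omega>))) * w_exp (V \<omega>) * indicator {a<..b} (T \<omega>) \<partial>M) =
    (\<integral>\<^sup>+p. ennreal (f1 (XX (fst p) (fst (snd p))) * G (expv (snd (snd p)))) *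
      (indicator {a<..b} (fst p) * w_exp (snd (snd p)) * jumps (fst p) (fst (snd p)) (snd (snd p))) \<partial>(lborel \<Otimes>\<^sub>M (M \<Otimes>\<^sub>M \<mu>)))"
    (is "?lhs = ?rhs")
proof -
  note [measurable] = test_function_measurable[OF f1] test_function_measurable[OF G]
  note fD = test_functionD(2,3)[OF f1] and GD = test_functionD(2,3)[OF G]
  have a: "0 < a" using ab by (simp add: active_def)
  let ?J = "\<lambda>t. levy_limit (\<lambda>v. G (expv v) * (below f1 t (c t) - below f1 t (c t - l1norm v)))"
  note J = crossing_limit_jump[OF f1 G ab]
  have "?lhs = (\<integral>\<^sup>+\<omega>. ennreal (f1 (U \<omega>) * ((1 - exp (- l1norm (V \<omega>))) * G (expv (V \<omega>))) * indicator {a<..b} (T \<omega>)) \<partial>M)"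
    using fD GD by (intro nn_integral_cong) (auto simp: w_exp_def ennreal_mult[symmetric] ac_simps split: split_indicator)
  also have "\<dots> = ennreal (\<integral>\<omega>. f1 (U \<omega>) * ((1 - exp (- l1norm (V \<omega>))) * G (expv (V \<omega>))) * indicator {a<..b} (T \<omega>) \<partial>M)"
  proof (rule nn_integral_eq_integral)
    show "integrable M (\<lambda>\<omega>. f1 (U \<omega>) * ((1 - exp (- l1norm (V \<omega>))) * G (expv (V \<omega>))) * indicator {a<..b} (T \<omega>))"
      using fD GD by (intro integrable_const_bound[where B=1]) (auto simp: abs_mult indicator_def intro!: mult_le_one)
  qed (use fD GD in auto)
  also have "\<dots> = ennreal (\<integral>t. indicator {a<..b} t * ?J t \<partial>lborel)" unfolding J(2) ..
  also have "\<dots> = (\<integral>\<^sup>+t. ennreal (indicator {a<..b} t * ?J t) \<partial>lborel)"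
  proof (rule nn_integral_eq_integral[OF J(1), symmetric], rule AE_I2)
    fix t
    have "0 \<le> ?J t" if "0 < t"
      unfolding levy_limit_def
      using that GD below_mono[OF f1] by (intro integral_nonneg_AE AE_I2 mult_nonneg_nonneg) auto
    then show "0 \<le> indicator {a<..b} t * ?J t" using a by (auto simp: indicator_def)
  qed
  also have "\<dots> = (\<integral>\<^sup>+t. \<integral>\<^sup>+q. ennreal (f1 (XX t (fst q)) * G (expv (snd q))) *
      (indicator {a<..b} t * w_exp (snd q) * jumps t (fst q) (snd q)) \<partial>(M \<Otimes>\<^sub>M \<mu>) \<partial>lborel)"
  proof (rule nn_integral_cong)
    fix t :: real
    show "ennreal (indicator {a<..b} t * ?J t) = (\<integral>\<^sup>+q. ennreal (f1 (XX t (fst q)) * G (expv (snd q))) *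
      (indicator {a<..b} t * w_exp (snd q) * jumps t (fst q) (snd q)) \<partial>(M \<Otimes>\<^sub>M \<mu>))"
    proof (cases "t \<in> {a<..b}")
      case True
      then have t: "0 < t" using a by simp
      note [measurable] = measurable_below[OF f1 t]
      have [measurable]: "X t \<in> borel_measurable M" "S t \<in> borel_measurable M" using t by (auto intro!: measurable_X measurable_S)
      let ?A = "\<lambda>v. {c t - l1norm v<..c t}"
      have "ennreal (?J t) = (\<integral>\<^sup>+v. ennreal ((1 - exp (- l1norm v)) * (G (expv v) * (below f1 t (c t) - below f1 t (c t - l1norm v)))) \<partial>\<mu>)"
        unfolding levy_limit_def
      proof (rule nn_integral_eq_integral[symmetric])
        show "integrable \<mu> (\<lambda>v. (1 - exp (- l1norm v)) * (G (expv v) * (below f1 t (c t) - below f1 t (c t - l1norm v))))"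
        proof (rule integrable_levy_limit[where B=1])
          fix x :: "real^'d"
          show "\<bar>G (expv x) * (below f1 t (c t) - below f1 t (c t - l1norm x))\<bar> \<le> 1"
            using GD[of "expv x"] below_bounds[OF f1, of t "c t"] below_bounds[OF f1, of t "c t - l1norm x"] below_mono[OF f1, of t "c t - l1norm x" "c t"] t
            by (auto simp: abs_mult intro!: mult_le_one)
        qed measurable
        show "AE v in \<mu>. 0 \<le> (1 - exp (- l1norm v)) * (G (expv v) * (below f1 t (c t) - below f1 t (c t - l1norm v)))"
          using GD below_mono[OF f1, of t] t by (intro AE_I2 mult_nonneg_nonneg) auto
      qed
      also have "\<dots> = (\<integral>\<^sup>+v. \<integral>\<^sup>+\<omega>. ennreal (f1 (XX t \<omega>) * G (expv v)) * (w_exp v * jumps t \<omega> v) \<partial>M \<partial>\<mu>)"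
      proof (rule nn_integral_cong)
        fix v :: "real^'d"
        have "below f1 t (c t) - below f1 t (c t - l1norm v) = (\<integral>\<omega>. f1 (X t \<omega>) * indicator (?A v) (S t \<omega>) \<partial>M)"
          using t by (intro below_diff[OF f1]) auto
        then have "ennreal (below f1 t (c t) - below f1 t (c t - l1norm v)) = (\<integral>\<^sup>+\<omega>. ennreal (f1 (X t \<omega>) * indicator (?A v) (S t \<omega>)) \<partial>M)"
          using t fD by (simp add: nn_integral_eq_integral[OF integrable_below[OF f1]])
        then have "ennreal ((1 - exp (- l1norm v)) * (G (expv v) * (below f1 t (c t) - below f1 t (c t - l1norm v)))) =
          w_exp v * ennreal (G (expv v)) * (\<integral>\<^sup>+\<omega>. ennreal (f1 (X t \<omega>) * indicator (?A v) (S t \<omega>)) \<partial>M)"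
          using GD[of "expv v"] below_mono[OF f1, of t "c t - l1norm v" "c t"] t
          by (simp add: w_exp_def ennreal_mult mult.assoc)
        also have "\<dots> = (\<integral>\<^sup>+\<omega>. w_exp v * ennreal (G (expv v)) * ennreal (f1 (X t \<omega>) * indicator (?A v) (S t \<omega>)) \<partial>M)"
          by (rule nn_integral_cmult[symmetric]) measurable
        also have "\<dots> = (\<integral>\<^sup>+\<omega>. ennreal (f1 (XX t \<omega>) * G (expv v)) * (w_exp v * jumps t \<omega> v) \<partial>M)"
          using t fD GD by (intro nn_integral_cong) (auto simp: jumps_def cc_def norm_process_def indicator_def ennreal_mult ac_simps)
        finally show "ennreal ((1 - exp (- l1norm v)) * (G (expv v) * (below f1 t (c t) - below f1 t (c t - l1norm v)))) =
          (\<integral>\<^sup>+\<omega>. ennreal (f1 (XX t \<omega>) * G (expv v)) * (w_exp v * jumps t \<omega> v) \<partial>M)" .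
      qed
      also have "\<dots> = (\<integral>\<^sup>+q. ennreal (f1 (XX t (fst q)) * G (expv (snd q))) * (w_exp (snd q) * jumps t (fst q) (snd q)) \<partial>(M \<Otimes>\<^sub>M \<mu>))"
        using t by (subst Mm.nn_integral_snd[symmetric]) (auto intro!: borel_measurable_times_ennreal)
      finally show ?thesis using True by simp
    qed simp
  qed
  also have "\<dots> = ?rhs"
    by (subst sigma_finite_measure.nn_integral_fst[OF Mm.P.sigma_finite_measure_axioms, symmetric]) auto
  finally show ?thesis .
qed

text \<open>\<open>\<mu>\<close> may be infinite near \<open>0\<close>, so the comparison is made
  after weighting with \<open>w_exp\<close>: both weighted measures are finite and agree on test
  functions. Off \<open>v = 0\<close> the weight is positive and finite and is divided out
  again.\<close>

lemma jump_law:
  assumes ab: "a \<in> active" "b \<in> active" "a < b" and C: "C \<in> sets borel"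
  shows "(\<integral>\<^sup>+\<omega>. indicator C (U \<omega>, V \<omega>) * indicator (- {0}) (V \<omega>) * indicator {a<..b} (T \<omega>) \<partial>M) =
    (\<integral>\<^sup>+t. indicator {a<..b} t * emeasure (nu1 M X \<mu> c t) C \<partial>lborel)"
proof -
  have a: "0 < a" using ab by (simp add: active_def)
  have C'[measurable]: "C \<in> sets (borel \<Otimes>\<^sub>M borel)" using C by (subst borel_prod)
  let ?PP = "lborel \<Otimes>\<^sub>M (M \<Otimes>\<^sub>M \<mu>)"
  let ?d1 = "\<lambda>\<omega>. w_exp (V \<omega>) * indicator {a<..b} (T \<omega>)"
  let ?d2 = "\<lambda>p. indicator {a<..b} (fst p) * w_exp (snd (snd p)) * jumps (fst p) (fst (snd p)) (snd (snd p))"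
  let ?Y1 = "\<lambda>\<omega>. (U \<omega>, V \<omega>)" and ?Y2 = "\<lambda>p. (XX (fst p) (fst (snd p)), snd (snd p))"
  have [measurable]: "?d1 \<in> borel_measurable M" by measurable
  have [measurable]: "?d2 \<in> borel_measurable ?PP" by measurable
  have Y1[measurable]: "?Y1 \<in> M \<rightarrow>\<^sub>M borel \<Otimes>\<^sub>M borel" by measurable
  have Y2[measurable]: "?Y2 \<in> ?PP \<rightarrow>\<^sub>M borel \<Otimes>\<^sub>M borel" by measurable
  let ?M1 = "distr (density M ?d1) (borel \<Otimes>\<^sub>M borel) ?Y1"
  let ?M2 = "distr (density ?PP ?d2) (borel \<Otimes>\<^sub>M borel) ?Y2"
  have nn1: "(\<integral>\<^sup>+p. h p \<partial>?M1) = (\<integral>\<^sup>+\<omega>. ?d1 \<omega> * h (?Y1 \<omega>) \<partial>M)" if [measurable]: "h \<in> borel_measurable (borel \<Otimes>\<^sub>M borel)" for h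
    by (subst nn_integral_distr) (auto simp: nn_integral_density)
  have nn2: "(\<integral>\<^sup>+p. h p \<partial>?M2) = (\<integral>\<^sup>+p. ?d2 p * h (?Y2 p) \<partial>?PP)" if [measurable]: "h \<in> borel_measurable (borel \<Otimes>\<^sub>M borel)" for h
    by (subst nn_integral_distr) (auto simp: nn_integral_density)
  have test: "(\<integral>\<^sup>+p. ennreal (f (fst p) * G (expv (snd p))) \<partial>?M1) = (\<integral>\<^sup>+p. ennreal (f (fst p) * G (expv (snd p))) \<partial>?M2)"
    if f: "test_function L f" and G: "test_function L' G" for L f L' G
  proof -
    note [measurable] = test_function_measurable[OF f] test_function_measurable[OF G]
    have "(\<integral>\<^sup>+p. ennreal (f (fst p) * G (expv (snd p))) \<partial>?M1) = (\<integral>\<^sup>+\<omega>. ennreal (f (U \<omega>) * G (expv (V \<omega>))) * w_exp (V \<omega>) * indicator {a<..b} (T \<omega>) \<partial>M)"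
      by (subst nn1) (auto simp: ac_simps)
    also have "\<dots> = (\<integral>\<^sup>+p. ennreal (f (fst p) * G (expv (snd p))) \<partial>?M2)"
      unfolding jump_test[OF f G ab] by (subst nn2) (auto simp: ac_simps)
    finally show ?thesis .
  qed
  have one: "test_function 0 (\<lambda>_::real^'d. 1)" by (simp add: test_function_def)
  have e1: "emeasure ?M1 (space ?M1) \<le> 1"
  proof -
    have "emeasure ?M1 (space ?M1) = (\<integral>\<^sup>+p. 1 \<partial>?M1)" by simp
    also have "\<dots> = (\<integral>\<^sup>+\<omega>. ?d1 \<omega> * 1 \<partial>M)" by (rule nn1) simp
    also have "\<dots> \<le> (\<integral>\<^sup>+\<omega>. 1 \<partial>M)" by (intro nn_integral_mono) (auto simp: w_exp_def split: split_indicator)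
    finally show ?thesis by (simp add: emeasure_space_1)
  qed
  \<comment> \<open>Testing with the constant \<open>1\<close> transfers finiteness from the first
    measure to the second.\<close>
  have e2: "emeasure ?M2 (space ?M2) = emeasure ?M1 (space ?M1)"
    using test[OF one one] by simp
  have "?M1 = ?M2"
  proof (rule measure_pair_eqI_test)
    have f1: "emeasure ?M1 (space ?M1) \<noteq> \<infinity>" using e1 by (metis ennreal_one_neq_top infinity_ennreal_def top_unique)
    show "finite_measure ?M1" by (rule finite_measureI[OF f1])
    show "finite_measure ?M2" by (rule finite_measureI) (unfold e2, rule f1)
    show "sets ?M1 = sets borel" "sets ?M2 = sets borel" by (subst borel_prod[symmetric], simp)+
  qed (rule test)
  \<comment> \<open>The value \<open>0\<close> at jump \<open>0\<close> supplies the indicator of a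
    nonzero jump and avoids the inverse of a vanishing weight.\<close>
  let ?h = "\<lambda>p::(real^'d) \<times> (real^'d). indicator C p * (if snd p = 0 then 0 else inverse (w_exp (snd p)))"
  have [measurable]: "?h \<in> borel_measurable (borel \<Otimes>\<^sub>M borel)" by measurable
  have winv: "w_exp v * inverse (w_exp v) = 1" if "v \<noteq> 0" for v
  proof -
    have "0 < l1norm v" using that l1norm_nonneg[of v] l1norm_eq_0_iff[of v] by linarith
    then have "w_exp v \<noteq> 0" "w_exp v \<noteq> top" by (auto simp: w_exp_def ennreal_eq_0_iff)
    then show ?thesis by (simp add: ennreal_divide_self[unfolded divide_ennreal_def] less_top)
  qed
  have "(\<integral>\<^sup>+\<omega>. indicator C (U \<omega>, V \<omega>) * indicator (- {0}) (V \<omega>) * indicator {a<..b} (T \<omega>) \<partial>M) = (\<integral>\<^sup>+\<omega>. ?d1 \<omega> * ?h (?Y1 \<omega>) \<partial>M)"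
    by (intro nn_integral_cong) (auto simp: winv split: split_indicator)
  also have "\<dots> = (\<integral>\<^sup>+p. ?h p \<partial>?M1)" by (rule nn1[symmetric]) measurable
  also have "\<dots> = (\<integral>\<^sup>+p. ?h p \<partial>?M2)" using \<open>?M1 = ?M2\<close> by simp
  also have "\<dots> = (\<integral>\<^sup>+p. ?d2 p * ?h (?Y2 p) \<partial>?PP)" by (rule nn2) measurable
  also have "\<dots> = (\<integral>\<^sup>+p. indicator {a<..b} (fst p) * (jumps (fst p) (fst (snd p)) (snd (snd p)) * indicator C (?Y2 p)) \<partial>?PP)"
  proof (rule nn_integral_cong)
    fix p :: "real \<times> 'w \<times> (real^'d)"
    show "?d2 p * ?h (?Y2 p) = indicator {a<..b} (fst p) * (jumps (fst p) (fst (snd p)) (snd (snd p)) * indicator C (?Y2 p))"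
    proof (cases "snd (snd p) = 0")
      case True
      then have "jumps (fst p) (fst (snd p)) (snd (snd p)) = 0" by (simp add: jumps_def)
      then show ?thesis by simp
    next
      case False
      then show ?thesis using winv[OF False] by (auto split: split_indicator simp: jumps_def)
    qed
  qed
  also have "\<dots> = (\<integral>\<^sup>+t. \<integral>\<^sup>+q. indicator {a<..b} t * (jumps t (fst q) (snd q) * indicator C (XX t (fst q), snd q)) \<partial>(M \<Otimes>\<^sub>M \<mu>) \<partial>lborel)"
    by (subst sigma_finite_measure.nn_integral_fst[OF Mm.P.sigma_finite_measure_axioms, symmetric]) auto
  also have "\<dots> = (\<integral>\<^sup>+t. indicator {a<..b} t * emeasure (nu1 M X \<mu> c t) C \<partial>lborel)"
  proof (rule nn_integral_cong)
    fix t :: real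
    show "(\<integral>\<^sup>+q. indicator {a<..b} t * (jumps t (fst q) (snd q) * indicator C (XX t (fst q), snd q)) \<partial>(M \<Otimes>\<^sub>M \<mu>)) =
      indicator {a<..b} t * emeasure (nu1 M X \<mu> c t) C"
    proof (cases "t \<in> {a<..b}")
      case True
      then have "0 < t" using a by simp
      then show ?thesis using True by (simp add: nu1_eq[OF _ C])
    qed simp
  qed
  finally show ?thesis .
qed

text \<open>The density of creeping over the boundary at time \<open>t\<close>; outside
  \<open>F\<close> it is the first summand of the normalizer.\<close>

definition creep :: "real \<Rightarrow> ennreal" where
  "creep t = ennreal (slope t * gg t (c t))"

lemma measurable_creep [measurable]:
  assumes "0 < a" shows "(\<lambda>t. indicator {a<..b} t * creep t) \<in> borel_measurable borel"
proof -
  note [measurable] = measurable_slope_Ioc[OF assms, of b]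
  have "(\<lambda>t. ennreal ((indicator {a<..b} t * slope t) * gg t (cc t))) \<in> borel_measurable borel" by measurable
  also have "(\<lambda>t. ennreal ((indicator {a<..b} t * slope t) * gg t (cc t))) = (\<lambda>t. indicator {a<..b} t * creep t)"
    using assms by (auto simp: creep_def cc_def indicator_def fun_eq_iff)
  finally show ?thesis .
qed

lemma measurable_bridge_cc: "(\<lambda>t. bridge_law t (cc t)) \<in> borel \<rightarrow>\<^sub>M prob_algebra borel"
  using measurable_compose[OF measurable_Pair[OF measurable_ident measurable_cc] measurable_bridge_law] by simp

lemma measurable_emeasure_bridge_cc [measurable]:
  "A \<in> sets borel \<Longrightarrow> (\<lambda>t. emeasure (bridge_law t (cc t)) A) \<in> borel_measurable borel"
  using measurable_emeasure_kernel[OF measurable_prob_algebraD[OF measurable_bridge_cc]] .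

text \<open>The pattern of the jump law on one copy of the state space: the law of \<open>U\<close>
  on \<open>V = 0\<close> and passage in \<open>(a, b]\<close> is compared with the mixture of
  bridge laws over time. Both are finite and agree on test functions.\<close>

lemma creep_law:
  assumes ab: "a \<in> active" "b \<in> active" "a < b" and A: "A \<in> sets borel"
  shows "(\<integral>\<^sup>+\<omega>. indicator A (U \<omega>) * indicator {0} (V \<omega>) * indicator {a<..b} (T \<omega>) \<partial>M) =
    (\<integral>\<^sup>+t. indicator {a<..b} t * creep t * emeasure (bridge_law t (cc t)) A \<partial>lborel)"
proof -
  have a: "0 < a" using ab by (simp add: active_def)
  note [measurable] = measurable_creep[OF a, of b]
  let ?d1 = "\<lambda>\<omega>. indicator {0} (V \<omega>) * indicator {a<..b} (T \<omega>) :: ennreal"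
  let ?d2 = "\<lambda>t. indicator {a<..b} t * creep t"
  have [measurable]: "?d1 \<in> borel_measurable M" by measurable
  let ?M1 = "distr (density M ?d1) borel U"
  let ?D2 = "density lborel ?d2"
  let ?M2 = "?D2 \<bind> (\<lambda>t. bridge_law t (cc t))"
  have KD: "(\<lambda>t. bridge_law t (cc t)) \<in> ?D2 \<rightarrow>\<^sub>M subprob_algebra borel"
    using measurable_prob_algebraD[OF measurable_bridge_cc] by simp
  have sp: "space ?D2 \<noteq> {}" by simp
  have setsM2: "sets ?M2 = sets borel"
    by (rule sets_bind[OF _ sp]) (use KD in \<open>auto dest: subprob_measurableD(2)\<close>)
  have nn1: "(\<integral>\<^sup>+x. h x \<partial>?M1) = (\<integral>\<^sup>+\<omega>. ?d1 \<omega> * h (U \<omega>) \<partial>M)" if [measurable]: "h \<in> borel_measurable borel" for h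
    by (subst nn_integral_distr) (auto simp: nn_integral_density)
  have nn2: "(\<integral>\<^sup>+x. h x \<partial>?M2) = (\<integral>\<^sup>+t. ?d2 t * (\<integral>\<^sup>+x. h x \<partial>bridge_law t (cc t)) \<partial>lborel)" if h[measurable]: "h \<in> borel_measurable borel" for h
  proof -
    have "(\<lambda>t. \<integral>\<^sup>+x. h x \<partial>bridge_law t (cc t)) \<in> borel_measurable lborel"
      using nn_integral_measurable_subprob_algebra2[of "\<lambda>_. h" lborel borel "\<lambda>t. bridge_law t (cc t)"] KD by simp
    then show ?thesis
      using KD by (subst nn_integral_bind[where B=borel]) (auto simp: nn_integral_density)
  qed
  have test: "(\<integral>\<^sup>+x. ennreal (f x) \<partial>?M1) = (\<integral>\<^sup>+x. ennreal (f x) \<partial>?M2)" if f: "test_function L f" for L f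
  proof -
    note [measurable] = test_function_measurable[OF f]
    note fD = test_functionD(2,3)[OF f]
    have "(\<integral>\<^sup>+x. ennreal (f x) \<partial>?M1) = (\<integral>\<^sup>+\<omega>. ennreal (f (U \<omega>) * indicator {0} (V \<omega>) * indicator {a<..b} (T \<omega>)) \<partial>M)"
      using fD by (subst nn1) (auto intro!: nn_integral_cong split: split_indicator)
    also have "\<dots> = ennreal (\<integral>\<omega>. f (U \<omega>) * indicator {0} (V \<omega>) * indicator {a<..b} (T \<omega>) \<partial>M)"
    proof (rule nn_integral_eq_integral)
      show "integrable M (\<lambda>\<omega>. f (U \<omega>) * indicator {0} (V \<omega>) * indicator {a<..b} (T \<omega>))"
        using fD by (intro integrable_const_bound[where B=1]) (auto simp: indicator_def)
    qed (use fD in auto)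
    also have "\<dots> = ennreal (\<integral>t. slice f t (c t) * (indicator {a<..b} t * slope t) \<partial>lborel)"
      unfolding crossing_limit_creep[OF f ab] ..
    also have "\<dots> = (\<integral>\<^sup>+t. ennreal (slice f t (c t) * (indicator {a<..b} t * slope t)) \<partial>lborel)"
    proof (rule nn_integral_eq_integral[symmetric])
      show "integrable lborel (\<lambda>t. slice f t (c t) * (indicator {a<..b} t * slope t))"
        using ab by (intro integrable_slice_slope[OF f ab(1,2)]) auto
      show "AE t in lborel. 0 \<le> slice f t (c t) * (indicator {a<..b} t * slope t)"
      proof (intro AE_I2)
        fix t show "0 \<le> slice f t (c t) * (indicator {a<..b} t * slope t)"
          using slice_bounds(1)[OF f, of t "c t"] slope_nonneg[of t] a by (auto simp: indicator_def)
      qed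
    qed
    also have "\<dots> = (\<integral>\<^sup>+t. ?d2 t * (\<integral>\<^sup>+x. ennreal (f x) \<partial>bridge_law t (cc t)) \<partial>lborel)"
    proof (rule nn_integral_cong)
      fix t :: real
      show "ennreal (slice f t (c t) * (indicator {a<..b} t * slope t)) = ?d2 t * (\<integral>\<^sup>+x. ennreal (f x) \<partial>bridge_law t (cc t))"
      proof (cases "t \<in> {a<..b}")
        case True
        then have t: "0 < t" using a by simp
        have "(\<integral>\<^sup>+x. ennreal (f x) \<partial>bridge_law t (c t)) = ennreal (\<integral>x. f x \<partial>bridge_law t (c t))"
          using fD by (intro nn_integral_eq_integral integrable_bridge_law[OF f]) auto
        then show ?thesis
          using True t slope_nonneg[OF t] integral_bridge_law_bounds(1)[OF f, of t "c t"]
          by (simp add: creep_def cc_def slice_def ennreal_mult[symmetric] ac_simps)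
      qed simp
    qed
    also have "\<dots> = (\<integral>\<^sup>+x. ennreal (f x) \<partial>?M2)" by (rule nn2[symmetric]) measurable
    finally show ?thesis .
  qed
  have one: "test_function 0 (\<lambda>_::real^'d. 1)" by (simp add: test_function_def)
  have e1: "emeasure ?M1 (space ?M1) \<le> 1"
  proof -
    have "emeasure ?M1 (space ?M1) = (\<integral>\<^sup>+p. 1 \<partial>?M1)" by simp
    also have "\<dots> = (\<integral>\<^sup>+\<omega>. ?d1 \<omega> * 1 \<partial>M)" by (rule nn1) simp
    also have "\<dots> \<le> (\<integral>\<^sup>+\<omega>. 1 \<partial>M)" by (intro nn_integral_mono) (auto split: split_indicator)
    finally show ?thesis by (simp add: emeasure_space_1)
  qed
  have e2: "emeasure ?M2 (space ?M2) = emeasure ?M1 (space ?M1)"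
    using test[OF one] by simp
  have fin: "finite_measure ?M1" "finite_measure ?M2"
  proof -
    have f1: "emeasure ?M1 (space ?M1) \<noteq> \<infinity>" using e1 by (metis ennreal_one_neq_top infinity_ennreal_def top_unique)
    show "finite_measure ?M1" by (rule finite_measureI[OF f1])
    show "finite_measure ?M2" by (rule finite_measureI) (unfold e2, rule f1)
  qed
  have "?M1 = ?M2"
  proof (rule emeasure_eqI_closed[OF fin(1) _ setsM2])
    fix B :: "(real^'d) set" assume B: "closed B" "B \<noteq> {}"
    let ?f = "\<lambda>n x. max 0 (1 - real n * infdist x B)"
    have tf: "test_function (real n) (?f n)" for n by (rule test_function_infdist) simp
    have lim: "(\<lambda>n. \<integral>\<^sup>+x. ennreal (?f n x) \<partial>N) \<longlonglongrightarrow> emeasure N B" if N: "finite_measure N" "sets N = sets borel" for N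
    proof -
      interpret N: finite_measure N by fact
      have mN: "measurable N borel = measurable borel borel" by (rule measurable_cong_sets) (simp_all add: N)
      have "(\<lambda>n. \<integral>\<^sup>+x. ennreal (?f n x) \<partial>N) \<longlonglongrightarrow> (\<integral>\<^sup>+x. ennreal (indicator B x) \<partial>N)"
      proof (rule nn_integral_dominated_convergence[where w="\<lambda>_. 1"])
        show "AE x in N. ennreal (?f n x) \<le> 1" for n
          using test_functionD(3)[OF tf[of n]] by (intro AE_I2) simp
        show "(\<integral>\<^sup>+x. 1 \<partial>N) < \<infinity>" using N.emeasure_finite[of "space N"] by (simp add: less_top[symmetric])
        show "AE x in N. (\<lambda>n. ennreal (?f n x)) \<longlonglongrightarrow> ennreal (indicator B x)"
          by (intro AE_I2 tendsto_ennrealI infdist_approx_tendsto B)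
        show "(\<lambda>x. ennreal (?f n x)) \<in> borel_measurable N" for n
          unfolding mN using test_function_measurable[OF tf[of n]] by measurable
        show "(\<lambda>x. ennreal (indicator B x)) \<in> borel_measurable N"
          using N B by (intro measurable_compose[OF _ measurable_ennreal] borel_measurable_indicator) (simp add: borel_closed)
      qed simp
      then show ?thesis using N B by (simp add: ennreal_indicator borel_closed)
    qed
    show "emeasure ?M1 B = emeasure ?M2 B"
      using lim[OF fin(1) sets_distr] lim[OF fin(2) setsM2] unfolding test[OF tf] by (rule LIMSEQ_unique)
  qed simp
  have "(\<integral>\<^sup>+\<omega>. indicator A (U \<omega>) * indicator {0} (V \<omega>) * indicator {a<..b} (T \<omega>) \<partial>M) = (\<integral>\<^sup>+x. indicator A x \<partial>?M1)"
    using A by (subst nn1) (auto simp: ac_simps)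
  also have "\<dots> = (\<integral>\<^sup>+x. indicator A x \<partial>?M2)" using \<open>?M1 = ?M2\<close> by simp
  also have "\<dots> = (\<integral>\<^sup>+t. indicator {a<..b} t * creep t * emeasure (bridge_law t (cc t)) A \<partial>lborel)"
    using A by (subst nn2) (auto simp: ac_simps)
  finally show ?thesis .
qed

end

section \<open>The conditional law at the passage time\<close>

text \<open>Inside a member of the exhaustion both measures are finite and agree on a generator.
  Monotone limits then reach all of \<open>I\<close>, and its complement is null for both.\<close>

lemma measure_eqI_Ioc_exhaustion:
  fixes M1 M2 :: "real measure" and p q :: "nat \<Rightarrow> real"
  assumes sets: "sets M1 = sets borel" "sets M2 = sets borel"
    and inc: "incseq (\<lambda>k. {p k<..q k})" and I: "I = (\<Union>k. {p k<..q k})"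
    and eq: "\<And>k x. p k < x \<Longrightarrow> x \<le> q k \<Longrightarrow> emeasure M1 {p k<..x} = emeasure M2 {p k<..x}"
    and fin: "\<And>k. emeasure M1 {p k<..q k} \<noteq> \<infinity>"
    and null: "emeasure M1 (- I) = 0" "emeasure M2 (- I) = 0"
  shows "M1 = M2"
proof (rule measure_eqI)
  show "sets M1 = sets M2" using sets by simp
  fix B assume "B \<in> sets M1"
  then have B: "B \<in> sets borel" using sets by simp
  let ?J = "\<lambda>k. {p k<..q k}"
  have J: "emeasure M1 (?J k \<inter> B) = emeasure M2 (?J k \<inter> B)" for k
  proof -
    have "density M1 (indicator (?J k)) = density M2 (indicator (?J k))"
    proof (rule measure_eqI_generator_eq[where E="range atMost" and \<Omega>=UNIV and A="\<lambda>i. {..real i}"])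
      show "Int_stable (range (atMost :: real \<Rightarrow> _))" by (auto simp: Int_stable_def)
      show "sets (density M1 (indicator (?J k))) = sigma_sets UNIV (range atMost)"
        "sets (density M2 (indicator (?J k))) = sigma_sets UNIV (range atMost)"
        using sets by (simp_all add: borel_eq_atMost)
      show "(\<Union>i. {..real i}) = UNIV" using real_arch_simple by auto
      fix Y assume "Y \<in> range (atMost :: real \<Rightarrow> _)"
      then obtain y where Y: "Y = {..y}" by auto
      have "?J k \<inter> Y = {p k<..min (q k) y}" unfolding Y by auto
      moreover have "emeasure M1 {p k<..min (q k) y} = emeasure M2 {p k<..min (q k) y}"
      proof (cases "p k < min (q k) y")
        case True
        then show ?thesis by (intro eq) auto
      next
        case False
        then have "{p k<..min (q k) y} = {}" by auto
        then show ?thesis by (simp only: emeasure_empty)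
      qed
      ultimately show "emeasure (density M1 (indicator (?J k))) Y = emeasure (density M2 (indicator (?J k))) Y"
        using sets by (simp add: emeasure_restricted Y)
    next
      fix i :: nat
      have "emeasure M1 (?J k \<inter> {..real i}) \<le> emeasure M1 (?J k)"
        using sets by (intro emeasure_mono) auto
      then show "emeasure (density M1 (indicator (?J k))) {..real i} \<noteq> \<infinity>"
        using fin[of k] sets by (auto simp: emeasure_restricted top_unique)
    qed auto
    then have "emeasure (density M1 (indicator (?J k))) B = emeasure (density M2 (indicator (?J k))) B" by simp
    then show ?thesis using sets B by (simp add: emeasure_restricted)
  qed
  have sup: "emeasure N B = (SUP k. emeasure N (?J k \<inter> B))" if N: "sets N = sets borel" "emeasure N (- I) = 0" for N
  proof -
    have "I \<in> sets borel" unfolding I by auto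
    then have "- I \<in> sets borel" by (metis borel_comp)
    then have "- I \<in> null_sets N" using N by (simp add: null_sets_def)
    then have "emeasure N B = emeasure N (B - (- I))"
      using N B by (intro emeasure_Diff_null_set[symmetric]) simp_all
    also have "B - (- I) = (\<Union>k. ?J k \<inter> B)" unfolding I by auto
    also have "emeasure N (\<Union>k. ?J k \<inter> B) = (SUP k. emeasure N (?J k \<inter> B))"
      using N B inc by (intro SUP_emeasure_incseq[symmetric]) (auto simp: mono_def le_fun_def)
    finally show ?thesis .
  qed
  show "emeasure M1 B = emeasure M2 B"
    unfolding sup[OF sets(1) null(1)] sup[OF sets(2) null(2)] J ..
qed

context boundary_crossing
begin

interpretation mu: sigma_finite_measure \<mu> by (rule sigma_finite_levy)
interpretation Mm: pair_sigma_finite M \<mu> ..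

text \<open>The joint density in \<open>t\<close> of the passage time and the event
  \<open>(U, V) \<in> C\<close>. As a function of \<open>C\<close> it is the unnormalised
  conditional law, with the creeping part placed on jump \<open>0\<close>.\<close>

definition passage_density :: "real \<Rightarrow> ((real^'d) \<times> (real^'d)) set \<Rightarrow> ennreal" where
  "passage_density t C = indicator active t *
     (emeasure (nu1 M X \<mu> c t) C + creep t * emeasure (bridge_law t (cc t)) ((\<lambda>u. (u, 0)) -` C))"

lemma sets_bridge_cc [simp]: "sets (bridge_law t (cc t)) = sets borel"
  and prob_bridge_cc: "prob_space (bridge_law t (cc t))"
  using measurable_space[OF measurable_bridge_cc, of t] by (auto simp: space_prob_algebra)

lemma sets_nu1: "sets (nu1 M X \<mu> c t) = sets borel"
proof -
  have "sets (nu1 M X \<mu> c t) = sets (borel \<Otimes>\<^sub>M borel)"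
    unfolding nu1_def sets_density by (intro sets_pair_measure_cong) (auto simp: sets_levy_measure)
  then show ?thesis by (subst borel_prod[symmetric])
qed

lemma measurable_zero_jump [measurable]: "(\<lambda>u::real^'d. (u, 0::real^'d)) \<in> borel \<rightarrow>\<^sub>M borel"
  by (intro borel_measurable_continuous_onI continuous_intros)

lemma zero_jump_section: "C \<in> sets borel \<Longrightarrow> (\<lambda>u::real^'d. (u, 0::real^'d)) -` C \<in> sets borel"
  using measurable_sets[OF measurable_zero_jump, of C] by simp

lemma active_borel [measurable]: "active \<in> sets borel"
proof -
  have "{t \<in> space borel. 0 < t \<and> 0 < cc t} \<in> sets borel" by measurable
  also have "{t \<in> space borel. 0 < t \<and> 0 < cc t} = active" by (auto simp: active_def cc_def)
  finally show ?thesis .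
qed

lemma measurable_passage_density [measurable]:
  assumes C: "C \<in> sets borel" shows "(\<lambda>t. passage_density t C) \<in> borel_measurable borel"
proof -
  have C'[measurable]: "C \<in> sets (borel \<Otimes>\<^sub>M borel)" using C by (subst borel_prod)
  let ?j = "\<lambda>t. \<integral>\<^sup>+q. jumps t (fst q) (snd q) * indicator C (XX t (fst q), snd q) \<partial>(M \<Otimes>\<^sub>M \<mu>)"
  let ?c = "\<lambda>t. ennreal ((indicator {0<..} t * slope t) * gg t (cc t))"
  have j[measurable]: "?j \<in> borel_measurable borel"
    by (rule sigma_finite_measure.borel_measurable_nn_integral[OF Mm.P.sigma_finite_measure_axioms]) (simp add: split_beta)
  note [measurable] = zero_jump_section[OF C]
  have "(\<lambda>t. indicator active t * (?j t + ?c t * emeasure (bridge_law t (cc t)) ((\<lambda>u. (u, 0)) -` C))) \<in> borel_measurable borel"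
    by measurable
  also have "(\<lambda>t. indicator active t * (?j t + ?c t * emeasure (bridge_law t (cc t)) ((\<lambda>u. (u, 0)) -` C))) = (\<lambda>t. passage_density t C)"
  proof
    fix t :: real
    show "indicator active t * (?j t + ?c t * emeasure (bridge_law t (cc t)) ((\<lambda>u. (u, 0)) -` C)) = passage_density t C"
    proof (cases "t \<in> active")
      case True
      then have "0 < t" by (simp add: active_def)
      then show ?thesis using True by (simp add: passage_density_def nu1_eq[OF _ C] creep_def cc_def)
    qed (simp add: passage_density_def)
  qed
  finally show ?thesis .
qed

lemma passage_density_mono: "C \<in> sets borel \<Longrightarrow> passage_density t C \<le> passage_density t UNIV"
  unfolding passage_density_def
  by (intro mult_left_mono add_mono emeasure_mono) (auto simp: sets_nu1)

text \<open>On \<open>(a, b]\<close> inside \<open>active\<close> the jump and creeping parts add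
  up. The exhaustion extends the identity to all Borel sets of times, as both sides vanish outside
  \<open>active\<close>.\<close>

lemma passage_law:
  assumes B: "B \<in> sets borel" and C: "C \<in> sets borel"
  shows "(\<integral>\<^sup>+\<omega>. indicator C (U \<omega>, V \<omega>) * indicator B (T \<omega>) \<partial>M) = (\<integral>\<^sup>+t. indicator B t * passage_density t C \<partial>lborel)"
proof -
  have C'[measurable]: "C \<in> sets (borel \<Otimes>\<^sub>M borel)" using C by (subst borel_prod)
  note [measurable] = zero_jump_section[OF C]
  let ?C0 = "(\<lambda>u. (u, 0)) -` C"
  have d[measurable]: "(\<lambda>\<omega>. indicator C (U \<omega>, V \<omega>) :: ennreal) \<in> borel_measurable M" by measurable
  let ?M1 = "distr (density M (\<lambda>\<omega>. indicator C (U \<omega>, V \<omega>))) borel (\<lambda>\<omega>. T \<omega>)"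
  let ?M2 = "density lborel (\<lambda>t. passage_density t C)"
  have m1: "emeasure ?M1 B = (\<integral>\<^sup>+\<omega>. indicator C (U \<omega>, V \<omega>) * indicator B (T \<omega>) \<partial>M)" if "B \<in> sets borel" for B
  proof -
    have "emeasure ?M1 B = (\<integral>\<^sup>+x. indicator B x \<partial>?M1)" using that by simp
    also have "\<dots> = (\<integral>\<^sup>+\<omega>. indicator B (T \<omega>) \<partial>density M (\<lambda>\<omega>. indicator C (U \<omega>, V \<omega>)))"
      using that by (intro nn_integral_distr) auto
    also have "\<dots> = (\<integral>\<^sup>+\<omega>. indicator C (U \<omega>, V \<omega>) * indicator B (T \<omega>) \<partial>M)"
      using that by (intro nn_integral_density) auto
    finally show ?thesis .
  qed
  have m2: "emeasure ?M2 B = (\<integral>\<^sup>+t. indicator B t * passage_density t C \<partial>lborel)" if "B \<in> sets borel" for B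
    using that C by (subst emeasure_density) (auto simp: mult.commute)
  have Ioc_borel: "{a<..b} \<in> sets borel" for a b :: real by simp
  have Ioc: "emeasure ?M1 {a<..b} = emeasure ?M2 {a<..b}" if ab: "a \<in> active" "b \<in> active" "a < b" for a b
  proof -
    have a: "0 < a" using ab by (simp add: active_def)
    note [measurable] = measurable_creep[OF a, of b]
    have nu1m: "(\<lambda>t. indicator {a<..b} t * emeasure (nu1 M X \<mu> c t) C) \<in> borel_measurable lborel"
    proof -
      let ?j = "\<lambda>t. \<integral>\<^sup>+q. jumps t (fst q) (snd q) * indicator C (XX t (fst q), snd q) \<partial>(M \<Otimes>\<^sub>M \<mu>)"
      have [measurable]: "?j \<in> borel_measurable borel"
        by (rule sigma_finite_measure.borel_measurable_nn_integral[OF Mm.P.sigma_finite_measure_axioms]) (simp add: split_beta)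
      have "(\<lambda>t. indicator {a<..b} t * ?j t) \<in> borel_measurable lborel" by measurable
      also have "(\<lambda>t. indicator {a<..b} t * ?j t) = (\<lambda>t. indicator {a<..b} t * emeasure (nu1 M X \<mu> c t) C)"
      proof
        fix t
        show "indicator {a<..b} t * ?j t = indicator {a<..b} t * emeasure (nu1 M X \<mu> c t) C"
        proof (cases "t \<in> {a<..b}")
          case True
          then have "0 < t" using a by simp
          then show ?thesis by (simp add: nu1_eq[OF _ C])
        qed simp
      qed
      finally show ?thesis .
    qed
    have creep_m: "(\<lambda>t. indicator {a<..b} t * creep t * emeasure (bridge_law t (cc t)) ?C0) \<in> borel_measurable lborel"
      using borel_measurable_times_ennreal[OF measurable_creep[OF a, of b] measurable_emeasure_bridge_cc[OF zero_jump_section[OF C]]] by simp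
    have "emeasure ?M1 {a<..b} = (\<integral>\<^sup>+\<omega>. indicator C (U \<omega>, V \<omega>) * indicator (- {0}) (V \<omega>) * indicator {a<..b} (T \<omega>) +
        indicator ?C0 (U \<omega>) * indicator {0} (V \<omega>) * indicator {a<..b} (T \<omega>) \<partial>M)"
      unfolding m1[OF Ioc_borel[of a b]]
      by (intro nn_integral_cong) (auto split: split_indicator)
    also have "\<dots> = (\<integral>\<^sup>+t. indicator {a<..b} t * emeasure (nu1 M X \<mu> c t) C \<partial>lborel) +
      (\<integral>\<^sup>+t. indicator {a<..b} t * creep t * emeasure (bridge_law t (cc t)) ?C0 \<partial>lborel)"
      unfolding jump_law[OF ab C, symmetric] creep_law[OF ab zero_jump_section[OF C], symmetric]
      by (rule nn_integral_add) measurable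
    also have "\<dots> = (\<integral>\<^sup>+t. indicator {a<..b} t * emeasure (nu1 M X \<mu> c t) C +
      indicator {a<..b} t * creep t * emeasure (bridge_law t (cc t)) ?C0 \<partial>lborel)"
      by (rule nn_integral_add[OF nu1m creep_m, symmetric])
    also have "\<dots> = (\<integral>\<^sup>+t. indicator {a<..b} t * passage_density t C \<partial>lborel)"
    proof (rule nn_integral_cong)
      fix t
      show "indicator {a<..b} t * emeasure (nu1 M X \<mu> c t) C + indicator {a<..b} t * creep t * emeasure (bridge_law t (cc t)) ?C0 =
        indicator {a<..b} t * passage_density t C"
        using active_interval[OF ab(1,2), of t] by (cases "t \<in> {a<..b}") (auto simp: passage_density_def)
    qed
    also have "\<dots> = emeasure ?M2 {a<..b}" by (rule m2[symmetric]) simp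
    finally show ?thesis .
  qed
  obtain p q where pq: "\<And>k. p k \<in> active" "\<And>k. q k \<in> active" "\<And>k::nat. p k < q k"
      "incseq (\<lambda>k. {p k<..q k})" "active = (\<Union>k. {p k<..q k})"
      "AE \<omega> in M. \<exists>k. c (q k) < S (q k) \<omega>"
  proof (rule active_exhaustion)
    fix p q :: "nat \<Rightarrow> real"
    assume a: "\<And>k. p k \<in> active" "\<And>k. q k \<in> active" "\<And>k. p k < q k"
      "incseq (\<lambda>k. {p k<..q k})" "active = (\<Union>k. {p k<..q k})"
      "AE \<omega> in M. \<exists>k. c (q k) < S (q k) \<omega>"
    show thesis by (rule that[of p q, OF a])
  qed
  have "?M1 = ?M2"
  proof (rule measure_eqI_Ioc_exhaustion[OF _ _ pq(4,5)])
    show "emeasure ?M1 {p k<..x} = emeasure ?M2 {p k<..x}" if "p k < x" "x \<le> q k" for k x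
      using that active_interval[OF pq(1)[of k] pq(2)[of k], of x] by (intro Ioc pq(1)) simp_all
    show "emeasure ?M1 {p k<..q k} \<noteq> \<infinity>" for k
    proof -
      have "emeasure ?M1 {p k<..q k} \<le> (\<integral>\<^sup>+\<omega>. 1 \<partial>M)"
        unfolding m1[OF Ioc_borel[of "p k" "q k"]] by (intro nn_integral_mono) (auto split: split_indicator)
      also have "\<dots> = 1" by (simp add: emeasure_space_1)
      finally show ?thesis by (metis ennreal_one_neq_top infinity_ennreal_def top_unique)
    qed
    have A: "- active \<in> sets borel" by (metis active_borel borel_comp)
    have "emeasure ?M1 (- active) = (\<integral>\<^sup>+\<omega>. 0 \<partial>M)"
      unfolding m1[OF A]
    proof (rule nn_integral_cong_AE)
      show "AE \<omega> in M. indicator C (U \<omega>, V \<omega>) * indicator (- active) (T \<omega>) = (0::ennreal)"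
        using AE_T_active by eventually_elim simp
    qed
    then show "emeasure ?M1 (- active) = 0" by simp
    have "emeasure ?M2 (- active) = (\<integral>\<^sup>+t. 0 \<partial>(lborel :: real measure))"
      unfolding m2[OF A] by (intro nn_integral_cong) (auto simp: passage_density_def split: split_indicator)
    then show "emeasure ?M2 (- active) = 0" by simp
  qed auto
  then show ?thesis using m1[OF B] m2[OF B] by simp
qed

lemma UNIV_borel: "UNIV \<in> sets borel"
  by simp

text \<open>That the passage time has a density keeps it off the null set \<open>F\<close> and makes
  this density positive and finite at it, almost surely.\<close>

lemma distr_T: "distr M borel (\<lambda>\<omega>. T \<omega>) = density lborel (\<lambda>t. passage_density t UNIV)"
proof (rule measure_eqI)
  fix B assume "B \<in> sets (distr M borel (\<lambda>\<omega>. T \<omega>))"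
  then have B[measurable]: "B \<in> sets borel" by simp
  have "emeasure (distr M borel (\<lambda>\<omega>. T \<omega>)) B = (\<integral>\<^sup>+x. indicator B x \<partial>distr M borel (\<lambda>\<omega>. T \<omega>))" by simp
  also have "\<dots> = (\<integral>\<^sup>+\<omega>. indicator UNIV (U \<omega>, V \<omega>) * indicator B (T \<omega>) \<partial>M)"
    by (subst nn_integral_distr) auto
  also have "\<dots> = emeasure (density lborel (\<lambda>t. passage_density t UNIV)) B"
    unfolding passage_law[OF B UNIV_borel] by (subst emeasure_density) (auto simp: mult.commute)
  finally show "emeasure (distr M borel (\<lambda>\<omega>. T \<omega>)) B = emeasure (density lborel (\<lambda>t. passage_density t UNIV)) B" .
qed simp

section \<open>The normalizer and the conditional law\<close>

lemma norm_levy_tail_eq: "norm_levy_tail \<mu> x = (\<integral>\<^sup>+v. (if x < l1norm v then 1 else 0) \<partial>\<mu>)"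
proof -
  have "norm_levy_tail \<mu> x = (\<integral>\<^sup>+s. indicator {x<..} s \<partial>distr \<mu> borel l1norm)"
    by (simp add: norm_levy_tail_def norm_levy_measure_def)
  also have "\<dots> = (\<integral>\<^sup>+v. indicator {x<..} (l1norm v) \<partial>\<mu>)" by (rule nn_integral_distr) auto
  finally show ?thesis by (simp add: indicator_def of_bool_def)
qed

text \<open>For a state with norm \<open>s\<close> below the boundary, integrating out the jump
  gives the Levy tail at \<open>c t - s\<close>. The bridge law has total mass \<open>1\<close>, so
  creeping contributes the density factor alone.\<close>

lemma normalizer_eq:
  assumes t: "t \<in> active" "t \<notin> F"
  shows "normalizer M X \<mu> g c t = passage_density t UNIV"
proof -
  have t0: "0 < t" using t by (simp add: active_def)
  have [measurable]: "S t \<in> borel_measurable M" "X t \<in> borel_measurable M" using t0 by (auto intro!: measurable_S measurable_X)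
  have tail[measurable]: "(\<lambda>s. norm_levy_tail \<mu> (c t - s)) \<in> borel_measurable borel"
    unfolding norm_levy_tail_eq by measurable
  have "emeasure (nu1 M X \<mu> c t) UNIV = (\<integral>\<^sup>+p. jumps t (fst p) (snd p) \<partial>(M \<Otimes>\<^sub>M \<mu>))"
    by (subst nu1_eq[OF t0]) auto
  also have "\<dots> = (\<integral>\<^sup>+\<omega>. \<integral>\<^sup>+v. jumps t \<omega> v \<partial>\<mu> \<partial>M)"
    using t0 by (subst mu.nn_integral_fst[symmetric]) auto
  also have "\<dots> = (\<integral>\<^sup>+\<omega>. norm_levy_tail \<mu> (c t - S t \<omega>) * indicator {0..c t} (S t \<omega>) \<partial>M)"
  proof (rule nn_integral_cong)
    fix \<omega>
    show "(\<integral>\<^sup>+v. jumps t \<omega> v \<partial>\<mu>) = norm_levy_tail \<mu> (c t - S t \<omega>) * indicator {0..c t} (S t \<omega>)"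
      using t0 by (cases "S t \<omega> \<le> c t") (simp_all add: jumps_def cc_def norm_levy_tail_eq norm_process_def)
  qed
  also have "\<dots> = (\<integral>\<^sup>+s\<in>{0..c t}. norm_levy_tail \<mu> (c t - s) \<partial>distr M borel (S t))"
    by (subst nn_integral_distr) auto
  finally have "emeasure (nu1 M X \<mu> c t) UNIV = (\<integral>\<^sup>+s\<in>{0..c t}. norm_levy_tail \<mu> (c t - s) \<partial>distr M borel (S t))" .
  moreover have "emeasure (bridge_law t (cc t)) UNIV = 1"
    using prob_space.emeasure_space_1[OF prob_bridge_cc[of t]] sets_eq_imp_space_eq[OF sets_bridge_cc[of t]] by simp
  moreover have "ennreal (- deriv c t * g t (c t)) = creep t"
    using t(2) by (simp add: creep_def slope_def gg_eq[OF t0])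
  ultimately show ?thesis
    using t(1) by (simp add: normalizer_def passage_density_def add.commute)
qed

text \<open>Times at which the conditional law can be formed by division; the law of the passage
  time is concentrated on them.\<close>

definition good :: "real set" where
  "good = {t \<in> active. t \<notin> F \<and> passage_density t UNIV \<noteq> 0 \<and> passage_density t UNIV \<noteq> \<infinity>}"

lemma good_borel [measurable]: "good \<in> sets borel"
proof -
  have [measurable]: "(\<lambda>t. passage_density t UNIV) \<in> borel_measurable borel" by (rule measurable_passage_density) simp
  have "{t \<in> space borel. t \<in> active \<and> t \<notin> F \<and> passage_density t UNIV \<noteq> 0 \<and> passage_density t UNIV \<noteq> \<infinity>} \<in> sets borel"
    by measurable
  then show ?thesis by (simp add: good_def)
qed

lemma AE_lborel_good: "AE t in lborel. passage_density t UNIV \<noteq> 0 \<longrightarrow> t \<in> good"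
proof -
  have [measurable]: "(\<lambda>t. passage_density t UNIV) \<in> borel_measurable borel" by (rule measurable_passage_density) simp
  have "(\<integral>\<^sup>+t. passage_density t UNIV \<partial>lborel) = emeasure (density lborel (\<lambda>t. passage_density t UNIV)) UNIV"
    by (subst emeasure_density) auto
  also have "\<dots> = 1"
    unfolding distr_T[symmetric] using prob_space.emeasure_space_1[OF prob_space_distr[OF measurable_T]] by simp
  finally have "AE t in lborel. passage_density t UNIV \<noteq> \<infinity>"
    by (intro nn_integral_PInf_AE) auto
  moreover have "AE t in lborel. t \<notin> F"
    by (rule AE_not_in) (use F_null in \<open>auto simp: null_sets_def\<close>)
  ultimately show ?thesis
    by eventually_elim (auto simp: good_def passage_density_def[of _ UNIV] split: split_indicator_asm)
qed

lemma AE_T_good: "AE \<omega> in M. T \<omega> \<in> good"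
proof -
  have [measurable]: "(\<lambda>t. passage_density t UNIV) \<in> borel_measurable borel" by (rule measurable_passage_density) simp
  have "AE t in density lborel (\<lambda>t. passage_density t UNIV). t \<in> good"
    using AE_lborel_good by (subst AE_density) (auto elim!: eventually_mono simp: zero_less_iff_neq_zero)
  then show ?thesis unfolding distr_T[symmetric] by (subst (asm) AE_distr_iff) auto
qed

text \<open>The sum of the jump measure and the bridge law embedded at jump \<open>0\<close> is
  again a measure; scaling normalises it.\<close>

lemma conditional_law_exists:
  assumes "t \<in> good"
  shows "\<exists>Q. sets Q = sets borel \<and> (\<forall>C\<in>sets borel. emeasure Q C = inverse (passage_density t UNIV) * passage_density t C)"
proof -
  let ?B = "scale_measure (creep t) (distr (bridge_law t (cc t)) borel (\<lambda>u. (u, 0::real^'d)))"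
  have B: "emeasure ?B C = creep t * emeasure (bridge_law t (cc t)) ((\<lambda>u. (u, 0)) -` C)" if "C \<in> sets borel" for C
    using that sets_eq_imp_space_eq[OF sets_bridge_cc[of t]] by (simp add: emeasure_distr measurable_cong_sets[OF sets_bridge_cc refl])
  obtain Q where Q: "sets Q = sets (nu1 M X \<mu> c t)" "\<forall>C\<in>sets (nu1 M X \<mu> c t). emeasure Q C = emeasure (nu1 M X \<mu> c t) C + emeasure ?B C"
    using sum_measure_exists[of ?B "nu1 M X \<mu> c t"] by (auto simp: sets_nu1)
  show ?thesis
  proof (intro exI[of _ "scale_measure (inverse (passage_density t UNIV)) Q"] conjI ballI)
    show "sets (scale_measure (inverse (passage_density t UNIV)) Q) = sets borel" using Q(1) by (simp add: sets_nu1)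
    fix C :: "((real^'d) \<times> (real^'d)) set" assume C: "C \<in> sets borel"
    then have "emeasure Q C = emeasure (nu1 M X \<mu> c t) C + emeasure ?B C" using Q(2) unfolding sets_nu1 by blast
    also have "\<dots> = passage_density t C" unfolding B[OF C] using assms by (simp add: passage_density_def good_def)
    finally show "emeasure (scale_measure (inverse (passage_density t UNIV)) Q) C = inverse (passage_density t UNIV) * passage_density t C"
      by simp
  qed
qed

text \<open>A kernel needs a probability measure at every argument, including infinite ones and the
  finite times outside \<open>good\<close>; a point mass fills these in.\<close>

definition conditional_law :: "ereal \<Rightarrow> ((real^'d) \<times> (real^'d)) measure" where
  "conditional_law x = (if x \<in> ereal ` good
     then SOME Q. sets Q = sets borel \<and>
       (\<forall>C\<in>sets borel. emeasure Q C = inverse (passage_density (real_of_ereal x) UNIV) * passage_density (real_of_ereal x) C)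
     else return borel 0)"

lemma conditional_law:
  assumes "t \<in> good"
  shows "sets (conditional_law (ereal t)) = sets borel"
    "C \<in> sets borel \<Longrightarrow> emeasure (conditional_law (ereal t)) C = inverse (passage_density t UNIV) * passage_density t C"
  using someI_ex[OF conditional_law_exists[OF assms]] assms by (auto simp: conditional_law_def)

lemma measurable_conditional_law: "conditional_law \<in> borel \<rightarrow>\<^sub>M prob_algebra borel"
proof (rule measurable_prob_algebra_generated[where G="sets borel" and \<Omega>=UNIV])
  show "sets borel = sigma_sets UNIV (sets (borel :: ((real^'d) \<times> (real^'d)) measure))"
    using sets.sigma_sets_eq[of "borel :: ((real^'d) \<times> (real^'d)) measure"] by simp
  show "Int_stable (sets (borel :: ((real^'d) \<times> (real^'d)) measure))" by (rule sets.Int_stable)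
  show sets: "sets (conditional_law x) = sets borel" for x
  proof (cases "x \<in> ereal ` good")
    case True
    then show ?thesis using conditional_law(1) by auto
  qed (simp add: conditional_law_def)
  show "prob_space (conditional_law x)" for x
  proof (cases "x \<in> ereal ` good")
    case True
    then obtain t where t: "t \<in> good" "x = ereal t" by auto
    have "inverse a * a = 1" if "a \<noteq> 0" "a \<noteq> \<infinity>" for a :: ennreal
      using that by (metis ennreal_divide_self divide_ennreal_def infinity_ennreal_def mult.commute top.not_eq_extremum)
    then have "emeasure (conditional_law x) UNIV = 1"
      using t conditional_law(2)[OF t(1), of UNIV] by (simp add: good_def)
    then show ?thesis using sets_eq_imp_space_eq[OF sets[of x]] by (intro prob_spaceI) simp
  qed (simp add: conditional_law_def prob_space_return)
  fix C :: "((real^'d) \<times> (real^'d)) set" assume C: "C \<in> sets borel"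
  note [measurable] = measurable_passage_density[OF C] measurable_passage_density[OF UNIV_borel]
  have "(\<lambda>x. if \<bar>x\<bar> \<noteq> \<infinity> \<and> real_of_ereal x \<in> good
      then inverse (passage_density (real_of_ereal x) UNIV) * passage_density (real_of_ereal x) C else indicator C 0) \<in> borel_measurable borel"
    by measurable
  also have "(\<lambda>x. if \<bar>x\<bar> \<noteq> \<infinity> \<and> real_of_ereal x \<in> good
      then inverse (passage_density (real_of_ereal x) UNIV) * passage_density (real_of_ereal x) C else indicator C 0) =
    (\<lambda>x. emeasure (conditional_law x) C)"
  proof
    fix x :: ereal
    show "(if \<bar>x\<bar> \<noteq> \<infinity> \<and> real_of_ereal x \<in> good
      then inverse (passage_density (real_of_ereal x) UNIV) * passage_density (real_of_ereal x) C else indicator C 0) = emeasure (conditional_law x) C"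
      using conditional_law(2)[OF _ C] C by (cases x) (auto simp: conditional_law_def[of \<infinity>] conditional_law_def[of "-\<infinity>"] conditional_law_def[of "ereal _"])
  qed
  finally show "(\<lambda>x. emeasure (conditional_law x) C) \<in> borel_measurable borel" .
qed auto

text \<open>Disintegration: \<open>passage_law\<close> gives the joint density,
  \<open>distr_T\<close> the density of the time, and on \<open>good\<close> their quotient is the
  kernel. For almost every other time both densities vanish.\<close>

lemma regular_cond_distr_conditional_law:
  "regular_cond_distr M \<tau> (\<lambda>\<omega>. (U \<omega>, V \<omega>)) conditional_law"
proof (rule regular_cond_distrI[OF prob_space_axioms measurable_\<tau> _ measurable_conditional_law])
  show "(\<lambda>\<omega>. (U \<omega>, V \<omega>)) \<in> borel_measurable M"
    unfolding borel_prod[symmetric] by measurable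
  fix B :: "ereal set" and C :: "((real^'d) \<times> (real^'d)) set"
  assume B: "B \<in> sets borel" and C: "C \<in> sets borel"
  let ?B = "ereal -` B"
  have B'[measurable]: "?B \<in> sets borel" using measurable_sets[of ereal borel borel B] B by simp
  have KC: "(\<lambda>x. emeasure (conditional_law x) C) \<in> borel_measurable borel"
    using measurable_emeasure_kernel[OF measurable_prob_algebraD[OF measurable_conditional_law] C] .
  have h[measurable]: "(\<lambda>t. emeasure (conditional_law (ereal t)) C * indicator ?B t) \<in> borel_measurable borel"
    by (intro borel_measurable_times_ennreal measurable_compose[OF _ KC] borel_measurable_indicator B') simp
  have dm: "(\<lambda>t. passage_density t UNIV) \<in> borel_measurable lborel" using measurable_passage_density[of UNIV] by simp
  have "(\<integral>\<^sup>+\<omega>. indicator C (U \<omega>, V \<omega>) * indicator B (\<tau> \<omega>) \<partial>M) = (\<integral>\<^sup>+\<omega>. indicator C (U \<omega>, V \<omega>) * indicator ?B (T \<omega>) \<partial>M)"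
  proof (rule nn_integral_cong_AE)
    show "AE \<omega> in M. indicator C (U \<omega>, V \<omega>) * indicator B (\<tau> \<omega>) = (indicator C (U \<omega>, V \<omega>) * indicator ?B (T \<omega>) :: ennreal)"
      using AE_T_active
    proof eventually_elim
      case (elim \<omega>)
      then have "\<tau> \<omega> \<in> B \<longleftrightarrow> T \<omega> \<in> ?B" by simp
      then show ?case by (simp only: indicator_def)
    qed
  qed
  also have "\<dots> = (\<integral>\<^sup>+t. indicator ?B t * passage_density t C \<partial>lborel)" by (rule passage_law[OF B' C])
  also have "\<dots> = (\<integral>\<^sup>+t. passage_density t UNIV * (emeasure (conditional_law (ereal t)) C * indicator ?B t) \<partial>lborel)"
  proof (rule nn_integral_cong_AE)
    show "AE t in lborel. indicator ?B t * passage_density t C = passage_density t UNIV * (emeasure (conditional_law (ereal t)) C * indicator ?B t)"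
      using AE_lborel_good
    proof eventually_elim
      case (elim t)
      show ?case
      proof (cases "passage_density t UNIV = 0")
        case True
        then show ?thesis using passage_density_mono[OF C, of t] by simp
      next
        case False
        then have t: "t \<in> good" using elim by simp
        then have "passage_density t UNIV * inverse (passage_density t UNIV) = 1"
          using ennreal_divide_self[of "passage_density t UNIV"] False by (simp add: good_def divide_ennreal_def less_top)
        then show ?thesis unfolding conditional_law(2)[OF t C] by (simp add: mult.assoc[symmetric] mult.commute[of "indicator _ _"])
      qed
    qed
  qed
  also have "\<dots> = (\<integral>\<^sup>+t. emeasure (conditional_law (ereal t)) C * indicator ?B t \<partial>distr M borel (\<lambda>\<omega>. T \<omega>))"
    unfolding distr_T using dm h by (subst nn_integral_density) auto
  also have "\<dots> = (\<integral>\<^sup>+\<omega>. emeasure (conditional_law (ereal (T \<omega>))) C * indicator ?B (T \<omega>) \<partial>M)"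
    by (rule nn_integral_distr) (use h in auto)
  also have "\<dots> = (\<integral>\<^sup>+\<omega>. emeasure (conditional_law (\<tau> \<omega>)) C * indicator B (\<tau> \<omega>) \<partial>M)"
  proof (rule nn_integral_cong_AE)
    show "AE \<omega> in M. emeasure (conditional_law (ereal (T \<omega>))) C * indicator ?B (T \<omega>) = emeasure (conditional_law (\<tau> \<omega>)) C * indicator B (\<tau> \<omega>)"
      using AE_T_active
    proof eventually_elim
      case (elim \<omega>)
      then have "\<tau> \<omega> \<in> B \<longleftrightarrow> T \<omega> \<in> ?B" "ereal (T \<omega>) = \<tau> \<omega>" by simp_all
      then show ?case by (simp only: indicator_def)
    qed
  qed
  finally show "(\<integral>\<^sup>+\<omega>. indicator C (U \<omega>, V \<omega>) * indicator B (\<tau> \<omega>) \<partial>M) = (\<integral>\<^sup>+\<omega>. emeasure (conditional_law (\<tau> \<omega>)) C * indicator B (\<tau> \<omega>) \<partial>M)" .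
qed

text \<open>No pair in \<open>C\<close> has jump \<open>0\<close>, so the creeping part contributes
  nothing.\<close>

lemma conditional_law_jump:
  assumes t: "t \<in> good" and C: "C \<in> sets borel" "C \<subseteq> {0..} \<times> ({0..} - {0})"
  shows "emeasure (conditional_law (ereal t)) C = inverse (normalizer M X \<mu> g c t) * emeasure (nu1 M X \<mu> c t) C"
proof -
  have ta: "t \<in> active" "t \<notin> F" using t by (auto simp: good_def)
  have "(\<lambda>u. (u, 0)) -` C = {}" using C(2) by auto
  then have "passage_density t C = emeasure (nu1 M X \<mu> c t) C" using ta by (simp add: passage_density_def)
  then show ?thesis unfolding conditional_law(2)[OF t C(1)] normalizer_eq[OF ta] by simp
qed

text \<open>\<open>nu1\<close> gives no mass to \<open>v = 0\<close>, because a jump of size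
  \<open>0\<close> cannot exceed a nonnegative distance to the boundary.\<close>

lemma conditional_law_creep:
  assumes t: "t \<in> good" and A: "A \<in> sets borel"
  shows "emeasure (conditional_law (ereal t)) (A \<times> {0}) = inverse (normalizer M X \<mu> g c t) * emeasure (nu2 bridge_law g c t) A"
proof -
  have ta: "t \<in> active" "t \<notin> F" and t0: "0 < t" using t by (auto simp: good_def active_def)
  have AC: "A \<times> {0::real^'d} \<in> sets borel"
  proof -
    have "A \<times> {0::real^'d} \<in> sets (borel \<Otimes>\<^sub>M borel)" using A by (intro pair_measureI) auto
    then show ?thesis by (subst (asm) borel_prod)
  qed
  have "emeasure (nu1 M X \<mu> c t) (A \<times> {0}) = (\<integral>\<^sup>+p. 0 \<partial>(M \<Otimes>\<^sub>M \<mu>))"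
    unfolding nu1_eq[OF t0 AC] by (intro nn_integral_cong) (auto simp: jumps_def split: split_indicator)
  moreover have "(\<lambda>u. (u, 0)) -` (A \<times> {0}) = A" by auto
  ultimately have "passage_density t (A \<times> {0}) = creep t * emeasure (bridge_law t (c t)) A"
    using ta t0 by (simp add: passage_density_def cc_def)
  also have "\<dots> = emeasure (nu2 bridge_law g c t) A"
    using ta by (simp add: nu2_def creep_def slope_def gg_eq[OF t0])
  finally show ?thesis unfolding conditional_law(2)[OF t AC] normalizer_eq[OF ta] by simp
qed

lemma AE_passage_time: "AE \<omega> in M. \<tau> \<omega> \<in> ereal ` ({0<..} - F)"
  using AE_T_active AE_T_good
proof eventually_elim
  case (elim \<omega>)
  then show ?case by (intro image_eqI[of _ _ "T \<omega>"]) (auto simp: good_def active_def)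
qed

lemma AE_conditional_law:
  "AE \<omega> in M. \<forall>t. \<tau> \<omega> = ereal t \<longrightarrow>
    (\<forall>C\<in>sets borel. C \<subseteq> {0..} \<times> ({0..} - {0}) \<longrightarrow>
      emeasure (conditional_law (ereal t)) C = inverse (normalizer M X \<mu> g c t) * emeasure (nu1 M X \<mu> c t) C) \<and>
    (\<forall>A\<in>sets borel. A \<subseteq> {0..} \<longrightarrow>
      emeasure (conditional_law (ereal t)) (A \<times> {0}) = inverse (normalizer M X \<mu> g c t) * emeasure (nu2 bridge_law g c t) A)"
  using AE_T_good
proof eventually_elim
  case (elim \<omega>)
  then show ?case by (auto intro: conditional_law_jump conditional_law_creep)
qed

end

theorem theorem3p7:
  fixes M :: "'w measure"
    and X :: "real \<Rightarrow> 'w \<Rightarrow> real ^ 'd"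
    and \<mu> :: "(real ^ 'd) measure"
    and g :: "real \<Rightarrow> real \<Rightarrow> real"
  assumes "driftless_subordinator M X \<mu>"
    and "emeasure (norm_levy_measure \<mu>) {0<..} = \<infinity>"
    and "continuous_density M (norm_process X) g"
  shows "\<exists>K. cond_distr_given_norm M X K \<and>
    (\<forall>c F. boundary c F \<longrightarrow>
      (AE \<omega> in M. passage_time X c \<omega> \<in> ereal ` ({0<..} - F)) \<and>
      (\<exists>Q. regular_cond_distr M (passage_time X c)
              (\<lambda>\<omega>. (pre_passage X c \<omega>, passage_jump X c \<omega>)) Q \<and>
        (AE \<omega> in M. \<forall>t. passage_time X c \<omega> = ereal t \<longrightarrow>
          (\<forall>C\<in>sets borel. C \<subseteq> {0..} \<times> ({0..} - {0}) \<longrightarrow>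
            emeasure (Q (ereal t)) C =
              inverse (normalizer M X \<mu> g c t) * emeasure (nu1 M X \<mu> c t) C) \<and>
          (\<forall>A\<in>sets borel. A \<subseteq> {0..} \<longrightarrow>
            emeasure (Q (ereal t)) (A \<times> {0}) =
              inverse (normalizer M X \<mu> g c t) * emeasure (nu2 K g c t) A))))"
proof -
  interpret D: density_subordinator M X \<mu> g
    using assms(1,3) by (intro density_subordinator.intro density_subordinator_axioms.intro)
  show ?thesis
  \<comment> \<open>The version \<open>bridge_law\<close> is built from the process alone, so it can
    be fixed before \<open>c\<close> and \<open>F\<close> and serves every boundary.\<close>
  proof (intro exI[of _ D.bridge_law] conjI D.cond_distr_bridge_law allI impI)
    fix c F assume "boundary c F"
    then interpret B: boundary_crossing M X \<mu> g c F
      by unfold_locales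
    show "AE \<omega> in M. passage_time X c \<omega> \<in> ereal ` ({0<..} - F)"
      by (rule B.AE_passage_time)
    show "\<exists>Q. regular_cond_distr M (passage_time X c) (\<lambda>\<omega>. (pre_passage X c \<omega>, passage_jump X c \<omega>)) Q \<and>
        (AE \<omega> in M. \<forall>t. passage_time X c \<omega> = ereal t \<longrightarrow>
          (\<forall>C\<in>sets borel. C \<subseteq> {0..} \<times> ({0..} - {0}) \<longrightarrow>
            emeasure (Q (ereal t)) C =
              inverse (normalizer M X \<mu> g c t) * emeasure (nu1 M X \<mu> c t) C) \<and>
          (\<forall>A\<in>sets borel. A \<subseteq> {0..} \<longrightarrow>
            emeasure (Q (ereal t)) (A \<times> {0}) =
              inverse (normalizer M X \<mu> g c t) * emeasure (nu2 D.bridge_law g c t) A))"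
      using B.regular_cond_distr_conditional_law B.AE_conditional_law by blast
  qed
qed

end
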